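(* Let $f:\mathbb{N}\to[0,\infty)$ be of the form $f(x)=x^{r(x)}$, where $r$ decreases monotonically to $0$ as $x\to\infty$ and satisfies, for every $A>0$, $r(x)\gg_A \frac{(\log\log x)^A}{\log x}$ (i.e. for every $A>0$ there is $c_A>0$ with $r(x)\ge c_A\frac{(\log\log x)^A}{\log x}$ for all sufficiently large $x$). Let $\alpha$ be any badly approximable number. Then: (1) The sequence $(a_n^{(f)}\alpha)_{n\in\mathbb{N}} \pmod 1$, where $(a_n^{(f)})_{n\in\mathbb{N}}$ is the increasing enumeration of $\{n\in\mathbb{N}: P^-(n)>f(n)\}$, has Poissonian correlations of $k$-th order for every $k\ge 2$. Consequently, it has Poissonian gaps. (2) The triangular array $(a_{n,x}^{(f)}\alpha) \pmod 1$, whose $x$-th row ($x\in\mathbb{N}$) consists of the points $\{a\alpha\}$ with $a$ running through $\{1\le a\le x: P^-(a)>f(x)\}$, has Poissonian correlations of $k$-th order for every $k\ge 2$, and thus also Poissonian gaps.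
   Context: Here $\{t\}$ denotes the fractional part of a real number $t$, $\|t\|$ the distance to the nearest integer, and $P^-(n)$ the smallest prime divisor of $n$ (with the usual convention $P^-(1)=\infty$). An irrational $\alpha$ is badly approximable if $\liminf_{n\to\infty} n\|n\alpha\|>0$, equivalently if the partial quotients of its continued fraction are bounded. Poissonian correlations of $k$-th order ($k\ge 2$): a sequence $(x_n)_{n\in\mathbb{N}}\subseteq[0,1)$ has this property if for every (bounded) axis-parallel rectangle $\boldsymbol{R}\subseteq\mathbb{R}^{k-1}$, $$R_k(\boldsymbol{R},N):=\frac1N\#\Big\{\boldsymbol{n}\in[1,N]^k_{\neq}: (x_{n_1}-x_{n_2},x_{n_1}-x_{n_3},\ldots,x_{n_1}-x_{n_k})\in\tfrac{1}{N}\boldsymbol{R}\Big\}\longrightarrow \mathrm{Vol}(\boldsymbol{R})\quad(N\to\infty),$$ where $[1,N]^k_{\neq}$ is the set of integer $k$-tuples with pairwise distinct entries in $\{1,\dots,N\}$ and $\mathrm{Vol}$ is $(k-1)$-dimensional Lebesgue measure. Poissonian gaps: writing $x_1^{(N)}\le\dots\le x_N^{(N)}$ for the ordered sample of $x_1,\dots,x_N$, for all $[a,b]\subset[0,\infty)$, $$\lim_{N\to\infty}\frac1N\#\Big\{1\le n\le N-1: x_{n+1}^{(N)}-x_n^{(N)}\in\tfrac1N[a,b]\Big\}=\int_a^b e^{-t}\,dt .$$ For a triangular array the same definitions are used with the first $N$ points replaced by the points of the $x$-th row, with $N$ replaced by the number of points in that row, here $\Phi(x,f(x))=\#\{1\le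 n\le x:P^-(n)>f(x)\}$, and with the limit taken as $x\to\infty$. *)

theory Defs
  imports
    "HOL-Analysis.Analysis"
    "HOL-Computational_Algebra.Primes"
    "HOL-Library.Infinite_Set"
begin

definition badly_approximable :: "real \<Rightarrow> bool" where
  "badly_approximable \<alpha> \<longleftrightarrow>
     \<alpha> \<notin> \<rat> \<and> liminf (\<lambda>n. ereal (real n * infdist (real n * \<alpha>) \<int>)) > 0"

text \<open>The infimum is taken in the extended reals, so the value at 1 is \<open>\<infinity>\<close>.\<close>

definition least_prime_divisor :: "nat \<Rightarrow> ereal" where
  "least_prime_divisor n = (INF p\<in>{p. prime p \<and> p dvd n}. ereal (real p))"

text \<open>
  Points of a finite sample of size \<open>N\<close> are \<open>x 1, \<dots>, x N\<close>; the value \<open>x 0\<close> is never used.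
  A vector in $\mathbb{R}^{k-1}$ is an extensional function on \<open>{2..k}\<close>, the coordinate \<open>j\<close>
  corresponding to the difference \<open>x (n 1) - x (n j)\<close>. The sides of a rectangle
  may be open, closed, half-open or degenerate.
\<close>

definition bounded_rectangle :: "nat \<Rightarrow> (nat \<Rightarrow> real) set \<Rightarrow> bool" where
  "bounded_rectangle k R \<longleftrightarrow>
     (\<exists>I :: nat \<Rightarrow> real set. (\<forall>j\<in>{2..k}. is_interval (I j) \<and> bounded (I j)) \<and> R = Pi\<^sub>E {2..k} I)"

definition rectangle_volume :: "nat \<Rightarrow> (nat \<Rightarrow> real) set \<Rightarrow> real" where
  "rectangle_volume k R = measure (Pi\<^sub>M {2..k} (\<lambda>_. lborel)) R"

definition correlation :: "nat \<Rightarrow> (nat \<Rightarrow> real) set \<Rightarrow> nat \<Rightarrow> (nat \<Rightarrow> real) \<Rightarrow> real" where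
  "correlation k R N x =
     real (card {n \<in> {1..k} \<rightarrow>\<^sub>E {1..N}. inj_on n {1..k} \<and>
       (\<lambda>j\<in>{2..k}. real N * (x (n 1) - x (n j))) \<in> R}) / real N"

definition ordered_sample :: "nat \<Rightarrow> (nat \<Rightarrow> real) \<Rightarrow> nat \<Rightarrow> real" where
  "ordered_sample N x n = sort (map x [1..<N + 1]) ! (n - 1)"

definition gap_proportion :: "real \<Rightarrow> real \<Rightarrow> nat \<Rightarrow> (nat \<Rightarrow> real) \<Rightarrow> real" where
  "gap_proportion a b N x =
     real (card {n \<in> {1..N - 1}.
       ordered_sample N x (n + 1) - ordered_sample N x n \<in> {a / real N..b / real N}}) / real N"

definition poissonian_correlations :: "nat \<Rightarrow> (nat \<Rightarrow> real) \<Rightarrow> bool" where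
  "poissonian_correlations k x \<longleftrightarrow>
     (\<forall>R. bounded_rectangle k R \<longrightarrow> (\<lambda>N. correlation k R N x) \<longlonglongrightarrow> rectangle_volume k R)"

definition poissonian_gaps :: "(nat \<Rightarrow> real) \<Rightarrow> bool" where
  "poissonian_gaps x \<longleftrightarrow>
     (\<forall>a b. 0 \<le> a \<and> a \<le> b \<longrightarrow>
       (\<lambda>N. gap_proportion a b N x) \<longlonglongrightarrow> integral {a..b} (\<lambda>t. exp (- t)))"

text \<open>
  A triangular array is given by its row lengths \<open>L\<close> and its entries \<open>y\<close>:
  row \<open>m\<close> is \<open>y m 1, \<dots>, y m (L m)\<close>.
\<close>

definition array_poissonian_correlations ::
  "nat \<Rightarrow> (nat \<Rightarrow> nat) \<Rightarrow> (nat \<Rightarrow> nat \<Rightarrow> real) \<Rightarrow> bool" where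
  "array_poissonian_correlations k L y \<longleftrightarrow>
     (\<forall>R. bounded_rectangle k R \<longrightarrow>
       (\<lambda>m. correlation k R (L m) (y m)) \<longlonglongrightarrow> rectangle_volume k R)"

definition array_poissonian_gaps :: "(nat \<Rightarrow> nat) \<Rightarrow> (nat \<Rightarrow> nat \<Rightarrow> real) \<Rightarrow> bool" where
  "array_poissonian_gaps L y \<longleftrightarrow>
     (\<forall>a b. 0 \<le> a \<and> a \<le> b \<longrightarrow>
       (\<lambda>m. gap_proportion a b (L m) (y m)) \<longlonglongrightarrow> integral {a..b} (\<lambda>t. exp (- t)))"

definition rough_set :: "(nat \<Rightarrow> real) \<Rightarrow> nat set" where
  "rough_set f = {n. 1 \<le> n \<and> least_prime_divisor n > ereal (f n)}"

definition rough_row :: "(nat \<Rightarrow> real) \<Rightarrow> nat \<Rightarrow> nat set" where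
  "rough_row f x = {a. 1 \<le> a \<and> a \<le> x \<and> least_prime_divisor a > ereal (f x)}"

text \<open>
  \<open>enumerate\<close> lists a set increasingly from index 0, also a finite one for
  indices below its cardinality; the sequences here start at index 1.
\<close>

definition rough_seq :: "(nat \<Rightarrow> real) \<Rightarrow> real \<Rightarrow> nat \<Rightarrow> real" where
  "rough_seq f \<alpha> n = frac (real (enumerate (rough_set f) (n - 1)) * \<alpha>)"

definition rough_array :: "(nat \<Rightarrow> real) \<Rightarrow> real \<Rightarrow> nat \<Rightarrow> nat \<Rightarrow> real" where
  "rough_array f \<alpha> x n = frac (real (enumerate (rough_row f x) (n - 1)) * \<alpha>)"

end

theory Submission
  imports Defs "HOL-Number_Theory.Number_Theory"
begin

text \<open>
  Tuples of rough numbers are counted with their differences \<open>h\<^sub>j = a\<^sub>1 - a\<^sub>j\<close> fixed. After the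
  primes up to a constant have been handled by fixing residue classes, the Brun--Hooley sieve has an arbitrarily small
  relative error, and \<open>r \<longlonglongrightarrow> 0\<close> keeps its level a small power of \<open>X\<close>. The main term is a
  singular series in \<open>h\<close>, which is close to 1 on average over the \<open>h\<close> for which every
  \<open>h\<^sub>j \<alpha>\<close> lies in an interval of length \<open>O(1 / N)\<close> modulo 1; the growth condition makes the
  density of the rough numbers smaller than any power of \<open>1 / ln (ln X)\<close>, which absorbs the losses
  in this average. It relies on the equidistribution of such \<open>h\<^sub>j\<close> in
  progressions, with an error uniform in the modulus, since \<open>\<alpha>\<close> is badly approximable. The threshold
  \<open>n powr r n\<close> of the sequence is reduced to constant thresholds by cutting \<open>{1..X}\<close> into \<open>O(ln (ln X))\<close> intervals on which
  \<open>r\<close> is almost constant. Gaps follow from correlations by the Bonferroni inequalities.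
\<close>

section \<open>Primes\<close>

text \<open>The length of the interval left for \<open>a 1\<close> depends on all shifts jointly.
  Only after the summations are exchanged, with \<open>t = a 1\<close> fixed, does each shift run
  through its own interval, so that the average becomes a product.

  Averaging the singular series means summing over squarefree moduli. The main terms yield a product
  of \<open>1 + b / p^2\<close>, close to 1, but an error common to all moduli is multiplied by a
  product of \<open>1 + b / p\<close>. Over all sifting primes this would be a power of
  \<open>ln X\<close>, more than the assumed density can repay. A nonzero difference has only
  \<open>O(ln X)\<close> prime divisors, however, so those above \<open>(ln X)^2\<close> are
  harmless, and the loss is a power of \<open>ln (ln X)\<close>. It is repaid by the square root in
  the lattice point error, whose size relative to the main term is about the square root of the
  density.

  No asymptotic formula for the density is used. The number of points comes from the same count with
  \<open>k = 1\<close>, and two nearby thresholds have nearly the same density; so Chebyshev bounds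
  suffice in place of Mertens' theorem. Fractional parts enter last: the counts are modulo 1, and
  wrap-around tuples are few.\<close>

definition primes_between :: "real \<Rightarrow> real \<Rightarrow> nat set" where
  "primes_between y x = {p. prime p \<and> y < real p \<and> real p \<le> x}"

lemma finite_primes_between [simp, intro]: "finite (primes_between y x)"
proof (rule finite_subset)
  show "primes_between y x \<subseteq> {..nat \<lfloor>x\<rfloor>}"
    by (auto simp: primes_between_def le_nat_floor)
qed auto

lemma prime_primes_between: "p \<in> primes_between y x \<Longrightarrow> prime p"
  by (simp add: primes_between_def)

lemma ge_2_primes_between: "p \<in> primes_between y x \<Longrightarrow> real p \<ge> 2"
  using prime_ge_2_nat[of p] by (auto simp: primes_between_def)

lemma pos_primes_between: "p \<in> primes_between y x \<Longrightarrow> p > 0"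
  using prime_gt_0_nat[of p] by (auto simp: primes_between_def)

lemma primes_between_Un:
  "y \<le> v \<Longrightarrow> v \<le> x \<Longrightarrow> primes_between y x = primes_between y v \<union> primes_between v x"
  by (auto simp: primes_between_def)

lemma primes_between_disjoint: "primes_between y v \<inter> primes_between v x = {}"
  by (auto simp: primes_between_def)

lemma sum_primes_between_split:
  fixes f :: "nat \<Rightarrow> 'a::comm_monoid_add"
  shows "y \<le> v \<Longrightarrow> v \<le> x \<Longrightarrow> sum f (primes_between y x) = sum f (primes_between y v) + sum f (primes_between v x)"
  by (simp add: primes_between_Un[of y v x] sum.union_disjoint primes_between_disjoint)

lemma prod_primes_between_split:
  fixes f :: "nat \<Rightarrow> 'a::comm_monoid_mult"
  shows "y \<le> v \<Longrightarrow> v \<le> x \<Longrightarrow> prod f (primes_between y x) = prod f (primes_between y v) * prod f (primes_between v x)"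
  by (simp add: primes_between_Un[of y v x] prod.union_disjoint primes_between_disjoint)

lemma primes_between_mono: "y' \<le> y \<Longrightarrow> x \<le> x' \<Longrightarrow> primes_between y x \<subseteq> primes_between y' x'"
  by (auto simp: primes_between_def)

text \<open>The semiring is kept general because the lemma is needed over \<open>nat\<close>, for a
  central binomial coefficient, and over \<open>int\<close>, for differences of tuple entries, which
  may be negative.\<close>

lemma prod_primes_dvd:
  fixes n :: "'a::{factorial_semiring_gcd}"
  assumes "finite D" "\<And>p. p \<in> D \<Longrightarrow> prime p" "\<And>p. p \<in> D \<Longrightarrow> p dvd n"
  shows "\<Prod>D dvd n"
  using assms
proof (induction D rule: finite_induct)
  case (insert p D)
  have "coprime p (\<Prod>D)"
    using insert by (intro prod_coprime_right primes_coprime) auto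
  then show ?case
    using insert by (simp add: divides_mult)
qed auto

section \<open>Chebyshev's bound and sums of reciprocals of primes\<close>

lemma card_primes_doubling:
  fixes n :: nat
  assumes "n \<ge> 2"
  shows "real (card (primes_between n (2 * n))) * ln n \<le> n * ln 4"
proof -
  let ?P = "primes_between n (2 * n)"
  \<comment> \<open>Chebyshev's argument: a prime in \<open>(n, 2n]\<close> divides
    \<open>fact (2 * n)\<close> but not \<open>fact n\<close>, hence divides the central binomial
    coefficient. The product of all these primes is therefore at most \<open>4 ^ n\<close>.\<close>
  have "\<Prod>?P dvd (2 * n choose n)"
  proof (rule prod_primes_dvd)
    fix p assume "p \<in> ?P"
    then have p: "prime p" "n < p" "p \<le> 2 * n"
      by (auto simp: primes_between_def simp flip: of_nat_less_iff of_nat_le_iff)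
    have "p dvd fact (2 * n)"
      using p by (subst prime_dvd_fact_iff) auto
    also have "fact (2 * n) = fact n * fact n * (2 * n choose n)"
      using binomial_fact_lemma[of n "2 * n"] by (simp add: mult_2)
    finally show "p dvd (2 * n choose n)"
      using p by (auto simp: prime_dvd_mult_iff prime_dvd_fact_iff)
  qed (auto dest: prime_primes_between)
  then have "\<Prod>?P \<le> (2 * n choose n)"
    by (rule dvd_imp_le) auto
  also have "\<dots> \<le> 2 ^ (2 * n)"
    by (rule binomial_le_pow2)
  also have "(2::nat) ^ (2 * n) = 4 ^ n"
    by (simp add: power_mult)
  finally have "real (\<Prod>?P) \<le> real (4 ^ n)"
    by (simp only: of_nat_le_iff)
  then have le: "real (\<Prod>?P) \<le> 4 ^ n" by simp
  have "real n ^ card ?P = (\<Prod>p\<in>?P. real n)"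
    by simp
  also have "\<dots> \<le> (\<Prod>p\<in>?P. real p)"
    by (intro prod_mono) (auto simp: primes_between_def)
  also have "\<dots> = real (\<Prod>?P)"
    by simp
  also note le
  finally have "ln (real n ^ card ?P) \<le> ln (4 ^ n)"
    using assms by (subst ln_le_cancel_iff) auto
  then show ?thesis
    using assms by (simp add: ln_realpow)
qed

lemma sum_inverse_primes_doubling:
  fixes n :: nat
  assumes "n \<ge> 2"
  shows "(\<Sum>p\<in>primes_between n (2 * n). 1 / real p) \<le> 2 / ln n"
proof -
  have "(\<Sum>p\<in>primes_between n (2 * n). 1 / real p) \<le> (\<Sum>p\<in>primes_between n (2 * n). 1 / real n)"
    using assms by (intro sum_mono divide_left_mono) (auto simp: primes_between_def)
  also have "\<dots> = (real (card (primes_between n (2 * n))) * ln n) / (n * ln n)"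
    using assms by simp
  also have "\<dots> \<le> (n * ln 4) / (n * ln n)"
    by (intro divide_right_mono card_primes_doubling assms) (use assms in auto)
  also have "\<dots> = ln 4 / ln n"
    using assms by simp
  also have "ln 4 \<le> (2::real)"
    using ln_le_minus_one[of 2] ln_realpow[of 2 2] by simp
  finally show ?thesis
    using assms by (simp add: divide_right_mono)
qed

text \<open>Dyadic blocks starting at the integer part of \<open>y\<close>, each contributing
  \<open>O(1 / ln y)\<close>. This is weaker than Mertens' theorem but good enough where it is
  applied: it stays bounded for \<open>x\<close> up to a fixed power of \<open>y\<close>, and it is
  small when \<open>ln x / ln y\<close> is close to 1 and \<open>y\<close> is large.\<close>

lemma sum_inverse_primes_between:
  fixes x y :: real
  assumes "4 \<le> y" "y \<le> x"
  shows "(\<Sum>p\<in>primes_between y x. 1 / real p) \<le> 8 * (ln x - ln y + 1) / ln y"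
proof -
  define n where "n = nat \<lfloor>y\<rfloor>"
  have n: "n \<ge> 2" "real n \<le> y" "y < real n + 1" "n \<ge> 4"
    using assms unfolding n_def by linarith+
  have ny: "ln y \<le> 2 * ln n"
  proof -
    have "y \<le> real n ^ 2"
    proof -
      have "2 * real n \<le> real n * real n" using n by (intro mult_right_mono) auto
      moreover have "y \<le> 2 * real n" using n by linarith
      ultimately show ?thesis by (simp add: power2_eq_square)
    qed
    then have "ln y \<le> ln (real n ^ 2)"
      using assms n by (subst ln_le_cancel_iff) auto
    then show ?thesis using n by (simp add: ln_realpow)
  qed
  have iter: "(\<Sum>p\<in>primes_between n (2 ^ i * n). 1 / real p) \<le> i * (2 / ln n)" for i :: nat
  proof (induction i)
    case 0
    have "primes_between n n = {}" by (auto simp: primes_between_def)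
    then show ?case by simp
  next
    case (Suc i)
    have i1: "1 \<le> (2::nat) ^ i" by simp
    have "ln n \<le> ln (2 ^ i * n :: nat)"
      using n i1 by (subst ln_le_cancel_iff) auto
    moreover have "0 < ln (real n)" using n by simp
    ultimately have "2 / ln (2 ^ i * n :: nat) \<le> 2 / ln n"
      by (intro divide_left_mono) auto
    moreover have "2 ^ i * n \<ge> 2"
      using n i1 by (metis le_trans mult_le_mono1 nat_mult_1)
    ultimately have "(\<Sum>p\<in>primes_between (2 ^ i * n :: nat) (2 * (2 ^ i * n :: nat)). 1 / real p) \<le> 2 / ln n"
      using sum_inverse_primes_doubling[of "2 ^ i * n"] by (simp add: mult.assoc)
    moreover have "(\<Sum>p\<in>primes_between n (2 ^ Suc i * n). 1 / real p) =
       (\<Sum>p\<in>primes_between n (2 ^ i * n). 1 / real p) + (\<Sum>p\<in>primes_between (2 ^ i * n) (2 ^ Suc i * n). 1 / real p)"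
      using n by (intro sum_primes_between_split) (auto simp: mult_le_cancel_right1)
    ultimately show ?case
      using Suc.IH by (simp add: algebra_simps add_divide_distrib)
  qed
  define i where "i = nat \<lceil>log 2 (x / n)\<rceil>"
  have xn: "x / n \<ge> 1" using assms n by (simp add: field_simps)
  then have l0: "log 2 (x / n) \<ge> 0" by (simp add: zero_le_log_cancel_iff)
  have "log 2 (x / n) \<le> real i" unfolding i_def by linarith
  then have "x / n \<le> 2 ^ i"
    using xn by (simp add: log_le_iff powr_realpow)
  then have xi: "x \<le> 2 ^ i * n" using n by (simp add: field_simps)
  have half: "ln y \<le> ln n + 1/2"
  proof -
    have "ln (y / n) \<le> y / n - 1" using n assms by (intro ln_le_minus_one) auto
    also have "y / n \<le> (real n + 1) / n" using n by (intro divide_right_mono) auto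
    then have "y / n - 1 \<le> 1 / n" using n by (simp add: add_divide_distrib)
    also have "1 / real n \<le> 1 / 2" using n by (intro divide_left_mono) auto
    finally show ?thesis using n assms by (simp add: ln_div)
  qed
  have "log 2 (x / n) = (ln x - ln n) / ln 2"
    using assms n by (simp add: log_def ln_div)
  also have "\<dots> \<le> (ln x - ln y + 1/2) / ln 2"
    using half by (intro divide_right_mono) auto
  also have "\<dots> \<le> (ln x - ln y + 1/2) / (1/2)"
    using assms ln2_ge_two_thirds by (intro divide_left_mono add_nonneg_nonneg mult_pos_pos) auto
  finally have "log 2 (x / n) \<le> (ln x - ln y + 1/2) / (1/2)" .
  moreover have "real i \<le> log 2 (x / n) + 1" unfolding i_def using l0 by linarith
  ultimately have i: "real i \<le> 2 * (ln x - ln y + 1)" by simp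
  have "(\<Sum>p\<in>primes_between y x. 1 / real p) \<le> (\<Sum>p\<in>primes_between n (2 ^ i * n). 1 / real p)"
    using xi n by (intro sum_mono2 primes_between_mono) auto
  also have "\<dots> \<le> i * (2 / ln n)" by (rule iter)
  also have "\<dots> \<le> 2 * (ln x - ln y + 1) * (4 / ln y)"
    using i ny assms n by (intro mult_mono) (auto simp: field_simps)
  finally show ?thesis by simp
qed

text \<open>This is what makes blocks of primes between the square root of \<open>z\<close> and
  \<open>z\<close> suitable for the sieve: their total weight is bounded uniformly in
  \<open>z\<close>.\<close>

lemma sum_inverse_primes_square:
  fixes x y :: real
  assumes "4 \<le> y" "x \<le> y ^ 2"
  shows "(\<Sum>p\<in>primes_between y x. 1 / real p) \<le> 16"
proof -
  have y: "ln y \<ge> 1"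
  proof -
    have "ln 4 \<ge> (1::real)" using ln_realpow[of 2 2] ln2_ge_two_thirds by simp
    also have "ln 4 \<le> ln y" using assms by simp
    finally show ?thesis .
  qed
  have "(\<Sum>p\<in>primes_between y x. 1 / real p) \<le> (\<Sum>p\<in>primes_between y (y ^ 2). 1 / real p)"
    using assms by (intro sum_mono2 primes_between_mono) auto
  also have "\<dots> \<le> 8 * (ln (y ^ 2) - ln y + 1) / ln y"
    using assms by (intro sum_inverse_primes_between) (auto simp: power2_eq_square)
  also have "\<dots> = 8 * (ln y + 1) / ln y"
    using assms by (simp add: ln_realpow)
  also have "\<dots> \<le> 16" using y by (simp add: field_simps)
  finally show ?thesis .
qed

text \<open>Repeated squaring from 4 passes \<open>x\<close> after about \<open>log 2 (ln x)\<close>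
  steps, each adding at most 16. The factor 24 is 16 divided by the lower bound 2/3 for
  \<open>ln 2\<close>.\<close>

lemma sum_inverse_primes_le:
  fixes x :: real
  assumes "x \<ge> 16"
  shows "(\<Sum>p\<in>primes_between 0 x. 1 / real p) \<le> 24 * ln (ln x) + 20"
proof -
  have iter: "(\<Sum>p\<in>primes_between 0 (4 ^ (2 ^ i)). 1 / real p) \<le> 16 * i + 4" for i :: nat
  proof (induction i)
    case 0
    have "primes_between 0 4 \<subseteq> {1..4}"
      by (auto simp: primes_between_def)
    then have "card (primes_between 0 4) \<le> card {1..4::nat}"
      by (intro card_mono) auto
    moreover have "(\<Sum>p\<in>primes_between 0 4. 1 / real p) \<le> (\<Sum>p\<in>primes_between 0 4. 1)"
      by (intro sum_mono) (auto dest: pos_primes_between)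
    ultimately show ?case by simp
  next
    case (Suc i)
    have "(4::real) ^ 1 \<le> 4 ^ (2 ^ i)" by (intro power_increasing) auto
    then have "(\<Sum>p\<in>primes_between (4 ^ (2 ^ i)) (4 ^ (2 ^ Suc i)). 1 / real p) \<le> 16"
      by (intro sum_inverse_primes_square) (auto simp: power_mult mult.commute simp flip: power_mult)
    moreover have "(\<Sum>p\<in>primes_between 0 (4 ^ (2 ^ Suc i)). 1 / real p) = 
       (\<Sum>p\<in>primes_between 0 (4 ^ (2 ^ i)). 1 / real p) + (\<Sum>p\<in>primes_between (4 ^ (2 ^ i)) (4 ^ (2 ^ Suc i)). 1 / real p)"
      by (rule sum_primes_between_split) (auto intro!: power_increasing)
    ultimately show ?case using Suc.IH by simp
  qed
  have lx: "ln x \<ge> 2"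
  proof -
    have "ln 16 \<ge> (2::real)" using ln_realpow[of 2 4] ln2_ge_two_thirds by simp
    also have "ln 16 \<le> ln x" using assms by simp
    finally show ?thesis .
  qed
  have l4: "ln 4 \<ge> (1::real)" using ln_realpow[of 2 2] ln2_ge_two_thirds by simp
  define i where "i = nat \<lceil>log 2 (ln x)\<rceil>"
  have l0: "log 2 (ln x) \<ge> 1" using lx by (simp add: le_log_iff)
  have "log 2 (ln x) \<le> real i" unfolding i_def by linarith
  then have "ln x \<le> 2 ^ i"
    using lx by (simp add: log_le_iff powr_realpow)
  also have "\<dots> \<le> 2 ^ i * ln 4" using l4 by simp
  also have "\<dots> = ln (4 ^ (2 ^ i))" by (simp add: ln_realpow)
  finally have xi: "x \<le> 4 ^ (2 ^ i)"
    using assms by (subst (asm) ln_le_cancel_iff) auto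
  have "(\<Sum>p\<in>primes_between 0 x. 1 / real p) \<le> (\<Sum>p\<in>primes_between 0 (4 ^ (2 ^ i)). 1 / real p)"
    using xi by (intro sum_mono2 primes_between_mono) auto
  also have "\<dots> \<le> 16 * real i + 4" using iter[of i] by simp
  also have "real i \<le> log 2 (ln x) + 1" unfolding i_def using l0 by linarith
  also have "log 2 (ln x) = ln (ln x) / ln 2" by (simp add: log_def)
  also have "\<dots> \<le> ln (ln x) / (2/3)"
    using lx ln2_ge_two_thirds by (intro divide_left_mono) auto
  finally show ?thesis by simp
qed

lemma exp_le_one_minus:
  fixes t :: real
  assumes "0 \<le> t" "t \<le> 1 / 2"
  shows "exp (- 2 * t) \<le> 1 - t"
proof -
  have "- 2 * t \<le> - t - 2 * t\<^sup>2"
    using mult_left_mono[of t "1/2" t] assms by (simp add: power2_eq_square)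
  also have "\<dots> \<le> ln (1 - t)"
    by (rule ln_one_minus_pos_lower_bound) (use assms in auto)
  finally have "exp (- 2 * t) \<le> exp (ln (1 - t))" by simp
  then show ?thesis using assms by simp
qed

section \<open>Products over primes as sifting densities\<close>

definition mertens_prod :: "real \<Rightarrow> real \<Rightarrow> real" where
  "mertens_prod y x = (\<Prod>p\<in>primes_between y x. 1 - 1 / real p)"

lemma mertens_factor: "p \<in> primes_between y x \<Longrightarrow> 1 / 2 \<le> 1 - 1 / real p \<and> 1 - 1 / real p \<le> 1"
  using ge_2_primes_between[of p y x] by (auto simp: field_simps)

lemma mertens_prod_pos: "mertens_prod y x > 0"
  unfolding mertens_prod_def by (intro prod_pos) (use mertens_factor in force)

lemma mertens_prod_le_1: "mertens_prod y x \<le> 1"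
  unfolding mertens_prod_def by (intro prod_le_1) (use mertens_factor in force)

lemma mertens_prod_split:
  "y \<le> v \<Longrightarrow> v \<le> x \<Longrightarrow> mertens_prod y x = mertens_prod y v * mertens_prod v x"
  unfolding mertens_prod_def by (rule prod_primes_between_split)

lemma mertens_prod_antimono:
  assumes "x \<le> x'"
  shows "mertens_prod y x' \<le> mertens_prod y x"
proof (cases "y \<le> x")
  case True
  then show ?thesis
    using mertens_prod_split[of y x x'] assms mertens_prod_le_1[of x x'] mertens_prod_pos[of y x] by simp
next
  case False
  then have "primes_between y x = {}" by (auto simp: primes_between_def)
  then show ?thesis using mertens_prod_le_1[of y x'] by (simp add: mertens_prod_def[of y x])
qed

lemma mertens_prod_ge_exp:
  "exp (- 2 * (\<Sum>p\<in>primes_between y x. 1 / real p)) \<le> mertens_prod y x"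
proof -
  have "exp (- 2 * (\<Sum>p\<in>primes_between y x. 1 / real p)) = (\<Prod>p\<in>primes_between y x. exp (- 2 * (1 / real p)))"
    by (simp add: exp_sum sum_distrib_left)
  also have "\<dots> \<le> mertens_prod y x"
    unfolding mertens_prod_def
    by (intro prod_mono conjI exp_le_one_minus) (auto simp: field_simps dest: ge_2_primes_between)
  finally show ?thesis .
qed

text \<open>The exponent 48 is twice the 24 of the prime sum. Any fixed exponent would do: the bound
  serves to show that the rough numbers up to \<open>X\<close> number at least \<open>X\<close>
  divided by a fixed power of \<open>ln X\<close>.\<close>

lemma mertens_prod_ge:
  assumes "x \<ge> 16"
  shows "mertens_prod 0 x \<ge> exp (- 40) * ln x powr (- 48)"
proof -
  have "ln x > 0" using assms by simp
  then have "exp (- 40) * ln x powr (- 48) = exp (- 2 * (24 * ln (ln x) + 20))"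
    by (simp add: powr_def exp_add [symmetric])
  also have "\<dots> \<le> exp (- 2 * (\<Sum>p\<in>primes_between 0 x. 1 / real p))"
    using sum_inverse_primes_le[OF assms] by simp
  finally show ?thesis using mertens_prod_ge_exp[of 0 x] by simp
qed

text \<open>Splitting the smooth numbers up to \<open>x\<close> by divisibility by one prime at a time gives
  the Euler product bound without infinite products.\<close>

lemma sum_inverse_smooth_le:
  fixes x :: real
  assumes "finite P" "\<And>p. p \<in> P \<Longrightarrow> prime p"
  shows "(\<Sum>n | n > 0 \<and> real n \<le> x \<and> prime_factors n \<subseteq> P. 1 / real n) * (\<Prod>p\<in>P. 1 - 1 / real p) \<le> 1"
  using assms
proof (induction P rule: finite_induct)
  case empty
  have "{n. n > 0 \<and> real n \<le> x \<and> prime_factors n \<subseteq> {}} \<subseteq> {1}"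
    by (auto simp: prime_factorization_empty_iff)
  then have "(\<Sum>n | n > 0 \<and> real n \<le> x \<and> prime_factors n \<subseteq> {}. 1 / real n) \<le> (\<Sum>n\<in>{1::nat}. 1 / real n)"
    by (intro sum_mono2) auto
  then show ?case by simp
next
  case (insert p P)
  define H where "H P = {n. n > 0 \<and> real n \<le> x \<and> prime_factors n \<subseteq> P}" for P :: "nat set"
  have fin: "finite (H P)" for P
    by (rule finite_subset[of _ "{..nat \<lfloor>x\<rfloor>}"]) (auto simp: H_def le_nat_floor)
  have p: "prime p" using insert by auto
  have p2: "real p \<ge> 2" using prime_ge_2_nat[OF p] by simp
  have "H (insert p P) = H P \<union> {n \<in> H (insert p P). p dvd n}"
    using insert.hyps p by (auto simp: H_def in_prime_factors_iff)
  moreover have "H P \<inter> {n \<in> H (insert p P). p dvd n} = {}"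
    using insert.hyps p by (auto simp: H_def in_prime_factors_iff)
  ultimately have "(\<Sum>n\<in>H (insert p P). 1 / real n) = (\<Sum>n\<in>H P. 1 / real n) + (\<Sum>n | n \<in> H (insert p P) \<and> p dvd n. 1 / real n)"
    using fin sum.union_disjoint[of "H P" "{n \<in> H (insert p P). p dvd n}"] by simp
  also have "(\<Sum>n | n \<in> H (insert p P) \<and> p dvd n. 1 / real n) \<le> (\<Sum>n\<in>(*) p ` H (insert p P). 1 / real n)"
  proof (intro sum_mono2)
    show "{n \<in> H (insert p P). p dvd n} \<subseteq> (*) p ` H (insert p P)"
    proof
      fix n assume "n \<in> {n \<in> H (insert p P). p dvd n}"
      then obtain m where m: "n = p * m" "p * m \<in> H (insert p P)" by auto
      then have "real m \<le> x"
        using p2 by (auto simp: H_def intro: order_trans[rotated] simp flip: of_nat_mult)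
      with m have "m \<in> H (insert p P)"
        using p2 by (auto simp: H_def prime_factors_product)
      then show "n \<in> (*) p ` H (insert p P)" using m by blast
    qed
  qed (use fin in auto)
  also have "(\<Sum>n\<in>(*) p ` H (insert p P). 1 / real n) = (\<Sum>n\<in>H (insert p P). 1 / real p * (1 / real n))"
    using p2 by (subst sum.reindex) (auto simp: inj_on_def)
  also have "\<dots> = 1 / real p * (\<Sum>n\<in>H (insert p P). 1 / real n)"
    by (simp only: sum_distrib_left)
  finally have "(\<Sum>n\<in>H (insert p P). 1 / real n) * (1 - 1 / real p) \<le> (\<Sum>n\<in>H P. 1 / real n)"
    by (simp add: algebra_simps)
  then have "(\<Sum>n\<in>H (insert p P). 1 / real n) * (1 - 1 / real p) * (\<Prod>p\<in>P. 1 - 1 / real p) \<le> (\<Sum>n\<in>H P. 1 / real n) * (\<Prod>p\<in>P. 1 - 1 / real p)"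
    using insert.prems prime_ge_1_nat by (intro mult_right_mono prod_nonneg) (auto simp: divide_le_eq_1)
  also have "\<dots> \<le> 1"
    using insert by (simp add: H_def)
  finally show ?case
    using insert.hyps by (simp add: H_def mult.assoc)
qed

text \<open>All prime factors of an integer up to \<open>x\<close> are at most \<open>x\<close>, so
  the sum over smooth numbers dominates the harmonic sum and hence \<open>ln x\<close>.\<close>

lemma mertens_prod_le:
  assumes "x > 1"
  shows "mertens_prod 0 x \<le> 1 / ln x"
proof -
  define n where "n = nat \<lfloor>x\<rfloor>"
  have n: "real n \<le> x" "x < real (n + 1)" "n \<ge> 1"
    using assms unfolding n_def by linarith+
  have "ln x \<le> ln (real (n + 1))" using n assms by (subst ln_le_cancel_iff) auto
  also have "\<dots> \<le> harm n" using harm_ge_ln[of n] by (simp add: add.commute) 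
  also have "harm n = (\<Sum>m\<in>{1..n}. 1 / real m)"
    by (simp add: harm_def field_simps)
  also have "\<dots> \<le> (\<Sum>m | m > 0 \<and> real m \<le> x \<and> prime_factors m \<subseteq> primes_between 0 x. 1 / real m)"
  proof (intro sum_mono2)
    show "finite {m. m > 0 \<and> real m \<le> x \<and> prime_factors m \<subseteq> primes_between 0 x}"
      by (rule finite_subset[of _ "{..n}"]) (auto simp: n_def le_nat_floor)
    show "{1..n} \<subseteq> {m. m > 0 \<and> real m \<le> x \<and> prime_factors m \<subseteq> primes_between 0 x}"
    proof safe
      fix m p assume m: "m \<in> {1..n}" and "p \<in> prime_factors m"
      then have "prime p" "p \<le> m" by (auto simp: in_prime_factors_iff dvd_imp_le)
      moreover have "real m \<le> x" using m n by (meson atLeastAtMost_iff of_nat_le_iff order_trans)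
      ultimately show "p \<in> primes_between 0 x"
        by (auto simp: primes_between_def prime_gt_0_nat)
    next
      fix m assume "m \<in> {1..n}"
      then show "real m \<le> x" using n by (meson atLeastAtMost_iff of_nat_le_iff order_trans)
    qed auto
  qed auto
  finally have "ln x * mertens_prod 0 x \<le> (\<Sum>m | m > 0 \<and> real m \<le> x \<and> prime_factors m \<subseteq> primes_between 0 x. 1 / real m) * mertens_prod 0 x"
    using mertens_prod_pos[of 0 x] by (intro mult_right_mono) auto
  also have "\<dots> \<le> 1"
    unfolding mertens_prod_def by (rule sum_inverse_smooth_le) (auto dest: prime_primes_between)
  finally show ?thesis using assms by (simp add: field_simps)
qed

text \<open>Telescoping with \<open>1 / n^2 \<le> 1 / (n - 1) - 1 / n\<close>. It bounds all losses
  of second order in \<open>1 / p\<close> once the primes up to \<open>w\<close> have been set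
  apart.\<close>

lemma sum_inverse_squares_primes:
  fixes w :: nat
  assumes "w \<ge> 1"
  shows "(\<Sum>p\<in>primes_between w x. 1 / real p ^ 2) \<le> 1 / w"
proof -
  have tele: "(\<Sum>n\<in>{w<..m}. 1 / real n ^ 2) \<le> 1 / w - 1 / m" if "m \<ge> w" for m
    using that
  proof (induction m rule: dec_induct)
    case (step m)
    have eq: "{w<..Suc m} = insert (Suc m) {w<..m}" using step by auto
    have "1 / real (Suc m) ^ 2 \<le> 1 / (real m * real (Suc m))"
      using step assms by (intro divide_left_mono) (auto simp: power2_eq_square)
    also have "\<dots> = 1 / m - 1 / Suc m"
      using step assms by (simp add: field_simps)
    finally show ?case using step.IH unfolding eq by simp
  qed auto
  define m where "m = max w (nat \<lfloor>x\<rfloor>)"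
  have "(\<Sum>p\<in>primes_between w x. 1 / real p ^ 2) \<le> (\<Sum>n\<in>{w<..m}. 1 / real n ^ 2)"
    by (intro sum_mono2) (auto simp: primes_between_def m_def le_nat_floor le_max_iff_disj)
  also have "\<dots> \<le> 1 / w - 1 / m" by (rule tele) (auto simp: m_def)
  also have "\<dots> \<le> 1 / w" by simp
  finally show ?thesis .
qed

lemma prod_one_plus_le_exp:
  fixes f :: "'a \<Rightarrow> real"
  assumes "\<And>x. x \<in> A \<Longrightarrow> f x \<ge> 0"
  shows "(\<Prod>x\<in>A. 1 + f x) \<le> exp (sum f A)"
proof (cases "finite A")
  case True
  have "(\<Prod>x\<in>A. 1 + f x) \<le> (\<Prod>x\<in>A. exp (f x))"
    using assms by (intro prod_mono) auto
  then show ?thesis using True by (simp add: exp_sum)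
qed auto

text \<open>For \<open>y = (ln X)^2\<close> the right-hand side is a constant times a power of
  \<open>ln (ln X)\<close>: the loss in the error term when the singular series is averaged.\<close>

lemma prod_one_plus_inverse_primes_le:
  fixes c :: real
  assumes "c \<ge> 0" "y \<ge> 16" "w \<ge> 0"
  shows "(\<Prod>p\<in>primes_between w y. 1 + c / real p) \<le> exp (c * (24 * ln (ln y) + 20))"
proof -
  have "(\<Prod>p\<in>primes_between w y. 1 + c / real p) \<le> exp (\<Sum>p\<in>primes_between w y. c / real p)"
    using assms by (intro prod_one_plus_le_exp) auto
  also have "(\<Sum>p\<in>primes_between w y. c / real p) \<le> (\<Sum>p\<in>primes_between 0 y. c / real p)"
    using assms by (intro sum_mono2 primes_between_mono) auto
  also have "\<dots> = c * (\<Sum>p\<in>primes_between 0 y. 1 / real p)"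
    by (simp add: sum_distrib_left)
  also have "\<dots> \<le> c * (24 * ln (ln y) + 20)"
    using assms by (intro mult_left_mono sum_inverse_primes_le) auto
  finally show ?thesis by simp
qed

text \<open>The distinct prime divisors multiply to a divisor of \<open>h\<close>, and each is at
  least 2. A nonzero difference of size \<open>X\<close> thus has only \<open>O(ln X)\<close> of
  them.\<close>

lemma card_prime_divisors_le:
  fixes h :: int
  assumes "h \<noteq> 0"
  shows "2 ^ card {p \<in> primes_between y x. int p dvd h} \<le> \<bar>real_of_int h\<bar>"
proof -
  let ?D = "{p \<in> primes_between y x. int p dvd h}"
  have "\<Prod>(int ` ?D) dvd h"
    by (rule prod_primes_dvd) (auto dest: prime_primes_between)
  then have "\<Prod>(int ` ?D) \<le> \<bar>h\<bar>"
    using assms dvd_imp_le_int[of h "\<Prod>(int ` ?D)"] by linarith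
  then have le: "(\<Prod>p\<in>?D. int p) \<le> \<bar>h\<bar>"
    by (subst (asm) prod.reindex) auto
  have "(2::int) ^ card ?D = (\<Prod>p\<in>?D. 2)" by simp
  also have "\<dots> \<le> (\<Prod>p\<in>?D. int p)"
    by (intro prod_mono) (auto dest!: prime_primes_between prime_ge_2_nat)
  also note le
  finally have "real_of_int (2 ^ card ?D) \<le> of_int \<bar>h\<bar>" by (simp only: of_int_le_iff)
  then show ?thesis by simp
qed

section \<open>The Brun--Hooley sieve\<close>

lemma sum_subsets_insert:
  fixes F :: "'a set \<Rightarrow> real"
  assumes "finite P" "p \<notin> P"
  shows "(\<Sum>D | D \<subseteq> insert p P \<and> Q (card D). F D) =
    (\<Sum>D | D \<subseteq> P \<and> Q (card D). F D) + (\<Sum>D | D \<subseteq> P \<and> Q (Suc (card D)). F (insert p D))"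
proof -
  have card: "card (insert p D) = Suc (card D)" if "D \<subseteq> P" for D
    using that assms finite_subset[of D P] by (subst card_insert_disjoint) auto
  have eq: "{D. D \<subseteq> insert p P \<and> Q (card D)} = {D. D \<subseteq> P \<and> Q (card D)} \<union> insert p ` {D. D \<subseteq> P \<and> Q (Suc (card D))}"
  proof (intro equalityI subsetI)
    fix D assume D: "D \<in> {D. D \<subseteq> insert p P \<and> Q (card D)}"
    show "D \<in> {D. D \<subseteq> P \<and> Q (card D)} \<union> insert p ` {D. D \<subseteq> P \<and> Q (Suc (card D))}"
    proof (cases "p \<in> D")
      case True
      define E where "E = D - {p}"
      have E: "D = insert p E" "E \<subseteq> P" using True D by (auto simp: E_def)
      then show ?thesis using D card[of E] by auto
    qed (use D in auto)
  qed (auto simp: card)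
  have fin: "finite {D. D \<subseteq> P \<and> R D}" for R
    using assms by (auto intro: finite_subset[of _ "Pow P"])
  have inj: "inj_on (insert p) {D. D \<subseteq> P \<and> Q (Suc (card D))}"
    using assms by (auto simp: inj_on_def)
  show ?thesis
    unfolding eq using fin assms
    by (subst sum.union_disjoint) (auto simp: sum.reindex[OF inj])
qed

text \<open>The elementary symmetric polynomial of degree \<open>n\<close>.\<close>

definition esum :: "nat \<Rightarrow> 'a set \<Rightarrow> ('a \<Rightarrow> real) \<Rightarrow> real" where
  "esum n P g = (\<Sum>D | D \<subseteq> P \<and> card D = n. \<Prod>p\<in>D. g p)"

text \<open>Inclusion-exclusion for the product of the \<open>1 - g p\<close>, cut off after subsets
  of size \<open>b\<close>.\<close>

definition psum :: "nat \<Rightarrow> 'a set \<Rightarrow> ('a \<Rightarrow> real) \<Rightarrow> real" where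
  "psum b P g = (\<Sum>D | D \<subseteq> P \<and> card D \<le> b. (-1) ^ card D * (\<Prod>p\<in>D. g p))"

lemma subsets_card_0: "finite P \<Longrightarrow> {D. D \<subseteq> P \<and> card D = 0} = {{}}"
  using finite_subset[of _ P] by (auto simp: card_eq_0_iff)

lemma esum_0: "finite P \<Longrightarrow> esum 0 P g = 1"
  unfolding esum_def by (subst subsets_card_0) auto

lemma psum_0: "finite P \<Longrightarrow> psum 0 P g = 1"
  unfolding psum_def le_zero_eq by (subst subsets_card_0) auto

lemma prod_insert_subset:
  fixes g :: "'a \<Rightarrow> real"
  assumes "finite P" "p \<notin> P" "D \<subseteq> P"
  shows "prod g (insert p D) = g p * prod g D" "card (insert p D) = Suc (card D)"
proof -
  have "finite D" "p \<notin> D" using assms finite_subset by auto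
  then show "prod g (insert p D) = g p * prod g D" "card (insert p D) = Suc (card D)" by simp_all
qed

lemma esum_insert:
  assumes "finite P" "p \<notin> P"
  shows "esum (Suc n) (insert p P) g = esum (Suc n) P g + g p * esum n P g"
  unfolding esum_def
  by (subst sum_subsets_insert[OF assms])
     (simp add: sum_distrib_left prod_insert_subset[OF assms] cong: conj_cong)

lemma psum_insert:
  assumes "finite P" "p \<notin> P"
  shows "psum (Suc b) (insert p P) g = psum (Suc b) P g - g p * psum b P g"
  unfolding psum_def
  by (subst sum_subsets_insert[OF assms])
     (simp add: sum_distrib_left prod_insert_subset[OF assms] sum_negf mult_ac cong: conj_cong)

lemma esum_nonneg:
  "(\<And>p. p \<in> P \<Longrightarrow> g p \<ge> 0) \<Longrightarrow> esum n P g \<ge> 0"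
  unfolding esum_def by (intro sum_nonneg prod_nonneg) auto

text \<open>The weights lie in \<open>[0, 1]\<close> instead of being indicators because the
  inequality is used twice: pointwise for the indicators of divisibility, and for the local
  densities. Adding an element reduces the claim for \<open>b\<close> to the claims for
  \<open>b\<close> and \<open>b - 1\<close>; the minus sign in the recursion of \<open>psum\<close>
  makes the two errors add up with the same sign.\<close>

lemma bonferroni:
  fixes g :: "'a \<Rightarrow> real"
  assumes "finite P" "\<And>p. p \<in> P \<Longrightarrow> 0 \<le> g p \<and> g p \<le> 1"
  shows "0 \<le> (-1) ^ b * (psum b P g - (\<Prod>p\<in>P. 1 - g p)) \<and>
         (-1) ^ b * (psum b P g - (\<Prod>p\<in>P. 1 - g p)) \<le> esum (Suc b) P g"
  using assms
proof (induction P arbitrary: b rule: finite_induct)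
  case empty
  have "{D::'a set. D \<subseteq> {} \<and> card D \<le> b} = {{}}" by auto
  moreover have "{D::'a set. D \<subseteq> {} \<and> card D = Suc b} = {}" by auto
  ultimately show ?case by (simp add: psum_def esum_def)
next
  case (insert p P)
  let ?V = "\<Prod>p\<in>P. 1 - g p"
  have g: "0 \<le> g p" "g p \<le> 1" using insert.prems by auto
  have V: "0 \<le> ?V" "?V \<le> 1"
    using insert.prems by (auto intro!: prod_nonneg prod_le_1)
  have IH: "0 \<le> (-1) ^ b * (psum b P g - ?V)" "(-1) ^ b * (psum b P g - ?V) \<le> esum (Suc b) P g" for b
    using insert.IH[of b] insert.prems by auto
  show ?case
  proof (cases b)
    case 0
    have "g p * ?V \<le> g p * 1" using g V by (intro mult_left_mono) auto
    moreover have "0 \<le> g p * ?V" using g V by simp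
    ultimately show ?thesis
      using IH[of 0] insert.hyps 0 by (simp add: psum_0 esum_insert esum_0 algebra_simps)
  next
    case (Suc b')
    have "(-1) ^ b * (psum b (insert p P) g - (\<Prod>p\<in>insert p P. 1 - g p)) =
       (-1) ^ Suc b' * (psum (Suc b') P g - ?V) + g p * ((-1) ^ b' * (psum b' P g - ?V))"
      using insert.hyps Suc by (simp add: psum_insert algebra_simps)
    moreover have "g p * ((-1) ^ b' * (psum b' P g - ?V)) \<ge> 0"
      using IH[of b'] g by simp
    moreover have "g p * ((-1) ^ b' * (psum b' P g - ?V)) \<le> g p * esum (Suc b') P g"
      using IH[of b'] g by (intro mult_left_mono) auto
    ultimately show ?thesis
      using IH[of "Suc b'"] insert.hyps Suc by (simp add: esum_insert)
  qed
qed

lemma power_Suc_add_ge: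
  fixes a b :: real
  assumes "a \<ge> 0" "b \<ge> 0"
  shows "a ^ Suc n + real (Suc n) * b * a ^ n \<le> (a + b) ^ Suc n"
proof (induction n)
  case (Suc n)
  have "a ^ Suc (Suc n) + real (Suc (Suc n)) * b * a ^ Suc n \<le> (a + b) * (a ^ Suc n + real (Suc n) * b * a ^ n)"
    using assms by (simp add: algebra_simps)
  also have "\<dots> \<le> (a + b) * (a + b) ^ Suc n"
    using assms Suc by (intro mult_left_mono) auto
  finally show ?case by simp
qed auto

text \<open>In the expansion of \<open>sum g P ^ n\<close> the product over each subset of size
  \<open>n\<close> occurs \<open>fact n\<close> times. This factorial is what later makes the
  truncation errors summable.\<close>

lemma esum_le:
  fixes g :: "'a \<Rightarrow> real"
  assumes "finite P" "\<And>p. p \<in> P \<Longrightarrow> 0 \<le> g p"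
  shows "esum n P g \<le> sum g P ^ n / fact n"
  using assms
proof (induction P arbitrary: n rule: finite_induct)
  case empty
  have "{D::'a set. D \<subseteq> {} \<and> card D = n} = (if n = 0 then {{}} else {})" by auto
  then show ?case by (simp add: esum_def)
next
  case (insert p P)
  show ?case
  proof (cases n)
    case 0
    then show ?thesis using insert by (simp add: esum_0)
  next
    case (Suc m)
    let ?L = "sum g P"
    have L: "?L \<ge> 0" using insert.prems by (intro sum_nonneg) auto
    have "esum n (insert p P) g = esum (Suc m) P g + g p * esum m P g"
      using insert.hyps Suc by (simp add: esum_insert)
    also have "\<dots> \<le> ?L ^ Suc m / fact (Suc m) + g p * (?L ^ m / fact m)"
    proof -
      have "esum n P g \<le> ?L ^ n / fact n" for n
        using insert.IH insert.prems by blast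
      from this[of "Suc m"] this[of m] show ?thesis
        using insert.prems by (intro add_mono mult_left_mono) blast+
    qed
    also have "\<dots> = (?L ^ Suc m + real (Suc m) * g p * ?L ^ m) / fact (Suc m)"
      by (simp add: divide_simps)
    also have "\<dots> \<le> (?L + g p) ^ Suc m / fact (Suc m)"
      using L insert.prems by (intro divide_right_mono power_Suc_add_ge) auto
    finally show ?thesis using insert.hyps Suc by (simp add: add.commute)
  qed
qed

text \<open>\<open>\<nu> p\<close> will be the number of residue classes excluded at
  \<open>p\<close>, so this sum is the accumulated rounding error of a truncated expansion, that is,
  the cost of the sieve level.\<close>

lemma sum_small_subsets_le:
  fixes \<nu> :: "'a \<Rightarrow> real"
  assumes "finite P" "\<And>p. p \<in> P \<Longrightarrow> 0 \<le> \<nu> p"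
  shows "(\<Sum>D | D \<subseteq> P \<and> card D \<le> n. \<Prod>p\<in>D. \<nu> p) \<le> (1 + sum \<nu> P) ^ n"
  using assms
proof (induction P arbitrary: n rule: finite_induct)
  case empty
  have "{D::'a set. D \<subseteq> {} \<and> card D \<le> n} = {{}}" by auto
  then show ?case by simp
next
  case (insert p P)
  show ?case
  proof (cases n)
    case 0
    have "{D. D \<subseteq> insert p P \<and> card D \<le> 0} = {{}}"
      using insert.hyps subsets_card_0[of "insert p P"] by simp
    then show ?thesis using 0 by simp
  next
    case (Suc m)
    have L: "sum \<nu> P \<ge> 0" using insert.prems by (intro sum_nonneg) auto
    have "(\<Sum>D | D \<subseteq> insert p P \<and> card D \<le> n. \<Prod>p\<in>D. \<nu> p) =
       (\<Sum>D | D \<subseteq> P \<and> card D \<le> Suc m. \<Prod>p\<in>D. \<nu> p) + \<nu> p * (\<Sum>D | D \<subseteq> P \<and> card D \<le> m. \<Prod>p\<in>D. \<nu> p)"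
      unfolding Suc using insert.hyps
      by (subst sum_subsets_insert)
         (auto simp: sum_distrib_left prod_insert_subset[OF insert.hyps] cong: conj_cong intro!: sum.cong)
    also have "\<dots> \<le> (1 + sum \<nu> P) ^ Suc m + \<nu> p * (1 + sum \<nu> P) ^ m"
    proof -
      have "(\<Sum>D | D \<subseteq> P \<and> card D \<le> n. \<Prod>p\<in>D. \<nu> p) \<le> (1 + sum \<nu> P) ^ n" for n
        using insert.IH insert.prems by blast
      from this[of "Suc m"] this[of m] show ?thesis
        using insert.prems by (intro add_mono mult_left_mono) blast+
    qed
    also have "\<nu> p * (1 + sum \<nu> P) ^ m \<le> real (Suc m) * \<nu> p * (1 + sum \<nu> P) ^ m"
    proof -
      have "0 \<le> \<nu> p * (1 + sum \<nu> P) ^ m" using insert.prems L by simp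
      from mult_right_mono[OF _ this, of 1 "real (Suc m)"] show ?thesis by (simp add: mult.assoc)
    qed
    also have "(1 + sum \<nu> P) ^ Suc m + real (Suc m) * \<nu> p * (1 + sum \<nu> P) ^ m \<le> (1 + sum \<nu> P + \<nu> p) ^ Suc m"
      using insert.prems L by (intro power_Suc_add_ge) auto
    finally show ?thesis using insert.hyps Suc by (simp add: add_ac)
  qed
qed

section \<open>Combining blocks of primes\<close>

lemma prod_sum_PiE:
  fixes f :: "'a \<Rightarrow> 'b \<Rightarrow> 'c::comm_semiring_1"
  assumes "finite J" "\<And>j. j \<in> J \<Longrightarrow> finite (F j)"
  shows "(\<Prod>j\<in>J. \<Sum>D\<in>F j. f j D) = (\<Sum>\<phi>\<in>PiE J F. \<Prod>j\<in>J. f j (\<phi> j))"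
  using assms
proof (induction J rule: finite_induct)
  case (insert i J)
  have inj: "inj_on (\<lambda>(y, g). g(i := y)) (F i \<times> PiE J F)"
    using insert.hyps by (intro inj_combinator) auto
  have "(\<Sum>\<phi>\<in>PiE (insert i J) F. \<Prod>j\<in>insert i J. f j (\<phi> j)) =
      (\<Sum>(y, g)\<in>F i \<times> PiE J F. \<Prod>j\<in>insert i J. f j ((g(i := y)) j))"
    unfolding PiE_insert_eq by (subst sum.reindex[OF inj]) (simp add: case_prod_unfold)
  also have "\<dots> = (\<Sum>(y, g)\<in>F i \<times> PiE J F. f i y * (\<Prod>j\<in>J. f j (g j)))"
  proof (rule sum.cong, simp, clarify)
    fix y g
    have "(\<Prod>j\<in>J. f j ((g(i := y)) j)) = (\<Prod>j\<in>J. f j (g j))"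
      using insert.hyps by (intro prod.cong) auto
    then show "(\<Prod>j\<in>insert i J. f j ((g(i := y)) j)) = f i y * (\<Prod>j\<in>J. f j (g j))"
      using insert.hyps by simp
  qed
  also have "\<dots> = (\<Sum>y\<in>F i. f i y) * (\<Sum>g\<in>PiE J F. \<Prod>j\<in>J. f j (g j))"
    by (simp add: sum_product sum.cartesian_product)
  finally show ?case using insert by simp
qed auto

text \<open>Hooley's device for lower bounds. Lower truncations of single blocks may be negative and
  cannot be multiplied. Instead the upper bounds \<open>u j\<close> are traded for the true factors
  \<open>x j\<close> one at a time; each trade costs one error factor \<open>c l\<close>, while the
  other factors may stay at \<open>u j\<close>. Every term is again a product of sums over subsets,
  one sum per block, and can be averaged.\<close>

lemma prod_diff_le:
  fixes x u c :: "'a \<Rightarrow> real"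
  assumes "finite J" "\<And>j. j \<in> J \<Longrightarrow> 0 \<le> x j \<and> x j \<le> u j \<and> u j \<le> x j + c j"
  shows "(\<Prod>j\<in>J. u j) - (\<Prod>j\<in>J. x j) \<le> (\<Sum>l\<in>J. \<Prod>j\<in>J. if j = l then c j else u j)"
  using assms
proof (induction J rule: finite_induct)
  case (insert i J)
  let ?U = "\<Prod>j\<in>J. u j" and ?X = "\<Prod>j\<in>J. x j"
  let ?S = "\<Sum>l\<in>J. \<Prod>j\<in>J. if j = l then c j else u j"
  have i: "0 \<le> x i" "x i \<le> u i" "u i \<le> x i + c i" using insert.prems by auto
  have U: "?U \<ge> 0" using insert.prems by (intro prod_nonneg) force
  have XU: "?X \<le> ?U" using insert.prems by (intro prod_mono) auto
  have "(\<Sum>l\<in>insert i J. \<Prod>j\<in>insert i J. if j = l then c j else u j) =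
     c i * ?U + (\<Sum>l\<in>J. \<Prod>j\<in>insert i J. if j = l then c j else u j)"
  proof -
    have "(\<Prod>j\<in>J. if j = i then c j else u j) = ?U"
      using insert.hyps by (intro prod.cong) auto
    then show ?thesis using insert.hyps by simp
  qed
  also have "(\<Sum>l\<in>J. \<Prod>j\<in>insert i J. if j = l then c j else u j) = u i * ?S"
    using insert.hyps by (auto simp: sum_distrib_left intro!: sum.cong)
  finally have eq: "(\<Sum>l\<in>insert i J. \<Prod>j\<in>insert i J. if j = l then c j else u j) = c i * ?U + u i * ?S" .
  have "u i * ?U - x i * ?X = (u i - x i) * ?U + x i * (?U - ?X)"
    by (simp add: algebra_simps)
  also have "\<dots> \<le> c i * ?U + u i * ?S"
  proof -
    have "u i - x i \<le> c i" "0 \<le> u i" using i by linarith+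
    moreover have "?U - ?X \<le> ?S" using insert by auto
    ultimately show ?thesis using i U XU by (intro add_mono mult_right_mono mult_mono) auto
  qed
  finally show ?case using eq insert.hyps by simp
qed auto

text \<open>A product over blocks of sums over subsets is a sum over unions of one subset per block.
  The blocks are disjoint, so products over the union factor and \<open>level\<close> applies to it.
  Leaving \<open>F\<close> and \<open>coef\<close> open covers both the truncated sums in all blocks
  and the variant in which one block carries its error term.\<close>

lemma sieve_expand:
  fixes P :: "'j \<Rightarrow> 'p set" and g \<nu> :: "'p \<Rightarrow> real" and coef :: "'j \<Rightarrow> 'p set \<Rightarrow> real"
  assumes "finite S" "finite J" "\<And>j. j \<in> J \<Longrightarrow> finite (P j)"
    and disj: "\<And>i j. i \<in> J \<Longrightarrow> j \<in> J \<Longrightarrow> i \<noteq> j \<Longrightarrow> P i \<inter> P j = {}"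
    and F: "\<And>j. j \<in> J \<Longrightarrow> F j \<subseteq> Pow (P j)"
    and coef: "\<And>j D. \<bar>coef j D\<bar> \<le> 1"
    and level: "\<And>D. D \<subseteq> (\<Union>j\<in>J. P j) \<Longrightarrow> \<bar>real (card {t\<in>S. \<forall>p\<in>D. B p t}) - Y * (\<Prod>p\<in>D. g p)\<bar> \<le> (\<Prod>p\<in>D. \<nu> p)"
  shows "\<bar>(\<Sum>t\<in>S. \<Prod>j\<in>J. \<Sum>D\<in>F j. coef j D * (\<Prod>p\<in>D. of_bool (B p t))) - Y * (\<Prod>j\<in>J. \<Sum>D\<in>F j. coef j D * (\<Prod>p\<in>D. g p))\<bar>
     \<le> (\<Prod>j\<in>J. \<Sum>D\<in>F j. \<Prod>p\<in>D. \<nu> p)"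
proof -
  have finF: "finite (F j)" if "j \<in> J" for j
    using F[OF that] assms(3)[OF that] by (meson finite_Pow_iff finite_subset)
  have sub1: "\<phi> j \<subseteq> P j" if "\<phi> \<in> PiE J F" "j \<in> J" for \<phi> j
    using F[OF that(2)] PiE_mem[OF that] by auto
  have union: "(\<Prod>j\<in>J. \<Prod>p\<in>\<phi> j. h p) = (\<Prod>p\<in>(\<Union>j\<in>J. \<phi> j). h p)" if "\<phi> \<in> PiE J F" for \<phi> and h :: "'p \<Rightarrow> real"
  proof (rule prod.UNION_disjoint[symmetric])
    show "\<forall>i\<in>J. finite (\<phi> i)"
      using sub1[OF that] assms(3) finite_subset by metis
    show "\<forall>i\<in>J. \<forall>j\<in>J. i \<noteq> j \<longrightarrow> \<phi> i \<inter> \<phi> j = {}"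
      using sub1[OF that] disj by (metis disjoint_iff subsetD)
  qed fact
  have expand: "(\<Prod>j\<in>J. \<Sum>D\<in>F j. coef j D * (\<Prod>p\<in>D. h p)) =
     (\<Sum>\<phi>\<in>PiE J F. (\<Prod>j\<in>J. coef j (\<phi> j)) * (\<Prod>p\<in>(\<Union>j\<in>J. \<phi> j). h p))" for h :: "'p \<Rightarrow> real"
    using assms(2) finF by (subst prod_sum_PiE) (auto simp: prod.distrib union intro!: sum.cong)
  have sub: "(\<Union>j\<in>J. \<phi> j) \<subseteq> (\<Union>j\<in>J. P j)" if "\<phi> \<in> PiE J F" for \<phi>
    using sub1[OF that] by blast
  have finU: "finite (\<Union>j\<in>J. P j)" using assms by auto
  have count: "(\<Sum>t\<in>S. \<Prod>p\<in>D. of_bool (B p t) :: real) = real (card {t\<in>S. \<forall>p\<in>D. B p t})" if "D \<subseteq> (\<Union>j\<in>J. P j)" for D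
  proof -
    have "finite D" using that finU by (rule finite_subset)
    then have "(\<Prod>p\<in>D. of_bool (B p t) :: real) = of_bool (\<forall>p\<in>D. B p t)" for t
      by (induction D rule: finite_induct) auto
    then show ?thesis
      using assms(1) by (simp add: sum.If_cases of_bool_def Int_def)
  qed
  have "(\<Sum>t\<in>S. \<Prod>j\<in>J. \<Sum>D\<in>F j. coef j D * (\<Prod>p\<in>D. of_bool (B p t))) - Y * (\<Prod>j\<in>J. \<Sum>D\<in>F j. coef j D * (\<Prod>p\<in>D. g p)) =
      (\<Sum>\<phi>\<in>PiE J F. (\<Prod>j\<in>J. coef j (\<phi> j)) * (\<Sum>t\<in>S. \<Prod>p\<in>(\<Union>j\<in>J. \<phi> j). of_bool (B p t))) -
      (\<Sum>\<phi>\<in>PiE J F. Y * ((\<Prod>j\<in>J. coef j (\<phi> j)) * (\<Prod>p\<in>(\<Union>j\<in>J. \<phi> j). g p)))"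
    unfolding expand sum_distrib_left by (subst sum.swap) (rule refl)
  also have "\<dots> = (\<Sum>\<phi>\<in>PiE J F. (\<Prod>j\<in>J. coef j (\<phi> j)) *
      (real (card {t\<in>S. \<forall>p\<in>(\<Union>j\<in>J. \<phi> j). B p t}) - Y * (\<Prod>p\<in>(\<Union>j\<in>J. \<phi> j). g p)))"
    unfolding sum_subtractf[symmetric]
    by (intro sum.cong refl) (simp only: count[OF sub] right_diff_distrib mult_ac)
  also have "\<bar>\<dots>\<bar> \<le> (\<Sum>\<phi>\<in>PiE J F. 1 * (\<Prod>p\<in>(\<Union>j\<in>J. \<phi> j). \<nu> p))"
  proof (rule order_trans[OF sum_abs], rule sum_mono)
    fix \<phi> assume \<phi>: "\<phi> \<in> PiE J F"
    have "\<bar>\<Prod>j\<in>J. coef j (\<phi> j)\<bar> \<le> 1"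
      unfolding abs_prod using coef by (intro prod_le_1) auto
    then show "\<bar>(\<Prod>j\<in>J. coef j (\<phi> j)) *
      (real (card {t\<in>S. \<forall>p\<in>(\<Union>j\<in>J. \<phi> j). B p t}) - Y * (\<Prod>p\<in>(\<Union>j\<in>J. \<phi> j). g p))\<bar> \<le> 1 * (\<Prod>p\<in>(\<Union>j\<in>J. \<phi> j). \<nu> p)"
      unfolding abs_mult using level[OF sub[OF \<phi>]] by (intro mult_mono) auto
  qed
  also have "\<dots> = (\<Prod>j\<in>J. \<Sum>D\<in>F j. \<Prod>p\<in>D. \<nu> p)"
    using assms(2) finF by (subst prod_sum_PiE) (auto simp: union intro!: sum.cong)
  finally show ?thesis .
qed

text \<open>Even truncation makes every block an upper bound, so the product over the blocks bounds
  the sifted count from above; \<open>prod_diff_le\<close> converts the truncation errors of the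
  blocks into a lower bound. After averaging, each block contributes its error
  \<open>\<eta> j\<close> relative to the main term, so these errors add up instead of
  multiplying.\<close>

lemma brun_hooley_blocks:
  fixes P :: "'j \<Rightarrow> 'p set" and g \<nu> :: "'p \<Rightarrow> real" and b :: "'j \<Rightarrow> nat" and B :: "'p \<Rightarrow> 't \<Rightarrow> bool"
  assumes "finite S" "finite J" "\<And>j. j \<in> J \<Longrightarrow> finite (P j)"
    and disj: "\<And>i j. i \<in> J \<Longrightarrow> j \<in> J \<Longrightarrow> i \<noteq> j \<Longrightarrow> P i \<inter> P j = {}"
    and g: "\<And>j p. j \<in> J \<Longrightarrow> p \<in> P j \<Longrightarrow> 0 \<le> g p \<and> g p \<le> 1 \<and> 0 \<le> \<nu> p"
    and level: "\<And>D. D \<subseteq> (\<Union>j\<in>J. P j) \<Longrightarrow> \<bar>real (card {t\<in>S. \<forall>p\<in>D. B p t}) - Y * (\<Prod>p\<in>D. g p)\<bar> \<le> (\<Prod>p\<in>D. \<nu> p)"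
    and Y: "Y \<ge> 0"
    and b: "\<And>j. j \<in> J \<Longrightarrow> even (b j)"
    and E: "\<And>j. j \<in> J \<Longrightarrow> \<eta> j \<ge> 0 \<and> esum (Suc (b j)) (P j) g \<le> \<eta> j * (\<Prod>p\<in>P j. 1 - g p)"
    and H: "sum \<eta> J \<le> 1"
  shows "\<bar>real (card {t\<in>S. \<forall>p\<in>(\<Union>j\<in>J. P j). \<not> B p t}) - Y * (\<Prod>j\<in>J. \<Prod>p\<in>P j. 1 - g p)\<bar> \<le>
     3 * sum \<eta> J * (Y * (\<Prod>j\<in>J. \<Prod>p\<in>P j. 1 - g p)) +
     (1 + real (card J)) * (\<Prod>j\<in>J. (1 + sum \<nu> (P j)) ^ Suc (b j))"
proof -
  define V where "V j = (\<Prod>p\<in>P j. 1 - g p)" for j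
  define R where "R = (\<Prod>j\<in>J. (1 + sum \<nu> (P j)) ^ Suc (b j))"
  define \<beta> where "\<beta> t p = (of_bool (B p t) :: real)" for t p
  define x where "x t j = (\<Prod>p\<in>P j. 1 - \<beta> t p)" for t j
  define u where "u t j = psum (b j) (P j) (\<beta> t)" for t j
  define c where "c t j = esum (Suc (b j)) (P j) (\<beta> t)" for t j
  define H where "H = sum \<eta> J"
  have H01: "0 \<le> H" "H \<le> 1" using H E by (auto simp: H_def intro!: sum_nonneg)
  have V0: "V j \<ge> 0" if "j \<in> J" for j
    unfolding V_def using g that by (intro prod_nonneg) auto
  have bounds: "0 \<le> x t j \<and> x t j \<le> u t j \<and> u t j \<le> x t j + c t j" if "j \<in> J" for t j
  proof -
    have "x t j \<ge> 0" unfolding x_def \<beta>_def by (intro prod_nonneg) auto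
    then show ?thesis
      using bonferroni[of "P j" "\<beta> t" "b j"] b[OF that] assms(3)[OF that]
      by (auto simp: x_def u_def c_def \<beta>_def)
  qed
  have psum_g: "V j \<le> psum (b j) (P j) g \<and> psum (b j) (P j) g \<le> V j + \<eta> j * V j" if "j \<in> J" for j
  proof -
    have "0 \<le> psum (b j) (P j) g - V j \<and> psum (b j) (P j) g - V j \<le> esum (Suc (b j)) (P j) g"
      using bonferroni[of "P j" g "b j"] b[OF that] assms(3)[OF that] g[OF that] by (auto simp: V_def)
    then show ?thesis using E[OF that] by (auto simp: V_def)
  qed
  have indicator: "real (card {t\<in>S. \<forall>p\<in>(\<Union>j\<in>J. P j). \<not> B p t}) = (\<Sum>t\<in>S. \<Prod>j\<in>J. x t j)"
  proof -
    have "x t j = of_bool (\<forall>p\<in>P j. \<not> B p t)" if "j \<in> J" for t j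
    proof -
      have "(\<Prod>p\<in>Q. 1 - of_bool (B p t)) = (of_bool (\<forall>p\<in>Q. \<not> B p t) :: real)" if "finite Q" for Q
        using that by (induction Q rule: finite_induct) auto
      then show ?thesis using assms(3)[OF that] by (simp add: x_def \<beta>_def)
    qed
    then have "(\<Prod>j\<in>J. x t j) = (\<Prod>j\<in>J. of_bool (\<forall>p\<in>P j. \<not> B p t))" for t
      by (intro prod.cong) auto
    also have "(\<Prod>j\<in>J. of_bool (\<forall>p\<in>P j. \<not> B p t)) = (of_bool (\<forall>j\<in>J. \<forall>p\<in>P j. \<not> B p t) :: real)" for t
      using assms(2) by (induction J rule: finite_induct) auto
    finally show ?thesis
      using assms(1) by (simp add: sum.If_cases of_bool_def Int_def)
  qed
  \<comment> \<open>\<open>None\<close> stands for the truncated sum in every block.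
    \<open>Some l\<close> replaces block \<open>l\<close> by the unsigned sum over subsets of size
    \<open>Suc (b l)\<close>, which bounds the truncation error of that block.\<close>
  define F where "F l j = {D. D \<subseteq> P j \<and> (if l = Some j then card D = Suc (b j) else card D \<le> b j)}" for l j
  define cf where "cf l j D = (if l = Some j then 1 else (-1) ^ card D :: real)" for l :: "'j option" and j and D :: "'p set"
  have R_bound: "(\<Prod>j\<in>J. \<Sum>D\<in>F l j. \<Prod>p\<in>D. \<nu> p) \<le> R" for l
    unfolding R_def
  proof (intro prod_mono conjI)
    fix j assume j: "j \<in> J"
    show "0 \<le> (\<Sum>D\<in>F l j. \<Prod>p\<in>D. \<nu> p)"
      using g[OF j] by (intro sum_nonneg prod_nonneg) (auto simp: F_def)
    have "(\<Sum>D\<in>F l j. \<Prod>p\<in>D. \<nu> p) \<le> (\<Sum>D | D \<subseteq> P j \<and> card D \<le> Suc (b j). \<Prod>p\<in>D. \<nu> p)"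
      using g[OF j] assms(3)[OF j]
      by (intro sum_mono2 prod_nonneg) (auto simp: F_def intro: finite_subset[of _ "Pow (P j)"])
    also have "\<dots> \<le> (1 + sum \<nu> (P j)) ^ Suc (b j)"
      using g[OF j] assms(3)[OF j] by (intro sum_small_subsets_le) auto
    finally show "(\<Sum>D\<in>F l j. \<Prod>p\<in>D. \<nu> p) \<le> (1 + sum \<nu> (P j)) ^ Suc (b j)" .
  qed
  have sel: "(\<Sum>D\<in>F l j. cf l j D * (\<Prod>p\<in>D. h p)) = (if l = Some j then esum (Suc (b j)) (P j) h else psum (b j) (P j) h)" for l j h
    by (simp add: F_def cf_def esum_def psum_def)
  have expand: "\<bar>(\<Sum>t\<in>S. \<Prod>j\<in>J. if l = Some j then c t j else u t j) -
       Y * (\<Prod>j\<in>J. if l = Some j then esum (Suc (b j)) (P j) g else psum (b j) (P j) g)\<bar> \<le> R" for l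
  proof -
    have H: "\<bar>(\<Sum>t\<in>S. \<Prod>j\<in>J. \<Sum>D\<in>F l j. cf l j D * (\<Prod>p\<in>D. of_bool (B p t))) - Y * (\<Prod>j\<in>J. \<Sum>D\<in>F l j. cf l j D * (\<Prod>p\<in>D. g p))\<bar>
     \<le> (\<Prod>j\<in>J. \<Sum>D\<in>F l j. \<Prod>p\<in>D. \<nu> p)"
      by (rule sieve_expand[where P = P]) (use assms in \<open>auto simp: F_def cf_def\<close>)
    have "\<beta> t = (\<lambda>p. of_bool (B p t))" for t by (auto simp: \<beta>_def)
    note eq = this[symmetric]
    show ?thesis
      using order_trans[OF H R_bound[of l]] unfolding sel eq c_def u_def .
  qed
  have prodV: "(\<Prod>j\<in>J. V j) \<ge> 0" using V0 by (intro prod_nonneg) auto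
  have \<eta>0: "\<eta> j \<ge> 0" if "j \<in> J" for j using E[OF that] by simp
  have expH: "(\<Prod>j\<in>J. 1 + \<eta> j) \<le> exp H"
    unfolding H_def using \<eta>0 by (intro prod_one_plus_le_exp)
  \<comment> \<open>Since \<open>H \<le> 1\<close>, this bounds the product of the
    \<open>1 + \<eta> j\<close> both by \<open>1 + 2 * H\<close> and by 3, the source of the
    numerical factors in the conclusion.\<close>
  have exp2: "exp H \<le> 1 + 2 * H"
  proof -
    have "exp H \<le> 1 + H + H\<^sup>2" using H01 by (rule exp_bound)
    also have "H\<^sup>2 \<le> H" using H01 by (simp add: power2_eq_square mult_left_le)
    finally show ?thesis by simp
  qed
  have up: "(\<Prod>j\<in>J. psum (b j) (P j) g) \<le> (1 + 2 * H) * (\<Prod>j\<in>J. V j)"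
  proof -
    have "(\<Prod>j\<in>J. psum (b j) (P j) g) \<le> (\<Prod>j\<in>J. (1 + \<eta> j) * V j)"
      using psum_g V0 by (intro prod_mono) (force simp: algebra_simps)
    also have "\<dots> = (\<Prod>j\<in>J. 1 + \<eta> j) * (\<Prod>j\<in>J. V j)" by (rule prod.distrib)
    also have "\<dots> \<le> (1 + 2 * H) * (\<Prod>j\<in>J. V j)"
      using expH exp2 prodV by (intro mult_right_mono) auto
    finally show ?thesis .
  qed
  have lo: "(\<Prod>j\<in>J. V j) \<le> (\<Prod>j\<in>J. psum (b j) (P j) g)"
    using psum_g V0 by (intro prod_mono) auto
  have err: "(\<Prod>j\<in>J. if j = l then esum (Suc (b j)) (P j) g else psum (b j) (P j) g) \<le> \<eta> l * 3 * (\<Prod>j\<in>J. V j)" if l: "l \<in> J" for l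
  proof -
    have "(\<Prod>j\<in>J. if j = l then esum (Suc (b j)) (P j) g else psum (b j) (P j) g) \<le>
       (\<Prod>j\<in>J. (if j = l then \<eta> j else 1 + \<eta> j) * V j)"
    proof (intro prod_mono conjI)
      fix j assume j: "j \<in> J"
      show "0 \<le> (if j = l then esum (Suc (b j)) (P j) g else psum (b j) (P j) g)"
        using psum_g[OF j] V0[OF j] esum_nonneg[of "P j" g] g[OF j] by auto
      show "(if j = l then esum (Suc (b j)) (P j) g else psum (b j) (P j) g) \<le> (if j = l then \<eta> j else 1 + \<eta> j) * V j"
        using psum_g[OF j] E[OF j] by (auto simp: V_def algebra_simps)
    qed
    also have "\<dots> = \<eta> l * (\<Prod>j\<in>J - {l}. 1 + \<eta> j) * (\<Prod>j\<in>J. V j)"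
    proof -
      have "(\<Prod>j\<in>J. if j = l then \<eta> j else 1 + \<eta> j) = \<eta> l * (\<Prod>j\<in>J - {l}. 1 + \<eta> j)"
        using assms(2) l by (subst prod.remove[of J l]) (auto intro!: arg_cong2[of _ _ _ _ "(*)"] prod.cong)
      then show ?thesis by (simp add: prod.distrib)
    qed
    also have "\<dots> \<le> \<eta> l * 3 * (\<Prod>j\<in>J. V j)"
    proof -
      have "(\<Prod>j\<in>J - {l}. 1 + \<eta> j) \<le> (\<Prod>j\<in>J. 1 + \<eta> j)"
        using assms(2) \<eta>0 by (intro prod_mono2) auto
      then have "(\<Prod>j\<in>J - {l}. 1 + \<eta> j) \<le> 3" using expH exp2 H01 by linarith
      then show ?thesis using \<eta>0[OF l] prodV by (intro mult_right_mono mult_left_mono) auto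
    qed
    finally show ?thesis .
  qed
  let ?N = "real (card {t\<in>S. \<forall>p\<in>(\<Union>j\<in>J. P j). \<not> B p t})"
  have "?N \<le> (\<Sum>t\<in>S. \<Prod>j\<in>J. u t j)"
    unfolding indicator using bounds by (intro sum_mono prod_mono) auto
  also have "\<dots> \<le> Y * (\<Prod>j\<in>J. psum (b j) (P j) g) + R"
    using expand[of None] by simp
  also have "\<dots> \<le> Y * ((1 + 2 * H) * (\<Prod>j\<in>J. V j)) + R"
    using up Y by (intro add_right_mono mult_left_mono) auto
  finally have upper: "?N \<le> Y * (\<Prod>j\<in>J. V j) + 2 * H * (Y * (\<Prod>j\<in>J. V j)) + R"
    by (simp add: algebra_simps)
  have "Y * (\<Prod>j\<in>J. V j) - R \<le> Y * (\<Prod>j\<in>J. psum (b j) (P j) g) - R"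
    using lo Y by (intro diff_right_mono mult_left_mono) auto
  also have "\<dots> \<le> (\<Sum>t\<in>S. \<Prod>j\<in>J. u t j)"
    using expand[of None] by simp
  also have "\<dots> \<le> (\<Sum>t\<in>S. (\<Prod>j\<in>J. x t j) + (\<Sum>l\<in>J. \<Prod>j\<in>J. if j = l then c t j else u t j))"
    using prod_diff_le[OF assms(2) bounds] by (intro sum_mono) (simp add: algebra_simps)
  also have "\<dots> = ?N + (\<Sum>l\<in>J. \<Sum>t\<in>S. \<Prod>j\<in>J. if Some l = Some j then c t j else u t j)"
    unfolding indicator sum.distrib by (subst sum.swap) (auto intro!: sum.cong prod.cong)
  also have "(\<Sum>l\<in>J. \<Sum>t\<in>S. \<Prod>j\<in>J. if Some l = Some j then c t j else u t j) \<le> (\<Sum>l\<in>J. Y * (\<eta> l * 3 * (\<Prod>j\<in>J. V j)) + R)"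
  proof (rule sum_mono)
    fix l assume l: "l \<in> J"
    have "(\<Sum>t\<in>S. \<Prod>j\<in>J. if Some l = Some j then c t j else u t j) \<le>
       Y * (\<Prod>j\<in>J. if Some l = Some j then esum (Suc (b j)) (P j) g else psum (b j) (P j) g) + R"
      using expand[of "Some l"] by linarith
    also have "(\<Prod>j\<in>J. if Some l = Some j then esum (Suc (b j)) (P j) g else psum (b j) (P j) g) \<le> \<eta> l * 3 * (\<Prod>j\<in>J. V j)"
      using err[OF l] by (simp add: eq_commute)
    finally show "(\<Sum>t\<in>S. \<Prod>j\<in>J. if Some l = Some j then c t j else u t j) \<le> Y * (\<eta> l * 3 * (\<Prod>j\<in>J. V j)) + R"
      using Y by (simp add: mult_left_mono)
  qed
  also have "\<dots> = 3 * H * (Y * (\<Prod>j\<in>J. V j)) + card J * R"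
    by (simp add: sum.distrib H_def sum_distrib_left sum_distrib_right mult_ac)
  finally have lower: "Y * (\<Prod>j\<in>J. V j) \<le> ?N + 3 * H * (Y * (\<Prod>j\<in>J. V j)) + card J * R + R"
    by (simp add: algebra_simps)
  have "R \<ge> 0" unfolding R_def
    using g by (intro prod_nonneg zero_le_power add_nonneg_nonneg sum_nonneg) auto
  then have "card J * R \<ge> 0" by simp
  moreover have "H * (Y * (\<Prod>j\<in>J. V j)) \<ge> 0" using H01 Y prodV by simp
  ultimately show ?thesis
    using upper lower unfolding V_def[symmetric] R_def[symmetric] H_def[symmetric]
    by (simp add: algebra_simps abs_le_iff)
qed

section \<open>Residue classes in an interval\<close>

lemma cong_interval_image:
  fixes u v c q :: int
  assumes "q > 0"
  shows "{t\<in>{u<..v}. [t = c] (mod q)} =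
    (\<lambda>m. c + q * m) ` {\<lfloor>real_of_int (u - c) / q\<rfloor><..\<lfloor>real_of_int (v - c) / q\<rfloor>}"
proof -
  define a where "a = real_of_int (u - c) / q"
  define b where "b = real_of_int (v - c) / q"
    have iff: "m \<in> {\<lfloor>a\<rfloor><..\<lfloor>b\<rfloor>} \<longleftrightarrow> c + q * m \<in> {u<..v}" for m
    proof -
      have "m \<in> {\<lfloor>a\<rfloor><..\<lfloor>b\<rfloor>} \<longleftrightarrow> a < of_int m \<and> of_int m \<le> b"
        by (simp add: floor_less_iff le_floor_iff)
      also have "\<dots> \<longleftrightarrow> real_of_int (u - c) < of_int (q * m) \<and> of_int (q * m) \<le> real_of_int (v - c)"
        using assms by (simp add: a_def b_def field_simps)
      also have "\<dots> \<longleftrightarrow> c + q * m \<in> {u<..v}"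
        unfolding of_int_less_iff of_int_le_iff by auto
      finally show ?thesis .
    qed
    show ?thesis unfolding a_def[symmetric] b_def[symmetric]
    proof (intro equalityI subsetI)
      fix t assume t: "t \<in> {t\<in>{u<..v}. [t = c] (mod q)}"
      then have "[c = t] (mod q)" by (auto intro: cong_sym)
      then obtain m where "t = c + q * m"
        unfolding cong_iff_lin by blast
      then show "t \<in> (\<lambda>m. c + q * m) ` {\<lfloor>a\<rfloor><..\<lfloor>b\<rfloor>}" using t iff[of m] by auto
    next
      fix t assume "t \<in> (\<lambda>m. c + q * m) ` {\<lfloor>a\<rfloor><..\<lfloor>b\<rfloor>}"
      then obtain m where m: "t = c + q * m" "m \<in> {\<lfloor>a\<rfloor><..\<lfloor>b\<rfloor>}" by blast
      moreover have "[c + q * m = c] (mod q)" by (simp add: cong_def)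
      ultimately show "t \<in> {t\<in>{u<..v}. [t = c] (mod q)}" using iff[of m] by blast
    qed
qed

lemma card_cong_interval:
  fixes u v c q :: int
  assumes "q > 0" "u \<le> v"
  shows "\<bar>real (card {t\<in>{u<..v}. [t = c] (mod q)}) - (v - u) / q\<bar> \<le> 1"
proof -
  define a where "a = real_of_int (u - c) / q"
  define b where "b = real_of_int (v - c) / q"
  have ab: "a \<le> b" using assms unfolding a_def b_def by (intro divide_right_mono) auto
  have eq: "{t\<in>{u<..v}. [t = c] (mod q)} = (\<lambda>m. c + q * m) ` {\<lfloor>a\<rfloor><..\<lfloor>b\<rfloor>}"
    unfolding a_def b_def by (rule cong_interval_image[OF assms(1)])
  have "card {t\<in>{u<..v}. [t = c] (mod q)} = nat (\<lfloor>b\<rfloor> - \<lfloor>a\<rfloor>)"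
    unfolding eq using assms by (subst card_image) (auto simp: inj_on_def)
  then have "real (card {t\<in>{u<..v}. [t = c] (mod q)}) = \<lfloor>b\<rfloor> - \<lfloor>a\<rfloor>"
    using floor_mono[OF ab] by simp
  moreover have "(v - u) / q = b - a"
    by (simp add: a_def b_def diff_divide_distrib)
  ultimately show ?thesis by linarith
qed

text \<open>By the Chinese remainder theorem, each choice of residues from the sets
  \<open>\<Omega> p\<close> is a single class modulo \<open>q\<close> times the product of
  \<open>D\<close>. Each class is counted with error at most 1, and the error bound is the number of
  choices. \<open>q\<close> and \<open>c\<close> vary in the induction because every step absorbs
  one prime into the modulus.\<close>

lemma card_residues_interval:
  fixes u v c q :: int and D :: "nat set" and \<Omega> :: "nat \<Rightarrow> int set"
  assumes "finite D" "\<And>p. p \<in> D \<Longrightarrow> prime p" "\<And>p. p \<in> D \<Longrightarrow> coprime (int p) q"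
    and "\<And>p. p \<in> D \<Longrightarrow> \<Omega> p \<subseteq> {0..<int p}" and "q > 0" "u \<le> v"
  shows "\<bar>real (card {t\<in>{u<..v}. [t = c] (mod q) \<and> (\<forall>p\<in>D. t mod int p \<in> \<Omega> p)}) -
     (v - u) / q * (\<Prod>p\<in>D. real (card (\<Omega> p)) / p)\<bar> \<le> (\<Prod>p\<in>D. real (card (\<Omega> p)))"
  using assms
proof (induction D arbitrary: q c rule: finite_induct)
  case empty
  then show ?case using card_cong_interval[of q u v c] by simp
next
  case (insert p D)
  have p: "prime p" "p > 0" using insert.prems by (auto simp: prime_gt_0_nat)
  have finO: "finite (\<Omega> p)" using insert.prems(3)[of p] by (auto intro: finite_subset)
  have "\<exists>c'. [c' = c] (mod q) \<and> [c' = \<omega>] (mod int p)" for \<omega>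
    using insert.prems(2)[of p] binary_chinese_remainder_int[of q "int p" c \<omega>]
    by (simp add: coprime_commute)
  then have "\<exists>cc. \<forall>\<omega>. [cc \<omega> = c] (mod q) \<and> [cc \<omega> = \<omega>] (mod int p)"
    by (intro choice) blast
  then obtain cc where cc: "[cc \<omega> = c] (mod q)" "[cc \<omega> = \<omega>] (mod int p)" for \<omega>
    by blast
  have iff: "[t = c] (mod q) \<and> t mod int p = \<omega> \<longleftrightarrow> [t = cc \<omega>] (mod q * int p)" if "\<omega> \<in> \<Omega> p" for t \<omega>
  proof -
    have "\<omega> mod int p = \<omega>" using insert.prems(3)[of p] that by auto
    then have "[t = c] (mod q) \<and> t mod int p = \<omega> \<longleftrightarrow> [t = cc \<omega>] (mod q) \<and> [t = cc \<omega>] (mod int p)"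
      using cc[of \<omega>] unfolding cong_def by metis
    also have "\<dots> \<longleftrightarrow> [t = cc \<omega>] (mod q * int p)"
    proof
      assume "[t = cc \<omega>] (mod q) \<and> [t = cc \<omega>] (mod int p)"
      then show "[t = cc \<omega>] (mod q * int p)"
        using insert.prems(2)[of p] by (intro coprime_cong_mult) (auto simp: coprime_commute)
    next
      assume "[t = cc \<omega>] (mod q * int p)"
      then show "[t = cc \<omega>] (mod q) \<and> [t = cc \<omega>] (mod int p)"
        by (meson cong_dvd_modulus dvd_triv_left dvd_triv_right)
    qed
    finally show ?thesis .
  qed
  let ?A = "\<lambda>\<omega>. {t\<in>{u<..v}. [t = cc \<omega>] (mod q * int p) \<and> (\<forall>p\<in>D. t mod int p \<in> \<Omega> p)}"
  have eq1: "{t\<in>{u<..v}. [t = c] (mod q) \<and> (\<forall>p\<in>insert p D. t mod int p \<in> \<Omega> p)} = (\<Union>\<omega>\<in>\<Omega> p. ?A \<omega>)"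
  proof (intro equalityI subsetI)
    fix t assume "t \<in> {t\<in>{u<..v}. [t = c] (mod q) \<and> (\<forall>p\<in>insert p D. t mod int p \<in> \<Omega> p)}"
    then show "t \<in> (\<Union>\<omega>\<in>\<Omega> p. ?A \<omega>)"
      using iff[of "t mod int p" t] by blast
  next
    fix t assume "t \<in> (\<Union>\<omega>\<in>\<Omega> p. ?A \<omega>)"
    then obtain \<omega> where "\<omega> \<in> \<Omega> p" "t \<in> ?A \<omega>" by blast
    then show "t \<in> {t\<in>{u<..v}. [t = c] (mod q) \<and> (\<forall>p\<in>insert p D. t mod int p \<in> \<Omega> p)}"
      using iff[of \<omega> t] by blast
  qed
  have eq2: "card (\<Union>\<omega>\<in>\<Omega> p. ?A \<omega>) = (\<Sum>\<omega>\<in>\<Omega> p. card (?A \<omega>))"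
  proof (rule card_UN_disjoint[OF finO])
    show "\<forall>i\<in>\<Omega> p. \<forall>j\<in>\<Omega> p. i \<noteq> j \<longrightarrow> ?A i \<inter> ?A j = {}"
    proof (intro ballI impI)
      fix i j assume ij: "i \<in> \<Omega> p" "j \<in> \<Omega> p" "i \<noteq> j"
      show "?A i \<inter> ?A j = {}"
      proof (rule ccontr)
        assume "?A i \<inter> ?A j \<noteq> {}"
        then obtain t where "t \<in> ?A i" "t \<in> ?A j" by blast
        then show False using iff[of i t] iff[of j t] ij by blast
      qed
    qed
    show "\<forall>i\<in>\<Omega> p. finite (?A i)"
      by (intro ballI finite_subset[OF _ finite_greaterThanAtMost_int[of u v]]) blast
  qed
  have card_eq: "real (card {t\<in>{u<..v}. [t = c] (mod q) \<and> (\<forall>p\<in>insert p D. t mod int p \<in> \<Omega> p)}) =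
     (\<Sum>\<omega>\<in>\<Omega> p. real (card (?A \<omega>)))" unfolding eq1 eq2 by (rule of_nat_sum)
  have IH: "\<bar>real (card (?A \<omega>)) - (v - u) / (q * int p) * (\<Prod>p\<in>D. real (card (\<Omega> p)) / p)\<bar> \<le> (\<Prod>p\<in>D. real (card (\<Omega> p)))" for \<omega>
  proof -
    have "coprime (int p') (q * int p)" if "p' \<in> D" for p'
    proof -
      have "p' \<noteq> p" using that insert.hyps by auto
      then have "coprime p' p" using insert.prems(1) that p by (intro primes_coprime) auto
      then show ?thesis using insert.prems(2)[of p'] that by simp
    qed
    with insert.prems p show ?thesis
      by (intro insert.IH[of "q * int p" "cc \<omega>"]) auto
  qed
  have main: "(v - u) / q * (\<Prod>p\<in>insert p D. real (card (\<Omega> p)) / p) =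
     (\<Sum>\<omega>\<in>\<Omega> p. (v - u) / (q * int p) * (\<Prod>p\<in>D. real (card (\<Omega> p)) / p))"
    using insert.hyps p by simp
  have le: "\<bar>(\<Sum>\<omega>\<in>\<Omega> p. real (card (?A \<omega>))) - (\<Sum>\<omega>\<in>\<Omega> p. (v - u) / (q * int p) * (\<Prod>p\<in>D. real (card (\<Omega> p)) / p))\<bar> \<le>
     (\<Sum>\<omega>\<in>\<Omega> p. \<Prod>p\<in>D. real (card (\<Omega> p)))"
    unfolding sum_subtractf[symmetric] by (rule order_trans[OF sum_abs]) (rule sum_mono, rule IH)
  have "(\<Sum>\<omega>\<in>\<Omega> p. \<Prod>p\<in>D. real (card (\<Omega> p))) = (\<Prod>p\<in>insert p D. real (card (\<Omega> p)))"
    using insert.hyps by simp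
  then show ?case using le unfolding card_eq main by linarith
qed

text \<open>Blocks of primes between \<open>z powr (1 / 2 ^ Suc j)\<close> and
  \<open>z powr (1 / 2 ^ j)\<close> have bounded weight. The truncation grows linearly in
  \<open>j\<close> while the logarithms of the primes halve, so the total level is a fixed power of
  \<open>z\<close>; the relative errors of the blocks form part of the tail of an exponential
  series, which a late start makes as small as desired. The constants depend on \<open>k\<close> and
  \<open>\<eta>\<close> only.\<close>

lemma brun_hooley:
  fixes k :: nat and \<eta> :: real
  assumes "\<eta> > 0"
  obtains w0 :: nat and C :: real where "C \<ge> 0"
    "\<And>(w::nat) z (S :: int set) B (\<nu> :: nat \<Rightarrow> nat) Y. w \<ge> w0 \<Longrightarrow> z \<ge> 2 \<Longrightarrow> finite S \<Longrightarrow> Y \<ge> 0 \<Longrightarrow>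
       (\<And>p. p \<in> primes_between w z \<Longrightarrow> \<nu> p \<le> k) \<Longrightarrow>
       (\<And>D. D \<subseteq> primes_between w z \<Longrightarrow>
          \<bar>real (card {t\<in>S. \<forall>p\<in>D. B p t}) - Y * (\<Prod>p\<in>D. real (\<nu> p) / p)\<bar> \<le> (\<Prod>p\<in>D. real (\<nu> p))) \<Longrightarrow>
       \<bar>real (card {t\<in>S. \<forall>p\<in>primes_between w z. \<not> B p t}) - Y * (\<Prod>p\<in>primes_between w z. 1 - real (\<nu> p) / p)\<bar> \<le>
         \<eta> * (Y * (\<Prod>p\<in>primes_between w z. 1 - real (\<nu> p) / p)) + z powr C"
proof -
  \<comment> \<open>\<open>K\<close> bounds the sum of \<open>\<nu> p / p\<close> over one block, 16
    being the bound for the reciprocals. The factor \<open>exp (2 * K)\<close> in \<open>f\<close>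
    makes the error relative: the product of the \<open>1 - \<nu> p / p\<close> over a block is at
    least \<open>exp (- 2 * K)\<close>.\<close>
  define K where "K = 16 * real k"
  define f where "f n = exp (2 * K) * (K ^ n / fact n)" for n
  have K0: "K \<ge> 0" by (simp add: K_def)
  have f0: "f n \<ge> 0" for n using K0 by (simp add: f_def)
  have "summable (\<lambda>n. K ^ n / fact n)"
    using summable_exp[of K] by (simp add: field_simps)
  then have summ: "summable f"
    unfolding f_def by (rule summable_mult)
  define \<eta>' where "\<eta>' = min (\<eta> / 3) 1"
  have "\<eta>' > 0" using assms by (simp add: \<eta>'_def)
  from suminf_exist_split[OF this summ] obtain N where N: "\<And>n. n \<ge> N \<Longrightarrow> norm (\<Sum>i. f (i + n)) < \<eta>'" by blast
  \<comment> \<open>Even, to obtain upper bounds. \<open>N\<close> makes the tail small, and the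
    growth in \<open>j\<close> keeps it summable over an unbounded number of blocks.\<close>
  define b where "b j = 2 * (N + j)" for j
  \<comment> \<open>Above \<open>2 * k\<close> all densities \<open>\<nu> p / p\<close> are at most
    1/2; the sum over a block needs primes above 4; and a nonempty block has
    \<open>zz j > k + 1\<close>.\<close>
  define w0 where "w0 = 2 * k + 4"
  \<comment> \<open>\<open>8 * N + 12\<close> bounds the sum of the exponents in
    \<open>expo\<close>; the remaining 2 pays for the factor \<open>1 + T\<close>.\<close>
  define C where "C = 8 * real N + 14"
  have tail: "(\<Sum>j<T. f (Suc (b j))) \<le> \<eta>'" for T
  proof -
    have "(\<Sum>j<T. f (Suc (b j))) = (\<Sum>i\<in>(\<lambda>j. 2 * j + 1) ` {..<T}. f (i + 2 * N))"
      by (subst sum.reindex) (auto simp: inj_on_def b_def algebra_simps)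
    also have "\<dots> \<le> (\<Sum>i. f (i + 2 * N))"
      using f0 by (intro sum_le_suminf) (auto simp: summable_iff_shift summ)
    also have "\<dots> \<le> \<eta>'" using N[of "2 * N"] by (simp add: abs_less_iff)
    finally show ?thesis .
  qed
  show thesis
  proof (rule that[of C w0])
    show "C \<ge> 0" by (simp add: C_def)
    fix w :: nat and z :: real and S :: "int set" and B and \<nu> :: "nat \<Rightarrow> nat" and Y :: real
    assume w: "w \<ge> w0" and z: "z \<ge> 2" and S: "finite S" and Y: "Y \<ge> 0"
    assume \<nu>: "\<And>p. p \<in> primes_between w z \<Longrightarrow> \<nu> p \<le> k"
    assume level: "\<And>D. D \<subseteq> primes_between w z \<Longrightarrow>
          \<bar>real (card {t\<in>S. \<forall>p\<in>D. B p t}) - Y * (\<Prod>p\<in>D. real (\<nu> p) / p)\<bar> \<le> (\<Prod>p\<in>D. real (\<nu> p))"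
    have w4: "w \<ge> 4" "w \<ge> 2 * k" "w \<ge> k + 1" using w by (auto simp: w0_def)
    define zz where "zz j = z powr (1 / 2 ^ j)" for j :: nat
    define P where "P j = primes_between (max w (zz (Suc j))) (zz j)" for j
    \<comment> \<open>Since \<open>2 ^ T\<close> exceeds \<open>ln z\<close>, the number
      \<open>zz T\<close> is at most \<open>exp 1\<close> and hence below \<open>w\<close>, so
      \<open>T\<close> blocks exhaust the primes.\<close>
    define T where "T = nat \<lceil>ln z\<rceil>"
    have zz1: "zz j \<ge> 1" for j unfolding zz_def using z by (intro ge_one_powr_ge_zero) auto
    have zz_mono: "zz j \<le> zz i" if "i \<le> j" for i j
      unfolding zz_def using z that by (intro powr_mono divide_left_mono power_increasing) auto
    have zz_sq: "zz (Suc j) ^ 2 = zz j" for j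
      using z by (simp add: zz_def power2_eq_square flip: powr_add)
    have zzT: "zz T \<le> w"
    proof -
      have "real T < 2 ^ T" by (rule of_nat_less_two_power)
      moreover have "ln z \<le> T" unfolding T_def by linarith
      ultimately have "ln z \<le> 2 ^ T" by linarith
      then have "ln (zz T) \<le> 1" using z by (simp add: zz_def ln_powr)
      then have "zz T \<le> exp 1" using zz1[of T] by (metis exp_le_cancel_iff exp_ln less_le_trans zero_less_one)
      also have "\<dots> \<le> 4" using e_less_272 by simp
      also have "4 \<le> real w" using w4 by simp
      finally show ?thesis .
    qed
    have "(\<Union>j<n. P j) = primes_between (max w (zz n)) z" for n
    proof (induction n)
      case 0
      then show ?case using z by (auto simp: primes_between_def zz_def)
    next
      case (Suc n)
      have "(\<Union>j<Suc n. P j) = P n \<union> primes_between (max w (zz n)) z"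
        using Suc by (simp add: lessThan_Suc)
      also have "\<dots> = primes_between (max w (zz (Suc n))) z"
        using zz_mono[of n "Suc n"] zz_mono[of 0 n] z by (auto simp: P_def primes_between_def zz_def[of 0])
      finally show ?case .
    qed
    from this[of T] have union: "(\<Union>j<T. P j) = primes_between w z"
      using zzT by (simp add: max_absorb1)
    have P_sub: "P j \<subseteq> primes_between w z" if "j < T" for j
      using union that by blast
    have disj: "P i \<inter> P j = {}" if "i \<noteq> j" for i j
    proof -
      have *: "P i \<inter> P j = {}" if "i < j" for i j
        using zz_mono[of "Suc i" j] that by (auto simp: P_def primes_between_def)
      show ?thesis using *[of i j] *[of j i] that by (cases "i < j") (auto simp: Int_commute)
    qed
    have finP: "finite (P j)" for j by (simp add: P_def)
    have g_half: "0 \<le> real (\<nu> p) / p \<and> real (\<nu> p) / p \<le> 1 / 2" if "j < T" "p \<in> P j" for j p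
    proof -
      have "p \<in> primes_between w z" using P_sub that by blast
      then have "\<nu> p \<le> k" "real w < real p" using \<nu> by (auto simp: primes_between_def)
      then have "2 * real (\<nu> p) \<le> real p" using w4(2) by (simp flip: of_nat_le_iff of_nat_less_iff)
      then show ?thesis using \<open>real w < real p\<close> by (simp add: field_simps)
    qed
    have L: "(\<Sum>p\<in>P j. real (\<nu> p) / p) \<le> K" if "j < T" for j
    proof -
      have "(\<Sum>p\<in>P j. real (\<nu> p) / p) \<le> (\<Sum>p\<in>P j. real k / p)"
        using \<nu> P_sub[OF that] by (intro sum_mono divide_right_mono) auto
      also have "\<dots> = k * (\<Sum>p\<in>P j. 1 / p)" by (simp add: sum_distrib_left)
      finally have le: "(\<Sum>p\<in>P j. real (\<nu> p) / p) \<le> k * (\<Sum>p\<in>P j. 1 / p)" .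
      have "(\<Sum>p\<in>P j. 1 / p) \<le> 16"
        unfolding P_def
      proof (rule sum_inverse_primes_square)
        show "zz j \<le> (max (real w) (zz (Suc j)))\<^sup>2"
          using zz1[of "Suc j"] zz_sq[of j] power_mono[of "zz (Suc j)" "max (real w) (zz (Suc j))" 2] by simp
      qed (use w4 in auto)
      from mult_left_mono[OF this, of "real k"] show ?thesis using le by (simp add: K_def)
    qed
    have E: "esum (Suc (b j)) (P j) (\<lambda>p. real (\<nu> p) / p) \<le> f (Suc (b j)) * (\<Prod>p\<in>P j. 1 - real (\<nu> p) / p)" if j: "j < T" for j
    proof -
      have "esum (Suc (b j)) (P j) (\<lambda>p. real (\<nu> p) / p) \<le> (\<Sum>p\<in>P j. real (\<nu> p) / p) ^ Suc (b j) / fact (Suc (b j))"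
        using g_half[OF j] finP by (intro esum_le) auto
      also have "\<dots> \<le> K ^ Suc (b j) / fact (Suc (b j))"
        using L[OF j] by (intro divide_right_mono power_mono sum_nonneg) auto
      also have "\<dots> = f (Suc (b j)) * exp (- 2 * K)"
        by (simp add: f_def exp_minus)
      finally have le: "esum (Suc (b j)) (P j) (\<lambda>p. real (\<nu> p) / p) \<le> f (Suc (b j)) * exp (- 2 * K)" .
      have "exp (- 2 * K) \<le> exp (- 2 * (\<Sum>p\<in>P j. real (\<nu> p) / p))"
        using L[OF j] by simp
      also have "\<dots> = (\<Prod>p\<in>P j. exp (- 2 * (real (\<nu> p) / p)))"
        using finP by (simp add: exp_sum sum_distrib_left)
      also have "\<dots> \<le> (\<Prod>p\<in>P j. 1 - real (\<nu> p) / p)"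
        using g_half[OF j] by (intro prod_mono conjI exp_le_one_minus) auto
      finally have "exp (- 2 * K) \<le> (\<Prod>p\<in>P j. 1 - real (\<nu> p) / p)" .
      from mult_left_mono[OF this f0[of "Suc (b j)"]] show ?thesis using le by linarith
    qed
    \<comment> \<open>A nonempty block has both its cardinality and \<open>k + 1\<close> bounded by
      \<open>zz j\<close>, so the base is at most \<open>zz j ^ 2\<close>; an empty block is
      trivial.\<close>
    have R1: "(1 + (\<Sum>p\<in>P j. real (\<nu> p))) ^ Suc (b j) \<le> z powr ((4 * real N + 4 * real j + 2) / 2 ^ j)" if j: "j < T" for j
    proof (cases "P j = {}")
      case True
      then show ?thesis using z by (simp add: ge_one_powr_ge_zero)
    next
      case False
      then obtain p0 where "p0 \<in> P j" by blast
      then have "real w < zz j" by (auto simp: P_def primes_between_def)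
      then have zk: "real k + 1 \<le> zz j" using w4(3) by (simp flip: of_nat_le_iff)
      have "P j \<subseteq> {1..nat \<lfloor>zz j\<rfloor>}"
        by (auto simp: P_def primes_between_def le_nat_floor prime_ge_1_nat Suc_leI prime_gt_0_nat)
      then have "card (P j) \<le> nat \<lfloor>zz j\<rfloor>" using card_mono[of "{1..nat \<lfloor>zz j\<rfloor>}"] by fastforce
      then have cP: "real (card (P j)) \<le> zz j" using zz1[of j] by linarith
      have "1 + (\<Sum>p\<in>P j. real (\<nu> p)) \<le> 1 + (\<Sum>p\<in>P j. real k)"
        using \<nu> P_sub[OF j] by (intro add_left_mono sum_mono) auto
      also have "\<dots> = 1 + real (card (P j)) * k" by simp
      also have "\<dots> \<le> zz j + zz j * k"
        using zz1[of j] cP by (intro add_mono mult_right_mono) auto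
      also have "\<dots> = zz j * (real k + 1)" by (simp add: algebra_simps)
      also have "\<dots> \<le> zz j * zz j" using zk zz1[of j] by (intro mult_left_mono) auto
      finally have "(1 + (\<Sum>p\<in>P j. real (\<nu> p))) ^ Suc (b j) \<le> (zz j * zz j) ^ Suc (b j)"
        by (intro power_mono add_nonneg_nonneg sum_nonneg) auto
      also have "\<dots> = zz j ^ (2 * Suc (b j))"
        by (simp only: power_mult power2_eq_square)
      also have "\<dots> = zz j powr real (2 * Suc (b j))"
        using zz1[of j] by (subst powr_realpow) auto
      also have "\<dots> = z powr ((4 * real N + 4 * real j + 2) / 2 ^ j)"
        by (simp add: zz_def powr_powr b_def algebra_simps add_divide_distrib)
      finally show ?thesis .
    qed
    have expo: "(\<Sum>j<n. (4 * real N + 4 * real j + 2) / 2 ^ j) = 8 * N + 12 - (8 * N + 12 + 8 * real n) / 2 ^ n" for n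
    proof (induction n)
      case (Suc n)
      show ?case unfolding sum.lessThan_Suc Suc by (simp add: field_simps)
    qed auto
    have R2: "(\<Prod>j<T. (1 + (\<Sum>p\<in>P j. real (\<nu> p))) ^ Suc (b j)) \<le> z powr (8 * N + 12)"
    proof -
      have "(\<Prod>j<T. (1 + (\<Sum>p\<in>P j. real (\<nu> p))) ^ Suc (b j)) \<le> (\<Prod>j<T. z powr ((4 * real N + 4 * real j + 2) / 2 ^ j))"
        using R1 by (intro prod_mono conjI zero_le_power add_nonneg_nonneg sum_nonneg) auto
      also have "\<dots> = z powr (\<Sum>j<T. (4 * real N + 4 * real j + 2) / 2 ^ j)"
        using z by (subst powr_sum) auto
      also have "\<dots> \<le> z powr (8 * N + 12)"
        using z unfolding expo by (intro powr_mono) auto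
      finally show ?thesis .
    qed
    have R: "(1 + real (card {..<T})) * (\<Prod>j<T. (1 + (\<Sum>p\<in>P j. real (\<nu> p))) ^ Suc (b j)) \<le> z powr C"
    proof -
      have "ln z > 0" using z by simp
      then have "real T \<le> ln z + 1" unfolding T_def by linarith
      moreover have "ln z \<le> z - 1" using z by (intro ln_le_minus_one) auto
      ultimately have "1 + real (card {..<T}) \<le> 1 + z" by simp
      also have "\<dots> \<le> z * z"
        using mult_right_mono[of 2 z z] z by linarith
      also have "\<dots> = z powr 2" using z by (simp add: powr_numeral power2_eq_square)
      finally have "1 + real (card {..<T}) \<le> z powr 2" .
      then have "(1 + real (card {..<T})) * (\<Prod>j<T. (1 + (\<Sum>p\<in>P j. real (\<nu> p))) ^ Suc (b j)) \<le> z powr 2 * z powr (8 * N + 12)"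
        using R2 by (intro mult_mono prod_nonneg ballI zero_le_power add_nonneg_nonneg sum_nonneg) auto
      also have "\<dots> = z powr C" by (simp add: C_def algebra_simps flip: powr_add)
      finally show ?thesis .
    qed
    have prodV: "(\<Prod>j<T. \<Prod>p\<in>P j. 1 - real (\<nu> p) / p) = (\<Prod>p\<in>primes_between w z. 1 - real (\<nu> p) / p)"
      unfolding union[symmetric] using finP disj by (subst prod.UNION_disjoint) auto
    have V0: "(\<Prod>p\<in>primes_between w z. 1 - real (\<nu> p) / p) \<ge> 0"
    proof -
      have "0 \<le> 1 - real (\<nu> p) / p" if "j < T" "p \<in> P j" for j p
        using g_half[OF that] by linarith
      then show ?thesis unfolding prodV[symmetric] by (intro prod_nonneg) auto
    qed
    have tail': "(\<Sum>j<T. f (Suc (b j))) \<le> 1" "3 * (\<Sum>j<T. f (Suc (b j))) \<le> \<eta>"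
      using tail[of T] by (auto simp: \<eta>'_def)
    have "\<bar>real (card {t\<in>S. \<forall>p\<in>(\<Union>j\<in>{..<T}. P j). \<not> B p t}) - Y * (\<Prod>j<T. \<Prod>p\<in>P j. 1 - real (\<nu> p) / p)\<bar> \<le>
     3 * (\<Sum>j<T. f (Suc (b j))) * (Y * (\<Prod>j<T. \<Prod>p\<in>P j. 1 - real (\<nu> p) / p)) +
     (1 + real (card {..<T})) * (\<Prod>j<T. (1 + (\<Sum>p\<in>P j. real (\<nu> p))) ^ Suc (b j))"
    proof (rule brun_hooley_blocks)
      show "0 \<le> real (\<nu> p) / real p \<and> real (\<nu> p) / real p \<le> 1 \<and> 0 \<le> real (\<nu> p)" if "j \<in> {..<T}" "p \<in> P j" for j p
      proof -
        have "real (\<nu> p) / p \<le> 1 / 2" using g_half[of j p] that by simp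
        then have "real (\<nu> p) / p \<le> 1" by linarith
        then show ?thesis by simp
      qed
    qed (use S disj finP level Y E f0 tail' in \<open>auto simp: union b_def\<close>)
    also have "\<dots> \<le> \<eta> * (Y * (\<Prod>j<T. \<Prod>p\<in>P j. 1 - real (\<nu> p) / p)) + z powr C"
      using R tail'(2) V0 Y unfolding prodV by (intro add_mono mult_right_mono) auto
    finally show "\<bar>real (card {t\<in>S. \<forall>p\<in>primes_between w z. \<not> B p t}) - Y * (\<Prod>p\<in>primes_between w z. 1 - real (\<nu> p) / p)\<bar> \<le>
         \<eta> * (Y * (\<Prod>p\<in>primes_between w z. 1 - real (\<nu> p) / p)) + z powr C"
      unfolding union prodV .
  qed
qed

section \<open>Counting lattice points for badly approximable rotations\<close>

text \<open>\<open>J\<close> may be any set of reals and need not lie in the unit interval, so that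
  intervals around 0 require no case distinction.\<close>

definition mod1_in :: "real set \<Rightarrow> real \<Rightarrow> bool" where
  "mod1_in J x \<longleftrightarrow> (\<exists>m::int. x - of_int m \<in> J)"

text \<open>For \<open>i\<close> in a full period, \<open>i * \<theta>\<close> is within
  \<open>1 / q\<close> of \<open>i * a / q\<close>, and \<open>i * a\<close> runs through all
  residues modulo \<open>q\<close>. The points are thus equally spaced ones moved by at most one
  spacing, which changes the count by a constant only. Squeezing \<open>J\<close> between an open
  and a closed interval covers all kinds of endpoints.\<close>

lemma rotation_block_count:
  fixes \<theta> \<beta> lo hi :: real and a q :: int
  assumes "coprime a q" "q > 0" "\<bar>q * \<theta> - a\<bar> \<le> 1 / q"
    and J: "{lo<..<hi} \<subseteq> J" "J \<subseteq> {lo..hi}" and "lo \<le> hi" "hi - lo < 1"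
  shows "\<bar>real (card {i\<in>{0..<q}. mod1_in J (of_int i * \<theta> + \<beta>)}) - q * (hi - lo)\<bar> \<le> 3"
proof -
  define S where "S = {i\<in>{0..<q}. mod1_in J (of_int i * \<theta> + \<beta>)}"
  define e where "e i = of_int i * (\<theta> - a / q)" for i :: int
  have q0: "real_of_int q > 0" using assms by simp
  have x: "of_int i * \<theta> + \<beta> = \<beta> + of_int (i * a) / q + e i" for i
    using q0 by (simp add: e_def algebra_simps)
  have e: "\<bar>e i\<bar> \<le> 1 / q" if "i \<in> {0..<q}" for i
  proof -
    have "\<bar>\<theta> - a / q\<bar> = \<bar>q * \<theta> - a\<bar> / q" using q0 by (simp add: field_simps abs_if)
    also have "\<dots> \<le> (1 / q) / q" using assms q0 by (intro divide_right_mono) auto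
    finally have "\<bar>e i\<bar> \<le> q * ((1 / q) / q)"
      unfolding e_def abs_mult using that by (intro mult_mono) auto
    then show ?thesis using q0 by simp
  qed
  have finS: "finite S" unfolding S_def by (rule finite_subset[of _ "{0..<q}"]) auto
  have "\<exists>m. \<forall>i\<in>S. of_int i * \<theta> + \<beta> - of_int (m i :: int) \<in> J"
    by (rule bchoice) (auto simp: S_def mod1_in_def)
  then obtain m where m: "\<And>i. i \<in> S \<Longrightarrow> of_int i * \<theta> + \<beta> - of_int (m i :: int) \<in> J" by blast
  \<comment> \<open>Up to \<open>\<beta>\<close> and an error of \<open>1 / q\<close>, the fraction
    \<open>r i / q\<close> is the representative of \<open>i * \<theta>\<close> found in
    \<open>J\<close>. Membership therefore confines \<open>r i\<close> to an interval with at most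
    \<open>q * (hi - lo) + 3\<close> integers.\<close>
  define r where "r i = i * a - q * m i" for i
  define L where "L = q * (lo - \<beta>) - 1"
  define U where "U = q * (hi - \<beta>) + 1"
  have r_bounds: "L \<le> r i \<and> r i \<le> U" if i: "i \<in> S" for i
  proof -
    have "lo \<le> \<beta> + of_int (i * a) / q + e i - of_int (m i)" "\<beta> + of_int (i * a) / q + e i - of_int (m i) \<le> hi"
      using m[OF i] J unfolding x by auto
    moreover have "\<bar>e i\<bar> \<le> 1 / q" using e i by (simp add: S_def)
    moreover have "real_of_int (r i) = q * (of_int (i * a) / q - m i)"
      using q0 by (simp add: r_def field_simps)
    ultimately have "lo - \<beta> - 1 / q \<le> r i / q \<and> r i / q \<le> hi - \<beta> + 1 / q"
      using q0 by (simp add: abs_le_iff)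
    then have "q * (lo - \<beta> - 1 / q) \<le> r i \<and> r i \<le> q * (hi - \<beta> + 1 / q)"
      using q0 by (simp add: pos_le_divide_eq pos_divide_le_eq mult.commute)
    then show ?thesis using q0 by (simp add: L_def U_def algebra_simps)
  qed
  have inj: "inj_on r S"
  proof (rule inj_onI)
    fix i j assume ij: "i \<in> S" "j \<in> S" "r i = r j"
    then have "(i - j) * a = q * (m i - m j)" by (simp add: r_def algebra_simps)
    then have "q dvd (i - j) * a" by simp
    then have "q dvd i - j" using assms(1) by (simp add: coprime_commute coprime_dvd_mult_left_iff)
    moreover have "\<bar>i - j\<bar> < q" using ij by (auto simp: S_def)
    ultimately show "i = j" using zdvd_not_zless[of "\<bar>i - j\<bar>" q] by (cases "i = j") auto
  qed
  have "card S \<le> card {\<lceil>L\<rceil>..\<lfloor>U\<rfloor>}"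
    using r_bounds inj by (intro card_inj_on_le[of r]) (auto simp: ceiling_le_iff le_floor_iff)
  moreover have "q * (lo - \<beta>) \<le> q * (hi - \<beta>)" using q0 assms by (intro mult_left_mono) auto
  then have "L \<le> U" unfolding L_def U_def by linarith
  ultimately have "real (card S) \<le> U - L + 1" by simp linarith
  then have upper: "real (card S) \<le> q * (hi - lo) + 3"
    by (simp add: U_def L_def algebra_simps)
  \<comment> \<open>For the lower bound the correspondence is inverted: the inverse of
    \<open>a\<close> modulo \<open>q\<close> recovers the index from a numerator \<open>s\<close>,
    taken far enough inside the interval to survive the perturbation by
    \<open>1 / q\<close>.\<close>
  obtain a' where a': "[a * a' = 1] (mod q)" using assms(1) cong_solve_coprime_int by blast
  define g where "g s = (s * a') mod q" for s
  define L' where "L' = q * (lo - \<beta>) + 1"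
  define U' where "U' = q * (hi - \<beta>) - 1"
  have ga: "[g s * a = s] (mod q)" for s
  proof -
    have "[g s * a = (s * a') * a] (mod q)" by (intro cong_mult) (auto simp: g_def)
    also have "(s * a') * a = s * (a * a')" by simp
    also have "[s * (a * a') = s * 1] (mod q)" by (intro cong_mult a') auto
    finally show ?thesis by simp
  qed
  let ?R = "{\<lfloor>L'\<rfloor> + 1..\<lceil>U'\<rceil> - 1}"
  have R: "L' < real_of_int s \<and> real_of_int s < U'" if "s \<in> ?R" for s
    using that by (auto; linarith)
  have gS: "g s \<in> S" if s: "s \<in> ?R" for s
  proof -
    have gq: "g s \<in> {0..<q}" using assms(2) by (simp add: g_def)
    from ga[of s] obtain k where k: "s = g s * a + q * k" unfolding cong_iff_lin by blast
    have "L' < real_of_int s" "real_of_int s < U'" using R[OF s] by auto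
    then have "L' / q < s / q" "s / q < U' / q"
      using q0 by (auto intro: divide_strict_right_mono)
    moreover have "L' / q = lo - \<beta> + 1 / q" "U' / q = hi - \<beta> - 1 / q"
      using q0 by (simp_all add: L'_def U'_def add_divide_distrib diff_divide_distrib)
    ultimately have "lo - \<beta> + 1 / q < s / q \<and> s / q < hi - \<beta> - 1 / q"
      by simp
    moreover have "s / q = of_int (g s * a) / q + of_int k"
      using q0 by (subst k) (simp add: field_simps)
    ultimately have "of_int (g s) * \<theta> + \<beta> - of_int (- k) \<in> {lo<..<hi}"
      unfolding x using e[OF gq] by (auto simp: abs_le_iff)
    then show ?thesis using J gq unfolding S_def mod1_in_def by blast
  qed
  have injg: "inj_on g ?R"
  proof (rule inj_onI)
    fix s t assume st: "s \<in> ?R" "t \<in> ?R" "g s = g t"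
    have "[s = t] (mod q)" using ga[of s] ga[of t] st(3) by (metis cong_sym cong_trans)
    then have "q dvd s - t" by (simp add: cong_iff_dvd_diff)
    \<comment> \<open>Here \<open>hi - lo < 1\<close> enters: the admissible numerators spread over
      less than \<open>q\<close>, so distinct ones are incongruent.\<close>
    moreover have "\<bar>s - t\<bar> < q"
    proof -
      have "\<bar>real_of_int s - real_of_int t\<bar> < U' - L'" using R[OF st(1)] R[OF st(2)] by linarith
      also have "\<dots> \<le> q * (hi - lo)" by (simp add: U'_def L'_def algebra_simps)
      also have "\<dots> \<le> real_of_int q * 1" using assms q0 by (intro mult_left_mono) auto
      finally show ?thesis by linarith
    qed
    ultimately show "s = t" using zdvd_not_zless[of "\<bar>s - t\<bar>" q] by (cases "s = t") auto
  qed
  have "card ?R \<le> card S"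
    using gS injg finS by (intro card_inj_on_le[of g]) auto
  then have "U' - L' - 1 \<le> real (card S)" by simp linarith
  then have "q * (hi - lo) - 3 \<le> real (card S)" by (simp add: U'_def L'_def algebra_simps)
  with upper show ?thesis unfolding S_def[symmetric] by linarith
qed

text \<open>Full periods are split off one by one with error 3 each. The incomplete last one is
  compared with a full period, whence the term \<open>q * (hi - lo)\<close>.\<close>

lemma rotation_run_count:
  fixes \<theta> \<beta> lo hi :: real and a q M :: int and n :: nat
  assumes "coprime a q" "q > 0" "\<bar>q * \<theta> - a\<bar> \<le> 1 / q"
    and J: "{lo<..<hi} \<subseteq> J" "J \<subseteq> {lo..hi}" and "lo \<le> hi" "hi - lo < 1"
  shows "\<bar>real (card {m\<in>{M..<M + int n}. mod1_in J (of_int m * \<theta> + \<beta>)}) - n * (hi - lo)\<bar> \<le>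
    3 * (n / q) + q * (hi - lo) + 3"
proof (induction n arbitrary: M rule: less_induct)
  case (less n)
  have q0: "real_of_int q > 0" using assms by simp
  let ?B = "{m\<in>{M..<M + q}. mod1_in J (of_int m * \<theta> + \<beta>)}"
  have "?B = (\<lambda>i. M + i) ` {i\<in>{0..<q}. mod1_in J (of_int i * \<theta> + (\<beta> + of_int M * \<theta>))}"
  proof (intro equalityI subsetI)
    fix m assume "m \<in> ?B"
    then show "m \<in> (\<lambda>i. M + i) ` {i\<in>{0..<q}. mod1_in J (of_int i * \<theta> + (\<beta> + of_int M * \<theta>))}"
      by (intro image_eqI[of _ _ "m - M"]) (auto simp: algebra_simps)
  qed (auto simp: algebra_simps)
  then have "card ?B = card {i\<in>{0..<q}. mod1_in J (of_int i * \<theta> + (\<beta> + of_int M * \<theta>))}"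
    by (simp add: card_image)
  then have B: "\<bar>real (card ?B) - q * (hi - lo)\<bar> \<le> 3"
    using rotation_block_count[OF assms, of "\<beta> + of_int M * \<theta>"] by simp
  show ?case
  proof (cases "int n < q")
    case True
    have "card {m\<in>{M..<M + int n}. mod1_in J (of_int m * \<theta> + \<beta>)} \<le> card ?B"
      using True by (intro card_mono finite_subset[of ?B "{M..<M + q}"]) auto
    moreover have "n * (hi - lo) \<le> q * (hi - lo)"
      using True assms by (intro mult_right_mono) linarith+
    moreover have "0 \<le> n * (hi - lo)" "0 \<le> 3 * (n / q)" using assms q0 by auto
    ultimately show ?thesis using B by linarith
  next
    case False
    define n' where "n' = n - nat q"
    have n: "int n = q + int n'" using False assms by (simp add: n'_def)
    have nr: "real n = q + real n'" using n by linarith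
    let ?A = "\<lambda>M n. {m\<in>{M..<M + int n}. mod1_in J (of_int m * \<theta> + \<beta>)}"
    have "?A M n = ?B \<union> ?A (M + q) n'" using n assms by auto
    moreover have "?B \<inter> ?A (M + q) n' = {}" by auto
    moreover have "finite ?B" "finite (?A (M + q) n')"
      by (rule finite_subset[of _ "{M..<M + q}"], blast, blast, rule finite_subset[of _ "{M + q..<M + q + int n'}"]) blast+
    ultimately have "card (?A M n) = card ?B + card (?A (M + q) n')"
      using card_Un_disjoint[of ?B "?A (M + q) n'"] by simp
    moreover have "\<bar>real (card (?A (M + q) n')) - n' * (hi - lo)\<bar> \<le> 3 * (n' / q) + q * (hi - lo) + 3"
      by (rule less.IH) (use n assms in linarith)
    moreover have "3 * (n / q) = 3 + 3 * (n' / q)" "n * (hi - lo) = q * (hi - lo) + n' * (hi - lo)"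
      using q0 by (simp_all add: nr field_simps)
    ultimately show ?thesis using B by linarith
  qed
qed

text \<open>The liminf controls large \<open>n\<close> only. For the finitely many others
  irrationality makes the distance positive, and a minimum yields one constant.\<close>

lemma badly_approximable_bound:
  assumes "badly_approximable \<alpha>"
  obtains c :: real where "c > 0" "\<And>(n::nat) (m::int). n > 0 \<Longrightarrow> c \<le> n * \<bar>n * \<alpha> - m\<bar>"
proof -
  let ?d = "\<lambda>n::nat. infdist (real n * \<alpha>) \<int>"
  have irr: "\<alpha> \<notin> \<rat>" and lim: "liminf (\<lambda>n. ereal (real n * ?d n)) > 0"
    using assms by (auto simp: badly_approximable_def)
  from lim obtain e :: real where e: "0 < ereal e" "ereal e < liminf (\<lambda>n. ereal (real n * ?d n))"
    using ereal_dense2 by blast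
  then have "eventually (\<lambda>n. ereal e < ereal (real n * ?d n)) sequentially"
    by (intro less_LiminfD)
  then obtain N where N: "\<And>n. n \<ge> N \<Longrightarrow> e < real n * ?d n"
    by (auto simp: eventually_sequentially)
  have pos: "0 < real n * ?d n" if "n > 0" for n
  proof -
    have "real n * \<alpha> \<notin> \<int>"
    proof
      assume "real n * \<alpha> \<in> \<int>"
      then obtain k where "real n * \<alpha> = of_int k" by (rule Ints_cases)
      then have "\<alpha> = of_int k / of_nat n" using that by (simp add: field_simps)
      also have "\<dots> \<in> \<rat>" by (intro Rats_divide Rats_of_int Rats_of_nat)
      finally show False using irr by contradiction
    qed
    moreover have "closed (\<int> :: real set)" by (rule closed_Ints)
    ultimately have "?d n \<noteq> 0" by (metis Ints_0 empty_iff in_closed_iff_infdist_zero)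
    then show ?thesis using that infdist_nonneg[of "real n * \<alpha>" \<int>] by simp
  qed
  define c where "c = Min (insert e ((\<lambda>n. real n * ?d n) ` {1..N}))"
  have "c > 0" unfolding c_def using e pos by (subst Min_gr_iff) auto
  moreover have "c \<le> n * \<bar>n * \<alpha> - m\<bar>" if "n > 0" for n :: nat and m :: int
  proof -
    have "c \<le> real n * ?d n"
    proof (cases "n \<le> N")
      case True
      then show ?thesis unfolding c_def using that by (intro Min_le) auto
    next
      case False
      have "c \<le> e" unfolding c_def by (intro Min_le) auto
      then show ?thesis using N[of n] False by simp
    qed
    also have "?d n \<le> dist (real n * \<alpha>) (of_int m)" by (rule infdist_le) auto
    then have "real n * ?d n \<le> n * \<bar>n * \<alpha> - m\<bar>" by (intro mult_left_mono) (auto simp: dist_real_def)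
    finally show ?thesis .
  qed
  ultimately show thesis by (intro that) auto
qed

text \<open>The error term is uniform in the modulus \<open>d\<close>: the Dirichlet approximation of \<open>d\<alpha>\<close> with
  denominator at most \<open>N\<close> has denominator at least a constant times \<open>N / d\<close>, which exactly
  compensates for the \<open>1 / d\<close> in the length of the progression.\<close>

lemma rotation_progression_count:
  assumes "badly_approximable \<alpha>"
  obtains C :: real where "C \<ge> 1"
    "\<And>(d::nat) (c::int) (u::int) (v::int) (lo::real) (hi::real) J. d > 0 \<Longrightarrow> u < v \<Longrightarrow> {lo<..<hi} \<subseteq> J \<Longrightarrow> J \<subseteq> {lo..hi} \<Longrightarrow>
       lo \<le> hi \<Longrightarrow> hi - lo < 1 \<Longrightarrow>
       \<bar>real (card {h\<in>{u<..v}. [h = c] (mod int d) \<and> mod1_in J (of_int h * \<alpha>)}) - (v - u) * (hi - lo) / d\<bar> \<le>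
         C * (sqrt ((v - u) * (hi - lo)) + 1)"
proof -
  obtain c0 where c0: "c0 > 0" "\<And>(n::nat) (m::int). n > 0 \<Longrightarrow> c0 \<le> n * \<bar>n * \<alpha> - m\<bar>"
    using badly_approximable_bound[OF assms] by blast
  show thesis
  proof (rule that[of "3 / c0 + 9"], goal_cases)
    case 1
    show ?case using c0(1) by (simp add: add_increasing)
  next
    case (2 d c u v lo hi J)
    then have d: "d > 0" and uv: "u < v" and J: "{lo<..<hi} \<subseteq> J" "J \<subseteq> {lo..hi}" and lohi: "lo \<le> hi" "hi - lo < 1"
      by auto
    define Y where "Y = real_of_int (v - u)"
    define \<delta> where "\<delta> = hi - lo"
    \<comment> \<open>Keeps the quotient below finite when the interval is degenerate or shorter
      than \<open>1 / Y\<close>. The choice \<open>s = sqrt (Y / \<delta>')\<close> balances the two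
      error terms \<open>Y / s\<close> and \<open>s * \<delta>'\<close>, both of which equal
      \<open>sqrt (Y * \<delta>')\<close>.\<close>
    define \<delta>' where "\<delta>' = max \<delta> (1 / Y)"
    have Y: "Y \<ge> 1" using uv unfolding Y_def by linarith
    have \<delta>: "0 \<le> \<delta>" "\<delta> < 1" using lohi by (auto simp: \<delta>_def)
    have \<delta>': "0 < \<delta>'" "\<delta>' \<le> 1" "\<delta> \<le> \<delta>'" using Y \<delta> by (auto simp: \<delta>'_def less_max_iff_disj)
    define s where "s = sqrt (Y / \<delta>')"
    have s1: "s \<ge> 1" unfolding s_def using Y \<delta>' by (simp add: field_simps)
    define N where "N = nat \<lceil>s\<rceil>"
    have N: "s \<le> real N" "real N \<le> s + 1" using s1 unfolding N_def by linarith+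
    have N0: "N > 0" using N s1 by linarith
    have sY: "Y / s = sqrt (Y * \<delta>')" "s * \<delta>' = sqrt (Y * \<delta>')"
    proof -
      have "Y = sqrt Y * sqrt Y" "\<delta>' = sqrt \<delta>' * sqrt \<delta>'" "sqrt Y > 0" "sqrt \<delta>' > 0" using Y \<delta>' by auto
      then show "Y / s = sqrt (Y * \<delta>')" "s * \<delta>' = sqrt (Y * \<delta>')"
        unfolding s_def real_sqrt_divide real_sqrt_mult by (metis divide_divide_eq_right mult.commute nonzero_mult_div_cancel_right times_divide_eq_left less_irrefl)+
    qed
    have sYd: "sqrt (Y * \<delta>') \<le> sqrt (Y * \<delta>) + 1"
    proof -
      have "Y * \<delta>' = max (Y * \<delta>) 1" using Y by (simp add: \<delta>'_def max_def field_simps)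
      also have "\<dots> \<le> (sqrt (Y * \<delta>) + 1)\<^sup>2"
        using Y \<delta> by (auto simp: power2_eq_square algebra_simps)
      finally show ?thesis using Y \<delta> by (intro real_le_lsqrt) auto
    qed
    obtain a q where aq: "coprime a q" "0 < q" "q \<le> int N" "\<bar>of_int q * (real d * \<alpha>) - of_int a\<bar> < 1 / N"
      using Dirichlet_approx_coprime[OF N0] by blast
    have q0: "real_of_int q > 0" "real_of_int q \<le> N" using aq by linarith+
    have approx: "\<bar>q * (real d * \<alpha>) - a\<bar> \<le> 1 / q"
    proof -
      have "1 / real N \<le> 1 / q" using q0 by (intro divide_left_mono) auto
      then show ?thesis using aq(4) by linarith
    qed
    have qlow: "1 / (real d * q) \<le> 1 / (c0 * s)"
    proof -
      have "c0 \<le> (nat q * d) * \<bar>(nat q * d) * \<alpha> - a\<bar>"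
        using c0(2)[of "nat q * d" a] aq(2) d by simp
      also have "\<dots> = (q * d) * \<bar>q * (real d * \<alpha>) - a\<bar>"
        using aq(2) by (simp add: mult.assoc)
      also have "\<dots> \<le> (q * d) * (1 / N)"
        using aq q0 by (intro mult_left_mono) auto
      finally have "c0 * N \<le> q * d" using N0 by (simp add: field_simps)
      moreover have "c0 * s \<le> c0 * N" using N c0(1) by (intro mult_left_mono) auto
      ultimately have "c0 * s \<le> d * q" by (simp add: mult.commute)
      then show ?thesis using c0(1) s1 q0 d by (intro divide_left_mono) auto
    qed
    define A where "A = \<lfloor>real_of_int (u - c) / d\<rfloor>"
    define B where "B = \<lfloor>real_of_int (v - c) / d\<rfloor>"
    have AB: "A \<le> B" unfolding A_def B_def using uv by (intro floor_mono divide_right_mono) auto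
    define n where "n = nat (B - A)"
    have n: "real n = B - A" "int n = B - A" using AB by (auto simp: n_def)
    have nY: "\<bar>real n - Y / d\<bar> \<le> 1"
      unfolding n A_def B_def Y_def by (simp add: diff_divide_distrib) linarith
    have img: "{h\<in>{u<..v}. [h = c] (mod int d)} = (\<lambda>m. c + int d * m) ` {A<..B}"
      using cong_interval_image[of "int d" u v c] d unfolding A_def B_def by simp
    have "{h\<in>{u<..v}. [h = c] (mod int d) \<and> mod1_in J (of_int h * \<alpha>)} =
       {h\<in>{h\<in>{u<..v}. [h = c] (mod int d)}. mod1_in J (of_int h * \<alpha>)}" by auto
    also have "\<dots> = (\<lambda>m. c + int d * m) ` {m\<in>{A<..B}. mod1_in J (of_int m * (real d * \<alpha>) + of_int c * \<alpha>)}"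
      unfolding img by (auto simp: algebra_simps)
    also have "{A<..B} = {A + 1..<A + 1 + int n}" using n by auto
    finally have "card {h\<in>{u<..v}. [h = c] (mod int d) \<and> mod1_in J (of_int h * \<alpha>)} =
       card {m\<in>{A + 1..<A + 1 + int n}. mod1_in J (of_int m * (real d * \<alpha>) + of_int c * \<alpha>)}"
      using d by (simp add: card_image inj_on_def)
    then have main: "\<bar>real (card {h\<in>{u<..v}. [h = c] (mod int d) \<and> mod1_in J (of_int h * \<alpha>)}) - n * \<delta>\<bar> \<le> 3 * (n / q) + q * \<delta> + 3"
      unfolding \<delta>_def using rotation_run_count[OF aq(1,2) approx J lohi] by simp
    define E1 where "E1 = (1 / c0) * sqrt (Y * \<delta>')"
    have e1: "n / q \<le> E1 + 1"
    proof -
      have "n / q \<le> (Y / d + 1) / q" using nY q0 by (intro divide_right_mono) auto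
      also have "\<dots> = Y * (1 / (real d * q)) + 1 / q" by (simp add: add_divide_distrib)
      also have "\<dots> \<le> Y * (1 / (c0 * s)) + 1"
        using qlow Y aq(2) by (intro add_mono mult_left_mono) auto
      also have "Y * (1 / (c0 * s)) = (1 / c0) * (Y / s)" by simp
      finally show ?thesis unfolding E1_def sY(1) .
    qed
    have e2: "q * \<delta> \<le> sqrt (Y * \<delta>') + 1"
    proof -
      have "q * \<delta> \<le> (s + 1) * \<delta>'" using q0 N \<delta>' \<delta> by (intro mult_mono) auto
      then show ?thesis using sY \<delta>' by (simp add: algebra_simps)
    qed
    have e3: "\<bar>n * \<delta> - Y * \<delta> / d\<bar> \<le> 1"
    proof -
      have "n * \<delta> - Y * \<delta> / d = (n - Y / d) * \<delta>" by (simp add: algebra_simps)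
      also have "\<bar>\<dots>\<bar> \<le> 1 * 1" unfolding abs_mult using nY \<delta> by (intro mult_mono) auto
      finally show ?thesis by simp
    qed
    have "\<bar>real (card {h\<in>{u<..v}. [h = c] (mod int d) \<and> mod1_in J (of_int h * \<alpha>)}) - Y * \<delta> / d\<bar> \<le>
       3 * E1 + sqrt (Y * \<delta>') + 8"
    proof -
      have "\<bar>X - Z\<bar> \<le> 3 * E + r + 8"
        if "\<bar>X - T\<bar> \<le> 3 * N + M + 3" "N \<le> E + 1" "M \<le> r + 1" "\<bar>T - Z\<bar> \<le> 1" for X Z E r T N M :: real
        using that by linarith
      from this[OF main e1 e2 e3] show ?thesis .
    qed
    also have "\<dots> = (3 / c0 + 1) * sqrt (Y * \<delta>') + 8" by (simp add: E1_def algebra_simps)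
    also have "\<dots> \<le> (3 / c0 + 1) * (sqrt (Y * \<delta>) + 1) + 8 * (sqrt (Y * \<delta>) + 1)"
      using sYd c0(1) Y \<delta> by (intro add_mono mult_left_mono) auto
    also have "\<dots> = (3 / c0 + 9) * (sqrt (Y * \<delta>) + 1)" by (simp add: algebra_simps)
    finally have "\<bar>real (card {h\<in>{u<..v}. [h = c] (mod int d) \<and> mod1_in J (of_int h * \<alpha>)}) - Y * \<delta> / d\<bar> \<le>
       (3 / c0 + 9) * (sqrt (Y * \<delta>) + 1)" .
    then show ?case
      by (simp add: Y_def \<delta>_def)
  qed
qed

section \<open>Sifting shifted tuples\<close>

text \<open>The number of classes modulo \<open>p\<close> that \<open>t\<close> must avoid if no
  \<open>t - h j\<close> with \<open>p \<le> z j\<close> is to be divisible by \<open>p\<close>. The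
  coordinates have separate thresholds because they will lie in different pieces of the
  range.\<close>

definition residue_count :: "nat \<Rightarrow> (nat \<Rightarrow> real) \<Rightarrow> (nat \<Rightarrow> int) \<Rightarrow> nat \<Rightarrow> nat" where
  "residue_count k z h p = card ((\<lambda>j. h j mod int p) ` {j\<in>{1..k}. real p \<le> z j})"

text \<open>The singular series of the shifts together with its density factors, restricted to
  primes above \<open>w\<close>. A prime beyond all \<open>z j\<close> contributes the factor 1, so
  \<open>x\<close> is just a common upper limit.\<close>

definition sifted_density :: "nat \<Rightarrow> nat \<Rightarrow> real \<Rightarrow> (nat \<Rightarrow> real) \<Rightarrow> (nat \<Rightarrow> int) \<Rightarrow> real" where
  "sifted_density k w x z h = (\<Prod>p\<in>primes_between w x. 1 - real (residue_count k z h p) / p)"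

lemma residue_count_le: "residue_count k z h p \<le> card {j\<in>{1..k}. real p \<le> z j}" "residue_count k z h p \<le> k"
proof -
  show 1: "residue_count k z h p \<le> card {j\<in>{1..k}. real p \<le> z j}"
    unfolding residue_count_def by (rule card_image_le) auto
  have "card {j\<in>{1..k}. real p \<le> z j} \<le> card {1..k}" by (intro card_mono) auto
  with 1 show "residue_count k z h p \<le> k" by simp
qed

text \<open>Divisibility of \<open>t - h j\<close> by \<open>p\<close> is a condition on
  \<open>t\<close> modulo \<open>p\<close>, so at most \<open>k\<close> classes are excluded
  whatever the shifts are. The constants are independent of \<open>h\<close>, as they must be for
  the later summation over shifts. \<open>W\<close> will carry the primes up to
  \<open>w\<close>.\<close>

lemma sieve_shifts:
  fixes k :: nat and \<eta> :: real
  assumes "\<eta> > 0"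
  obtains w0 :: nat and C :: real where "C \<ge> 0"
    "\<And>(w::nat) (x::real) (z::nat \<Rightarrow> real) (h :: nat \<Rightarrow> int) (u::int) (v::int) (c::int) (W::int).
       w \<ge> w0 \<Longrightarrow> x \<ge> 2 \<Longrightarrow> u \<le> v \<Longrightarrow> W > 0 \<Longrightarrow>
       (\<And>p. p \<in> primes_between w x \<Longrightarrow> coprime (int p) W) \<Longrightarrow> (\<And>j. j \<in> {1..k} \<Longrightarrow> z j \<le> x) \<Longrightarrow>
       \<bar>real (card {t\<in>{u<..v}. [t = c] (mod W) \<and> (\<forall>j\<in>{1..k}. \<forall>p\<in>primes_between w (z j). \<not> int p dvd t - h j)})
          - (v - u) / W * sifted_density k w x z h\<bar> \<le>
         \<eta> * ((v - u) / W * sifted_density k w x z h) + x powr C"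
proof -
  obtain w0 :: nat and C :: real where C: "C \<ge> 0" and bh: "\<And>(w::nat) z (S :: int set) B (\<nu> :: nat \<Rightarrow> nat) Y. w \<ge> w0 \<Longrightarrow> z \<ge> 2 \<Longrightarrow> finite S \<Longrightarrow> Y \<ge> 0 \<Longrightarrow>
       (\<And>p. p \<in> primes_between w z \<Longrightarrow> \<nu> p \<le> k) \<Longrightarrow>
       (\<And>D. D \<subseteq> primes_between w z \<Longrightarrow>
          \<bar>real (card {t\<in>S. \<forall>p\<in>D. B p t}) - Y * (\<Prod>p\<in>D. real (\<nu> p) / p)\<bar> \<le> (\<Prod>p\<in>D. real (\<nu> p))) \<Longrightarrow>
       \<bar>real (card {t\<in>S. \<forall>p\<in>primes_between w z. \<not> B p t}) - Y * (\<Prod>p\<in>primes_between w z. 1 - real (\<nu> p) / p)\<bar> \<le>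
         \<eta> * (Y * (\<Prod>p\<in>primes_between w z. 1 - real (\<nu> p) / p)) + z powr C"
    by (rule brun_hooley[OF assms, of k]) blast
  show thesis
  proof (rule that[OF C, of w0], goal_cases)
    case (1 w x z h u v c W)
    define S where "S = {t\<in>{u<..v}. [t = c] (mod W)}"
    define \<Omega> where "\<Omega> p = (\<lambda>j. h j mod int p) ` {j\<in>{1..k}. real p \<le> z j}" for p :: nat
    define Y where "Y = real_of_int (v - u) / real_of_int W"
    have finS: "finite S" unfolding S_def by (rule finite_subset[of _ "{u<..v}"]) auto
    have Y0: "Y \<ge> 0" unfolding Y_def using 1 by simp
    have lev: "\<bar>real (card {t\<in>S. \<forall>p\<in>D. t mod int p \<in> \<Omega> p}) - Y * (\<Prod>p\<in>D. real (residue_count k z h p) / p)\<bar> \<le> (\<Prod>p\<in>D. real (residue_count k z h p))"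
      if D: "D \<subseteq> primes_between w x" for D
    proof -
      have eq: "{t\<in>S. \<forall>p\<in>D. t mod int p \<in> \<Omega> p} = {t\<in>{u<..v}. [t = c] (mod W) \<and> (\<forall>p\<in>D. t mod int p \<in> \<Omega> p)}"
        by (simp add: S_def conj_assoc)
      have "finite D" using D by (rule finite_subset) auto
      moreover have "prime p" "coprime (int p) W" if "p \<in> D" for p
        using D that 1(5) by (auto simp: primes_between_def)
      moreover have "\<Omega> p \<subseteq> {0..<int p}" if "p \<in> D" for p
        using D that by (auto simp: \<Omega>_def dest!: pos_primes_between)
      ultimately have "\<bar>real (card {t\<in>{u<..v}. [t = c] (mod W) \<and> (\<forall>p\<in>D. t mod int p \<in> \<Omega> p)}) -
         (v - u) / W * (\<Prod>p\<in>D. real (card (\<Omega> p)) / p)\<bar> \<le> (\<Prod>p\<in>D. real (card (\<Omega> p)))"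
        using 1(3,4) by (intro card_residues_interval)
      moreover have "residue_count k z h p = card (\<Omega> p)" for p
        by (simp only: residue_count_def \<Omega>_def)
      ultimately show ?thesis unfolding eq Y_def by (simp only:)
    qed
    have eq: "{t\<in>{u<..v}. [t = c] (mod W) \<and> (\<forall>j\<in>{1..k}. \<forall>p\<in>primes_between w (z j). \<not> int p dvd t - h j)} =
       {t\<in>S. \<forall>p\<in>primes_between w x. t mod int p \<notin> \<Omega> p}"
    proof -
      have "(\<forall>j\<in>{1..k}. \<forall>p\<in>primes_between w (z j). \<not> int p dvd t - h j) \<longleftrightarrow>
        (\<forall>p\<in>primes_between w x. t mod int p \<notin> \<Omega> p)" for t
      proof
        assume L: "\<forall>j\<in>{1..k}. \<forall>p\<in>primes_between w (z j). \<not> int p dvd t - h j"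
        show "\<forall>p\<in>primes_between w x. t mod int p \<notin> \<Omega> p"
        proof (intro ballI notI)
          fix p assume p: "p \<in> primes_between w x" "t mod int p \<in> \<Omega> p"
          then obtain j where j: "j \<in> {1..k}" "real p \<le> z j" "t mod int p = h j mod int p"
            by (auto simp: \<Omega>_def)
          then have "int p dvd t - h j" by (simp add: mod_eq_dvd_iff)
          moreover have "p \<in> primes_between w (z j)" using p j by (auto simp: primes_between_def)
          ultimately show False using L j by blast
        qed
      next
        assume R: "\<forall>p\<in>primes_between w x. t mod int p \<notin> \<Omega> p"
        show "\<forall>j\<in>{1..k}. \<forall>p\<in>primes_between w (z j). \<not> int p dvd t - h j"
        proof (intro ballI notI)
          fix j p assume j: "j \<in> {1..k}" and p: "p \<in> primes_between w (z j)" "int p dvd t - h j"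
          have "t mod int p = h j mod int p" using p by (simp add: mod_eq_dvd_iff)
          then have "t mod int p \<in> \<Omega> p" using j p by (auto simp: \<Omega>_def primes_between_def)
          moreover have "p \<in> primes_between w x" using p 1(6)[OF j] by (auto simp: primes_between_def)
          ultimately show False using R by blast
        qed
      qed
      then show ?thesis by (simp add: S_def conj_assoc)
    qed
    have rc: "residue_count k z h p \<le> k" for p by (rule residue_count_le)
    show ?case
      using bh[OF 1(1,2) finS Y0 rc lev] unfolding eq sifted_density_def Y_def by simp
  qed
qed

section \<open>Bounds for the singular series\<close>

lemma prod_one_minus_ge:
  fixes x :: "'a \<Rightarrow> real"
  assumes "finite A" "\<And>i. i \<in> A \<Longrightarrow> 0 \<le> x i \<and> x i \<le> 1"
  shows "1 - sum x A \<le> (\<Prod>i\<in>A. 1 - x i)"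
  using assms
proof (induction A rule: finite_induct)
  case (insert a A)
  have "sum x A \<ge> 0" using insert by (intro sum_nonneg) auto
  have P: "0 \<le> (\<Prod>i\<in>A. 1 - x i)" "(\<Prod>i\<in>A. 1 - x i) \<le> 1"
    using insert by (auto intro!: prod_nonneg prod_le_1)
  have "x a * (\<Prod>i\<in>A. 1 - x i) \<le> x a * 1" using P insert by (intro mult_left_mono) auto
  then show ?case using insert by (simp add: algebra_simps)
qed auto

lemma prod_mertens_prod:
  fixes k :: nat and z :: "nat \<Rightarrow> real"
  assumes "\<And>j. j \<in> {1..k} \<Longrightarrow> z j \<le> x"
  shows "(\<Prod>j\<in>{1..k}. mertens_prod w (z j)) =
    (\<Prod>p\<in>primes_between w x. (1 - 1 / real p) ^ card {j\<in>{1..k}. real p \<le> z j})"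
proof -
  have "mertens_prod w (z j) = (\<Prod>p\<in>primes_between w x. if real p \<le> z j then 1 - 1 / real p else 1)" if "j \<in> {1..k}" for j
  proof -
    have "primes_between w (z j) = {p\<in>primes_between w x. real p \<le> z j}"
      using assms[OF that] by (auto simp: primes_between_def)
    then show ?thesis unfolding mertens_prod_def by (simp add: prod.inter_filter)
  qed
  then have "(\<Prod>j\<in>{1..k}. mertens_prod w (z j)) =
     (\<Prod>j\<in>{1..k}. \<Prod>p\<in>primes_between w x. if real p \<le> z j then 1 - 1 / real p else 1)"
    by (intro prod.cong) auto
  also have "\<dots> = (\<Prod>p\<in>primes_between w x. \<Prod>j\<in>{1..k}. if real p \<le> z j then 1 - 1 / real p else 1)"
    by (rule prod.swap)
  also have "\<dots> = (\<Prod>p\<in>primes_between w x. (1 - 1 / real p) ^ card {j\<in>{1..k}. real p \<le> z j})"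
  proof (intro prod.cong refl)
    fix p
    have "(\<Prod>j\<in>{1..k}. if real p \<le> z j then 1 - 1 / real p else 1) = (\<Prod>j\<in>{j\<in>{1..k}. real p \<le> z j}. 1 - 1 / real p)"
      by (rule prod.inter_filter[symmetric]) simp
    then show "(\<Prod>j\<in>{1..k}. if real p \<le> z j then 1 - 1 / real p else 1) = (1 - 1 / real p) ^ card {j\<in>{1..k}. real p \<le> z j}"
      by (simp only: prod_constant)
  qed
  finally show ?thesis .
qed

lemma sifted_density_nonneg:
  assumes "w \<ge> k"
  shows "sifted_density k w x z h \<ge> 0"
  unfolding sifted_density_def
proof (intro prod_nonneg)
  fix p assume "p \<in> primes_between w x"
  then have "real k \<le> real p" using assms by (auto simp: primes_between_def)
  moreover have "real (residue_count k z h p) \<le> real k" using residue_count_le(2) of_nat_le_iff by blast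
  moreover have "real p > 0" using \<open>p \<in> primes_between w x\<close> by (auto simp: primes_between_def)
  ultimately show "0 \<le> 1 - real (residue_count k z h p) / p" by simp
qed

text \<open>Coinciding residues only increase the density, so the bound holds for every
  \<open>h\<close>. Without coincidences a factor is \<open>1 - m / p\<close>, which differs from
  \<open>(1 - 1 / p) ^ m\<close> in second order only, and these losses add up to at most
  \<open>k^2 / w\<close>.\<close>

lemma sifted_density_ge:
  assumes "w \<ge> k" "w \<ge> 1" "\<And>j. j \<in> {1..k} \<Longrightarrow> z j \<le> x"
  shows "(1 - real k ^ 2 / w) * (\<Prod>j\<in>{1..k}. mertens_prod w (z j)) \<le> sifted_density k w x z h"
proof -
  define M where "M p = card {j\<in>{1..k}. real p \<le> z j}" for p :: nat
  have Mk: "M p \<le> k" for p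
  proof -
    have "M p \<le> card {1..k}" unfolding M_def by (intro card_mono) auto
    then show ?thesis by simp
  qed
  have p_ge: "real k \<le> real p" "1 \<le> real p" "2 \<le> real p" if "p \<in> primes_between w x" for p
    using that assms ge_2_primes_between[OF that] by (auto simp: primes_between_def)
  \<comment> \<open>By Bernoulli, \<open>1 - m^2 / p^2 = (1 - m / p) * (1 + m / p)\<close> is at
    most \<open>(1 - m / p) * (1 + 1 / p) ^ m\<close>. Multiplication by
    \<open>(1 - 1 / p) ^ m\<close> leaves the factor \<open>(1 - 1 / p^2) ^ m\<close>, which is at
    most 1.\<close>
  have factor: "(1 - 1 / real p) ^ M p * (1 - real k ^ 2 / real p ^ 2) \<le> 1 - real (residue_count k z h p) / p"
    if p: "p \<in> primes_between w x" for p
  proof -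
    let ?m = "real (M p)"
    have p0: "real p \<ge> 2" "real p \<ge> k" using p_ge[OF p] by auto
    have m: "?m \<le> k" using Mk by simp
    have "1 - real k ^ 2 / real p ^ 2 \<le> 1 - ?m ^ 2 / real p ^ 2"
      using m p0 by (intro diff_left_mono divide_right_mono power_mono) auto
    also have "\<dots> = (1 - ?m / p) * (1 + ?m / p)"
      by (simp add: power2_eq_square algebra_simps power_divide)
    also have "\<dots> \<le> (1 - ?m / p) * (1 + 1 / p) ^ M p"
    proof (rule mult_left_mono)
      have "- 1 \<le> 1 / real p" using zero_le_divide_1_iff[of "real p"] by linarith
      from Bernoulli_inequality[OF this, of "M p"] show "1 + ?m / p \<le> (1 + 1 / real p) ^ M p" by simp
    qed (use m p0 in auto)
    finally have "(1 - 1 / real p) ^ M p * (1 - real k ^ 2 / real p ^ 2) \<le> (1 - 1 / real p) ^ M p * ((1 - ?m / p) * (1 + 1 / p) ^ M p)"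
      using p0 by (intro mult_left_mono) auto
    also have "\<dots> = ((1 - 1 / p) * (1 + 1 / p)) ^ M p * (1 - ?m / p)"
      by (simp add: power_mult_distrib)
    also have "\<dots> \<le> 1 * (1 - ?m / p)"
    proof (intro mult_right_mono power_le_one)
      have "(1 - 1 / real p) * (1 + 1 / p) = 1 - (1 / p) ^ 2" by (simp add: power2_eq_square algebra_simps)
      moreover have "(1 / real p) ^ 2 \<le> 1" using p0 by (intro power_le_one) auto
      ultimately show "0 \<le> (1 - 1 / real p) * (1 + 1 / p)" "(1 - 1 / real p) * (1 + 1 / p) \<le> 1" by auto
    qed (use m p0 in auto)
    also have "\<dots> \<le> 1 - real (residue_count k z h p) / p"
      using residue_count_le(1)[of k z h p] p0 by (simp add: M_def divide_right_mono)
    finally show ?thesis .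
  qed
  have kp: "0 \<le> real k ^ 2 / real p ^ 2 \<and> real k ^ 2 / real p ^ 2 \<le> 1" if "p \<in> primes_between w x" for p
    using p_ge[OF that] by (auto simp: divide_le_eq_1 power_mono)
  have "(\<Sum>p\<in>primes_between w x. real k ^ 2 / real p ^ 2) = real k ^ 2 * (\<Sum>p\<in>primes_between w x. 1 / real p ^ 2)"
    by (simp add: sum_distrib_left)
  also have "\<dots> \<le> real k ^ 2 * (1 / w)"
    by (intro mult_left_mono sum_inverse_squares_primes assms) auto
  finally have "1 - real k ^ 2 / w \<le> 1 - (\<Sum>p\<in>primes_between w x. real k ^ 2 / real p ^ 2)" by simp
  also have "\<dots> \<le> (\<Prod>p\<in>primes_between w x. 1 - real k ^ 2 / real p ^ 2)"
    using kp by (intro prod_one_minus_ge) auto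
  finally have "(1 - real k ^ 2 / w) * (\<Prod>j\<in>{1..k}. mertens_prod w (z j)) \<le>
      (\<Prod>p\<in>primes_between w x. 1 - real k ^ 2 / real p ^ 2) * (\<Prod>j\<in>{1..k}. mertens_prod w (z j))"
    using mertens_prod_pos by (intro mult_right_mono prod_nonneg) (auto intro: less_imp_le)
  also have "\<dots> = (\<Prod>p\<in>primes_between w x. (1 - 1 / real p) ^ M p * (1 - real k ^ 2 / real p ^ 2))"
    using prod_mertens_prod[of k z x w] assms(3) by (simp add: prod.distrib M_def mult.commute)
  also have "\<dots> \<le> sifted_density k w x z h"
    unfolding sifted_density_def
  proof (intro prod_mono conjI)
    fix p assume p: "p \<in> primes_between w x"
    show "0 \<le> (1 - 1 / real p) ^ M p * (1 - real k ^ 2 / real p ^ 2)"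
      using kp[OF p] p_ge[OF p] by (intro mult_nonneg_nonneg zero_le_power) auto
  qed (rule factor)
  finally show ?thesis .
qed

definition index_pairs :: "nat \<Rightarrow> (nat \<times> nat) set" where
  "index_pairs k = {(i, j). i \<in> {1..k} \<and> j \<in> {1..k} \<and> i < j}"

lemma finite_index_pairs [simp, intro]: "finite (index_pairs k)"
  by (rule finite_subset[of _ "{1..k} \<times> {1..k}"]) (auto simp: index_pairs_def)

lemma card_index_pairs: "card (index_pairs k) \<le> k ^ 2"
proof -
  have "card (index_pairs k) \<le> card ({1..k} \<times> {1..k})"
    by (rule card_mono) (auto simp: index_pairs_def)
  then show ?thesis by (simp add: power2_eq_square)
qed

lemma one_plus_power_le:
  fixes x :: real
  assumes "0 \<le> x" "x \<le> 1"
  shows "(1 + x) ^ n \<le> 1 + (2 ^ n - 1) * x"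
proof (induction n)
  case (Suc n)
  have "(2 ^ n - 1) * x * x \<le> (2 ^ n - 1) * x * 1"
    using assms by (intro mult_left_mono) auto
  moreover have "(1 + x) ^ Suc n \<le> (1 + x) * (1 + (2 ^ n - 1) * x)"
    using Suc assms by (simp add: mult_left_mono)
  ultimately show ?case by (simp add: algebra_simps)
qed (use assms in auto)

text \<open>AM--GM turns the product over all pairs of shifts into a sum over pairs.\<close>

lemma sifted_density_le:
  assumes "\<And>j. j \<in> {1..k} \<Longrightarrow> z j \<le> x"
  shows "sifted_density k w x z h \<le> (\<Prod>j\<in>{1..k}. mertens_prod w (z j)) *
    (1 + (\<Sum>(i, j)\<in>index_pairs k. (\<Prod>p\<in>{p\<in>primes_between w x. int p dvd h j - h i}. 1 + 2 ^ (k * k ^ 2 + 1) / real p) - 1))"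
proof -
  define P where "P = primes_between w x"
  define m where "m p = card {j\<in>{1..k}. real p \<le> z j}" for p :: nat
  define a where "a p = (1 + 2 / real p) ^ k" for p :: nat
  define d where "d i j = {p\<in>P. int p dvd h j - h i}" for i j
  \<comment> \<open>Only at these primes can two of the shifts share a residue class.\<close>
  define Bad where "Bad = (\<Union>(i, j)\<in>index_pairs k. d i j)"
  define y where "y i j = (\<Prod>p\<in>d i j. a p)" for i j
  define Q where "Q = index_pairs k"
  define n where "n = card Q"
  \<comment> \<open>Raising to the power \<open>n \<le> k ^ 2\<close> turns the factor of a bad
    prime into \<open>(1 + 2 / p) ^ (k * n)\<close>, which convexity bounds by
    \<open>1 + b / p\<close>.\<close>
  define b where "b = (2::real) ^ (k * k ^ 2 + 1)"
  have p2: "real p \<ge> 2" if "p \<in> P" for p using that ge_2_primes_between by (auto simp: P_def)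
  have a1: "a p \<ge> 1" if "p \<in> P" for p unfolding a_def using p2[OF that] by (intro one_le_power) auto
  have finP: "finite P" "finite (d i j)" for i j by (auto simp: P_def d_def)
  have mk: "m p \<le> k" for p
  proof -
    have "m p \<le> card {1..k}" unfolding m_def by (intro card_mono) auto
    then show ?thesis by simp
  qed
  \<comment> \<open>At a bad prime the factor is bounded by 1, at the cost of
    \<open>(1 + 2 / p) ^ k\<close>, because \<open>(1 - 1 / p) * (1 + 2 / p)\<close> is at least 1
    for \<open>p \<ge> 2\<close>. At the other primes the shifts are distinct and Bernoulli's
    inequality suffices.\<close>
  have fac: "1 - real (residue_count k z h p) / p \<le> (1 - 1 / real p) ^ m p * (if p \<in> Bad then a p else 1)" if p: "p \<in> P" for p
  proof (cases "p \<in> Bad")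
    case True
    have "1 \<le> ((1 - 1 / real p) * (1 + 2 / p)) ^ m p"
    proof (rule one_le_power)
      have "(1 - 1 / real p) * (1 + 2 / p) = 1 + (real p - 2) / p ^ 2"
        using p2[OF p] by (simp add: field_simps power2_eq_square)
      then show "1 \<le> (1 - 1 / real p) * (1 + 2 / p)" using p2[OF p] by simp
    qed
    also have "\<dots> = (1 - 1 / real p) ^ m p * (1 + 2 / p) ^ m p" by (rule power_mult_distrib)
    also have "\<dots> \<le> (1 - 1 / real p) ^ m p * (1 + 2 / p) ^ k"
      using mk p2[OF p] by (intro mult_left_mono power_increasing) auto
    finally have "1 \<le> (1 - 1 / real p) ^ m p * a p" by (simp add: a_def)
    moreover have "1 - real (residue_count k z h p) / p \<le> 1" by simp
    ultimately show ?thesis unfolding if_P[OF True] by linarith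
  next
    case False
    have "inj_on (\<lambda>j. h j mod int p) {j\<in>{1..k}. real p \<le> z j}"
    proof (rule inj_onI)
      fix i j assume ij: "i \<in> {j\<in>{1..k}. real p \<le> z j}" "j \<in> {j\<in>{1..k}. real p \<le> z j}" "h i mod int p = h j mod int p"
      have dv: "int p dvd h j - h i" "int p dvd h i - h j" using ij(3) by (simp_all add: mod_eq_dvd_iff[symmetric])
      have "\<not> i < j" "\<not> j < i"
        using False ij dv p by (auto simp: Bad_def index_pairs_def d_def)
      then show "i = j" by simp
    qed
    then have "residue_count k z h p = m p" by (simp add: residue_count_def m_def card_image)
    moreover have "1 + real (m p) * (- 1 / real p) \<le> (1 + (- 1 / real p)) ^ m p"
      using p2[OF p] by (intro Bernoulli_inequality) auto
    ultimately show ?thesis using False by simp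
  qed
  have y1: "y i j \<ge> 1" for i j
    unfolding y_def using a1 by (intro prod_ge_1) (auto simp: d_def)
  have "sifted_density k w x z h \<le> (\<Prod>p\<in>P. (1 - 1 / real p) ^ m p * (if p \<in> Bad then a p else 1))"
    unfolding sifted_density_def P_def[symmetric]
  proof (intro prod_mono conjI fac)
    fix p assume p: "p \<in> P"
    have "card ((\<lambda>j. h j mod int p) ` {j\<in>{1..k}. real p \<le> z j}) \<le> card {0..<int p}"
      using p2[OF p] by (intro card_mono) auto
    then have "real (residue_count k z h p) \<le> real p" by (simp add: residue_count_def)
    then show "0 \<le> 1 - real (residue_count k z h p) / p" using p2[OF p] by simp
  qed
  also have "\<dots> = (\<Prod>j\<in>{1..k}. mertens_prod w (z j)) * (\<Prod>p\<in>P. if p \<in> Bad then a p else 1)"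
    using prod_mertens_prod[of k z x w] assms by (simp add: prod.distrib m_def P_def)
  also have "(\<Prod>p\<in>P. if p \<in> Bad then a p else 1) = (\<Prod>p\<in>Bad. a p)"
  proof -
    have "Bad = {p\<in>P. p \<in> Bad}" by (auto simp: Bad_def d_def)
    then show ?thesis using prod.inter_filter[OF finP(1), of a "\<lambda>p. p \<in> Bad"] by simp
  qed
  finally have up: "sifted_density k w x z h \<le> (\<Prod>j\<in>{1..k}. mertens_prod w (z j)) * (\<Prod>p\<in>Bad. a p)" .
  have BadQ: "(\<Prod>p\<in>Bad. a p) \<le> (\<Prod>(i, j)\<in>Q. y i j)"
  proof -
    have "(\<Prod>p\<in>(\<Union>(i, j)\<in>R. d i j). a p) \<le> (\<Prod>(i, j)\<in>R. y i j)" if "finite R" for R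
      using that
    proof (induction R rule: finite_induct)
      case (insert q R)
      obtain i j where q: "q = (i, j)" by (cases q)
      have fin: "finite (\<Union>(i, j)\<in>R. d i j)" using insert.hyps finP by (auto simp: case_prod_unfold)
      let ?E = "\<Union>(i, j)\<in>R. d i j"
      have "(\<Prod>p\<in>(\<Union>(i, j)\<in>insert q R. d i j). a p) = (\<Prod>p\<in>(d i j - ?E) \<union> ?E. a p)"
        by (intro prod.cong) (auto simp: q)
      also have "\<dots> = (\<Prod>p\<in>d i j - ?E. a p) * (\<Prod>p\<in>?E. a p)"
        using fin finP by (intro prod.union_disjoint) auto
      also have "\<dots> \<le> y i j * (\<Prod>(i, j)\<in>R. y i j)"
      proof (intro mult_mono insert.IH)
        show "(\<Prod>p\<in>d i j - ?E. a p) \<le> y i j"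
          unfolding y_def using finP a1 by (intro prod_mono2) (auto simp: d_def intro: order_trans[OF zero_le_one])
        show "0 \<le> y i j" using y1[of i j] by linarith
        show "0 \<le> (\<Prod>p\<in>?E. a p)"
          by (intro prod_nonneg) (auto simp: a_def)
      qed
      also have "\<dots> = (\<Prod>(i, j)\<in>insert q R. y i j)" using insert.hyps by (simp add: q)
      finally show ?case .
    qed auto
    from this[of Q] show ?thesis by (simp add: Bad_def Q_def)
  qed
  have amgm: "(\<Prod>(i, j)\<in>Q. y i j) \<le> 1 + (\<Sum>(i, j)\<in>Q. y i j ^ n - 1)"
  proof (cases "Q = {}")
    case False
    have n0: "n > 0" using False by (simp add: n_def Q_def card_gt_0_iff)
    let ?y = "\<lambda>q. case q of (i, j) \<Rightarrow> y i j"
    have y1': "?y q \<ge> 1" for q using y1 by (cases q) auto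
    then have y0': "?y q > 0" for q using less_le_trans[OF zero_less_one] by blast
    have "prod ?y Q = (\<Prod>q\<in>Q. ?y q ^ n) powr (1 / n)"
    proof -
      have "(\<Prod>q\<in>Q. ?y q ^ n) = (prod ?y Q) ^ n" by (simp add: prod_power_distrib)
      moreover have "prod ?y Q > 0" using y0' by (intro prod_pos) auto
      ultimately show ?thesis using n0 by (simp add: powr_powr flip: powr_realpow)
    qed
    also have "\<dots> \<le> (\<Sum>q\<in>Q. ?y q ^ n / n)"
      unfolding n_def using False y0' by (intro arith_geom_mean) (auto simp: Q_def less_imp_le)
    also have "\<dots> = (\<Sum>q\<in>Q. 1 / n + (?y q ^ n - 1) / n)"
      by (intro sum.cong) (auto simp: diff_divide_distrib)
    also have "\<dots> = 1 + (\<Sum>q\<in>Q. (?y q ^ n - 1) / n)"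
      using n0 by (simp add: sum.distrib n_def)
    also have "\<dots> \<le> 1 + (\<Sum>q\<in>Q. ?y q ^ n - 1)"
    proof (intro add_left_mono sum_mono)
      fix q
      have "?y q ^ n - 1 \<ge> 0" using one_le_power[OF y1'[of q]] by simp
      from divide_left_mono[OF _ this, of 1 "real n"] n0 show "(?y q ^ n - 1) / n \<le> ?y q ^ n - 1" by simp
    qed
    finally show ?thesis by (simp add: case_prod_unfold)
  qed auto
  have yb: "y i j ^ n \<le> (\<Prod>p\<in>d i j. 1 + b / real p)" for i j
  proof -
    have "y i j ^ n = (\<Prod>p\<in>d i j. a p ^ n)" by (simp add: y_def prod_power_distrib)
    also have "\<dots> \<le> (\<Prod>p\<in>d i j. 1 + b / real p)"
    proof (intro prod_mono conjI)
      fix p assume p: "p \<in> d i j"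
      then have pP: "p \<in> P" by (simp add: d_def)
      show "0 \<le> a p ^ n" by (simp add: a_def)
      have "a p ^ n = (1 + 2 / real p) ^ (k * n)" by (simp add: a_def power_mult)
      also have "\<dots> \<le> (1 + 2 / real p) ^ (k * k ^ 2)"
        using card_index_pairs[of k] p2[OF pP] by (intro power_increasing) (auto simp: n_def Q_def)
      also have "\<dots> \<le> 1 + (2 ^ (k * k ^ 2) - 1) * (2 / real p)"
        using p2[OF pP] by (intro one_plus_power_le) auto
      also have "\<dots> \<le> 1 + 2 ^ (k * k ^ 2) * (2 / real p)"
        by (intro add_left_mono mult_right_mono) auto
      also have "\<dots> = 1 + b / real p" by (simp add: b_def)
      finally show "a p ^ n \<le> 1 + b / real p" .
    qed
    finally show ?thesis .
  qed
  have "(\<Sum>(i, j)\<in>Q. y i j ^ n - 1) \<le> (\<Sum>(i, j)\<in>Q. (\<Prod>p\<in>d i j. 1 + b / real p) - 1)"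
    using yb by (intro sum_mono) (auto simp: case_prod_unfold)
  then have "(\<Prod>p\<in>Bad. a p) \<le> 1 + (\<Sum>(i, j)\<in>Q. (\<Prod>p\<in>d i j. 1 + b / real p) - 1)"
    using BadQ amgm by linarith
  then have "(\<Prod>j\<in>{1..k}. mertens_prod w (z j)) * (\<Prod>p\<in>Bad. a p) \<le> (\<Prod>j\<in>{1..k}. mertens_prod w (z j)) *
      (1 + (\<Sum>(i, j)\<in>Q. (\<Prod>p\<in>d i j. 1 + b / real p) - 1))"
    using mertens_prod_pos by (intro mult_left_mono prod_nonneg) (auto intro: less_imp_le)
  with up show ?thesis unfolding Q_def d_def b_def P_def by linarith
qed

section \<open>Averages over shift tuples\<close>

lemma prod_one_plus_filter_minus_one:
  fixes b :: real
  assumes "finite P"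
  shows "(\<Prod>p\<in>{p\<in>P. q p}. 1 + b / real p) - 1 =
    (\<Sum>D\<in>Pow P - {{}}. (\<Prod>p\<in>D. b / real p) * of_bool (\<forall>p\<in>D. q p))"
proof -
  have "(\<Prod>p\<in>{p\<in>P. q p}. 1 + b / real p) = (\<Prod>p\<in>{p\<in>P. q p}. b / real p + 1)" by (simp add: add.commute)
  also have "\<dots> = (\<Sum>D\<in>Pow {p\<in>P. q p}. \<Prod>p\<in>D. b / real p)"
    using assms by (subst prod_add) auto
  also have "\<dots> = (\<Sum>D\<in>Pow P. (\<Prod>p\<in>D. b / real p) * of_bool (\<forall>p\<in>D. q p))"
    using assms by (intro sum.mono_neutral_cong_left) auto
  also have "\<dots> = 1 + (\<Sum>D\<in>Pow P - {{}}. (\<Prod>p\<in>D. b / real p) * of_bool (\<forall>p\<in>D. q p))"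
    using assms by (subst sum.remove[of _ "{}"]) auto
  finally show ?thesis by simp
qed

text \<open>Expand over sets \<open>D\<close> of primes: divisibility of \<open>h - e\<close> by all
  of \<open>D\<close> together with the class modulo \<open>W\<close> is one residue class, so
  \<open>lc\<close> applies. The density of that class supplies a second factor \<open>1 / p\<close>
  in the main term, where the product becomes convergent. The error \<open>E\<close> is the same for
  every modulus and gains nothing, so it meets the full product of \<open>1 + b / p\<close>.
  Subtracting 1 removes the empty set, whose contribution would be the whole main term.\<close>

lemma sum_prod_divisors_progression:
  fixes C b :: real and W :: nat and P :: "nat set"
  assumes lc: "\<And>(d::nat) (c::int). d > 0 \<Longrightarrow>
       real (card {h\<in>{u<..v}. [h = c] (mod int d) \<and> q h}) \<le> M / d + E"
    and M: "M \<ge> 0" "E \<ge> 0" and b: "b \<ge> 0" and W: "W > 0"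
    and P: "finite P" "\<And>p. p \<in> P \<Longrightarrow> prime p" "\<And>p. p \<in> P \<Longrightarrow> coprime p W"
  shows "(\<Sum>h\<in>{h\<in>{u<..v}. [h = c] (mod int W) \<and> q h}. (\<Prod>p\<in>{p\<in>P. int p dvd h - e}. 1 + b / real p) - 1)
     \<le> M / W * ((\<Prod>p\<in>P. 1 + b / real p ^ 2) - 1) + E * (\<Prod>p\<in>P. 1 + b / real p)"
proof -
  let ?H = "{h\<in>{u<..v}. [h = c] (mod int W) \<and> q h}"
  have finH: "finite ?H" by (rule finite_subset[of _ "{u<..v}"]) auto
  have cnt: "real (card {h\<in>?H. \<forall>p\<in>D. int p dvd h - e}) \<le> M / (real W * real (\<Prod>D)) + E" if D: "D \<subseteq> P" for D
  proof -
    have finD: "finite D" using D P(1) by (rule finite_subset)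
    have cop: "coprime (int W) (int (\<Prod>D))"
    proof -
      have "coprime W (\<Prod>D)" using D P by (intro prod_coprime_right) (auto simp: coprime_commute subset_iff)
      then show ?thesis by (simp only: coprime_int_iff)
    qed
    obtain c' where c': "[c' = c] (mod int W)" "[c' = e] (mod int (\<Prod>D))"
      using binary_chinese_remainder_int[OF cop, of c e] by blast
    have "\<Prod>D > 0" using D P(2) prime_gt_0_nat by (intro prod_pos) blast
    then have pos: "W * \<Prod>D > 0" using W by simp
    have "{h\<in>?H. \<forall>p\<in>D. int p dvd h - e} \<subseteq> {h\<in>{u<..v}. [h = c'] (mod int (W * \<Prod>D)) \<and> q h}"
    proof
      fix h assume h: "h \<in> {h\<in>?H. \<forall>p\<in>D. int p dvd h - e}"
      have "\<Prod>(int ` D) dvd h - e"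
        using h D P finD by (intro prod_primes_dvd) auto
      then have "int (\<Prod>D) dvd h - e" by (simp add: prod.reindex)
      then have "[h = e] (mod int (\<Prod>D))" by (simp add: cong_iff_dvd_diff)
      then have "[h = c'] (mod int (\<Prod>D))" by (rule cong_trans[OF _ cong_sym[OF c'(2)]])
      moreover have "[h = c] (mod int W)" using h by blast
      then have "[h = c'] (mod int W)" by (rule cong_trans[OF _ cong_sym[OF c'(1)]])
      ultimately have "[h = c'] (mod int W * int (\<Prod>D))" using cop by (intro coprime_cong_mult)
      then show "h \<in> {h\<in>{u<..v}. [h = c'] (mod int (W * \<Prod>D)) \<and> q h}" using h by simp
    qed
    then have "card {h\<in>?H. \<forall>p\<in>D. int p dvd h - e} \<le> card {h\<in>{u<..v}. [h = c'] (mod int (W * \<Prod>D)) \<and> q h}"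
      by (intro card_mono finite_subset[of "{h\<in>{u<..v}. [h = c'] (mod int (W * \<Prod>D)) \<and> q h}" "{u<..v}"]) auto
    also have "real \<dots> \<le> M / real (W * \<Prod>D) + E" by (rule lc[OF pos])
    finally show ?thesis by simp
  qed
  have "(\<Sum>h\<in>?H. (\<Prod>p\<in>{p\<in>P. int p dvd h - e}. 1 + b / real p) - 1) =
     (\<Sum>h\<in>?H. \<Sum>D\<in>Pow P - {{}}. (\<Prod>p\<in>D. b / real p) * of_bool (\<forall>p\<in>D. int p dvd h - e))"
    by (intro sum.cong refl prod_one_plus_filter_minus_one P)
  also have "\<dots> = (\<Sum>D\<in>Pow P - {{}}. (\<Prod>p\<in>D. b / real p) * real (card {h\<in>?H. \<forall>p\<in>D. int p dvd h - e}))"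
  proof (subst sum.swap, intro sum.cong refl)
    fix D
    have "(\<Sum>h\<in>?H. of_bool (\<forall>p\<in>D. int p dvd h - e) :: real) = real (card {h\<in>?H. \<forall>p\<in>D. int p dvd h - e})"
      using finH by (simp add: of_bool_def sum.inter_filter[symmetric])
    then show "(\<Sum>h\<in>?H. (\<Prod>p\<in>D. b / real p) * of_bool (\<forall>p\<in>D. int p dvd h - e)) =
       (\<Prod>p\<in>D. b / real p) * real (card {h\<in>?H. \<forall>p\<in>D. int p dvd h - e})"
      by (simp only: sum_distrib_left[symmetric])
  qed
  also have "\<dots> \<le> (\<Sum>D\<in>Pow P - {{}}. (\<Prod>p\<in>D. b / real p) * (M / (real W * real (\<Prod>D)) + E))"
    using cnt b by (intro sum_mono mult_left_mono prod_nonneg) auto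
  also have "\<dots> = M / W * (\<Sum>D\<in>Pow P - {{}}. \<Prod>p\<in>D. b / real p ^ 2) + E * (\<Sum>D\<in>Pow P - {{}}. \<Prod>p\<in>D. b / real p)"
    unfolding sum_distrib_left sum.distrib[symmetric]
    by (intro sum.cong refl) (simp add: algebra_simps prod_dividef prod.distrib power2_eq_square)
  also have "\<dots> \<le> M / W * ((\<Prod>p\<in>P. 1 + b / real p ^ 2) - 1) + E * (\<Prod>p\<in>P. 1 + b / real p)"
  proof (intro add_mono mult_left_mono)
    have exp: "(\<Prod>p\<in>P. 1 + f p) = 1 + (\<Sum>D\<in>Pow P - {{}}. \<Prod>p\<in>D. f p)" for f :: "nat \<Rightarrow> real"
    proof -
      have "(\<Prod>p\<in>P. f p + 1) = (\<Sum>D\<in>Pow P. \<Prod>p\<in>D. f p)" using P(1) by (subst prod_add) auto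
      also have "\<dots> = 1 + (\<Sum>D\<in>Pow P - {{}}. \<Prod>p\<in>D. f p)" using P(1) by (subst sum.remove[of _ "{}"]) auto
      finally show ?thesis by (simp add: add.commute)
    qed
    show "(\<Sum>D\<in>Pow P - {{}}. \<Prod>p\<in>D. b / real p ^ 2) \<le> (\<Prod>p\<in>P. 1 + b / real p ^ 2) - 1"
      by (simp add: exp)
    show "(\<Sum>D\<in>Pow P - {{}}. \<Prod>p\<in>D. b / real p) \<le> (\<Prod>p\<in>P. 1 + b / real p)"
      by (simp add: exp)
  qed (use M in auto)
  finally show ?thesis .
qed

text \<open>All coordinates except \<open>j\<close> are held fixed; \<open>h i\<close> then plays
  the role of the constant \<open>e\<close> in \<open>B\<close>.\<close>

lemma sum_PiE_pair_le:
  fixes H :: "nat \<Rightarrow> int set" and f :: "int \<Rightarrow> real"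
  assumes K: "finite K" "i \<in> K" "j \<in> K" "i \<noteq> j" and fin: "\<And>l. l \<in> K \<Longrightarrow> finite (H l)"
    and B: "\<And>e. (\<Sum>x\<in>H j. f (x - e)) \<le> B"
  shows "(\<Sum>h\<in>PiE K H. f (h j - h i)) \<le> B * (\<Prod>l\<in>K - {j}. real (card (H l)))"
proof -
  define K' where "K' = K - {j}"
  have K': "K = insert j K'" "j \<notin> K'" "finite K'" "i \<in> K'" using K by (auto simp: K'_def)
  have inj: "inj_on (\<lambda>(y, g). g(j := y)) (H j \<times> PiE K' H)"
    using K' by (intro inj_combinator) auto
  have "(\<Sum>h\<in>PiE K H. f (h j - h i)) = (\<Sum>(y, g)\<in>H j \<times> PiE K' H. f ((g(j := y)) j - (g(j := y)) i))"
    unfolding K'(1) PiE_insert_eq by (subst sum.reindex[OF inj]) (simp add: case_prod_unfold)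
  also have "\<dots> = (\<Sum>(y, g)\<in>H j \<times> PiE K' H. f (y - g i))"
    using K by (intro sum.cong) auto
  also have "\<dots> = (\<Sum>g\<in>PiE K' H. \<Sum>y\<in>H j. f (y - g i))"
    by (simp add: sum.cartesian_product[symmetric] sum.swap[of _ "H j"])
  also have "\<dots> \<le> (\<Sum>g\<in>PiE K' H. B)"
    by (intro sum_mono B)
  also have "\<dots> = B * (\<Prod>l\<in>K - {j}. real (card (H l)))"
    using K' by (simp add: card_PiE K'_def[symmetric])
  finally show ?thesis .
qed

text \<open>Division by \<open>M\<close> brings all factors into the unit interval, where the
  difference of two products is at most the sum of the differences of the factors.\<close>

lemma prod_diff_bound:
  fixes x y :: "'a \<Rightarrow> real"
  assumes "finite I" "\<And>i. i \<in> I \<Longrightarrow> 0 \<le> x i \<and> x i \<le> M" "\<And>i. i \<in> I \<Longrightarrow> 0 \<le> y i \<and> y i \<le> M"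
    and "\<And>i. i \<in> I \<Longrightarrow> \<bar>x i - y i\<bar> \<le> \<tau>" "M \<ge> 1" "\<tau> \<ge> 0" "card I \<le> n"
  shows "\<bar>prod x I - prod y I\<bar> \<le> real n * M ^ n * \<tau>"
proof -
  let ?m = "card I"
  have "\<bar>(\<Prod>i\<in>I. x i / M) - (\<Prod>i\<in>I. y i / M)\<bar> \<le> (\<Sum>i\<in>I. \<bar>x i / M - y i / M\<bar>)"
    using norm_prod_diff[of I "\<lambda>i. x i / M" "\<lambda>i. y i / M"] assms by simp
  also have "\<dots> \<le> (\<Sum>i\<in>I. \<tau>)"
  proof (rule sum_mono)
    fix i assume i: "i \<in> I"
    have "\<bar>x i / M - y i / M\<bar> = \<bar>x i - y i\<bar> / M"
      using assms(5) by (simp add: diff_divide_distrib[symmetric])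
    also have "\<dots> \<le> \<bar>x i - y i\<bar> / 1" using assms(5) by (intro divide_left_mono) auto
    finally show "\<bar>x i / M - y i / M\<bar> \<le> \<tau>" using assms(4)[OF i] by simp
  qed
  finally have le: "\<bar>prod x I / M ^ ?m - prod y I / M ^ ?m\<bar> \<le> ?m * \<tau>"
    by (simp add: prod_dividef)
  have "\<bar>prod x I - prod y I\<bar> = M ^ ?m * \<bar>prod x I / M ^ ?m - prod y I / M ^ ?m\<bar>"
    using assms(5) by (simp add: diff_divide_distrib[symmetric])
  also have "\<dots> \<le> M ^ ?m * (?m * \<tau>)" using le assms(5) by (intro mult_left_mono) auto
  also have "\<dots> \<le> M ^ n * (n * \<tau>)"
    using assms by (intro mult_mono power_increasing) auto
  finally show ?thesis by (simp add: mult_ac)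
qed

text \<open>The averaging argument in abstract form. \<open>U j\<close> is a sifting density and
  \<open>H j\<close> a set of shifts, so \<open>x j\<close> is the expected weighted number of
  shifts, and \<open>\<tau>\<close> bounds both the weight of a single shift and the error in the
  weighted number. A collision determines one coordinate and so costs a factor
  \<open>\<tau>\<close>; the excess \<open>gg' - 1\<close> has a small average by \<open>S\<close>.
  The bounds \<open>\<tau>\<close> and \<open>\<tau>'\<close> are kept apart because only the second
  contains the loss from the product over primes.\<close>

lemma injective_tuples_bounds:
  fixes H :: "nat \<Rightarrow> int set" and U x :: "nat \<Rightarrow> real" and gg gg' :: "int \<Rightarrow> real" and k :: nat
  assumes k: "k \<ge> 1" and H1: "H 1 = {0}" and finH: "\<And>j. j \<in> {1..k} \<Longrightarrow> finite (H j)"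
    and U: "\<And>j. j \<in> {2..k} \<Longrightarrow> 0 \<le> U j \<and> U j \<le> \<tau>"
    and x: "\<And>j. j \<in> {2..k} \<Longrightarrow> 0 \<le> x j \<and> x j \<le> B"
    and close: "\<And>j. j \<in> {2..k} \<Longrightarrow> \<bar>U j * card (H j) - x j\<bar> \<le> \<tau>"
    and \<tau>: "0 \<le> \<tau>" "\<tau> \<le> 1" "\<tau> \<le> \<tau>'" and \<eta>: "0 \<le> \<eta>" "\<eta> \<le> 1" and B: "B \<ge> 1"
    and gg: "\<And>h i j. h \<in> PiE {1..k} H \<Longrightarrow> inj_on h {1..k} \<Longrightarrow> i \<in> {1..k} \<Longrightarrow> j \<in> {1..k} \<Longrightarrow> i < j \<Longrightarrow> gg (h j - h i) \<le> (1 + \<eta>) * gg' (h j - h i)"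
    and gg': "\<And>d. 1 \<le> gg' d"
    and S: "\<And>j e. j \<in> {2..k} \<Longrightarrow> U j * (\<Sum>y\<in>H j. gg' (y - e) - 1) \<le> \<eta> * x j + \<tau>'"
  defines "A \<equiv> 6 * (real k + 1) ^ 3 * (B + 1) ^ k"
  shows "(\<Prod>j\<in>{2..k}. x j) - A * \<tau> \<le> (\<Prod>j\<in>{2..k}. U j) * card {h\<in>PiE {1..k} H. inj_on h {1..k}}" (is ?lower)
    and "(\<Prod>j\<in>{2..k}. U j) * (\<Sum>h | h \<in> PiE {1..k} H \<and> inj_on h {1..k}. 1 + (\<Sum>(i, j)\<in>index_pairs k. gg (h j - h i) - 1))
       \<le> (1 + 3 * real k ^ 2 * \<eta>) * (\<Prod>j\<in>{2..k}. x j) + A * \<tau>'" (is ?upper)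
proof -
  define M where "M = B + 1"
  define K where "K = {1..k}"
  define N where "N = (\<Prod>j\<in>{2..k}. U j)"
  define X where "X = (\<Prod>j\<in>{2..k}. x j)"
  define x' where "x' j = U j * card (H j)" for j
  define n where "n = card (index_pairs k)"
  define D where "D = real k * M ^ k"
  have M: "M \<ge> 1" using B by (simp add: M_def)
  have Mk: "M ^ k \<ge> 1" using M by simp
  have D0: "D \<ge> 0" using M by (simp add: D_def)
  have N0: "N \<ge> 0" unfolding N_def using U by (intro prod_nonneg) auto
  have x'0: "0 \<le> x' j \<and> x' j \<le> M" if "j \<in> {2..k}" for j
  proof -
    have "0 \<le> x' j" unfolding x'_def using U[OF that] by simp
    moreover have "x' j \<le> x j + \<tau>" using close[OF that] by (simp add: x'_def abs_le_iff)
    ultimately show ?thesis using x[OF that] \<tau> by (simp add: M_def)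
  qed
  have xM: "0 \<le> x j \<and> x j \<le> M" if "j \<in> {2..k}" for j
    using x[OF that] by (simp add: M_def)
  have X0: "X \<ge> 0" unfolding X_def using x by (intro prod_nonneg) auto
  have n: "real n \<le> real k ^ 2"
    using card_index_pairs[of k] unfolding n_def by (metis of_nat_le_iff of_nat_power)
  have insK: "K = insert 1 {2..k}" using k by (auto simp: K_def)
  have cardH: "(\<Prod>l\<in>K. real (card (H l))) = (\<Prod>l\<in>{2..k}. real (card (H l)))"
    unfolding insK using H1 by simp
  have finPiE: "finite (PiE K H)" using finH by (intro finite_PiE) (auto simp: K_def)
  have all: "N * card (PiE K H) = (\<Prod>j\<in>{2..k}. x' j)"
    using cardH by (simp add: card_PiE K_def N_def x'_def prod.distrib)
  have all_diff: "\<bar>(\<Prod>j\<in>{2..k}. x' j) - X\<bar> \<le> D * \<tau>"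
    unfolding X_def D_def using x'0 xM close M \<tau> by (intro prod_diff_bound) (auto simp: x'_def)
  \<comment> \<open>Coordinate \<open>j\<close> is averaged against \<open>f\<close>, and the others
    keep their masses \<open>x' l\<close>. \<open>\<eta>'\<close> and \<open>t\<close> are left open
    because the estimate is used for collisions and for the excesses.\<close>
  have pair: "N * (\<Sum>h\<in>PiE K H. f (h j - h i)) \<le> (\<eta>' * x j + t) * (\<Prod>l\<in>{2..k} - {j}. x' l)"
    if ij: "(i, j) \<in> index_pairs k" and f: "\<And>e. U j * (\<Sum>y\<in>H j. f (y - e)) \<le> \<eta>' * x j + t" and f0: "\<And>d. 0 \<le> f d"
    for i j f \<eta>' t
  proof -
    have j: "j \<in> {2..k}" "i \<in> K" "j \<in> K" "i \<noteq> j" using ij by (auto simp: index_pairs_def K_def)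
    have rest: "(\<Prod>l\<in>K - {j}. real (card (H l))) = (\<Prod>l\<in>{2..k} - {j}. real (card (H l)))"
    proof -
      have "K - {j} = insert 1 ({2..k} - {j})" using j insK by auto
      then show ?thesis using H1 by simp
    qed
    have Nj: "N = U j * (\<Prod>l\<in>{2..k} - {j}. U l)"
      unfolding N_def using j by (subst prod.remove[of _ j]) auto
    have P0: "0 \<le> (\<Prod>l\<in>{2..k} - {j}. x' l)" using x'0 by (intro prod_nonneg) auto
    show ?thesis
    proof (cases "U j = 0")
      case True
      then have "N = 0" using Nj by simp
      moreover have "0 \<le> \<eta>' * x j + t" using f[of 0] True by simp
      ultimately show ?thesis using P0 by simp
    next
      case False
      then have Uj: "U j > 0" using U[OF j(1)] by simp
      have "(\<Sum>h\<in>PiE K H. f (h j - h i)) \<le> (\<eta>' * x j + t) / U j * (\<Prod>l\<in>K - {j}. real (card (H l)))"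
      proof (rule sum_PiE_pair_le)
        show "(\<Sum>y\<in>H j. f (y - e)) \<le> (\<eta>' * x j + t) / U j" for e
          using f[of e] Uj by (simp add: pos_le_divide_eq mult.commute)
      qed (use j finH in \<open>auto simp: K_def\<close>)
      then have "N * (\<Sum>h\<in>PiE K H. f (h j - h i)) \<le> N * ((\<eta>' * x j + t) / U j * (\<Prod>l\<in>K - {j}. real (card (H l))))"
        using N0 by (rule mult_left_mono)
      also have "\<dots> = (\<eta>' * x j + t) * (\<Prod>l\<in>{2..k} - {j}. x' l)"
        using Uj unfolding rest Nj x'_def prod.distrib by simp
      finally show ?thesis .
    qed
  qed
  have Pj: "0 \<le> (\<Prod>l\<in>{2..k} - {j}. x' l) \<and> (\<Prod>l\<in>{2..k} - {j}. x' l) \<le> M ^ k" for j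
  proof -
    have "(\<Prod>l\<in>{2..k} - {j}. x' l) \<le> (\<Prod>l\<in>{2..k} - {j}. M)"
      using x'0 by (intro prod_mono) auto
    also have "\<dots> = M ^ card ({2..k} - {j})" by simp
    also have "\<dots> \<le> M ^ k"
    proof (rule power_increasing)
      have "card ({2..k} - {j}) \<le> card {2..k}" by (intro card_mono) auto
      then show "card ({2..k} - {j}) \<le> k" by simp
    qed (use M in auto)
    finally show ?thesis using x'0 by (auto intro!: prod_nonneg)
  qed
  have xPj: "x j * (\<Prod>l\<in>{2..k} - {j}. x' l) \<le> X + D * \<tau>" if j: "j \<in> {2..k}" for j
  proof -
    have "x j * (\<Prod>l\<in>{2..k} - {j}. x' l) = (\<Prod>l\<in>{2..k}. if l = j then x l else x' l)"
      using j by (subst prod.remove[of _ j]) (auto intro!: prod.cong)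
    moreover have "\<bar>(\<Prod>l\<in>{2..k}. if l = j then x l else x' l) - X\<bar> \<le> D * \<tau>"
      unfolding X_def D_def using x'0 xM close M \<tau> by (intro prod_diff_bound) (auto simp: x'_def)
    ultimately show ?thesis by (simp add: abs_le_iff)
  qed
  have arith: "real k ^ 2 + real k \<le> 6 * (real k + 1) ^ 3" "real k + 3 * real k ^ 3 + 2 * real k ^ 2 \<le> 6 * (real k + 1) ^ 3"
    by (simp_all add: power3_eq_cube power2_eq_square algebra_simps)
  show ?lower
  proof -
    \<comment> \<open>Union bound over pairs: a tuple that is not injective has a vanishing
      difference.\<close>
    let ?f = "\<lambda>d::int. of_bool (d = 0) :: real"
    have "real (card (PiE K H)) - (\<Sum>(i, j)\<in>index_pairs k. \<Sum>h\<in>PiE K H. ?f (h j - h i)) \<le> real (card {h\<in>PiE K H. inj_on h K})"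
    proof -
      have "1 - (\<Sum>(i, j)\<in>index_pairs k. ?f (h j - h i)) \<le> of_bool (inj_on h K)" for h
      proof (cases "inj_on h K")
        case True
        have "0 \<le> (\<Sum>(i, j)\<in>index_pairs k. ?f (h j - h i))" by (intro sum_nonneg) auto
        then show ?thesis using True by simp
      next
        case False
        then obtain i j where ij: "i \<in> K" "j \<in> K" "i \<noteq> j" "h i = h j" by (auto simp: inj_on_def)
        define q where "q = (min i j, max i j)"
        have q: "q \<in> index_pairs k" "h (snd q) = h (fst q)"
          using ij by (auto simp: q_def index_pairs_def K_def min_def max_def)
        have "1 = (case q of (i, j) \<Rightarrow> ?f (h j - h i))" using q(2) by (simp add: case_prod_unfold)
        also have "\<dots> \<le> (\<Sum>(i, j)\<in>index_pairs k. ?f (h j - h i))"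
          using q(1) by (intro member_le_sum) auto
        finally show ?thesis using False by simp
      qed
      then have "(\<Sum>h\<in>PiE K H. 1 - (\<Sum>(i, j)\<in>index_pairs k. ?f (h j - h i))) \<le> (\<Sum>h\<in>PiE K H. of_bool (inj_on h K))"
        by (intro sum_mono)
      also have "\<dots> = real (card {h\<in>PiE K H. inj_on h K})"
        using finPiE by (simp add: of_bool_def sum.inter_filter[symmetric])
      finally have *: "(\<Sum>h\<in>PiE K H. 1 - (\<Sum>(i, j)\<in>index_pairs k. ?f (h j - h i))) \<le> real (card {h\<in>PiE K H. inj_on h K})" .
      have "(\<Sum>h\<in>PiE K H. \<Sum>(i, j)\<in>index_pairs k. ?f (h j - h i)) = (\<Sum>(i, j)\<in>index_pairs k. \<Sum>h\<in>PiE K H. ?f (h j - h i))"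
        unfolding case_prod_unfold by (rule sum.swap)
      then show ?thesis using * by (simp add: sum_subtractf)
    qed
    then have "N * (real (card (PiE K H)) - (\<Sum>(i, j)\<in>index_pairs k. \<Sum>h\<in>PiE K H. ?f (h j - h i))) \<le> N * real (card {h\<in>PiE K H. inj_on h K})"
      using N0 by (rule mult_left_mono)
    then have "(\<Prod>j\<in>{2..k}. x' j) - (\<Sum>(i, j)\<in>index_pairs k. N * (\<Sum>h\<in>PiE K H. ?f (h j - h i))) \<le> N * real (card {h\<in>PiE K H. inj_on h K})"
      by (simp add: right_diff_distrib all sum_distrib_left case_prod_unfold)
    moreover have "(\<Sum>(i, j)\<in>index_pairs k. N * (\<Sum>h\<in>PiE K H. ?f (h j - h i))) \<le> (\<Sum>(i, j)\<in>index_pairs k. M ^ k * \<tau>)"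
    proof (rule sum_mono, clarify)
      fix i j assume ij: "(i, j) \<in> index_pairs k"
      then have j: "j \<in> {2..k}" by (auto simp: index_pairs_def)
      have "N * (\<Sum>h\<in>PiE K H. ?f (h j - h i)) \<le> (0 * x j + \<tau>) * (\<Prod>l\<in>{2..k} - {j}. x' l)"
      proof (rule pair[OF ij])
        fix e
        have "(\<Sum>y\<in>H j. ?f (y - e)) \<le> 1"
          using finH[of j] j by (simp add: of_bool_def sum.If_cases card_le_Suc0_iff_eq Int_def)
        then have "U j * (\<Sum>y\<in>H j. ?f (y - e)) \<le> U j * 1" using U[OF j] by (intro mult_left_mono) auto
        then show "U j * (\<Sum>y\<in>H j. ?f (y - e)) \<le> 0 * x j + \<tau>" using U[OF j] by simp
      qed auto
      also have "\<dots> \<le> \<tau> * M ^ k" using Pj[of j] \<tau> by (simp add: mult_left_mono)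
      finally show "N * (\<Sum>h\<in>PiE K H. ?f (h j - h i)) \<le> M ^ k * \<tau>" by (simp add: mult.commute)
    qed
    moreover have "(\<Sum>(i, j)\<in>index_pairs k. M ^ k * \<tau>) = n * (M ^ k * \<tau>)" by (simp add: n_def case_prod_unfold)
    moreover have "n * (M ^ k * \<tau>) \<le> real k ^ 2 * (M ^ k * \<tau>)" using n M \<tau> by (intro mult_right_mono) auto
    moreover have "real k ^ 2 * (M ^ k * \<tau>) + real k * (M ^ k * \<tau>) \<le> 6 * (real k + 1) ^ 3 * (M ^ k * \<tau>)"
      unfolding distrib_right[symmetric] using arith(1) M \<tau> by (intro mult_right_mono) auto
    moreover have "A * \<tau> = 6 * (real k + 1) ^ 3 * (M ^ k * \<tau>)" "D * \<tau> = real k * (M ^ k * \<tau>)"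
      by (simp_all add: A_def M_def D_def)
    moreover have "X \<le> (\<Prod>j\<in>{2..k}. x' j) + D * \<tau>" using all_diff by (simp add: abs_le_iff)
    ultimately show ?thesis
      unfolding X_def[symmetric] N_def[symmetric] K_def[symmetric] by linarith
  qed
  show ?upper
  proof -
    let ?I = "{h\<in>PiE K H. inj_on h K}"
    let ?g = "\<lambda>d. gg' d - 1"
    \<comment> \<open>Injectivity must be used first, since \<open>gg\<close> is controlled only for
      injective tuples. After that all terms are nonnegative, and the sum may be extended to all
      tuples, which restores the product structure.\<close>
    have "(\<Sum>h\<in>?I. 1 + (\<Sum>(i, j)\<in>index_pairs k. gg (h j - h i) - 1)) \<le>
       (\<Sum>h\<in>?I. 1 + (\<Sum>(i, j)\<in>index_pairs k. \<eta> + (1 + \<eta>) * ?g (h j - h i)))"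
    proof (intro sum_mono add_left_mono, clarify)
      fix h i j assume h: "h \<in> PiE K H" "inj_on h K" and ij: "(i, j) \<in> index_pairs k"
      have "gg (h j - h i) \<le> (1 + \<eta>) * gg' (h j - h i)"
        using h ij by (intro gg) (auto simp: K_def index_pairs_def)
      then show "gg (h j - h i) - 1 \<le> \<eta> + (1 + \<eta>) * ?g (h j - h i)" by (simp add: algebra_simps)
    qed
    also have "\<dots> \<le> (\<Sum>h\<in>PiE K H. 1 + (\<Sum>(i, j)\<in>index_pairs k. \<eta> + (1 + \<eta>) * ?g (h j - h i)))"
      using finPiE \<eta> gg' by (intro sum_mono2 add_nonneg_nonneg sum_nonneg) auto
    also have "\<dots> = (1 + n * \<eta>) * card (PiE K H) + (1 + \<eta>) * (\<Sum>h\<in>PiE K H. \<Sum>(i, j)\<in>index_pairs k. ?g (h j - h i))"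
    proof -
      have "1 + (\<Sum>(i, j)\<in>index_pairs k. \<eta> + (1 + \<eta>) * ?g (h j - h i)) = (1 + n * \<eta>) + (1 + \<eta>) * (\<Sum>(i, j)\<in>index_pairs k. ?g (h j - h i))" for h
        unfolding case_prod_unfold sum.distrib sum_distrib_left[symmetric] by (simp add: n_def)
      then show ?thesis by (simp only: sum.distrib sum_distrib_left[symmetric] sum_constant mult.commute[of "real (card (PiE K H))"]) (simp add: algebra_simps)
    qed
    also have "(\<Sum>h\<in>PiE K H. \<Sum>(i, j)\<in>index_pairs k. ?g (h j - h i)) = (\<Sum>(i, j)\<in>index_pairs k. \<Sum>h\<in>PiE K H. ?g (h j - h i))"
      unfolding case_prod_unfold by (rule sum.swap)
    finally have "N * (\<Sum>h\<in>?I. 1 + (\<Sum>(i, j)\<in>index_pairs k. gg (h j - h i) - 1)) \<le>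
       N * ((1 + n * \<eta>) * card (PiE K H) + (1 + \<eta>) * (\<Sum>(i, j)\<in>index_pairs k. \<Sum>h\<in>PiE K H. ?g (h j - h i)))"
      using N0 by (rule mult_left_mono)
    also have "\<dots> = (1 + n * \<eta>) * (\<Prod>j\<in>{2..k}. x' j) + (1 + \<eta>) * (\<Sum>(i, j)\<in>index_pairs k. N * (\<Sum>h\<in>PiE K H. ?g (h j - h i)))"
      by (simp add: all[symmetric] sum_distrib_left case_prod_unfold algebra_simps)
    also have "\<dots> \<le> (1 + n * \<eta>) * (X + D * \<tau>) + 2 * (n * (\<eta> * (X + D * \<tau>) + \<tau>' * M ^ k))"
    proof (intro add_mono mult_mono)
      show "(\<Prod>j\<in>{2..k}. x' j) \<le> X + D * \<tau>" using all_diff by (simp add: abs_le_iff)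
      have "(\<Sum>(i, j)\<in>index_pairs k. N * (\<Sum>h\<in>PiE K H. ?g (h j - h i))) \<le> (\<Sum>(i, j)\<in>index_pairs k. \<eta> * (X + D * \<tau>) + \<tau>' * M ^ k)"
      proof (rule sum_mono, clarify)
        fix i j assume ij: "(i, j) \<in> index_pairs k"
        then have j: "j \<in> {2..k}" by (auto simp: index_pairs_def)
        have "N * (\<Sum>h\<in>PiE K H. ?g (h j - h i)) \<le> (\<eta> * x j + \<tau>') * (\<Prod>l\<in>{2..k} - {j}. x' l)"
          using S[OF j] gg' by (intro pair[OF ij]) auto
        also have "\<dots> = \<eta> * (x j * (\<Prod>l\<in>{2..k} - {j}. x' l)) + \<tau>' * (\<Prod>l\<in>{2..k} - {j}. x' l)"
          by (simp add: algebra_simps)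
        also have "\<dots> \<le> \<eta> * (X + D * \<tau>) + \<tau>' * M ^ k"
          using xPj[OF j] Pj[of j] \<eta> \<tau> by (intro add_mono mult_left_mono) auto
        finally show "N * (\<Sum>h\<in>PiE K H. ?g (h j - h i)) \<le> \<eta> * (X + D * \<tau>) + \<tau>' * M ^ k" .
      qed
      also have "\<dots> = n * (\<eta> * (X + D * \<tau>) + \<tau>' * M ^ k)" by (simp add: n_def case_prod_unfold)
      finally show "(\<Sum>(i, j)\<in>index_pairs k. N * (\<Sum>h\<in>PiE K H. ?g (h j - h i))) \<le> n * (\<eta> * (X + D * \<tau>) + \<tau>' * M ^ k)" .
      show "0 \<le> (\<Sum>(i, j)\<in>index_pairs k. N * (\<Sum>h\<in>PiE K H. ?g (h j - h i)))"
        using N0 gg' by (intro sum_nonneg) (auto intro!: mult_nonneg_nonneg sum_nonneg)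
      show "0 \<le> (\<Prod>j\<in>{2..k}. x' j)" using x'0 by (intro prod_nonneg) auto
    qed (use \<eta> in auto)
    also have "\<dots> = (1 + 3 * (n * \<eta>)) * X + (1 + 3 * (n * \<eta>)) * (D * \<tau>) + 2 * n * \<tau>' * M ^ k"
      by (simp add: algebra_simps)
    also have "\<dots> \<le> (1 + 3 * real k ^ 2 * \<eta>) * X + A * \<tau>'"
    proof -
      have n\<eta>: "real n * \<eta> \<le> real k ^ 2 * \<eta>" "real k ^ 2 * \<eta> \<le> real k ^ 2 * 1"
        using n \<eta> by (intro mult_right_mono mult_left_mono; simp)+
      have "(1 + 3 * (n * \<eta>)) * X \<le> (1 + 3 * real k ^ 2 * \<eta>) * X"
        using n\<eta> X0 by (intro mult_right_mono) auto
      moreover have "(1 + 3 * (n * \<eta>)) * (D * \<tau>) \<le> (1 + 3 * real k ^ 2) * (D * \<tau>')"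
        using n\<eta> D0 \<tau> \<eta> by (intro mult_mono) auto
      moreover have "2 * n * \<tau>' * M ^ k \<le> 2 * real k ^ 2 * \<tau>' * M ^ k"
        using n \<tau> M by (intro mult_right_mono) auto
      moreover have "(real k + 3 * real k ^ 3 + 2 * real k ^ 2) * (M ^ k * \<tau>') \<le> 6 * (real k + 1) ^ 3 * (M ^ k * \<tau>')"
        using arith(2) M \<tau> by (intro mult_right_mono) auto
      ultimately show ?thesis
        unfolding A_def M_def[symmetric] D_def by (simp add: algebra_simps power3_eq_cube power2_eq_square)
    qed
    finally show ?thesis unfolding X_def N_def K_def .
  qed
qed

section \<open>Tuples in prescribed intervals\<close>

definition tuple_set :: "nat \<Rightarrow> (nat \<Rightarrow> int) \<Rightarrow> (nat \<Rightarrow> int) \<Rightarrow> (nat \<Rightarrow> real) \<Rightarrow> (nat \<Rightarrow> real set) \<Rightarrow> real \<Rightarrow> (nat \<Rightarrow> int) set" where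
  "tuple_set k u v z J \<alpha> = {a \<in> PiE {1..k} (\<lambda>j. {u j<..v j}). inj_on a {1..k} \<and>
     (\<forall>j\<in>{2..k}. mod1_in (J j) (of_int (a 1 - a j) * \<alpha>)) \<and>
     (\<forall>j\<in>{1..k}. \<forall>p\<in>primes_between 0 (z j). \<not> int p dvd a j)}"

text \<open>The candidates for \<open>a 1 - a j\<close> once the residues \<open>c\<close> modulo
  \<open>W\<close> are prescribed. The value \<open>{0}\<close> at index 1 lets the shifts form a
  tuple indexed like \<open>a\<close>.\<close>

definition shift_set :: "int \<Rightarrow> int \<Rightarrow> (nat \<Rightarrow> int) \<Rightarrow> (nat \<Rightarrow> real set) \<Rightarrow> real \<Rightarrow> nat \<Rightarrow> int set" where
  "shift_set X W c J \<alpha> j = (if j = 1 then {0} else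
     {h\<in>{-X..X}. [h = c 1 - c j] (mod W) \<and> mod1_in (J j) (of_int h * \<alpha>)})"

text \<open>The values of \<open>a 1\<close> that are compatible with given shifts: an intersection
  of \<open>k\<close> translated intervals, hence an interval.\<close>

definition shift_interval :: "nat \<Rightarrow> (nat \<Rightarrow> int) \<Rightarrow> (nat \<Rightarrow> int) \<Rightarrow> (nat \<Rightarrow> int) \<Rightarrow> int set" where
  "shift_interval k u v h = {t. \<forall>j\<in>{1..k}. t - h j \<in> {u j<..v j}}"

definition sifted_shifts :: "nat \<Rightarrow> nat \<Rightarrow> int \<Rightarrow> (nat \<Rightarrow> int) \<Rightarrow> (nat \<Rightarrow> real) \<Rightarrow> (nat \<Rightarrow> int) \<Rightarrow> (nat \<Rightarrow> int) \<Rightarrow> (nat \<Rightarrow> int) \<Rightarrow> int set" where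
  "sifted_shifts k w W c z u v h = {t\<in>shift_interval k u v h. [t = c 1] (mod W) \<and>
     (\<forall>j\<in>{1..k}. \<forall>p\<in>primes_between w (z j). \<not> int p dvd t - h j)}"

lemma finite_shift_set: "finite (shift_set X W c J \<alpha> j)"
  unfolding shift_set_def by (rule finite_subset[of _ "insert 0 {-X..X}"]) auto

lemma shift_interval_eq:
  assumes "k \<ge> 1"
  shows "shift_interval k u v h = {Max ((\<lambda>j. u j + h j) ` {1..k})<..Min ((\<lambda>j. v j + h j) ` {1..k})}"
proof -
  have ne: "(\<lambda>j. f j) ` {1..k} \<noteq> {}" for f :: "nat \<Rightarrow> int" using assms by auto
  have "t \<in> shift_interval k u v h \<longleftrightarrow> (\<forall>j\<in>{1..k}. u j + h j < t) \<and> (\<forall>j\<in>{1..k}. t \<le> v j + h j)" for t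
    by (auto simp: shift_interval_def algebra_simps)
  moreover have "Max ((\<lambda>j. u j + h j) ` {1..k}) < t \<longleftrightarrow> (\<forall>j\<in>{1..k}. u j + h j < t)" for t
    by (subst Max_less_iff) (use ne in auto)
  moreover have "t \<le> Min ((\<lambda>j. v j + h j) ` {1..k}) \<longleftrightarrow> (\<forall>j\<in>{1..k}. t \<le> v j + h j)" for t
    by (subst Min_ge_iff) (use ne in auto)
  ultimately show ?thesis by auto
qed

lemma finite_shift_interval: "k \<ge> 1 \<Longrightarrow> finite (shift_interval k u v h)"
  by (simp add: shift_interval_eq)

lemma finite_sifted_shifts: "k \<ge> 1 \<Longrightarrow> finite (sifted_shifts k w W c z u v h)"
  unfolding sifted_shifts_def by (rule finite_subset[OF _ finite_shift_interval]) auto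

text \<open>A tuple is determined by its shifts \<open>a 1 - a j\<close> together with
  \<open>a 1\<close>; the bounds on \<open>u\<close> and \<open>v\<close> keep all shifts in
  \<open>{-X..X}\<close>.\<close>

lemma card_tuple_class:
  assumes k: "k \<ge> 1" and uv: "\<And>j. j \<in> {1..k} \<Longrightarrow> 0 \<le> u j \<and> v j \<le> X"
  shows "card {a \<in> PiE {1..k} (\<lambda>j. {u j<..v j}). inj_on a {1..k} \<and>
     (\<forall>j\<in>{2..k}. mod1_in (J j) (of_int (a 1 - a j) * \<alpha>)) \<and>
     (\<forall>j\<in>{1..k}. [a j = c j] (mod W) \<and> (\<forall>p\<in>primes_between w (z j). \<not> int p dvd a j))} =
   (\<Sum>h | h \<in> PiE {1..k} (shift_set X W c J \<alpha>) \<and> inj_on h {1..k}. card (sifted_shifts k w W c z u v h))"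
    (is "card ?T = (\<Sum>h\<in>?H. card (?F h))")
proof -
  have one: "1 \<in> {1..k}" using k by simp
  have two: "j = 1 \<or> j \<in> {2..k}" if "j \<in> {1..k}" for j using that by auto
  have finH: "finite ?H"
    by (rule finite_subset[of _ "PiE {1..k} (shift_set X W c J \<alpha>)"]) (auto intro!: finite_PiE finite_shift_set)
  have "bij_betw (\<lambda>(h, t). \<lambda>j\<in>{1..k}. t - h j) (Sigma ?H ?F) ?T"
  proof (rule bij_betw_byWitness[where f' = "\<lambda>a. ((\<lambda>j\<in>{1..k}. a 1 - a j), a 1)"])
    show "\<forall>ht\<in>Sigma ?H ?F. (\<lambda>a. ((\<lambda>j\<in>{1..k}. a 1 - a j), a 1)) ((\<lambda>(h, t). \<lambda>j\<in>{1..k}. t - h j) ht) = ht"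
    proof
      fix ht assume "ht \<in> Sigma ?H ?F"
      then obtain h t where ht: "ht = (h, t)" and h: "h \<in> PiE {1..k} (shift_set X W c J \<alpha>)" by blast
      have h1: "h 1 = 0" using PiE_mem[OF h one] by (simp add: shift_set_def)
      have e1: "(\<lambda>j\<in>{1..k}. t - h j) 1 = t" using one h1 by simp
      have e2: "(\<lambda>j\<in>{1..k}. t - (\<lambda>j\<in>{1..k}. t - h j) j) = h"
        using h by (intro ext) (auto simp: PiE_def extensional_def restrict_def)
      show "(\<lambda>a. ((\<lambda>j\<in>{1..k}. a 1 - a j), a 1)) ((\<lambda>(h, t). \<lambda>j\<in>{1..k}. t - h j) ht) = ht"
        unfolding ht prod.case e1 e2 ..
    qed
    show "\<forall>a\<in>?T. (\<lambda>(h, t). \<lambda>j\<in>{1..k}. t - h j) ((\<lambda>a. ((\<lambda>j\<in>{1..k}. a 1 - a j), a 1)) a) = a"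
      by (auto simp: PiE_def extensional_def restrict_def)
    show "(\<lambda>(h, t). \<lambda>j\<in>{1..k}. t - h j) ` Sigma ?H ?F \<subseteq> ?T"
    proof
      fix y assume "y \<in> (\<lambda>(h, t). \<lambda>j\<in>{1..k}. t - h j) ` Sigma ?H ?F"
      then obtain ht where ht: "ht \<in> Sigma ?H ?F" "y = (\<lambda>(h, t). \<lambda>j\<in>{1..k}. t - h j) ht"
        by (rule imageE) simp
      obtain h t where eq: "ht = (h, t)" by (cases ht)
      have y: "y = (\<lambda>j\<in>{1..k}. t - h j)" using ht(2) eq by simp
      have h: "h \<in> PiE {1..k} (shift_set X W c J \<alpha>)" "inj_on h {1..k}" and t: "t \<in> ?F h"
        using ht(1) eq by auto
      define a where "a = (\<lambda>j\<in>{1..k}. t - h j)"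
      have h1: "h 1 = 0" using PiE_mem[OF h(1) one] by (simp add: shift_set_def)
      have a: "a j = t - h j" if "j \<in> {1..k}" for j using that by (simp add: a_def)
      have a1: "a 1 = t" using a[OF one] h1 by simp
      have 1: "a \<in> PiE {1..k} (\<lambda>j. {u j<..v j})"
        using t by (auto simp: a_def sifted_shifts_def shift_interval_def)
      have 2: "inj_on a {1..k}"
      proof (rule inj_onI)
        fix i j assume ij: "i \<in> {1..k}" "j \<in> {1..k}" "a i = a j"
        then have "h i = h j" by (simp add: a)
        then show "i = j" using h(2) ij by (simp add: inj_on_eq_iff)
      qed
      have 3: "\<forall>j\<in>{2..k}. mod1_in (J j) (of_int (a 1 - a j) * \<alpha>)"
      proof
        fix j assume j: "j \<in> {2..k}"
        then have jk: "j \<in> {1..k}" by auto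
        have "h j \<in> shift_set X W c J \<alpha> j" by (rule PiE_mem[OF h(1) jk])
        then have "mod1_in (J j) (of_int (h j) * \<alpha>)" using j by (auto simp: shift_set_def)
        then show "mod1_in (J j) (of_int (a 1 - a j) * \<alpha>)"
          unfolding a1 a[OF jk] by simp
      qed
      have 4: "\<forall>j\<in>{1..k}. [a j = c j] (mod W) \<and> (\<forall>p\<in>primes_between w (z j). \<not> int p dvd a j)"
      proof
        fix j assume j: "j \<in> {1..k}"
        have t1: "[t = c 1] (mod W)" and t2: "\<forall>p\<in>primes_between w (z j). \<not> int p dvd t - h j"
          using t j by (auto simp: sifted_shifts_def)
        have "[t - h j = c j] (mod W)"
        proof (cases "j = 1")
          case True
          then show ?thesis using t1 h1 by simp
        next
          case False
          have "h j \<in> shift_set X W c J \<alpha> j" by (rule PiE_mem[OF h(1) j])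
          then have "[h j = c 1 - c j] (mod W)" using False by (auto simp: shift_set_def)
          then have "[t - h j = c 1 - (c 1 - c j)] (mod W)" using t1 by (intro cong_diff)
          then show ?thesis by simp
        qed
        then show "[a j = c j] (mod W) \<and> (\<forall>p\<in>primes_between w (z j). \<not> int p dvd a j)"
          using t2 unfolding a[OF j] by blast
      qed
      show "y \<in> ?T"
        unfolding y a_def[symmetric] by (intro CollectI conjI 1 2 3 4)
    qed
    have "((\<lambda>j\<in>{1..k}. a 1 - a j), a 1) \<in> Sigma ?H ?F" if aT: "a \<in> ?T" for a
    proof -
      from aT
      have a: "a \<in> PiE {1..k} (\<lambda>j. {u j<..v j})" "inj_on a {1..k}"
        and m: "\<forall>j\<in>{2..k}. mod1_in (J j) (of_int (a 1 - a j) * \<alpha>)"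
        and c: "\<forall>j\<in>{1..k}. [a j = c j] (mod W) \<and> (\<forall>p\<in>primes_between w (z j). \<not> int p dvd a j)"
        by blast+
      have bd: "0 < a j \<and> a j \<le> X" if "j \<in> {1..k}" for j
        using PiE_mem[OF a(1) that] uv[OF that] by auto
      have 1: "(\<lambda>j\<in>{1..k}. a 1 - a j) \<in> PiE {1..k} (shift_set X W c J \<alpha>)"
      proof (rule restrict_PiE_iff[THEN iffD2], rule ballI)
        fix j assume j: "j \<in> {1..k}"
        show "a 1 - a j \<in> shift_set X W c J \<alpha> j"
        proof (cases "j = 1")
          case False
          have "[a 1 - a j = c 1 - c j] (mod W)" using c j one by (intro cong_diff) auto
          moreover have "a 1 - a j \<in> {-X..X}" using bd[OF one] bd[OF j] by auto
          moreover have "mod1_in (J j) (of_int (a 1 - a j) * \<alpha>)" using m two[OF j] False by blast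
          ultimately show ?thesis using False by (auto simp: shift_set_def)
        qed (simp add: shift_set_def)
      qed
      have 2: "inj_on (\<lambda>j\<in>{1..k}. a 1 - a j) {1..k}"
      proof (rule inj_onI)
        fix i j assume ij: "i \<in> {1..k}" "j \<in> {1..k}" "(\<lambda>j\<in>{1..k}. a 1 - a j) i = (\<lambda>j\<in>{1..k}. a 1 - a j) j"
        then have "a i = a j" by simp
        then show "i = j" using a(2) ij by (simp add: inj_on_eq_iff)
      qed
      have 3: "a 1 \<in> ?F (\<lambda>j\<in>{1..k}. a 1 - a j)"
        using a(1) c one by (auto simp: sifted_shifts_def shift_interval_def PiE_def Pi_def)
      show ?thesis
        by (intro SigmaI CollectI conjI 1 2 3)
    qed
    then show "(\<lambda>a. ((\<lambda>j\<in>{1..k}. a 1 - a j), a 1)) ` ?T \<subseteq> Sigma ?H ?F"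
      by blast
  qed
  then have "card ?T = card (Sigma ?H ?F)" by (simp add: bij_betw_same_card)
  also have "\<dots> = (\<Sum>h\<in>?H. card (?F h))"
    using finH finite_sifted_shifts[OF k] by (intro card_SigmaI) auto
  finally show ?thesis .
qed

text \<open>The length of the interval depends on all shifts at once, so the left-hand side does not
  factor. Writing the length as a sum over \<open>t\<close> and exchanging the sums leaves, for each
  \<open>t\<close>, independent conditions on the single shifts.\<close>

lemma sum_shift_interval:
  fixes g :: "(nat \<Rightarrow> int) \<Rightarrow> real"
  assumes k: "k \<ge> 1" and H1: "H 1 = {0}" and finH: "\<And>j. finite (H j)"
  shows "(\<Sum>h | h \<in> PiE {1..k} H \<and> inj_on h {1..k}. real (card (shift_interval k u v h)) * g h) =
    (\<Sum>t\<in>{u 1<..v 1}. \<Sum>h | h \<in> PiE {1..k} (\<lambda>j. {h\<in>H j. t - h \<in> {u j<..v j}}) \<and> inj_on h {1..k}. g h)"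
proof -
  let ?H = "{h. h \<in> PiE {1..k} H \<and> inj_on h {1..k}}"
  have one: "1 \<in> {1..k}" using k by simp
  have fin: "finite ?H"
    by (rule finite_subset[of _ "PiE {1..k} H"]) (auto intro!: finite_PiE finH)
  have "real (card (shift_interval k u v h)) = (\<Sum>t\<in>{u 1<..v 1}. of_bool (t \<in> shift_interval k u v h))" if "h \<in> ?H" for h
  proof -
    have "h 1 = 0" using PiE_mem[of h "{1..k}" H 1] that one H1 by simp
    have "t \<in> {u 1<..v 1}" if t: "t \<in> shift_interval k u v h" for t
    proof -
      have "t - h 1 \<in> {u 1<..v 1}" using t one unfolding shift_interval_def by blast
      then show ?thesis using \<open>h 1 = 0\<close> by simp
    qed
    then have "shift_interval k u v h = {t\<in>{u 1<..v 1}. t \<in> shift_interval k u v h}" by blast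
    then show ?thesis by (simp add: of_bool_def sum.inter_filter[symmetric])
  qed
  then have "(\<Sum>h\<in>?H. real (card (shift_interval k u v h)) * g h) =
     (\<Sum>h\<in>?H. \<Sum>t\<in>{u 1<..v 1}. of_bool (t \<in> shift_interval k u v h) * g h)"
    by (intro sum.cong) (simp_all only: sum_distrib_right)
  also have "\<dots> = (\<Sum>t\<in>{u 1<..v 1}. \<Sum>h\<in>?H. of_bool (t \<in> shift_interval k u v h) * g h)"
    by (rule sum.swap)
  also have "\<dots> = (\<Sum>t\<in>{u 1<..v 1}. \<Sum>h | h \<in> PiE {1..k} (\<lambda>j. {h\<in>H j. t - h \<in> {u j<..v j}}) \<and> inj_on h {1..k}. g h)"
  proof (rule sum.cong[OF refl])
    fix t
    have "(\<Sum>h\<in>?H. of_bool (t \<in> shift_interval k u v h) * g h) = (\<Sum>h\<in>?H. if t \<in> shift_interval k u v h then g h else 0)"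
      by (intro sum.cong) auto
    also have "\<dots> = (\<Sum>h\<in>{h\<in>?H. t \<in> shift_interval k u v h}. g h)"
      using fin by (rule sum.inter_filter[symmetric])
    also have "{h\<in>?H. t \<in> shift_interval k u v h} =
       {h. h \<in> PiE {1..k} (\<lambda>j. {h\<in>H j. t - h \<in> {u j<..v j}}) \<and> inj_on h {1..k}}"
      by (auto simp: shift_interval_def PiE_iff)
    finally show "(\<Sum>h\<in>?H. of_bool (t \<in> shift_interval k u v h) * g h) =
      (\<Sum>h | h \<in> PiE {1..k} (\<lambda>j. {h\<in>H j. t - h \<in> {u j<..v j}}) \<and> inj_on h {1..k}. g h)" .
  qed
  finally show ?thesis .
qed

section \<open>Primes up to \<open>w\<close> as residue classes\<close>

definition primorial :: "nat \<Rightarrow> nat" where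
  "primorial w = \<Prod>(primes_between 0 w)"

lemma primorial_pos: "primorial w > 0"
proof -
  have "0 < p" if "p \<in> primes_between 0 w" for p using pos_primes_between[OF that] .
  then show ?thesis unfolding primorial_def by (intro prod_pos) blast
qed

lemma coprime_primorial_iff: "coprime a (int (primorial w)) \<longleftrightarrow> (\<forall>p\<in>primes_between 0 w. \<not> int p dvd a)"
proof
  assume c: "coprime a (int (primorial w))"
  show "\<forall>p\<in>primes_between 0 w. \<not> int p dvd a"
  proof (intro ballI notI)
    fix p assume p: "p \<in> primes_between 0 w" "int p dvd a"
    have "p dvd primorial w" unfolding primorial_def using p(1) by (intro dvd_prodI[of _ _ "\<lambda>x. x", simplified]) auto
    then have "int p dvd int (primorial w)" by simp
    then have "is_unit (int p)" using c p(2) by (intro coprime_common_divisor)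
    then show False using ge_2_primes_between[OF p(1)] by simp
  qed
next
  assume a: "\<forall>p\<in>primes_between 0 w. \<not> int p dvd a"
  have "coprime a (\<Prod>p\<in>primes_between 0 w. int p)"
  proof (rule prod_coprime_right)
    fix p assume p: "p \<in> primes_between 0 w"
    then have "prime (int p)" by (auto dest: prime_primes_between)
    then have "coprime (int p) a" using a p by (intro prime_imp_coprime) auto
    then show "coprime a (int p)" by (simp add: coprime_commute)
  qed
  then show "coprime a (int (primorial w))" by (simp add: primorial_def)
qed

lemma coprime_primorial_large:
  assumes "p \<in> primes_between w x"
  shows "coprime (int p) (int (primorial w))"
proof -
  have "\<not> int q dvd int p" if q: "q \<in> primes_between 0 w" for q
  proof
    assume "int q dvd int p"
    then have "q dvd p" by simp
    then have "q = p" using primes_dvd_imp_eq prime_primes_between[OF q] prime_primes_between[OF assms] by blast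
    then show False using q assms by (auto simp: primes_between_def)
  qed
  then show ?thesis by (simp add: coprime_primorial_iff)
qed

lemma card_coprime_residues:
  assumes "w \<ge> 2"
  shows "real (card {r\<in>{0..<int (primorial w)}. coprime r (int (primorial w))}) = primorial w * mertens_prod 0 w"
proof -
  let ?W = "primorial w"
  have two: "2 \<in> primes_between 0 w" using assms two_is_prime_nat by (auto simp: primes_between_def)
  have "2 dvd ?W" unfolding primorial_def using two by (intro dvd_prodI[of _ _ "\<lambda>x. x", simplified]) auto
  then have W1: "?W > 1" using primorial_pos[of w] by (cases "?W = 1") auto
  have "{r\<in>{0..<int ?W}. coprime r (int ?W)} = int ` totatives ?W"
  proof (intro equalityI subsetI)
    fix r assume r: "r \<in> {r\<in>{0..<int ?W}. coprime r (int ?W)}"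
    then obtain m where m: "r = int m" by (metis atLeastLessThan_iff mem_Collect_eq nonneg_int_cases)
    have "coprime m ?W" using r m by simp
    moreover have "m \<noteq> 0" using calculation W1 by (cases "m = 0") auto
    ultimately show "r \<in> int ` totatives ?W" using r m by (auto simp: totatives_def)
  next
    fix r assume "r \<in> int ` totatives ?W"
    then obtain m where m: "r = int m" "0 < m" "m \<le> ?W" "coprime m ?W" by (auto simp: totatives_def)
    have "m \<noteq> ?W" using m W1 by auto
    then show "r \<in> {r\<in>{0..<int ?W}. coprime r (int ?W)}" using m by simp
  qed
  then have "card {r\<in>{0..<int ?W}. coprime r (int ?W)} = totient ?W"
    by (simp add: card_image totient_def)
  moreover have "prime_factors ?W = primes_between 0 w"
  proof (intro equalityI subsetI)
    fix p assume "p \<in> prime_factors ?W"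
    then have p: "prime p" "p dvd ?W" by (auto simp: in_prime_factors_iff)
    then obtain q where q: "q \<in> primes_between 0 w" "p dvd q"
      using prime_dvd_prod_iff[of "primes_between 0 w" p "\<lambda>x. x"] by (auto simp: primorial_def)
    then have "p = q" using p primes_dvd_imp_eq prime_primes_between by blast
    then show "p \<in> primes_between 0 w" using q by simp
  next
    fix p assume p: "p \<in> primes_between 0 w"
    have "p dvd ?W" unfolding primorial_def using p by (intro dvd_prodI[of _ _ "\<lambda>x. x", simplified]) auto
    then show "p \<in> prime_factors ?W"
      using primorial_pos[of w] prime_primes_between[OF p] by (simp add: in_prime_factors_iff)
  qed
  ultimately show ?thesis by (simp add: totient_formula2 mertens_prod_def)
qed

text \<open>Having no prime factor up to \<open>w\<close> means being coprime to
  \<open>primorial w\<close>. Once the residues of all coordinates are fixed, only primes above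
  \<open>w\<close> remain, for which second-order losses are small; the price is a number of classes
  that depends on \<open>w\<close> and \<open>k\<close> only.\<close>

lemma card_tuple_set_residues:
  assumes z: "\<And>j. j \<in> {1..k} \<Longrightarrow> real w \<le> z j"
  shows "card (tuple_set k u v z J \<alpha>) =
    (\<Sum>c\<in>PiE {1..k} (\<lambda>_. {r\<in>{0..<int (primorial w)}. coprime r (int (primorial w))}).
      card {a \<in> PiE {1..k} (\<lambda>j. {u j<..v j}). inj_on a {1..k} \<and>
     (\<forall>j\<in>{2..k}. mod1_in (J j) (of_int (a 1 - a j) * \<alpha>)) \<and>
     (\<forall>j\<in>{1..k}. [a j = c j] (mod int (primorial w)) \<and> (\<forall>p\<in>primes_between w (z j). \<not> int p dvd a j))})"
    (is "_ = (\<Sum>c\<in>?C. card (?T c))")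
proof -
  let ?W = "int (primorial w)"
  have W0: "?W > 0" using primorial_pos[of w] by simp
  let ?P = "PiE {1..k} (\<lambda>j. {u j<..v j})"
  have finP: "finite ?P" by (intro finite_PiE) auto
  have split: "primes_between 0 (z j) = primes_between 0 w \<union> primes_between w (z j)" if "j \<in> {1..k}" for j
    using z[OF that] by (intro primes_between_Un) auto
  have "tuple_set k u v z J \<alpha> = (\<Union>c\<in>?C. ?T c)"
  proof (intro equalityI subsetI)
    fix a assume a: "a \<in> tuple_set k u v z J \<alpha>"
    define c where "c = (\<lambda>j\<in>{1..k}. a j mod ?W)"
    have "c \<in> ?C"
    proof -
      have "a j mod ?W \<in> {r\<in>{0..<?W}. coprime r ?W}" if "j \<in> {1..k}" for j
      proof -
        have "coprime (a j) ?W"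
          unfolding coprime_primorial_iff using a split[OF that] that by (auto simp: tuple_set_def)
        then show ?thesis using W0 by simp
      qed
      then show ?thesis by (simp add: c_def restrict_PiE_iff)
    qed
    moreover have "a \<in> ?T c"
    proof -
      have "[a j = c j] (mod ?W) \<and> (\<forall>p\<in>primes_between w (z j). \<not> int p dvd a j)" if "j \<in> {1..k}" for j
        using a split[OF that] that by (auto simp: tuple_set_def c_def cong_def)
      then show ?thesis using a by (simp add: tuple_set_def)
    qed
    ultimately show "a \<in> (\<Union>c\<in>?C. ?T c)" by blast
  next
    fix a assume "a \<in> (\<Union>c\<in>?C. ?T c)"
    then obtain c where c: "c \<in> ?C" "a \<in> ?T c" by blast
    have "\<forall>p\<in>primes_between 0 (z j). \<not> int p dvd a j" if j: "j \<in> {1..k}" for j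
    proof -
      have "coprime (c j) ?W" using PiE_mem[OF c(1) j] by simp
      moreover have "[a j = c j] (mod ?W)" using c(2) j by simp
      ultimately have "coprime (a j) ?W" by (metis cong_imp_coprime cong_sym)
      then have "\<forall>p\<in>primes_between 0 w. \<not> int p dvd a j" by (simp add: coprime_primorial_iff)
      then show ?thesis using c(2) j unfolding split[OF j] by blast
    qed
    then show "a \<in> tuple_set k u v z J \<alpha>" using c(2) by (simp add: tuple_set_def)
  qed
  moreover have "card (\<Union>c\<in>?C. ?T c) = (\<Sum>c\<in>?C. card (?T c))"
  proof (rule card_UN_disjoint)
    show "finite ?C"
      by (intro finite_PiE finite_subset[OF _ finite_atLeastLessThan_int[of 0 ?W]]) auto
    show "\<forall>c\<in>?C. finite (?T c)" by (intro ballI finite_subset[OF _ finP]) auto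
    show "\<forall>c\<in>?C. \<forall>c'\<in>?C. c \<noteq> c' \<longrightarrow> ?T c \<inter> ?T c' = {}"
    proof (intro ballI impI)
      fix c c' assume c: "c \<in> ?C" "c' \<in> ?C" "c \<noteq> c'"
      show "?T c \<inter> ?T c' = {}"
      proof (rule ccontr)
        assume "?T c \<inter> ?T c' \<noteq> {}"
        then obtain a where a: "a \<in> ?T c" "a \<in> ?T c'" by blast
        have "c j = c' j" if j: "j \<in> {1..k}" for j
        proof -
          have "[a j = c j] (mod ?W)" "[a j = c' j] (mod ?W)" using a j by simp_all
          then have "[c j = c' j] (mod ?W)" by (rule cong_trans[OF cong_sym])
          then show ?thesis using PiE_mem[OF c(1) j] PiE_mem[OF c(2) j] by (simp add: cong_def)
        qed
        then have "c = c'" using c by (intro PiE_ext)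
        then show False using c by simp
      qed
    qed
  qed
  ultimately show ?thesis by simp
qed

text \<open>At most \<open>3 * ln X\<close> primes divide \<open>d\<close>, and each one above
  \<open>y\<close> contributes at most \<open>b / y\<close> to the exponent. For \<open>y\<close>
  larger than \<open>ln X\<close> the large primes are therefore negligible pointwise, and the
  average over \<open>d\<close> need only handle primes up to \<open>y\<close>.\<close>

lemma prod_large_prime_divisors_le:
  fixes b y X :: real and d :: int
  assumes "b \<ge> 0" "y > 0" "d \<noteq> 0" "\<bar>real_of_int d\<bar> \<le> 2 * X" "X \<ge> 2" "w \<le> y"
  shows "(\<Prod>p\<in>{p\<in>primes_between w x. int p dvd d}. 1 + b / real p) \<le>
    exp (b * (3 * ln X) / y) * (\<Prod>p\<in>{p\<in>primes_between w y. int p dvd d}. 1 + b / real p)"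
proof -
  let ?A = "{p\<in>primes_between w y. int p dvd d}" and ?B = "{p\<in>primes_between y x. int p dvd d}"
  have fin: "finite ?A" "finite ?B" by auto
  have "(\<Prod>p\<in>{p\<in>primes_between w x. int p dvd d}. 1 + b / real p) \<le> (\<Prod>p\<in>?A \<union> ?B. 1 + b / real p)"
  proof (rule prod_mono2)
    show "{p\<in>primes_between w x. int p dvd d} \<subseteq> ?A \<union> ?B" by (auto simp: primes_between_def)
  qed (use fin assms in auto)
  also have "\<dots> = (\<Prod>p\<in>?A. 1 + b / real p) * (\<Prod>p\<in>?B. 1 + b / real p)"
    using fin by (intro prod.union_disjoint) (auto simp: primes_between_def)
  also have "\<dots> \<le> (\<Prod>p\<in>?A. 1 + b / real p) * exp (b * (3 * ln X) / y)"
  proof (intro mult_left_mono prod_nonneg)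
    have "2 ^ card ?B \<le> 2 * X" using card_prime_divisors_le[OF assms(3), of y x] assms(4) by linarith
    then have "ln (2 ^ card ?B) \<le> ln (2 * X)" using assms by (subst ln_le_cancel_iff) auto
    then have "card ?B * ln 2 \<le> ln 2 + ln X" using assms by (simp add: ln_realpow ln_mult)
    also have "\<dots> \<le> 2 * ln X" using assms by simp
    finally have "card ?B * ln 2 \<le> 2 * ln X" .
    moreover have "card ?B * (2/3) \<le> card ?B * ln 2" using ln2_ge_two_thirds by (intro mult_left_mono) auto
    ultimately have cB: "card ?B \<le> 3 * ln X" by simp
    have "(\<Prod>p\<in>?B. 1 + b / real p) \<le> exp (\<Sum>p\<in>?B. b / real p)"
      using assms by (intro prod_one_plus_le_exp) auto
    also have "(\<Sum>p\<in>?B. b / real p) \<le> (\<Sum>p\<in>?B. b / y)"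
      using assms by (intro sum_mono divide_left_mono) (auto simp: primes_between_def)
    then have "exp (\<Sum>p\<in>?B. b / real p) \<le> exp (card ?B * (b / y))" by simp
    also have "card ?B * (b / y) \<le> (3 * ln X) * (b / y)"
      using cB assms by (intro mult_right_mono) auto
    then have "exp (card ?B * (b / y)) \<le> exp (b * (3 * ln X) / y)" by (simp add: mult_ac)
    finally show "(\<Prod>p\<in>?B. 1 + b / real p) \<le> exp (b * (3 * ln X) / y)" .
  qed (use assms in auto)
  finally show ?thesis by (simp add: mult.commute)
qed

lemma exp_le_one_plus_double:
  fixes t :: real
  assumes "0 \<le> t" "t \<le> 1"
  shows "exp t \<le> 1 + 2 * t"
proof -
  have "exp t \<le> 1 + t + t\<^sup>2" using assms by (rule exp_bound)
  moreover have "t\<^sup>2 \<le> t" using assms by (simp add: power2_eq_square mult_left_le)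
  ultimately show ?thesis by simp
qed

lemma sqrt_le_self: "1 \<le> x \<Longrightarrow> sqrt x \<le> x"
  by (rule real_le_lsqrt) (auto simp: power2_eq_square mult_le_cancel_left1)

section \<open>The number of tuples\<close>

text \<open>One residue class modulo \<open>W\<close>. \<open>U\<close> is the density for primes
  above \<open>w\<close> and \<open>V = \<rho> * U\<close> the density for all primes;
  \<open>L j / W\<close> is the expected number of shifts and \<open>Q * Mn\<close> the main term.
  There are two kinds of error: that of the equidistribution, of order \<open>sqrt \<sigma>\<close>
  relative to \<open>Q\<close> and enlarged by \<open>\<Lambda>\<close> in the upper bound, and the
  sieve remainder \<open>R\<close>, incurred once for every shift tuple.\<close>

lemma tuple_count_class:
  fixes k w :: nat and \<alpha> b B \<eta> CL C x \<sigma> D A2 A3 \<Lambda> y :: real and X :: nat and lo hi z :: "nat \<Rightarrow> real"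
    and u v c :: "nat \<Rightarrow> int" and J :: "nat \<Rightarrow> real set" and R :: real
  defines "b \<equiv> 2 ^ (k * k ^ 2 + 1)" and "W \<equiv> primorial w" and "\<rho> \<equiv> mertens_prod 0 w"
  defines "U \<equiv> \<lambda>j. mertens_prod w (z j)" and "V \<equiv> \<lambda>j. mertens_prod 0 (z j)"
  defines "L \<equiv> \<lambda>j. real_of_int (v j - u j) * (hi j - lo j)"
  defines "T \<equiv> {a \<in> PiE {1..k} (\<lambda>j. {u j<..v j}). inj_on a {1..k} \<and>
     (\<forall>j\<in>{2..k}. mod1_in (J j) (of_int (a 1 - a j) * \<alpha>)) \<and>
     (\<forall>j\<in>{1..k}. [a j = c j] (mod int W) \<and> (\<forall>p\<in>primes_between w (z j). \<not> int p dvd a j))}"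
  defines "Q \<equiv> U 1 / W * real_of_int (v 1 - u 1)" and "Mn \<equiv> (\<Prod>j\<in>{2..k}. U j * (L j / W))"
  defines "\<Lambda> \<equiv> (\<Prod>p\<in>primes_between w y. 1 + b / real p)"
  assumes k: "k \<ge> 1" and \<eta>: "0 < \<eta>" "\<eta> \<le> 1 / 2" and w: "real k ^ 2 / w \<le> \<eta>" "b / w \<le> \<eta> / 2" "w \<ge> k" "w \<ge> 1"
    and sieve: "\<And>(h::nat \<Rightarrow> int) (u::int) (v::int). u \<le> v \<Longrightarrow>
       \<bar>real (card {t\<in>{u<..v}. [t = c 1] (mod int W) \<and> (\<forall>j\<in>{1..k}. \<forall>p\<in>primes_between w (z j). \<not> int p dvd t - h j)})
          - (v - u) / W * sifted_density k w x z h\<bar> \<le> \<eta> * ((v - u) / W * sifted_density k w x z h) + R"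
    and R: "R \<ge> 0" and CL: "CL \<ge> 1"
    and lattice: "\<And>(d::nat) (c::int) (u::int) (v::int) (j::nat). d > 0 \<Longrightarrow> u < v \<Longrightarrow> j \<in> {2..k} \<Longrightarrow>
       \<bar>real (card {h\<in>{u<..v}. [h = c] (mod int d) \<and> mod1_in (J j) (of_int h * \<alpha>)}) - (v - u) * (hi j - lo j) / d\<bar> \<le>
         CL * (sqrt ((v - u) * (hi j - lo j)) + 1)"
    and X: "X \<ge> 2" "exp (b * (3 * ln X) / y) \<le> 1 + \<eta>" "y > 0" "w \<le> y"
    and uv: "\<And>j. j \<in> {1..k} \<Longrightarrow> 0 \<le> u j \<and> u j < v j \<and> v j \<le> int X"
    and z: "\<And>j. j \<in> {1..k} \<Longrightarrow> z j \<le> x" "\<And>j. j \<in> {1..k} \<Longrightarrow> w \<le> z j" "\<And>j. j \<in> {1..k} \<Longrightarrow> V j \<le> \<sigma>"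
    and I: "\<And>j. j \<in> {2..k} \<Longrightarrow> lo j \<le> hi j \<and> V j * L j \<le> B \<and> X * (hi j - lo j) \<le> D"
    and B: "B \<ge> 1" and D: "D \<ge> 1" and \<sigma>: "0 \<le> \<sigma>" "\<sigma> \<le> 1"
  defines "A2 \<equiv> CL * (B + 1) / \<rho>"
  defines "A3 \<equiv> 6 * (real k + 1) ^ 3 * (B / \<rho> + 1) ^ k"
  assumes \<tau>: "A2 * sqrt \<sigma> \<le> 1"
  shows "(1 - 2 * \<eta>) * (Q * (Mn - A3 * (A2 * sqrt \<sigma>))) - (7 * CL * D) ^ k * R \<le> card T"
    and "card T \<le> (1 + \<eta>) * (Q * ((1 + 3 * real k ^ 2 * \<eta>) * Mn + A3 * (A2 * sqrt \<sigma> * \<Lambda>))) + (7 * CL * D) ^ k * R"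
proof -
  define H where "H = shift_set (int X) (int W) c J \<alpha>"
  define HH where "HH t j = {h\<in>H j. t - h \<in> {u j<..v j}}" for t j
  define I where "I = {h. h \<in> PiE {1..k} H \<and> inj_on h {1..k}}"
  define II where "II t = {h. h \<in> PiE {1..k} (HH t) \<and> inj_on h {1..k}}" for t
  define \<tau> where "\<tau> = A2 * sqrt \<sigma>"
  define gg where "gg d = (\<Prod>p\<in>{p\<in>primes_between w x. int p dvd d}. 1 + b / real p)" for d
  define gg' where "gg' d = (\<Prod>p\<in>{p\<in>primes_between w y. int p dvd d}. 1 + b / real p)" for d
  define G where "G h = 1 + (\<Sum>(i, j)\<in>index_pairs k. gg (h j - h i) - 1)" for h :: "nat \<Rightarrow> int"
  define PU where "PU = (\<Prod>j\<in>{1..k}. U j)"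
  define PU2 where "PU2 = (\<Prod>j\<in>{2..k}. U j)"
  define Y1 where "Y1 = real_of_int (v 1 - u 1)"
  define len where "len h = real (card (shift_interval k u v h))" for h
  define S where "S h = real (card (sifted_shifts k w (int W) c z u v h))" for h
  have one: "1 \<in> {1..k}" using k by simp
  have b0: "b \<ge> 0" by (simp add: b_def)
  have W0: "W > 0" unfolding W_def by (rule primorial_pos)
  then have W1: "real W \<ge> 1" by linarith
  have \<rho>: "0 < \<rho>" "\<rho> \<le> 1" unfolding \<rho>_def using mertens_prod_pos mertens_prod_le_1 by auto
  have U0: "U j > 0" for j unfolding U_def by (rule mertens_prod_pos)
  have PU: "PU = U 1 * PU2"
  proof -
    have "{1..k} = insert 1 {2..k}" using k by auto
    then show ?thesis by (simp add: PU_def PU2_def)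
  qed
  have PU0: "PU \<ge> 0" "PU2 \<ge> 0" unfolding PU_def PU2_def using less_imp_le[OF U0] by (auto intro!: prod_nonneg)
  have VU: "V j = \<rho> * U j" if "j \<in> {1..k}" for j
    unfolding V_def \<rho>_def U_def using z(2)[OF that] by (intro mertens_prod_split) auto
  have U\<sigma>: "U j \<le> \<sigma> / \<rho>" if "j \<in> {1..k}" for j
    using VU[OF that] z(3)[OF that] \<rho> by (simp add: field_simps)
  have B\<rho>: "B / \<rho> \<ge> 1" using B \<rho> by (simp add: field_simps)
  have \<sigma>s: "\<sigma> \<le> sqrt \<sigma>"
  proof -
    have "\<sigma> * \<sigma> \<le> \<sigma>" using \<sigma> by (simp add: mult_left_le)
    then show ?thesis using \<sigma> by (intro real_le_rsqrt) (auto simp: power2_eq_square)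
  qed
  have \<tau>0: "0 \<le> \<tau>" "\<tau> \<le> 1"
    using \<tau> \<sigma> CL B \<rho> by (auto simp: \<tau>_def A2_def)
  have L0: "0 \<le> L j \<and> U j * L j \<le> B / \<rho>" if "j \<in> {2..k}" for j
  proof -
    have j: "j \<in> {1..k}" using that by auto
    have "0 \<le> L j" unfolding L_def using uv[OF j] I[OF that] by simp
    moreover have "\<rho> * (U j * L j) \<le> B" using I[OF that] VU[OF j] by (simp add: mult.assoc)
    ultimately show ?thesis using \<rho> by (simp add: field_simps)
  qed
  \<comment> \<open>The lattice point error weighted by the density. As \<open>U j * L j\<close> is
    bounded and \<open>U j \<le> \<sigma> / \<rho>\<close>, their geometric mean
    \<open>U j * sqrt (L j)\<close> is of order \<open>sqrt \<sigma>\<close>: the square root in the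
    counting error is what makes this small.\<close>
  have UE: "U j * (CL * (sqrt (L j) + 1)) \<le> \<tau>" if j2: "j \<in> {2..k}" for j
  proof -
    have j: "j \<in> {1..k}" using j2 by auto
    have "(U j * sqrt (L j))\<^sup>2 = U j * (U j * L j)"
      using L0[OF j2] by (simp add: power2_eq_square mult_ac)
    also have "\<dots> \<le> (\<sigma> / \<rho>) * (B / \<rho>)"
      using U\<sigma>[OF j] L0[OF j2] U0[of j] \<sigma> \<rho> by (intro mult_mono) auto
    also have "\<dots> = (\<sigma> / \<rho>) * (B / \<rho>) * 1" by (rule mult_1_right[symmetric])
    also have "\<dots> \<le> (\<sigma> / \<rho>) * (B / \<rho>) * B"
    proof (rule mult_left_mono[OF B])
      show "0 \<le> (\<sigma> / \<rho>) * (B / \<rho>)"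
        using B \<sigma> \<rho> by (intro mult_nonneg_nonneg divide_nonneg_nonneg) auto
    qed
    also have "\<dots> = (B * sqrt \<sigma> / \<rho>)\<^sup>2"
      using \<sigma> by (simp add: power2_eq_square power_divide)
    finally have sq: "(U j * sqrt (L j))\<^sup>2 \<le> (B * sqrt \<sigma> / \<rho>)\<^sup>2" .
    have "0 \<le> B * sqrt \<sigma> / \<rho>" using B \<sigma> \<rho> by simp
    with sq have 1: "U j * sqrt (L j) \<le> B * sqrt \<sigma> / \<rho>"
      by (rule power2_le_imp_le)
    have "U j \<le> sqrt \<sigma> / \<rho>"
      using U\<sigma>[OF j] divide_right_mono[OF \<sigma>s, of \<rho>] \<rho> by linarith
    with 1 have "U j * sqrt (L j) + U j \<le> (B + 1) * sqrt \<sigma> / \<rho>"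
      by (simp add: add_divide_distrib distrib_right)
    then have "CL * (U j * sqrt (L j) + U j) \<le> CL * ((B + 1) * sqrt \<sigma> / \<rho>)"
      using CL by (intro mult_left_mono) auto
    then show ?thesis by (simp add: \<tau>_def A2_def algebra_simps)
  qed
  have gg'1: "gg' d \<ge> 1" for d
    unfolding gg'_def using b0 by (intro prod_ge_1) auto
  have \<Lambda>1: "\<Lambda> \<ge> 1" unfolding \<Lambda>_def using b0 by (intro prod_ge_1) auto
  have H1: "H 1 = {0}" by (simp add: H_def shift_set_def)
  have finH: "finite (H j)" for j unfolding H_def by (rule finite_shift_set)
  have finHH: "finite (HH t j)" for t j unfolding HH_def using finH[of j] by (rule finite_subset[rotated]) auto
  have finI: "finite I" unfolding I_def
    by (rule finite_subset[of _ "PiE {1..k} H"]) (auto intro!: finite_PiE finH)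
  have cardT: "real (card T) = (\<Sum>h\<in>I. S h)"
  proof -
    have "card T = (\<Sum>h\<in>I. card (sifted_shifts k w (int W) c z u v h))"
      unfolding T_def I_def H_def
      by (rule card_tuple_class[OF k]) (use uv in force)
    then show ?thesis by (simp add: S_def)
  qed
  have sieve': "\<bar>S h - len h / W * sifted_density k w x z h\<bar> \<le> \<eta> * (len h / W * sifted_density k w x z h) + R" for h
  proof -
    define l r where "l = Max ((\<lambda>j. u j + h j) ` {1..k})" and "r = Min ((\<lambda>j. v j + h j) ` {1..k})"
    have eq: "shift_interval k u v h = {l<..r}" unfolding l_def r_def by (rule shift_interval_eq[OF k])
    show ?thesis
    proof (cases "l \<le> r")
      case True
      have "len h = r - l" using True by (simp add: len_def eq)
      moreover have "sifted_shifts k w (int W) c z u v h = {t\<in>{l<..r}. [t = c 1] (mod int W) \<and> (\<forall>j\<in>{1..k}. \<forall>p\<in>primes_between w (z j). \<not> int p dvd t - h j)}"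
        by (simp add: sifted_shifts_def eq)
      ultimately show ?thesis using sieve[OF True, of h] by (simp add: S_def)
    next
      case False
      then have "shift_interval k u v h = {}" using eq by simp
      then show ?thesis using R by (simp add: len_def S_def sifted_shifts_def)
    qed
  qed
  have dens0: "sifted_density k w x z h \<ge> 0" for h by (rule sifted_density_nonneg) (rule w)
  have dens_ge: "(1 - \<eta>) * PU \<le> sifted_density k w x z h" for h
  proof -
    have "(1 - \<eta>) * PU \<le> (1 - real k ^ 2 / w) * PU" using w PU0 by (intro mult_right_mono) auto
    also have "\<dots> \<le> sifted_density k w x z h"
      unfolding PU_def U_def using w z by (intro sifted_density_ge) auto
    finally show ?thesis .
  qed
  have dens_le: "sifted_density k w x z h \<le> PU * G h" for h
    unfolding PU_def U_def G_def gg_def b_def using z by (intro sifted_density_le) auto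
  have len0: "len h \<ge> 0" for h by (simp add: len_def)
  have lower_h: "(1 - 2 * \<eta>) * PU / W * (len h * 1) - R \<le> S h" for h
  proof -
    have "(1 - 2 * \<eta>) * PU \<le> (1 - \<eta>) * ((1 - \<eta>) * PU)" using PU0 \<eta> by (simp add: algebra_simps)
    also have "\<dots> \<le> (1 - \<eta>) * sifted_density k w x z h" using dens_ge \<eta> by (intro mult_left_mono) auto
    finally have "len h / W * ((1 - 2 * \<eta>) * PU) \<le> len h / W * ((1 - \<eta>) * sifted_density k w x z h)"
      using len0 by (intro mult_left_mono) auto
    moreover have "len h / W * ((1 - \<eta>) * sifted_density k w x z h) =
       len h / W * sifted_density k w x z h - \<eta> * (len h / W * sifted_density k w x z h)"
      by (simp add: algebra_simps)
    moreover have "(1 - 2 * \<eta>) * PU / W * (len h * 1) = len h / W * ((1 - 2 * \<eta>) * PU)" by simp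
    ultimately show ?thesis using sieve'[of h] unfolding abs_le_iff by linarith
  qed
  have upper_h: "S h \<le> (1 + \<eta>) * PU / W * (len h * G h) + R" for h
  proof -
    have "S h \<le> (1 + \<eta>) * (len h / W * sifted_density k w x z h) + R"
      using sieve'[of h] unfolding abs_le_iff by (simp add: algebra_simps add_divide_distrib)
    also have "(1 + \<eta>) * (len h / W * sifted_density k w x z h) \<le> (1 + \<eta>) * (len h / W * (PU * G h))"
      using dens_le len0 \<eta> by (intro mult_left_mono) auto
    then have "(1 + \<eta>) * (len h / W * sifted_density k w x z h) + R \<le> (1 + \<eta>) * (len h / W * (PU * G h)) + R" by simp
    finally show ?thesis by (simp add: mult_ac)
  qed
  have swap: "(\<Sum>h\<in>I. len h * g h) = (\<Sum>t\<in>{u 1<..v 1}. \<Sum>h\<in>II t. g h)" for g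
    unfolding len_def I_def II_def HH_def using k H1 finH by (rule sum_shift_interval)
  \<comment> \<open>For fixed \<open>t = a 1\<close> the shifts are independent and the abstract
    averaging applies. Its bound is \<open>B / \<rho>\<close> because \<open>U\<close> exceeds
    \<open>V\<close> by the factor \<open>1 / \<rho>\<close>.\<close>
  have inner: "Mn - A3 * \<tau> \<le> PU2 * card (II t)" "PU2 * (\<Sum>h\<in>II t. G h) \<le> (1 + 3 * real k ^ 2 * \<eta>) * Mn + A3 * (\<tau> * \<Lambda>)"
    if t: "t \<in> {u 1<..v 1}" for t
  proof -
    have HH1: "HH t 1 = {0}" unfolding HH_def H1 using t by auto
    have tX: "0 < t" "t \<le> int X" using t uv[OF one] by auto
    \<comment> \<open>The restriction to \<open>{-X..X}\<close> is automatic, since \<open>t\<close>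
      and \<open>t - h\<close> lie between 0 and \<open>X\<close>; an interval in a progression
      remains, as the lattice point count requires.\<close>
    have HHj: "HH t j = {h\<in>{t - v j - 1<..t - u j - 1}. [h = c 1 - c j] (mod int W) \<and> mod1_in (J j) (of_int h * \<alpha>)}"
      if j: "j \<in> {2..k}" for j
      using j uv[of j] tX by (auto simp: HH_def H_def shift_set_def)
    have cnt: "\<bar>real (card (HH t j)) - L j / W\<bar> \<le> CL * (sqrt (L j) + 1)" if j: "j \<in> {2..k}" for j
    proof -
      have "t - v j - 1 < t - u j - 1" using uv[of j] j by auto
      from lattice[OF W0 this j, of "c 1 - c j"] show ?thesis
        unfolding HHj[OF j] L_def by simp
    qed
    have b1: "0 \<le> U j \<and> U j \<le> \<tau>" if j: "j \<in> {2..k}" for j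
    proof -
      have "U j * 1 \<le> U j * (CL * (sqrt (L j) + 1))"
      proof (rule mult_left_mono)
        have "1 * 1 \<le> CL * (sqrt (L j) + 1)" using CL L0[OF j] by (intro mult_mono) auto
        then show "1 \<le> CL * (sqrt (L j) + 1)" by simp
      qed (use U0[of j] in simp)
      then show ?thesis using UE[OF j] U0[of j] by (intro conjI) linarith+
    qed
    have b2: "0 \<le> U j * (L j / W) \<and> U j * (L j / W) \<le> B / \<rho>" if j: "j \<in> {2..k}" for j
    proof -
      have nn: "0 \<le> U j * L j" using L0[OF j] U0[of j] by simp
      have "U j * L j / W \<le> U j * L j / 1" using nn W1 by (intro divide_left_mono) auto
      then show ?thesis using L0[OF j] nn by simp
    qed
    have b3: "\<bar>U j * card (HH t j) - U j * (L j / W)\<bar> \<le> \<tau>" if j: "j \<in> {2..k}" for j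
    proof -
      have "\<bar>U j * card (HH t j) - U j * (L j / W)\<bar> = U j * \<bar>card (HH t j) - L j / W\<bar>"
        unfolding right_diff_distrib[symmetric] abs_mult using U0[of j] by simp
      also have "\<dots> \<le> U j * (CL * (sqrt (L j) + 1))" using cnt[OF j] U0[of j] by (intro mult_left_mono) auto
      finally show ?thesis using UE[OF j] by simp
    qed
    have b4: "gg (h j - h i) \<le> (1 + \<eta>) * gg' (h j - h i)"
      if h: "h \<in> PiE {1..k} (HH t)" "inj_on h {1..k}" and ij: "i \<in> {1..k}" "j \<in> {1..k}" "i < j" for h i j
    proof -
      have ne: "h j - h i \<noteq> 0" using inj_onD[OF h(2) _ ij(2,1)] ij(3) by auto
      have bd: "\<bar>h j\<bar> \<le> int X" if "j \<in> {1..k}" for j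
        using PiE_mem[OF h(1) that] by (auto simp: HH_def H_def shift_set_def split: if_splits)
      have "\<bar>h j - h i\<bar> \<le> 2 * int X" using bd[OF ij(1)] bd[OF ij(2)] by linarith
      then have "\<bar>real_of_int (h j - h i)\<bar> \<le> 2 * real X" by linarith
      then have "gg (h j - h i) \<le> exp (b * (3 * ln X) / y) * gg' (h j - h i)"
        unfolding gg_def gg'_def using X ne b0 by (intro prod_large_prime_divisors_le) auto
      also have "\<dots> \<le> (1 + \<eta>) * gg' (h j - h i)"
        using X(2) gg'1[of "h j - h i"] by (intro mult_right_mono) auto
      finally show ?thesis .
    qed
    have b5: "U j * (\<Sum>q\<in>HH t j. gg' (q - e) - 1) \<le> \<eta> * (U j * (L j / W)) + \<tau> * \<Lambda>" if j: "j \<in> {2..k}" for j e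
    proof -
      have "(\<Sum>q\<in>HH t j. gg' (q - e) - 1) \<le> L j / W * ((\<Prod>p\<in>primes_between w y. 1 + b / real p ^ 2) - 1) + CL * (sqrt (L j) + 1) * \<Lambda>"
        unfolding HHj[OF j] gg'_def \<Lambda>_def
      proof (rule sum_prod_divisors_progression)
        fix d :: nat and c :: int assume d: "d > 0"
        have "t - v j - 1 < t - u j - 1" using uv[of j] j by auto
        from lattice[OF d this j, of c]
        show "real (card {h\<in>{t - v j - 1<..t - u j - 1}. [h = c] (mod int d) \<and> mod1_in (J j) (of_int h * \<alpha>)}) \<le> L j / d + CL * (sqrt (L j) + 1)"
          unfolding L_def by (simp add: abs_le_iff)
      next
        fix p assume p: "p \<in> primes_between w y"
        show "prime p" using p by (rule prime_primes_between)
        show "coprime p W" using coprime_primorial_large[OF p] by (simp add: W_def)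
      qed (use L0[OF j] CL b0 W0 in auto)
      also have "\<dots> \<le> L j / W * \<eta> + CL * (sqrt (L j) + 1) * \<Lambda>"
      proof (intro add_right_mono mult_left_mono)
        have "(\<Prod>p\<in>primes_between w y. 1 + b / real p ^ 2) \<le> exp (\<Sum>p\<in>primes_between w y. b / real p ^ 2)"
          using b0 by (intro prod_one_plus_le_exp) auto
        also have "(\<Sum>p\<in>primes_between w y. b / real p ^ 2) = b * (\<Sum>p\<in>primes_between w y. 1 / real p ^ 2)"
          by (simp add: sum_distrib_left)
        finally have 1: "(\<Prod>p\<in>primes_between w y. 1 + b / real p ^ 2) \<le> exp (b * (\<Sum>p\<in>primes_between w y. 1 / real p ^ 2))" .
        have "b * (\<Sum>p\<in>primes_between w y. 1 / real p ^ 2) \<le> b * (1 / w)"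
          using b0 w by (intro mult_left_mono sum_inverse_squares_primes) auto
        also have "b * (1 / w) = b / w" by simp
        also have "\<dots> \<le> \<eta> / 2" by (rule w(2))
        finally have 2: "b * (\<Sum>p\<in>primes_between w y. 1 / real p ^ 2) \<le> \<eta> / 2" .
        have 3: "0 \<le> b * (\<Sum>p\<in>primes_between w y. 1 / real p ^ 2)" using b0 by (intro mult_nonneg_nonneg sum_nonneg) auto
        have "exp (b * (\<Sum>p\<in>primes_between w y. 1 / real p ^ 2)) \<le> 1 + 2 * (b * (\<Sum>p\<in>primes_between w y. 1 / real p ^ 2))"
          using 2 3 \<eta> by (intro exp_le_one_plus_double) auto
        then show "(\<Prod>p\<in>primes_between w y. 1 + b / real p ^ 2) - 1 \<le> \<eta>" using 1 2 by linarith
        show "0 \<le> L j / W" using L0[OF j] by simp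
      qed
      finally have "U j * (\<Sum>q\<in>HH t j. gg' (q - e) - 1) \<le> U j * (L j / W * \<eta> + CL * (sqrt (L j) + 1) * \<Lambda>)"
        using U0[of j] by (intro mult_left_mono) auto
      also have "\<dots> = \<eta> * (U j * (L j / W)) + (U j * (CL * (sqrt (L j) + 1))) * \<Lambda>" by (simp add: algebra_simps)
      also have "\<dots> \<le> \<eta> * (U j * (L j / W)) + \<tau> * \<Lambda>"
        using UE[OF j] \<Lambda>1 by (intro add_left_mono mult_right_mono) auto
      finally show ?thesis .
    qed
    have \<tau>\<Lambda>: "\<tau> \<le> \<tau> * \<Lambda>" using mult_left_mono[OF \<Lambda>1 \<tau>0(1)] by simp
    have \<eta>1: "\<eta> \<le> 1" using \<eta> by simp
    show "Mn - A3 * \<tau> \<le> PU2 * card (II t)"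
      unfolding Mn_def A3_def PU2_def II_def
      by (rule injective_tuples_bounds(1)[where H = "HH t" and U = U and x = "\<lambda>j. U j * (L j / W)" and B = "B / \<rho>" and \<tau> = \<tau>
          and \<tau>' = "\<tau> * \<Lambda>" and \<eta> = \<eta> and gg = gg and gg' = gg' and k = k])
        ((rule k HH1 finHH b1 b2 b3 \<tau>0 \<tau>\<Lambda> less_imp_le[OF \<eta>(1)] \<eta>1 B\<rho> b4 gg'1 b5; assumption)+)
    show "PU2 * (\<Sum>h\<in>II t. G h) \<le> (1 + 3 * real k ^ 2 * \<eta>) * Mn + A3 * (\<tau> * \<Lambda>)"
      unfolding Mn_def A3_def PU2_def II_def G_def
      by (rule injective_tuples_bounds(2)[where H = "HH t" and U = U and x = "\<lambda>j. U j * (L j / W)" and B = "B / \<rho>" and \<tau> = \<tau>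
          and \<tau>' = "\<tau> * \<Lambda>" and \<eta> = \<eta> and gg = gg and gg' = gg' and k = k])
        ((rule k HH1 finHH b1 b2 b3 \<tau>0 \<tau>\<Lambda> less_imp_le[OF \<eta>(1)] \<eta>1 B\<rho> b4 gg'1 b5; assumption)+)
  qed
  have Y1: "Y1 = card {u 1<..v 1}" "Y1 \<ge> 0" using uv[OF one] by (auto simp: Y1_def)
  have Qeq: "Q = U 1 / W * Y1" by (simp add: Q_def Y1_def)
  have Q0: "U 1 / W \<ge> 0" using U0[of 1] by simp
  \<comment> \<open>Although shifts range up to \<open>X\<close>, the condition modulo 1 leaves at
    most \<open>7 * CL * D\<close> of them for each coordinate. So the sieve remainder is multiplied
    by a power of \<open>D\<close>, not of \<open>X\<close>.\<close>
  have "card I \<le> card (PiE {1..k} H)"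
    unfolding I_def by (intro card_mono finite_PiE finH) auto
  also have "\<dots> = (\<Prod>j\<in>{1..k}. card (H j))" by (simp add: card_PiE)
  finally have "real (card I) \<le> (\<Prod>j\<in>{1..k}. real (card (H j)))"
    by (metis of_nat_le_iff of_nat_prod)
  also have "\<dots> \<le> (\<Prod>j\<in>{1..k}. 7 * CL * D)"
  proof (intro prod_mono conjI)
    fix j assume j: "j \<in> {1..k}"
    show "real (card (H j)) \<le> 7 * CL * D"
    proof (cases "j = 1")
      case True
      have "1 * 1 \<le> CL * D" using CL D by (intro mult_mono) auto
      then show ?thesis using True H1 by simp
    next
      case False
      then have j2: "j \<in> {2..k}" using j by auto
      define \<delta> where "\<delta> = hi j - lo j"
      have \<delta>: "0 \<le> \<delta>" "X * \<delta> \<le> D" using I[OF j2] by (auto simp: \<delta>_def)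
      define s where "s = (2 * real X + 1) * \<delta>"
      have "s \<le> (3 * real X) * \<delta>" unfolding s_def using \<delta> X(1) by (intro mult_right_mono) auto
      then have s: "0 \<le> s" "s \<le> 3 * D" using \<delta> by (auto simp: s_def)
      have "H j = {h\<in>{- int X - 1<..int X}. [h = c 1 - c j] (mod int W) \<and> mod1_in (J j) (of_int h * \<alpha>)}"
        using False by (auto simp: H_def shift_set_def)
      moreover have "- int X - 1 < int X" by simp
      ultimately have "\<bar>real (card (H j)) - (int X - (- int X - 1)) * (hi j - lo j) / W\<bar> \<le> CL * (sqrt ((int X - (- int X - 1)) * (hi j - lo j)) + 1)"
        using lattice[OF W0 _ j2, of "- int X - 1" "int X" "c 1 - c j"] by simp
      then have "real (card (H j)) \<le> s / W + CL * (sqrt s + 1)"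
        unfolding s_def \<delta>_def abs_le_iff by (simp add: algebra_simps)
      also have "s / W \<le> s / 1" using s W1 by (intro divide_left_mono) auto
      then have "s / W + CL * (sqrt s + 1) \<le> s + CL * (sqrt s + 1)" by simp
      also have "sqrt s \<le> sqrt (3 * D)" using s by simp
      then have "sqrt s \<le> 3 * D" using sqrt_le_self[of "3 * D"] D by linarith
      then have "s + CL * (sqrt s + 1) \<le> 3 * D + CL * (3 * D + D)"
        using s D CL by (intro add_mono mult_left_mono) auto
      also have "\<dots> \<le> 3 * (CL * D) + CL * (3 * D + D)"
        using CL D by (simp add: mult_le_cancel_right1)
      also have "\<dots> = 7 * CL * D" by (simp add: algebra_simps)
      finally show ?thesis .
    qed
  qed auto
  also have "\<dots> = (7 * CL * D) ^ k" by simp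
  finally have cI: "card I * R \<le> (7 * CL * D) ^ k * R" using R by (intro mult_right_mono) auto
  show "(1 - 2 * \<eta>) * (Q * (Mn - A3 * (A2 * sqrt \<sigma>))) - (7 * CL * D) ^ k * R \<le> card T"
  proof -
    have True: "1 - 2 * \<eta> \<ge> 0" using \<eta> by simp
    have "(\<Sum>t\<in>{u 1<..v 1}. Mn - A3 * \<tau>) \<le> (\<Sum>t\<in>{u 1<..v 1}. PU2 * card (II t))"
      using inner(1) by (intro sum_mono) auto
    then have "Y1 * (Mn - A3 * \<tau>) \<le> PU2 * (\<Sum>h\<in>I. len h * 1)"
      unfolding swap by (simp add: Y1(1) sum_distrib_left)
    then have "(1 - 2 * \<eta>) * (U 1 / W) * (Y1 * (Mn - A3 * \<tau>)) \<le> (1 - 2 * \<eta>) * (U 1 / W) * (PU2 * (\<Sum>h\<in>I. len h * 1))"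
      using True Q0 by (intro mult_left_mono mult_nonneg_nonneg) auto
    also have "\<dots> = (\<Sum>h\<in>I. (1 - 2 * \<eta>) * PU / W * (len h * 1))"
      unfolding PU sum_distrib_left[symmetric] by simp
    finally have "(1 - 2 * \<eta>) * (Q * (Mn - A3 * \<tau>)) - card I * R \<le> (\<Sum>h\<in>I. (1 - 2 * \<eta>) * PU / W * (len h * 1) - R)"
      by (simp add: Qeq sum_subtractf mult_ac)
    also have "\<dots> \<le> card T" unfolding cardT by (intro sum_mono lower_h)
    finally show ?thesis using cI unfolding \<tau>_def by linarith
  qed
  have "card T \<le> (\<Sum>h\<in>I. (1 + \<eta>) * PU / W * (len h * G h) + R)"
    unfolding cardT by (intro sum_mono upper_h)
  also have "\<dots> = (1 + \<eta>) * (U 1 / W) * (PU2 * (\<Sum>h\<in>I. len h * G h)) + card I * R"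
    unfolding PU sum.distrib sum_distrib_left[symmetric] by simp
  also have "PU2 * (\<Sum>h\<in>I. len h * G h) = (\<Sum>t\<in>{u 1<..v 1}. PU2 * (\<Sum>h\<in>II t. G h))"
    unfolding swap by (simp add: sum_distrib_left)
  finally have T1: "card T \<le> (1 + \<eta>) * (U 1 / W) * (\<Sum>t\<in>{u 1<..v 1}. PU2 * (\<Sum>h\<in>II t. G h)) + card I * R" .
  have "(\<Sum>t\<in>{u 1<..v 1}. PU2 * (\<Sum>h\<in>II t. G h)) \<le> (\<Sum>t\<in>{u 1<..v 1}. (1 + 3 * real k ^ 2 * \<eta>) * Mn + A3 * (\<tau> * \<Lambda>))"
    using inner(2) by (intro sum_mono) auto
  also have "\<dots> = Y1 * ((1 + 3 * real k ^ 2 * \<eta>) * Mn + A3 * (\<tau> * \<Lambda>))" by (simp add: Y1(1))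
  finally have "(1 + \<eta>) * (U 1 / W) * (\<Sum>t\<in>{u 1<..v 1}. PU2 * (\<Sum>h\<in>II t. G h)) \<le>
      (1 + \<eta>) * (U 1 / W) * (Y1 * ((1 + 3 * real k ^ 2 * \<eta>) * Mn + A3 * (\<tau> * \<Lambda>)))"
    using \<eta> Q0 by (intro mult_left_mono mult_nonneg_nonneg) auto
  also have "\<dots> = (1 + \<eta>) * (Q * ((1 + 3 * real k ^ 2 * \<eta>) * Mn + A3 * (A2 * sqrt \<sigma> * \<Lambda>)))"
    by (simp add: Qeq \<tau>_def)
  finally show "card T \<le> (1 + \<eta>) * (Q * ((1 + 3 * real k ^ 2 * \<eta>) * Mn + A3 * (A2 * sqrt \<sigma> * \<Lambda>))) + (7 * CL * D) ^ k * R"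
    using T1 cI by linarith
qed

text \<open>Sums the classes modulo \<open>primorial w\<close>. As \<open>w\<close> depends only on
  \<open>k\<close> and \<open>\<eta>\<close>, the modulus, \<open>\<rho>\<close> and all quantities
  built from them are absorbed into \<open>A\<close>, which also serves as the exponent of
  \<open>ln (ln X)\<close>. The error that decides is the one with \<open>sqrt \<sigma>\<close>; the
  last one is the sieve remainder over all shift tuples.\<close>

lemma tuple_count:
  fixes k :: nat and \<alpha> B \<eta> :: real
  assumes k: "k \<ge> 1" and \<alpha>: "badly_approximable \<alpha>" and B: "B \<ge> 1" and \<eta>: "0 < \<eta>" "\<eta> \<le> 1"
  obtains w :: nat and A C :: real where "A \<ge> 1" "C \<ge> 0"
    "\<And>(X::nat) (u::nat \<Rightarrow> int) (v::nat \<Rightarrow> int) (z::nat \<Rightarrow> real) (lo::nat \<Rightarrow> real) (hi::nat \<Rightarrow> real) (J::nat \<Rightarrow> real set) (x::real) (\<sigma>::real) (D::real).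
      ln X \<ge> A \<Longrightarrow> (\<And>j. j \<in> {1..k} \<Longrightarrow> 0 \<le> u j \<and> u j < v j \<and> v j \<le> int X) \<Longrightarrow>
      (\<And>j. j \<in> {1..k} \<Longrightarrow> w \<le> z j \<and> z j \<le> x \<and> mertens_prod 0 (z j) \<le> \<sigma>) \<Longrightarrow>
      (\<And>j. j \<in> {2..k} \<Longrightarrow> lo j \<le> hi j \<and> hi j - lo j < 1 \<and> {lo j<..<hi j} \<subseteq> J j \<and> J j \<subseteq> {lo j..hi j} \<and>
         mertens_prod 0 (z j) * (real_of_int (v j - u j) * (hi j - lo j)) \<le> B \<and> X * (hi j - lo j) \<le> D) \<Longrightarrow>
      x \<ge> 2 \<Longrightarrow> 0 \<le> \<sigma> \<Longrightarrow> A * sqrt \<sigma> \<le> 1 \<Longrightarrow> D \<ge> 1 \<Longrightarrow>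
      \<bar>real (card (tuple_set k u v z J \<alpha>)) - real_of_int (v 1 - u 1) * mertens_prod 0 (z 1) * (\<Prod>j\<in>{2..k}. mertens_prod 0 (z j) * (real_of_int (v j - u j) * (hi j - lo j)))\<bar> \<le>
        \<eta> * (real_of_int (v 1 - u 1) * mertens_prod 0 (z 1) * (\<Prod>j\<in>{2..k}. mertens_prod 0 (z j) * (real_of_int (v j - u j) * (hi j - lo j)))) +
        A * (real_of_int (v 1 - u 1) * mertens_prod 0 (z 1)) * sqrt \<sigma> * ln (ln X) powr A + A * D ^ k * x powr C"
proof -
  define b where "b = (2::real) ^ (k * k ^ 2 + 1)"
  \<comment> \<open>The factor \<open>(1 + \<eta>1) * (1 + 3 * k^2 * \<eta>1)\<close> of the upper
    bound exceeds 1 by at most \<open>(1 + 3 + 3) * k^2 * \<eta>1\<close>, whence the 7.\<close>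
  define \<eta>1 where "\<eta>1 = \<eta> / (7 * real k ^ 2)"
  have k2: "real k ^ 2 \<ge> 1" using k by simp
  have \<eta>1: "0 < \<eta>1" "7 * (real k ^ 2 * \<eta>1) = \<eta>" using \<eta> k by (auto simp: \<eta>1_def)
  have \<eta>1k: "\<eta>1 \<le> real k ^ 2 * \<eta>1" using mult_right_mono[OF k2, of \<eta>1] \<eta>1 by simp
  have \<eta>1h: "\<eta>1 \<le> 1 / 2" "7 * \<eta>1 \<le> \<eta>" using \<eta>1 \<eta>1k \<eta> by linarith+
  have b0: "b \<ge> 0" by (simp add: b_def)
  obtain w0 :: nat and C :: real where C: "C \<ge> 0" and sieve: "\<And>(w::nat) (x::real) (z::nat \<Rightarrow> real) (h :: nat \<Rightarrow> int) (u::int) (v::int) (c::int) (W::int).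
       w \<ge> w0 \<Longrightarrow> x \<ge> 2 \<Longrightarrow> u \<le> v \<Longrightarrow> W > 0 \<Longrightarrow>
       (\<And>p. p \<in> primes_between w x \<Longrightarrow> coprime (int p) W) \<Longrightarrow> (\<And>j. j \<in> {1..k} \<Longrightarrow> z j \<le> x) \<Longrightarrow>
       \<bar>real (card {t\<in>{u<..v}. [t = c] (mod W) \<and> (\<forall>j\<in>{1..k}. \<forall>p\<in>primes_between w (z j). \<not> int p dvd t - h j)})
          - (v - u) / W * sifted_density k w x z h\<bar> \<le>
         \<eta>1 * ((v - u) / W * sifted_density k w x z h) + x powr C"
    by (rule sieve_shifts[OF \<eta>1(1), of k]) blast
  obtain CL :: real where CL: "CL \<ge> 1" and lattice: "\<And>(d::nat) (c::int) (u::int) (v::int) (lo::real) (hi::real) J. d > 0 \<Longrightarrow> u < v \<Longrightarrow> {lo<..<hi} \<subseteq> J \<Longrightarrow> J \<subseteq> {lo..hi} \<Longrightarrow>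
       lo \<le> hi \<Longrightarrow> hi - lo < 1 \<Longrightarrow>
       \<bar>real (card {h\<in>{u<..v}. [h = c] (mod int d) \<and> mod1_in J (of_int h * \<alpha>)}) - (v - u) * (hi - lo) / d\<bar> \<le>
         CL * (sqrt ((v - u) * (hi - lo)) + 1)"
    by (rule rotation_progression_count[OF \<alpha>]) blast
  \<comment> \<open>Large enough for the sieve and for both second-order losses:
    \<open>k^2 / w\<close> in the lower bound for the singular series and \<open>b / w\<close> in
    its average.\<close>
  define w where "w = w0 + 2 + k + nat \<lceil>real k ^ 2 / \<eta>1\<rceil> + nat \<lceil>2 * b / \<eta>1\<rceil>"
  have w: "w \<ge> w0" "w \<ge> 2" "w \<ge> k" "w \<ge> 1" by (auto simp: w_def)
  have "real k ^ 2 / \<eta>1 \<le> w" "2 * b / \<eta>1 \<le> w" unfolding w_def by linarith+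
  then have wk: "real k ^ 2 / w \<le> \<eta>1" and wb: "b / w \<le> \<eta>1 / 2"
    using \<eta>1(1) w by (simp_all add: field_simps)
  define W where "W = primorial w"
  define \<rho> where "\<rho> = mertens_prod 0 w"
  have W0: "W > 0" unfolding W_def by (rule primorial_pos)
  then have W1: "real W \<ge> 1" by linarith
  have \<rho>: "0 < \<rho>" "\<rho> \<le> 1" unfolding \<rho>_def using mertens_prod_pos mertens_prod_le_1 by auto
  define A2 where "A2 = CL * (B + 1) / \<rho>"
  define A3 where "A3 = 6 * (real k + 1) ^ 3 * (B / \<rho> + 1) ^ k"
  define \<Lambda>0 where "\<Lambda>0 = exp (b * (24 * ln 2 + 20))"
  have A23: "A2 \<ge> 0" "A3 \<ge> 0" "\<Lambda>0 \<ge> 0" using CL B \<rho> by (auto simp: A2_def A3_def \<Lambda>0_def)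
  define A where "A = 1 + A2 + real w + 4 + 6 * b / \<eta>1 + 2 * real W ^ k * A3 * A2 * \<Lambda>0 + 24 * b + (7 * real W * CL) ^ k"
  have A: "A \<ge> 1" "A \<ge> A2" "A \<ge> real w" "A \<ge> 4" "A \<ge> 6 * b / \<eta>1" "A \<ge> 2 * real W ^ k * A3 * A2 * \<Lambda>0" "A \<ge> 24 * b" "A \<ge> (7 * real W * CL) ^ k"
  proof -
    have p1: "0 \<le> 6 * b / \<eta>1" "0 \<le> 24 * b" "0 \<le> real w" using b0 \<eta>1 by auto
    have p2: "0 \<le> 2 * real W ^ k * A3 * A2 * \<Lambda>0" using A23 by simp
    have p3: "0 \<le> (7 * real W * CL) ^ k" using CL by simp
    show "A \<ge> 1" "A \<ge> A2" "A \<ge> real w" "A \<ge> 4" "A \<ge> 6 * b / \<eta>1" "A \<ge> 2 * real W ^ k * A3 * A2 * \<Lambda>0" "A \<ge> 24 * b" "A \<ge> (7 * real W * CL) ^ k"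
      unfolding A_def using p1 p2 p3 A23(1) by linarith+
  qed
  show thesis
  proof (rule that[of A C w], goal_cases)
    case 1 show ?case by (rule A(1))
  next
    case 2 show ?case by (rule C)
  next
    case (3 X u v z lo hi J x \<sigma> D)
    note lnX = 3(1) and uv = 3(2) and zz = 3(3) and I = 3(4) and x = 3(5) and \<sigma>0 = 3(6) and A\<sigma> = 3(7) and D = 3(8)
    define lam where "lam = ln (ln X)"
    \<comment> \<open>A compromise: primes above \<open>(ln X)^2\<close> dividing a difference
      contribute at most \<open>exp (3 * b / ln X)\<close>, while
      \<open>ln y = 2 * ln (ln X)\<close> keeps \<open>\<Lambda>\<close> below a power of
      \<open>ln (ln X)\<close>.\<close>
    define y where "y = (ln X)\<^sup>2"
    have lnX4: "ln X \<ge> 4" using lnX A(4) by linarith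
    then have X: "X \<ge> 2" by (cases "X = 0 \<or> X = 1") auto
    have y: "ln X \<le> y" "y \<ge> 16" "y > 0" "w \<le> y"
    proof -
      show 1: "ln X \<le> y" unfolding y_def power2_eq_square using lnX4 by (simp add: mult_le_cancel_left1)
      have "4 * 4 \<le> y" unfolding y_def power2_eq_square using lnX4 by (intro mult_mono) auto
      then show 2: "y \<ge> 16" by simp
      then show "y > 0" by simp
      show "w \<le> y" using 1 lnX A(3) by linarith
    qed
    have lam1: "lam \<ge> 1"
    proof -
      have "exp 1 \<le> ln X" using lnX4 e_less_272 by linarith
      then have "ln (exp 1) \<le> ln (ln X)" using lnX4 by (subst ln_le_cancel_iff) auto
      then show ?thesis by (simp add: lam_def)
    qed
    have sq1: "sqrt \<sigma> \<le> 1"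
    proof -
      have "1 * sqrt \<sigma> \<le> A * sqrt \<sigma>" using A(1) \<sigma>0 by (intro mult_right_mono) auto
      then show ?thesis using A\<sigma> by linarith
    qed
    then have \<sigma>1: "\<sigma> \<le> 1" by simp
    have A2\<sigma>: "A2 * sqrt \<sigma> \<le> 1"
      using mult_right_mono[OF A(2), of "sqrt \<sigma>"] \<sigma>0 A\<sigma> by simp
    have expy: "exp (b * (3 * ln X) / y) \<le> 1 + \<eta>1"
    proof -
      have e: "b * (3 * ln X) / y = 3 * b / ln X" using lnX4 by (simp add: y_def power2_eq_square)
      have "6 * b / \<eta>1 \<le> ln X" using A(5) lnX by linarith
      then have h: "3 * b / ln X \<le> \<eta>1 / 2" using \<eta>1(1) lnX4 by (simp add: field_simps)
      have "exp (3 * b / ln X) \<le> 1 + 2 * (3 * b / ln X)"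
      proof (rule exp_le_one_plus_double)
        show "3 * b / ln X \<le> 1" using h \<eta>1h by linarith
      qed (use b0 lnX4 in auto)
      then show ?thesis unfolding e using h by linarith
    qed
    define \<Lambda> where "\<Lambda> = (\<Prod>p\<in>primes_between w y. 1 + b / real p)"
    have \<Lambda>1: "1 \<le> \<Lambda>" unfolding \<Lambda>_def using b0 by (intro prod_ge_1) auto
    have \<Lambda>: "\<Lambda> \<le> \<Lambda>0 * lam powr A"
    proof -
      have "\<Lambda> \<le> exp (b * (24 * ln (ln y) + 20))"
        unfolding \<Lambda>_def using b0 y by (intro prod_one_plus_inverse_primes_le) auto
      also have "ln y = 2 * lam" using lnX4 by (simp add: y_def lam_def ln_realpow)
      also have "ln (2 * lam) = ln 2 + ln lam" using lam1 by (simp add: ln_mult)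
      also have "exp (b * (24 * (ln 2 + ln lam) + 20)) = \<Lambda>0 * lam powr (24 * b)"
        using lam1 by (simp add: \<Lambda>0_def powr_def algebra_simps flip: exp_add)
      also have "\<dots> \<le> \<Lambda>0 * lam powr A"
        using A(7) lam1 A23 by (intro mult_left_mono powr_mono) auto
      finally show ?thesis .
    qed
    define U where "U j = mertens_prod w (z j)" for j
    define V where "V j = mertens_prod 0 (z j)" for j
    define L where "L j = real_of_int (v j - u j) * (hi j - lo j)" for j
    define Y1 where "Y1 = real_of_int (v 1 - u 1)"
    define Q where "Q = U 1 / W * Y1"
    define Mn where "Mn = (\<Prod>j\<in>{2..k}. U j * (L j / W))"
    define M where "M = Y1 * V 1 * (\<Prod>j\<in>{2..k}. V j * L j)"
    define R where "R = x powr C"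
    have R0: "R \<ge> 0" by (simp add: R_def)
    let ?RR = "{r\<in>{0..<int W}. coprime r (int W)}"
    define CC where "CC = PiE {1..k} (\<lambda>_. ?RR)"
    define T where "T c = {a \<in> PiE {1..k} (\<lambda>j. {u j<..v j}). inj_on a {1..k} \<and>
     (\<forall>j\<in>{2..k}. mod1_in (J j) (of_int (a 1 - a j) * \<alpha>)) \<and>
     (\<forall>j\<in>{1..k}. [a j = c j] (mod int W) \<and> (\<forall>p\<in>primes_between w (z j). \<not> int p dvd a j))}" for c :: "nat \<Rightarrow> int"
    define lower where "lower = (1 - 2 * \<eta>1) * (Q * (Mn - A3 * (A2 * sqrt \<sigma>))) - (7 * CL * D) ^ k * R"
    define upper where "upper = (1 + \<eta>1) * (Q * ((1 + 3 * real k ^ 2 * \<eta>1) * Mn + A3 * (A2 * sqrt \<sigma> * \<Lambda>))) + (7 * CL * D) ^ k * R"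
    have cls: "lower \<le> card (T c) \<and> card (T c) \<le> upper" for c
    proof -
      have sv: "\<bar>real (card {t\<in>{u<..v}. [t = c 1] (mod int (primorial w)) \<and> (\<forall>j\<in>{1..k}. \<forall>p\<in>primes_between w (z j). \<not> int p dvd t - h j)})
          - (v - u) / primorial w * sifted_density k w x z h\<bar> \<le> \<eta>1 * ((v - u) / primorial w * sifted_density k w x z h) + R"
        if "u \<le> v" for h and u v :: int
        using sieve[of w x u v "int (primorial w)" z "c 1" h] that w x zz coprime_primorial_large[of _ w x] W0
        unfolding R_def W_def by simp
      have lt: "\<bar>real (card {h\<in>{u<..v}. [h = c] (mod int d) \<and> mod1_in (J j) (of_int h * \<alpha>)}) - (v - u) * (hi j - lo j) / d\<bar> \<le>
         CL * (sqrt ((v - u) * (hi j - lo j)) + 1)" if "d > 0" "u < v" "j \<in> {2..k}" for d j :: nat and c u v :: int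
        using lattice[of d u v "lo j" "hi j" "J j" c] I[OF that(3)] that by blast
      have c1: "mertens_prod 0 (z j) \<le> \<sigma>" if "j \<in> {1..k}" for j using zz[OF that] by blast
      have c2: "z j \<le> x" if "j \<in> {1..k}" for j using zz[OF that] by blast
      have c3: "real w \<le> z j" if "j \<in> {1..k}" for j using zz[OF that] by blast
      have c4: "lo j \<le> hi j \<and> mertens_prod 0 (z j) * (real_of_int (v j - u j) * (hi j - lo j)) \<le> B \<and> real X * (hi j - lo j) \<le> D"
        if "j \<in> {2..k}" for j using I[OF that] by blast
      have "lower \<le> card (T c)"
        unfolding lower_def T_def Q_def Mn_def A3_def A2_def U_def L_def W_def \<rho>_def Y1_def
        by (rule tuple_count_class(1)[where k = k and w = w and \<eta> = \<eta>1 and R = R and CL = CL and X = X and y = y and u = u and v = v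
            and z = z and lo = lo and hi = hi and x = x and \<sigma> = \<sigma> and B = B and D = D and c = c and J = J and \<alpha> = \<alpha>])
          ((rule k \<eta>1(1) \<eta>1h(1) wk wb[unfolded b_def] w(3) w(4) sv R0 CL lt X expy[unfolded b_def] y(3) y(4) uv c2 c3 c1 c4 B D \<sigma>0 \<sigma>1 A2\<sigma>[unfolded A2_def \<rho>_def]; assumption)+)
      moreover have "card (T c) \<le> upper"
        unfolding upper_def T_def Q_def Mn_def \<Lambda>_def b_def A3_def A2_def U_def L_def W_def \<rho>_def Y1_def
        by (rule tuple_count_class(2)[where k = k and w = w and \<eta> = \<eta>1 and R = R and CL = CL and X = X and y = y and u = u and v = v
            and z = z and lo = lo and hi = hi and x = x and \<sigma> = \<sigma> and B = B and D = D and c = c and J = J and \<alpha> = \<alpha>])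
          ((rule k \<eta>1(1) \<eta>1h(1) wk wb[unfolded b_def] w(3) w(4) sv R0 CL lt X expy[unfolded b_def] y(3) y(4) uv c2 c3 c1 c4 B D \<sigma>0 \<sigma>1 A2\<sigma>[unfolded A2_def \<rho>_def]; assumption)+)
      ultimately show ?thesis by blast
    qed
    have cardT: "card (tuple_set k u v z J \<alpha>) = (\<Sum>c\<in>CC. card (T c))"
      unfolding CC_def T_def W_def using zz by (intro card_tuple_set_residues) blast
    \<comment> \<open>The number of residue vectors, which is the \<open>k\<close>-th power of the
      totient of \<open>W\<close>. Multiplication by it turns each \<open>U j / W\<close> into
      \<open>V j\<close>.\<close>
    define N where "N = (real W * \<rho>) ^ k"
    have cardCC: "real (card CC) = N"
    proof -
      have "card CC = card ?RR ^ k" by (simp add: CC_def card_PiE)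
      moreover have "real (card ?RR) = W * \<rho>" unfolding W_def \<rho>_def by (rule card_coprime_residues[OF w(2)])
      ultimately show ?thesis by (simp add: N_def)
    qed
    have lo1: "N * lower \<le> card (tuple_set k u v z J \<alpha>)"
    proof -
      have "(\<Sum>c\<in>CC. lower) \<le> (\<Sum>c\<in>CC. real (card (T c)))" using cls by (intro sum_mono) blast
      then show ?thesis by (simp add: cardT cardCC)
    qed
    have up1: "card (tuple_set k u v z J \<alpha>) \<le> N * upper"
    proof -
      have "(\<Sum>c\<in>CC. real (card (T c))) \<le> (\<Sum>c\<in>CC. upper)" using cls by (intro sum_mono) blast
      then show ?thesis by (simp add: cardT cardCC)
    qed
    have one: "1 \<in> {1..k}" using k by simp
    have VU: "V j = \<rho> * U j" if "j \<in> {1..k}" for j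
      unfolding V_def \<rho>_def U_def using zz[OF that] by (intro mertens_prod_split) auto
    have Y1: "Y1 \<ge> 0" using uv[OF one] by (simp add: Y1_def)
    have V0: "V j > 0" "U j > 0" for j unfolding V_def U_def by (rule mertens_prod_pos)+
    have N_split: "N = (W * \<rho>) * (\<Prod>j\<in>{2..k}. W * \<rho>)"
      unfolding N_def using k by (simp add: power_Suc[symmetric] del: power_Suc)
    have NQM: "N * (Q * Mn) = M"
    proof -
      have "N * (Q * Mn) = (W * \<rho> * (U 1 / W * Y1)) * (\<Prod>j\<in>{2..k}. W * \<rho> * (U j * (L j / W)))"
        unfolding N_split Q_def Mn_def prod.distrib by (simp only: mult_ac)
      also have "(\<Prod>j\<in>{2..k}. W * \<rho> * (U j * (L j / W))) = (\<Prod>j\<in>{2..k}. V j * L j)"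
        using W0 VU by (intro prod.cong) auto
      also have "W * \<rho> * (U 1 / W * Y1) = Y1 * V 1" using W0 VU[OF one] by simp
      finally show ?thesis by (simp add: M_def)
    qed
    define P where "P = N * Q"
    have P: "0 \<le> P" "P \<le> real W ^ k * (Y1 * V 1)"
    proof -
      have "P = (W * \<rho> * (U 1 / W * Y1)) * (W * \<rho>) ^ (k - 1)"
        unfolding P_def N_split Q_def by simp
      also have "W * \<rho> * (U 1 / W * Y1) = Y1 * V 1" using W0 VU[OF one] by simp
      finally have P: "P = Y1 * V 1 * (W * \<rho>) ^ (k - 1)" .
      show "0 \<le> P" unfolding P using Y1 V0(1)[of 1] \<rho> by simp
      have "(W * \<rho>) ^ (k - 1) \<le> real W ^ (k - 1)"
        using \<rho> by (intro power_mono) (auto simp: mult_left_le)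
      also have "\<dots> \<le> real W ^ k" using W1 by (intro power_increasing) auto
      finally have "Y1 * V 1 * (W * \<rho>) ^ (k - 1) \<le> Y1 * V 1 * real W ^ k"
        using Y1 V0(1)[of 1] by (intro mult_left_mono mult_nonneg_nonneg) auto
      then show "P \<le> real W ^ k * (Y1 * V 1)" unfolding P by (simp add: mult_ac)
    qed
    have L0: "L j \<ge> 0" if j: "j \<in> {2..k}" for j
      unfolding L_def using I[OF j] uv[of j] j by auto
    have M0: "M \<ge> 0"
      unfolding M_def using Y1 V0(1) L0 by (intro mult_nonneg_nonneg prod_nonneg) (auto intro: less_imp_le)
    define E where "E = A3 * (A2 * sqrt \<sigma>)"
    have E0: "E \<ge> 0" using A23 \<sigma>0 by (simp add: E_def)
    have EL: "E \<le> E * \<Lambda>" using mult_left_mono[OF \<Lambda>1 E0] by simp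
    define HR where "HR = N * ((7 * CL * D) ^ k * R)"
    have HR: "HR \<le> A * D ^ k * R"
    proof -
      have "N \<le> real W ^ k" unfolding N_def using \<rho> by (intro power_mono) (auto simp: mult_left_le)
      then have "HR \<le> real W ^ k * ((7 * CL * D) ^ k * R)"
        unfolding HR_def using CL D R0 by (intro mult_right_mono) auto
      also have "\<dots> = (7 * real W * CL) ^ k * (D ^ k * R)" by (simp add: power_mult_distrib mult_ac)
      also have "\<dots> \<le> A * (D ^ k * R)" using A(8) D R0 by (intro mult_right_mono) auto
      finally show ?thesis by (simp add: mult.assoc)
    qed
    define Err where "Err = A * (Y1 * V 1) * sqrt \<sigma> * lam powr A"
    have PE: "2 * (P * (E * \<Lambda>)) \<le> Err"
    proof -
      have "2 * (P * (E * \<Lambda>)) \<le> 2 * (real W ^ k * (Y1 * V 1) * (E * (\<Lambda>0 * lam powr A)))"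
        using P E0 \<Lambda> \<Lambda>1 Y1 V0(1)[of 1] by (intro mult_left_mono mult_mono) auto
      also have "\<dots> = (2 * real W ^ k * A3 * A2 * \<Lambda>0) * ((Y1 * V 1) * sqrt \<sigma> * lam powr A)"
        by (simp add: E_def mult_ac)
      also have "\<dots> \<le> A * ((Y1 * V 1) * sqrt \<sigma> * lam powr A)"
        using A(6) Y1 V0(1)[of 1] \<sigma>0 by (intro mult_right_mono) auto
      finally show ?thesis by (simp add: Err_def mult.assoc)
    qed
    have low: "M - \<eta> * M - Err - A * D ^ k * R \<le> card (tuple_set k u v z J \<alpha>)"
    proof -
      have "N * lower = (1 - 2 * \<eta>1) * (N * (Q * Mn) - P * E) - HR"
        unfolding lower_def P_def E_def HR_def by (simp add: algebra_simps)
      then have "N * lower = M - 2 * \<eta>1 * M - (1 - 2 * \<eta>1) * (P * E) - HR"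
        unfolding NQM by (simp add: algebra_simps)
      moreover have "2 * \<eta>1 * M \<le> \<eta> * M" using \<eta>1h \<eta>1 M0 by (intro mult_right_mono) auto
      moreover have "(1 - 2 * \<eta>1) * (P * E) \<le> 1 * (P * E)" using \<eta>1 P E0 by (intro mult_right_mono) auto
      moreover have "P * E \<le> P * (E * \<Lambda>)" using EL P by (intro mult_left_mono) auto
      moreover have "0 \<le> P * (E * \<Lambda>)" using P E0 \<Lambda>1 by simp
      ultimately show ?thesis using lo1 PE HR by linarith
    qed
    have upp: "card (tuple_set k u v z J \<alpha>) \<le> M + \<eta> * M + Err + A * D ^ k * R"
    proof -
      have "N * upper = (1 + \<eta>1) * (1 + 3 * real k ^ 2 * \<eta>1) * (N * (Q * Mn)) + (1 + \<eta>1) * (P * (E * \<Lambda>)) + HR"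
        unfolding upper_def P_def E_def HR_def by (simp add: algebra_simps)
      then have eq: "N * upper = (1 + \<eta>1) * (1 + 3 * real k ^ 2 * \<eta>1) * M + (1 + \<eta>1) * (P * (E * \<Lambda>)) + HR"
        unfolding NQM .
      have "(1 + \<eta>1) * (1 + 3 * real k ^ 2 * \<eta>1) \<le> 1 + \<eta>"
      proof -
        have "\<eta>1 * (3 * real k ^ 2 * \<eta>1) \<le> 1 * (3 * real k ^ 2 * \<eta>1)"
          using \<eta>1h \<eta>1 by (intro mult_right_mono) auto
        moreover have "(1 + \<eta>1) * (1 + 3 * real k ^ 2 * \<eta>1) = 1 + \<eta>1 + 3 * (real k ^ 2 * \<eta>1) + \<eta>1 * (3 * real k ^ 2 * \<eta>1)"
          by (simp add: algebra_simps)
        ultimately show ?thesis using \<eta>1k \<eta>1 by linarith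
      qed
      then have "(1 + \<eta>1) * (1 + 3 * real k ^ 2 * \<eta>1) * M \<le> (1 + \<eta>) * M" using M0 by (rule mult_right_mono)
      moreover have "(1 + \<eta>1) * (P * (E * \<Lambda>)) \<le> 2 * (P * (E * \<Lambda>))"
        using \<eta>1h P E0 \<Lambda>1 by (intro mult_right_mono) auto
      moreover have "(1 + \<eta>) * M = M + \<eta> * M" by (simp add: algebra_simps)
      ultimately show ?thesis using up1 eq PE HR by linarith
    qed
    have "\<bar>real (card (tuple_set k u v z J \<alpha>)) - M\<bar> \<le> \<eta> * M + Err + A * D ^ k * R"
      using low upp by linarith
    then show ?case
      unfolding M_def Err_def R_def Y1_def V_def L_def lam_def .
  qed
qed

section \<open>Tuples from rough numbers\<close>

text \<open>The correlation count with differences taken modulo 1; the wrap-around tuples it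
  includes are removed later.\<close>

definition corr_set :: "nat \<Rightarrow> int set \<Rightarrow> (nat \<Rightarrow> real set) \<Rightarrow> real \<Rightarrow> (nat \<Rightarrow> int) set" where
  "corr_set k A J \<alpha> = {a \<in> PiE {1..k} (\<lambda>_. A). inj_on a {1..k} \<and>
     (\<forall>j\<in>{2..k}. mod1_in (J j) (of_int (a 1 - a j) * \<alpha>))}"

definition bohr_set :: "int \<Rightarrow> real set \<Rightarrow> real \<Rightarrow> int set" where
  "bohr_set X J \<alpha> = {h\<in>{-X..X}. mod1_in J (of_int h * \<alpha>)}"

lemma finite_bohr_set: "finite (bohr_set X J \<alpha>)"
  unfolding bohr_set_def by (rule finite_subset[of _ "{-X..X}"]) auto

lemma card_bohr_set_le:
  assumes "badly_approximable \<alpha>"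
  obtains C :: real where "C \<ge> 1"
    "\<And>(X::nat) (lo::real) (hi::real) J D. X \<ge> 1 \<Longrightarrow> {lo<..<hi} \<subseteq> J \<Longrightarrow> J \<subseteq> {lo..hi} \<Longrightarrow> lo \<le> hi \<Longrightarrow> hi - lo < 1 \<Longrightarrow>
       X * (hi - lo) \<le> D \<Longrightarrow> D \<ge> 1 \<Longrightarrow> real (card (bohr_set (int X) J \<alpha>)) \<le> C * D"
proof -
  obtain CL :: real where CL: "CL \<ge> 1" and lattice: "\<And>(d::nat) (c::int) (u::int) (v::int) (lo::real) (hi::real) J. d > 0 \<Longrightarrow> u < v \<Longrightarrow> {lo<..<hi} \<subseteq> J \<Longrightarrow> J \<subseteq> {lo..hi} \<Longrightarrow>
       lo \<le> hi \<Longrightarrow> hi - lo < 1 \<Longrightarrow>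
       \<bar>real (card {h\<in>{u<..v}. [h = c] (mod int d) \<and> mod1_in J (of_int h * \<alpha>)}) - (v - u) * (hi - lo) / d\<bar> \<le>
         CL * (sqrt ((v - u) * (hi - lo)) + 1)"
    by (rule rotation_progression_count[OF assms]) blast
  show thesis
  proof (rule that[of "3 + 4 * CL"], goal_cases)
    case 1 show ?case using CL by simp
  next
    case (2 X lo hi J D)
    define s where "s = (2 * real X + 1) * (hi - lo)"
    have "s \<le> (3 * real X) * (hi - lo)" unfolding s_def using 2 by (intro mult_right_mono) auto
    then have s: "0 \<le> s" "s \<le> 3 * D" using 2 by (auto simp: s_def)
    have "bohr_set (int X) J \<alpha> = {h\<in>{- int X - 1<..int X}. [h = 0] (mod int 1) \<and> mod1_in J (of_int h * \<alpha>)}"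
      by (auto simp: bohr_set_def cong_def)
    moreover have "- int X - 1 < int X" by simp
    ultimately have "\<bar>real (card (bohr_set (int X) J \<alpha>)) - (int X - (- int X - 1)) * (hi - lo) / real 1\<bar> \<le> CL * (sqrt ((int X - (- int X - 1)) * (hi - lo)) + 1)"
      using lattice[of 1 "- int X - 1" "int X" lo hi J 0] 2 by simp
    then have "real (card (bohr_set (int X) J \<alpha>)) \<le> s + CL * (sqrt s + 1)"
      unfolding s_def abs_le_iff by (simp add: algebra_simps)
    moreover have "sqrt s \<le> sqrt (3 * D)" using s by simp
    then have "sqrt s \<le> 3 * D" using sqrt_le_self[of "3 * D"] 2 by linarith
    then have "s + CL * (sqrt s + 1) \<le> 3 * D + CL * (3 * D + D)"
      using s 2 CL by (intro add_mono mult_left_mono) auto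
    ultimately show ?case by (simp add: algebra_simps)
  qed
qed

text \<open>One coordinate together with the differences from \<open>a 1\<close> determines the
  tuple, and each difference lies in a set of at most \<open>G\<close> elements. No sieving is
  involved, which is good enough when \<open>S\<close> is sparse.\<close>

lemma card_bohr_tuples_le:
  fixes S :: "int set" and G :: real
  assumes l: "l \<in> {1..k}" and S: "finite S" and A: "A \<subseteq> {1..int X}"
    and G: "G \<ge> 1" "\<And>j. j \<in> {2..k} \<Longrightarrow> real (card (bohr_set (int X) (J j) \<alpha>)) \<le> G"
  shows "real (card {a \<in> corr_set k A J \<alpha>. a l \<in> S}) \<le> card S * G ^ k"
proof -
  let ?T = "{a \<in> corr_set k A J \<alpha>. a l \<in> S}"
  let ?B = "PiE {2..k} (\<lambda>j. bohr_set (int X) (J j) \<alpha>)"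
  let ?f = "\<lambda>a::nat \<Rightarrow> int. (a l, \<lambda>j\<in>{2..k}. a 1 - a j)"
  have one: "1 \<in> {1..k}" using l by auto
  have inj: "inj_on ?f ?T"
  proof (rule inj_onI)
    fix a b assume a: "a \<in> ?T" and b: "b \<in> ?T" and eq: "?f a = ?f b"
    have al: "a l = b l" using eq by simp
    have d: "a 1 - a j = b 1 - b j" if "j \<in> {1..k}" for j
    proof (cases "j = 1")
      case False
      then have "j \<in> {2..k}" using that by auto
      moreover have "(\<lambda>j\<in>{2..k}. a 1 - a j) j = (\<lambda>j\<in>{2..k}. b 1 - b j) j" using eq by simp
      ultimately show ?thesis by simp
    qed simp
    have "a 1 = b 1" using d[OF l] al by simp
    then have "a j = b j" if "j \<in> {1..k}" for j using d[OF that] by simp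
    moreover have "a \<in> PiE {1..k} (\<lambda>_. A)" "b \<in> PiE {1..k} (\<lambda>_. A)" using a b by (auto simp: corr_set_def)
    ultimately show "a = b" by (intro PiE_ext)
  qed
  have img: "?f ` ?T \<subseteq> S \<times> ?B"
  proof
    fix y assume "y \<in> ?f ` ?T"
    then obtain a where a: "y = ?f a" "a \<in> ?T" by (rule imageE)
    have aA: "a j \<in> {1..int X}" if "j \<in> {1..k}" for j
      using a(2) A PiE_mem[of a "{1..k}" "\<lambda>_. A", OF _ that] by (auto simp: corr_set_def)
    have "a 1 - a j \<in> bohr_set (int X) (J j) \<alpha>" if j: "j \<in> {2..k}" for j
    proof -
      have "j \<in> {1..k}" using j by auto
      then have "a 1 - a j \<in> {- int X..int X}" using aA[OF one] aA[of j] by auto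
      moreover have "mod1_in (J j) (of_int (a 1 - a j) * \<alpha>)" using a(2) j by (auto simp: corr_set_def)
      ultimately show ?thesis unfolding bohr_set_def by blast
    qed
    then show "y \<in> S \<times> ?B" using a by (simp add: restrict_PiE_iff)
  qed
  have finB: "finite ?B" by (intro finite_PiE finite_bohr_set) auto
  have "card ?T \<le> card (S \<times> ?B)" using inj img S finB by (intro card_inj_on_le[of ?f]) auto
  also have "\<dots> = card S * (\<Prod>j\<in>{2..k}. card (bohr_set (int X) (J j) \<alpha>))"
    by (simp add: card_cartesian_product card_PiE)
  finally have "real (card ?T) \<le> real (card S * (\<Prod>j\<in>{2..k}. card (bohr_set (int X) (J j) \<alpha>)))"
    by (simp only: of_nat_le_iff)
  then have "real (card ?T) \<le> card S * (\<Prod>j\<in>{2..k}. real (card (bohr_set (int X) (J j) \<alpha>)))"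
    by (simp only: of_nat_mult of_nat_prod)
  also have "\<dots> \<le> card S * (\<Prod>j\<in>{2..k}. G)"
    using G by (intro mult_left_mono prod_mono) auto
  also have "(\<Prod>j\<in>{2..k}. G) \<le> G ^ k"
    using G(1) by (simp add: power_increasing)
  then have "card S * (\<Prod>j\<in>{2..k}. G) \<le> card S * G ^ k" by (intro mult_left_mono) auto
  finally show ?thesis .
qed

section \<open>Cutting the range into pieces\<close>

lemma tuple_set_subset_corr_set:
  assumes "\<And>j t. j \<in> {1..k} \<Longrightarrow> t \<in> {u j<..v j} \<Longrightarrow> (\<forall>p\<in>primes_between 0 (z j). \<not> int p dvd t) \<Longrightarrow> t \<in> A"
  shows "tuple_set k u v z J \<alpha> \<subseteq> corr_set k A J \<alpha>"
  using assms by (auto simp: tuple_set_def corr_set_def PiE_iff)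

lemma finite_corr_set: "finite A \<Longrightarrow> finite (corr_set k A J \<alpha>)"
  unfolding corr_set_def by (rule finite_subset[of _ "PiE {1..k} (\<lambda>_. A)"]) (auto intro!: finite_PiE)

lemma finite_tuple_set: "finite (tuple_set k u v z J \<alpha>)"
  unfolding tuple_set_def by (rule finite_subset[of _ "PiE {1..k} (\<lambda>j. {u j<..v j})"]) (auto intro!: finite_PiE)

text \<open>For a lower bound the sifted pieces must be disjoint and contained in \<open>A\<close>.
  Each coordinate chooses its piece independently, so the sum is over maps
  \<open>\<phi>\<close>.\<close>

lemma corr_set_pieces_lower:
  fixes u v :: "'i \<Rightarrow> int" and z :: "'i \<Rightarrow> real"
  assumes I: "finite I" and A: "finite A" and disj: "disjoint_family_on (\<lambda>i. {u i<..v i}) I"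
    and sub: "\<And>i t. i \<in> I \<Longrightarrow> t \<in> {u i<..v i} \<Longrightarrow> (\<forall>p\<in>primes_between 0 (z i). \<not> int p dvd t) \<Longrightarrow> t \<in> A"
  shows "(\<Sum>\<phi>\<in>PiE {1..k} (\<lambda>_. I). card (tuple_set k (\<lambda>j. u (\<phi> j)) (\<lambda>j. v (\<phi> j)) (\<lambda>j. z (\<phi> j)) J \<alpha>)) \<le> card (corr_set k A J \<alpha>)"
proof -
  let ?P = "PiE {1..k} (\<lambda>_. I)"
  let ?T = "\<lambda>\<phi>. tuple_set k (\<lambda>j. u (\<phi> j)) (\<lambda>j. v (\<phi> j)) (\<lambda>j. z (\<phi> j)) J \<alpha>"
  have "(\<Sum>\<phi>\<in>?P. card (?T \<phi>)) = card (\<Union>\<phi>\<in>?P. ?T \<phi>)"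
  proof (rule card_UN_disjoint[symmetric])
    show "finite ?P" using I by (intro finite_PiE) auto
    show "\<forall>\<phi>\<in>?P. finite (?T \<phi>)" by (simp add: finite_tuple_set)
    show "\<forall>\<phi>\<in>?P. \<forall>\<psi>\<in>?P. \<phi> \<noteq> \<psi> \<longrightarrow> ?T \<phi> \<inter> ?T \<psi> = {}"
    proof (intro ballI impI)
      fix \<phi> \<psi> assume \<phi>: "\<phi> \<in> ?P" "\<psi> \<in> ?P" "\<phi> \<noteq> \<psi>"
      then obtain j where j: "j \<in> {1..k}" "\<phi> j \<noteq> \<psi> j" using PiE_ext[of \<phi> "{1..k}" "\<lambda>_. I" \<psi>] by blast
      have "{u (\<phi> j)<..v (\<phi> j)} \<inter> {u (\<psi> j)<..v (\<psi> j)} = {}"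
        using disj j PiE_mem[OF \<phi>(1) j(1)] PiE_mem[OF \<phi>(2) j(1)] by (auto simp: disjoint_family_on_def)
      moreover have "a j \<in> {u (\<phi> j)<..v (\<phi> j)}" if "a \<in> ?T \<phi>" for a and \<phi> :: "nat \<Rightarrow> 'i"
        using that PiE_mem[of a "{1..k}" _ j] j(1) unfolding tuple_set_def by blast
      ultimately show "?T \<phi> \<inter> ?T \<psi> = {}" by blast
    qed
  qed
  also have "\<dots> \<le> card (corr_set k A J \<alpha>)"
  proof (intro card_mono finite_corr_set A UN_least)
    fix \<phi> assume \<phi>: "\<phi> \<in> ?P"
    show "?T \<phi> \<subseteq> corr_set k A J \<alpha>"
      using sub PiE_mem[OF \<phi>] by (intro tuple_set_subset_corr_set) blast
  qed
  finally show ?thesis .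
qed

text \<open>For an upper bound the sifted pieces must cover \<open>A\<close> outside an exceptional
  set \<open>S\<close>; overlaps do no harm.\<close>

lemma corr_set_pieces_upper:
  fixes u v :: "'i \<Rightarrow> int" and z :: "'i \<Rightarrow> real"
  assumes I: "finite I" and A: "finite A"
    and sub: "\<And>t. t \<in> A \<Longrightarrow> t \<in> S \<or> (\<exists>i\<in>I. t \<in> {u i<..v i} \<and> (\<forall>p\<in>primes_between 0 (z i). \<not> int p dvd t))"
  shows "card (corr_set k A J \<alpha>) \<le> (\<Sum>\<phi>\<in>PiE {1..k} (\<lambda>_. I). card (tuple_set k (\<lambda>j. u (\<phi> j)) (\<lambda>j. v (\<phi> j)) (\<lambda>j. z (\<phi> j)) J \<alpha>))
     + (\<Sum>l\<in>{1..k}. card {a \<in> corr_set k A J \<alpha>. a l \<in> S})"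
proof -
  let ?P = "PiE {1..k} (\<lambda>_. I)"
  let ?T = "\<lambda>\<phi>. tuple_set k (\<lambda>j. u (\<phi> j)) (\<lambda>j. v (\<phi> j)) (\<lambda>j. z (\<phi> j)) J \<alpha>"
  let ?U = "\<lambda>l. {a \<in> corr_set k A J \<alpha>. a l \<in> S}"
  have finP: "finite ?P" using I by (intro finite_PiE) auto
  have finU: "finite (?U l)" for l using finite_corr_set[OF A] by (rule finite_subset[rotated]) auto
  have "corr_set k A J \<alpha> \<subseteq> (\<Union>\<phi>\<in>?P. ?T \<phi>) \<union> (\<Union>l\<in>{1..k}. ?U l)"
  proof
    fix a assume a: "a \<in> corr_set k A J \<alpha>"
    show "a \<in> (\<Union>\<phi>\<in>?P. ?T \<phi>) \<union> (\<Union>l\<in>{1..k}. ?U l)"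
    proof (cases "\<exists>l\<in>{1..k}. a l \<in> S")
      case False
      have aA: "a \<in> PiE {1..k} (\<lambda>_. A)" using a by (simp add: corr_set_def)
      have "\<forall>j\<in>{1..k}. \<exists>i. i \<in> I \<and> a j \<in> {u i<..v i} \<and> (\<forall>p\<in>primes_between 0 (z i). \<not> int p dvd a j)"
        using sub PiE_mem[OF aA] False by blast
      from bchoice[OF this] obtain g where g: "\<And>j. j \<in> {1..k} \<Longrightarrow> g j \<in> I \<and> a j \<in> {u (g j)<..v (g j)} \<and> (\<forall>p\<in>primes_between 0 (z (g j)). \<not> int p dvd a j)"
        by blast
      define \<phi> where "\<phi> = restrict g {1..k}"
      have "\<phi> \<in> ?P" using g by (auto simp: \<phi>_def restrict_PiE_iff)
      moreover have "a \<in> ?T \<phi>"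
      proof -
        have "a j \<in> {u (\<phi> j)<..v (\<phi> j)} \<and> (\<forall>p\<in>primes_between 0 (z (\<phi> j)). \<not> int p dvd a j)" if "j \<in> {1..k}" for j
          using g[OF that] that by (simp add: \<phi>_def)
        then show ?thesis using a aA unfolding tuple_set_def corr_set_def PiE_iff by blast
      qed
      ultimately show ?thesis by blast
    qed (use a in blast)
  qed
  then have "card (corr_set k A J \<alpha>) \<le> card ((\<Union>\<phi>\<in>?P. ?T \<phi>) \<union> (\<Union>l\<in>{1..k}. ?U l))"
    using finP finU finite_tuple_set by (intro card_mono) auto
  also have "\<dots> \<le> card (\<Union>\<phi>\<in>?P. ?T \<phi>) + card (\<Union>l\<in>{1..k}. ?U l)" by (rule card_Un_le)
  also have "\<dots> \<le> (\<Sum>\<phi>\<in>?P. card (?T \<phi>)) + (\<Sum>l\<in>{1..k}. card (?U l))"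
    using finP by (intro add_mono card_UN_le) auto
  finally show ?thesis .
qed

lemma sum_PiE_const_product:
  fixes x :: "'i \<Rightarrow> real"
  assumes "finite I"
  shows "(\<Sum>\<phi>\<in>PiE {1..k::nat} (\<lambda>_. I). \<Prod>j\<in>{1..k}. x (\<phi> j)) = sum x I ^ k"
  using prod_sum_PiE[of "{1..k}" "\<lambda>_. I" "\<lambda>_. x"] assms by simp

lemma sum_PiE_first:
  fixes x :: "'i \<Rightarrow> real"
  assumes "finite I" "k \<ge> 1"
  shows "(\<Sum>\<phi>\<in>PiE {1..k::nat} (\<lambda>_. I). x (\<phi> 1)) = sum x I * real (card I) ^ (k - 1)"
proof -
  have ins: "{1..k} = insert 1 {2..k}" using assms(2) by auto
  have "(\<Sum>\<phi>\<in>PiE {1..k} (\<lambda>_. I). x (\<phi> 1)) = (\<Sum>\<phi>\<in>PiE {1..k} (\<lambda>_. I). \<Prod>j\<in>{1..k}. if j = 1 then x (\<phi> j) else 1)"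
    using assms(2) by (intro sum.cong) auto
  also have "\<dots> = (\<Prod>j\<in>{1..k}. \<Sum>i\<in>I. if j = 1 then x i else 1)"
    using prod_sum_PiE[of "{1..k}" "\<lambda>_. I" "\<lambda>j i. if j = 1 then x i else 1"] assms by simp
  also have "\<dots> = sum x I * (\<Prod>j\<in>{2..k}. \<Sum>i\<in>I. if j = 1 then x i else 1)"
    unfolding ins by (subst prod.insert) auto
  also have "(\<Prod>j\<in>{2..k}. \<Sum>i\<in>I. if j = 1 then x i else 1) = (\<Prod>j\<in>{2..k}. real (card I))"
    by (intro prod.cong) auto
  finally show ?thesis by simp
qed

text \<open>Raising a sifting limit to a power close to 1 adds primes of small total weight and
  hardly changes the density. This allows \<open>A\<close> to be enclosed between two sifted sets
  without an asymptotic formula for the density.\<close>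

lemma mertens_prod_ratio:
  assumes y: "4 \<le> y" "y \<le> x" and \<zeta>: "0 \<le> \<zeta>" "\<zeta> \<le> 1" and r: "32 * ((ln x - ln y + 1) / ln y) \<le> \<zeta>"
  shows "mertens_prod 0 y \<le> (1 + \<zeta>) * mertens_prod 0 x"
proof -
  have s: "(\<Sum>p\<in>primes_between y x. 1 / real p) \<le> \<zeta> / 4"
  proof -
    have "(\<Sum>p\<in>primes_between y x. 1 / real p) \<le> 8 * ((ln x - ln y + 1) / ln y)"
      using sum_inverse_primes_between[OF y] by (simp only: times_divide_eq_right)
    then show ?thesis using r by linarith
  qed
  have "1 - \<zeta> / 2 \<le> exp (- (\<zeta> / 2))" using exp_ge_add_one_self[of "- (\<zeta> / 2)"] by simp
  also have "\<dots> \<le> exp (- 2 * (\<Sum>p\<in>primes_between y x. 1 / real p))" using s by simp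
  also have "\<dots> \<le> mertens_prod y x" by (rule mertens_prod_ge_exp)
  finally have "(1 + \<zeta>) * (1 - \<zeta> / 2) \<le> (1 + \<zeta>) * mertens_prod y x" using \<zeta> by (intro mult_left_mono) auto
  moreover have "\<zeta> * \<zeta> \<le> \<zeta>" using \<zeta> by (simp add: mult_left_le)
  then have "1 \<le> (1 + \<zeta>) * (1 - \<zeta> / 2)" using \<zeta> by (simp add: algebra_simps)
  ultimately have "mertens_prod 0 y * 1 \<le> mertens_prod 0 y * ((1 + \<zeta>) * mertens_prod y x)"
    using mertens_prod_pos[of 0 y] by (intro mult_left_mono) auto
  also have "\<dots> = (1 + \<zeta>) * mertens_prod 0 x"
    using mertens_prod_split[of 0 y x] y by simp
  finally show ?thesis by simp
qed

lemma sum_main_terms: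
  fixes Y V :: "'i \<Rightarrow> real" and dl :: "nat \<Rightarrow> real"
  assumes "finite I" "k \<ge> 1"
  shows "(\<Sum>\<phi>\<in>PiE {1..k} (\<lambda>_. I). Y (\<phi> 1) * V (\<phi> 1) * (\<Prod>j\<in>{2..k}. V (\<phi> j) * (Y (\<phi> j) * dl j))) =
    (\<Sum>i\<in>I. Y i * V i) ^ k * (\<Prod>j\<in>{2..k}. dl j)"
proof -
  have ins: "{1..k} = insert 1 {2..k}" using assms(2) by auto
  have "Y (\<phi> 1) * V (\<phi> 1) * (\<Prod>j\<in>{2..k}. V (\<phi> j) * (Y (\<phi> j) * dl j)) =
     (\<Prod>j\<in>{1..k}. Y (\<phi> j) * V (\<phi> j)) * (\<Prod>j\<in>{2..k}. dl j)" for \<phi> :: "nat \<Rightarrow> 'i"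
    unfolding ins by (simp add: prod.distrib mult_ac)
  then have "(\<Sum>\<phi>\<in>PiE {1..k} (\<lambda>_. I). Y (\<phi> 1) * V (\<phi> 1) * (\<Prod>j\<in>{2..k}. V (\<phi> j) * (Y (\<phi> j) * dl j))) =
     (\<Sum>\<phi>\<in>PiE {1..k} (\<lambda>_. I). \<Prod>j\<in>{1..k}. Y (\<phi> j) * V (\<phi> j)) * (\<Prod>j\<in>{2..k}. dl j)"
    by (simp only: sum_distrib_right)
  then show ?thesis using sum_PiE_const_product[OF assms(1), where k = k and x = "\<lambda>i. Y i * V i"] by simp
qed

text \<open>The main terms factor over the coordinates and sum to a \<open>k\<close>-th power. The
  error that involves only the first coordinate recurs for every choice of the other pieces, whence
  \<open>card I ^ (k - 1)\<close>: the number of pieces must stay small compared with the saving in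
  \<open>q\<close>.\<close>

lemma sum_tuple_sets_bounds:
  fixes u v :: "'i \<Rightarrow> int" and z :: "'i \<Rightarrow> real" and J :: "nat \<Rightarrow> real set" and dl :: "nat \<Rightarrow> real"
  defines "V \<equiv> \<lambda>i. mertens_prod 0 (z i)" and "Y \<equiv> \<lambda>i. real_of_int (v i - u i)"
  assumes I: "finite I" and k: "k \<ge> 1"
    and est: "\<And>\<phi>. \<phi> \<in> PiE {1..k} (\<lambda>_. I) \<Longrightarrow>
      \<bar>real (card (tuple_set k (\<lambda>j. u (\<phi> j)) (\<lambda>j. v (\<phi> j)) (\<lambda>j. z (\<phi> j)) J \<alpha>)) -
         Y (\<phi> 1) * V (\<phi> 1) * (\<Prod>j\<in>{2..k}. V (\<phi> j) * (Y (\<phi> j) * dl j))\<bar> \<le>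
       \<eta> * (Y (\<phi> 1) * V (\<phi> 1) * (\<Prod>j\<in>{2..k}. V (\<phi> j) * (Y (\<phi> j) * dl j))) + q * (Y (\<phi> 1) * V (\<phi> 1)) + R"
  defines "S \<equiv> (\<Sum>i\<in>I. Y i * V i)"
  defines "T \<equiv> (\<Sum>\<phi>\<in>PiE {1..k} (\<lambda>_. I). card (tuple_set k (\<lambda>j. u (\<phi> j)) (\<lambda>j. v (\<phi> j)) (\<lambda>j. z (\<phi> j)) J \<alpha>))"
  shows "\<bar>real T - S ^ k * (\<Prod>j\<in>{2..k}. dl j)\<bar> \<le>
    \<eta> * (S ^ k * (\<Prod>j\<in>{2..k}. dl j)) + q * (S * real (card I) ^ (k - 1)) + real (card I) ^ k * R"
proof -
  define M where "M \<phi> = Y (\<phi> 1) * V (\<phi> 1) * (\<Prod>j\<in>{2..k}. V (\<phi> j) * (Y (\<phi> j) * dl j))" for \<phi>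
  define t where "t \<phi> = real (card (tuple_set k (\<lambda>j. u (\<phi> j)) (\<lambda>j. v (\<phi> j)) (\<lambda>j. z (\<phi> j)) J \<alpha>))" for \<phi>
  let ?P = "PiE {1..k} (\<lambda>_. I)"
  have M: "(\<Sum>\<phi>\<in>?P. M \<phi>) = S ^ k * (\<Prod>j\<in>{2..k}. dl j)"
    unfolding M_def S_def by (rule sum_main_terms[OF I k])
  have T: "real T = (\<Sum>\<phi>\<in>?P. t \<phi>)" by (simp add: T_def t_def)
  have "real T - S ^ k * (\<Prod>j\<in>{2..k}. dl j) = (\<Sum>\<phi>\<in>?P. t \<phi> - M \<phi>)"
    unfolding T M[symmetric] by (rule sum_subtractf[symmetric])
  also have "\<bar>\<dots>\<bar> \<le> (\<Sum>\<phi>\<in>?P. \<eta> * M \<phi> + q * (Y (\<phi> 1) * V (\<phi> 1)) + R)"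
    using est unfolding M_def t_def by (intro order_trans[OF sum_abs] sum_mono)
  also have "\<dots> = \<eta> * (\<Sum>\<phi>\<in>?P. M \<phi>) + q * (\<Sum>\<phi>\<in>?P. Y (\<phi> 1) * V (\<phi> 1)) + real (card ?P) * R"
    by (simp only: sum.distrib sum_distrib_left sum_constant)
  also have "(\<Sum>\<phi>\<in>?P. Y (\<phi> 1) * V (\<phi> 1)) = S * real (card I) ^ (k - 1)"
    unfolding S_def using sum_PiE_first[OF I k, where x = "\<lambda>i. Y i * V i"] by simp
  also have "real (card ?P) = real (card I) ^ k" by (simp add: card_PiE)
  finally show ?thesis unfolding M .
qed

text \<open>Lets the tuple count with \<open>k = 1\<close> serve as an estimate for the number of
  points.\<close>

lemma card_corr_set_1: "card (corr_set 1 A J \<alpha>) = card A"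
proof -
  have "corr_set 1 A J \<alpha> = PiE {1} (\<lambda>_. A)" by (auto simp: corr_set_def)
  then show ?thesis by (simp add: card_PiE)
qed

text \<open>The range \<open>X\<^sup>1\<^sup>-\<^sup>\<epsilon> < a \<le> X\<close> is cut into the intervals on which \<open>r\<close> is constant up to a factor \<open>1 + \<epsilon>\<close>.\<close>

lemma level_pieces:
  fixes r :: "int \<Rightarrow> real" and X0 X1 :: int and \<epsilon> \<rho> m :: real
  assumes \<epsilon>: "0 < \<epsilon>" and \<rho>: "0 < \<rho>"
    and mono: "\<And>a b. X0 < a \<Longrightarrow> a \<le> b \<Longrightarrow> b \<le> X1 \<Longrightarrow> r b \<le> r a"
    and low: "\<And>a. X0 < a \<Longrightarrow> a \<le> X1 \<Longrightarrow> \<rho> \<le> r a" and high: "\<And>a. X0 < a \<Longrightarrow> a \<le> X1 \<Longrightarrow> r a \<le> \<rho> * exp m"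
    and m: "m \<ge> 0"
  obtains I :: "nat set" and u v :: "nat \<Rightarrow> int" where "finite I" "real (card I) \<le> m / ln (1 + \<epsilon>) + 1"
    "disjoint_family_on (\<lambda>i. {u i<..v i}) I" "(\<Union>i\<in>I. {u i<..v i}) = {X0<..X1}"
    "\<And>i. i \<in> I \<Longrightarrow> X0 \<le> u i \<and> u i < v i \<and> v i \<le> X1"
    "\<And>i a. i \<in> I \<Longrightarrow> a \<in> {u i<..v i} \<Longrightarrow> \<rho> * (1 + \<epsilon>) ^ i \<le> r a \<and> r a \<le> \<rho> * (1 + \<epsilon>) ^ i * (1 + \<epsilon>)"
proof -
  \<comment> \<open>The exponent of the largest power of \<open>1 + \<epsilon>\<close> not exceeding
    \<open>r a / \<rho>\<close>. Since \<open>r\<close> decreases, each level set is an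
    interval.\<close>
  define lv where "lv a = nat \<lfloor>ln (r a / \<rho>) / ln (1 + \<epsilon>)\<rfloor>" for a
  have l\<epsilon>: "ln (1 + \<epsilon>) > 0" using \<epsilon> by simp
  define P where "P i = {a\<in>{X0<..X1}. lv a = i}" for i
  define I where "I = lv ` {X0<..X1}"
  define u where "u i = Min (P i) - 1" for i
  define v where "v i = Max (P i)" for i
  have rpos: "r a > 0" if "a \<in> {X0<..X1}" for a using low[of a] that \<rho> by auto
  have q0: "0 \<le> ln (r a / \<rho>) / ln (1 + \<epsilon>)" if "a \<in> {X0<..X1}" for a
    using low[of a] that \<rho> l\<epsilon> rpos[OF that] by (intro divide_nonneg_pos) auto
  have lv_mono: "lv b \<le> lv a" if "a \<in> {X0<..X1}" "b \<in> {X0<..X1}" "a \<le> b" for a b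
  proof -
    have "r b \<le> r a" using mono[of a b] that by auto
    then have "ln (r b / \<rho>) \<le> ln (r a / \<rho>)"
      using rpos[OF that(1)] rpos[OF that(2)] \<rho> by (subst ln_le_cancel_iff) (auto intro: divide_right_mono)
    then show ?thesis unfolding lv_def using l\<epsilon> by (intro nat_mono floor_mono divide_right_mono) auto
  qed
  have finP: "finite (P i)" for i unfolding P_def by (rule finite_subset[of _ "{X0<..X1}"]) auto
  have neP: "P i \<noteq> {}" if "i \<in> I" for i using that by (auto simp: I_def P_def)
  have P_eq: "{u i<..v i} = P i" if i: "i \<in> I" for i
  proof (intro equalityI subsetI)
    fix a assume a: "a \<in> {u i<..v i}"
    have mn: "Min (P i) \<in> P i" "Max (P i) \<in> P i" using finP neP[OF i] by auto
    have ord: "Min (P i) \<le> a" "a \<le> Max (P i)" using a by (auto simp: u_def v_def)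
    have aR: "a \<in> {X0<..X1}" using mn ord unfolding P_def by auto
    have "lv a \<le> lv (Min (P i))" "lv (Max (P i)) \<le> lv a"
      using lv_mono[of "Min (P i)" a] lv_mono[of a "Max (P i)"] mn ord aR unfolding P_def by auto
    then show "a \<in> P i" using mn aR unfolding P_def by auto
  next
    fix a assume "a \<in> P i"
    then show "a \<in> {u i<..v i}" using Min_le[OF finP, of a i] Max_ge[OF finP, of a i] by (auto simp: u_def v_def)
  qed
  show thesis
  proof (rule that[of I u v])
    show "finite I" by (simp add: I_def)
    have "I \<subseteq> {..nat \<lfloor>m / ln (1 + \<epsilon>)\<rfloor>}"
    proof
      fix i assume "i \<in> I"
      then obtain a where a: "a \<in> {X0<..X1}" "i = lv a" by (auto simp: I_def)
      have "r a / \<rho> \<le> exp m" using high[of a] a \<rho> by (simp add: field_simps)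
      then have "ln (r a / \<rho>) \<le> ln (exp m)" using rpos[OF a(1)] \<rho> by (subst ln_le_cancel_iff) auto
      then have "ln (r a / \<rho>) \<le> m" by simp
      then show "i \<in> {..nat \<lfloor>m / ln (1 + \<epsilon>)\<rfloor>}"
        unfolding a(2) lv_def using l\<epsilon> by (auto intro!: nat_mono floor_mono divide_right_mono)
    qed
    then have "card I \<le> card {..nat \<lfloor>m / ln (1 + \<epsilon>)\<rfloor>}" by (intro card_mono) auto
    then have "real (card I) \<le> real (nat \<lfloor>m / ln (1 + \<epsilon>)\<rfloor>) + 1" by simp
    moreover have "0 \<le> m / ln (1 + \<epsilon>)" using m l\<epsilon> by simp
    ultimately show "real (card I) \<le> m / ln (1 + \<epsilon>) + 1" by linarith
    show "disjoint_family_on (\<lambda>i. {u i<..v i}) I"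
      unfolding disjoint_family_on_def using P_eq by (auto simp: P_def)
    show "(\<Union>i\<in>I. {u i<..v i}) = {X0<..X1}"
    proof -
      have "(\<Union>i\<in>I. {u i<..v i}) = (\<Union>i\<in>I. P i)" using P_eq by (intro SUP_cong) auto
      also have "\<dots> = {X0<..X1}" by (auto simp: P_def I_def)
      finally show ?thesis .
    qed
    fix i assume i: "i \<in> I"
    have mn: "Min (P i) \<in> P i" "Max (P i) \<in> P i" using finP neP[OF i] by auto
    have "Min (P i) \<le> Max (P i)" using Min_le[OF finP mn(2)] .
    then show "X0 \<le> u i \<and> u i < v i \<and> v i \<le> X1" using mn unfolding u_def v_def P_def by auto
    fix a assume "a \<in> {u i<..v i}"
    then have a: "a \<in> {X0<..X1}" "lv a = i" using P_eq[OF i] by (auto simp: P_def)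
    define q where "q = ln (r a / \<rho>) / ln (1 + \<epsilon>)"
    have q: "real i \<le> q" "q < real i + 1" using q0[OF a(1)] a(2) unfolding lv_def q_def by linarith+
    have ra: "r a = \<rho> * (1 + \<epsilon>) powr q"
    proof -
      have "(1 + \<epsilon>) powr q = exp (q * ln (1 + \<epsilon>))" using \<epsilon> by (simp add: powr_def)
      also have "q * ln (1 + \<epsilon>) = ln (r a / \<rho>)" using l\<epsilon> by (simp add: q_def)
      also have "exp \<dots> = r a / \<rho>" using rpos[OF a(1)] \<rho> by simp
      finally show ?thesis using \<rho> by simp
    qed
    have "(1 + \<epsilon>) ^ i = (1 + \<epsilon>) powr real i" using \<epsilon> by (simp add: powr_realpow)
    also have "\<dots> \<le> (1 + \<epsilon>) powr q" using q \<epsilon> by (intro powr_mono) auto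
    finally have lo: "(1 + \<epsilon>) ^ i \<le> (1 + \<epsilon>) powr q" .
    have "(1 + \<epsilon>) powr q \<le> (1 + \<epsilon>) powr real (Suc i)" using q \<epsilon> by (intro powr_mono) auto
    also have "\<dots> = (1 + \<epsilon>) ^ Suc i" using \<epsilon> by (subst powr_realpow) auto
    finally have hi: "(1 + \<epsilon>) powr q \<le> (1 + \<epsilon>) ^ i * (1 + \<epsilon>)" by (simp add: mult.commute)
    show "\<rho> * (1 + \<epsilon>) ^ i \<le> r a \<and> r a \<le> \<rho> * (1 + \<epsilon>) ^ i * (1 + \<epsilon>)"
      unfolding ra using mult_left_mono[OF lo, of \<rho>] mult_left_mono[OF hi, of \<rho>] \<rho> by (simp add: mult.assoc)
  qed
qed

lemma eventually_ln_power_le: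
  fixes c \<epsilon> :: real
  assumes "c > 0" "\<epsilon> > 0"
  shows "eventually (\<lambda>X::nat. ln (real X) ^ n \<le> c * real X powr \<epsilon>) sequentially"
proof -
  have lim: "filterlim (\<lambda>X::nat. \<epsilon> * ln (real X)) at_top sequentially"
    using assms by (intro filterlim_tendsto_pos_mult_at_top[OF tendsto_const] filterlim_compose[OF ln_at_top filterlim_real_sequentially])
  have "((\<lambda>X::nat. (\<epsilon> * ln (real X)) ^ n / exp (\<epsilon> * ln (real X))) \<longlongrightarrow> 0) sequentially"
    by (rule filterlim_compose[OF tendsto_power_div_exp_0 lim])
  then have "eventually (\<lambda>X::nat. (\<epsilon> * ln (real X)) ^ n / exp (\<epsilon> * ln (real X)) < c * \<epsilon> ^ n) sequentially"
    using assms by (intro order_tendstoD) auto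
  then show ?thesis
    using eventually_gt_at_top[of 0]
  proof eventually_elim
    case (elim X)
    have "real X powr \<epsilon> = exp (\<epsilon> * ln (real X))" using elim by (simp add: powr_def)
    then show ?case using elim assms by (simp add: power_mult_distrib field_simps)
  qed
qed

lemma eventually_ln_ln_ge: "eventually (\<lambda>X::nat. c \<le> ln (ln (real X))) sequentially"
proof -
  have "filterlim (\<lambda>X::nat. ln (ln (real X))) at_top sequentially"
    by (intro filterlim_compose[OF ln_at_top] filterlim_compose[OF ln_at_top filterlim_real_sequentially] filterlim_ident)
  then show ?thesis by (simp add: filterlim_at_top)
qed

lemma exists_small_parameter:
  fixes Vol \<xi> :: real and k :: nat
  assumes "\<xi> > 0"
  obtains \<zeta> where "0 < \<zeta>" "\<zeta> \<le> 1 / 10" "(1 + \<zeta>) * (1 + 10 * \<zeta>) ^ k * Vol + 4 * \<zeta> \<le> Vol + \<xi>"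
    "Vol - \<xi> \<le> (1 - \<zeta>) * (1 - 10 * \<zeta>) ^ k * Vol - 4 * \<zeta>"
proof -
  have "((\<lambda>t::real. (1 + t) * (1 + 10 * t) ^ k * Vol + 4 * t) \<longlongrightarrow> (1 + 0) * (1 + 10 * 0) ^ k * Vol + 4 * 0) (at_right 0)"
    by (intro tendsto_intros)
  then have 1: "eventually (\<lambda>t::real. (1 + t) * (1 + 10 * t) ^ k * Vol + 4 * t < Vol + \<xi>) (at_right 0)"
    using assms by (intro order_tendstoD) auto
  have "((\<lambda>t::real. (1 - t) * (1 - 10 * t) ^ k * Vol - 4 * t) \<longlongrightarrow> (1 - 0) * (1 - 10 * 0) ^ k * Vol - 4 * 0) (at_right 0)"
    by (intro tendsto_intros)
  then have 2: "eventually (\<lambda>t::real. Vol - \<xi> < (1 - t) * (1 - 10 * t) ^ k * Vol - 4 * t) (at_right 0)"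
    using assms by (intro order_tendstoD) auto
  have 3: "eventually (\<lambda>t::real. t \<in> {0<..<1 / 10}) (at_right 0)"
    by (rule eventually_at_right_real) simp
  have "eventually (\<lambda>t::real. 0 < t \<and> t \<le> 1 / 10 \<and> (1 + t) * (1 + 10 * t) ^ k * Vol + 4 * t \<le> Vol + \<xi> \<and>
     Vol - \<xi> \<le> (1 - t) * (1 - 10 * t) ^ k * Vol - 4 * t) (at_right 0)"
    using 1 2 3 by eventually_elim auto
  from eventually_happens'[OF trivial_limit_at_right_real this] that show thesis by blast
qed

text \<open>On each piece \<open>A\<close> contains the numbers free of primes up to
  \<open>zp\<close> and is contained in those free of primes up to \<open>zm\<close>, and the two
  densities almost agree. The same comparison for \<open>k = 1\<close> gives \<open>card A\<close>,
  so the unknown density cancels in the quotient. No roughness is assumed for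
  \<open>a \<le> X powr (1 - \<epsilon>)\<close>: such numbers are negligible even with trivial
  bounds. The first conclusion, with its crude power of \<open>ln X\<close>, shows that
  \<open>card A\<close> tends to infinity and absorbs later errors.\<close>

lemma rough_tuples:
  fixes k :: nat and \<alpha> \<xi> :: real and lo hi :: "nat \<Rightarrow> real"
  assumes \<alpha>: "badly_approximable \<alpha>" and k: "k \<ge> 1" and lohi: "\<And>j. j \<in> {2..k} \<Longrightarrow> lo j \<le> hi j" and \<xi>: "\<xi> > 0"
  obtains \<epsilon> E :: real and Z :: nat where "0 < \<epsilon>" "\<epsilon> \<le> 1 / 4" "E > 0"
    "\<And>(X::nat) (A::int set) (r::int \<Rightarrow> real) (I::nat \<Rightarrow> real set). X \<ge> Z \<Longrightarrow>
      (\<And>a b. X powr (1 - \<epsilon>) < real_of_int a \<Longrightarrow> a \<le> b \<Longrightarrow> b \<le> int X \<Longrightarrow> r b \<le> r a) \<Longrightarrow>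
      (\<And>a. X powr (1 - \<epsilon>) < real_of_int a \<Longrightarrow> a \<le> int X \<Longrightarrow> r a \<le> \<epsilon>) \<Longrightarrow>
      ln (ln X) powr E \<le> r (int X) * ln X \<Longrightarrow> A \<subseteq> {1..int X} \<Longrightarrow>
      (\<And>a. X powr (1 - \<epsilon>) < real_of_int a \<Longrightarrow> a \<le> int X \<Longrightarrow> (\<And>p. prime p \<Longrightarrow> int p dvd a \<Longrightarrow> X powr r a < real p) \<Longrightarrow> a \<in> A) \<Longrightarrow>
      (\<And>a p. a \<in> A \<Longrightarrow> X powr (1 - \<epsilon>) < real_of_int a \<Longrightarrow> prime p \<Longrightarrow> int p dvd a \<Longrightarrow> X powr ((1 - \<epsilon>) * r a) < real p) \<Longrightarrow>
      (\<And>j. j \<in> {2..k} \<Longrightarrow> {lo j<..<hi j} \<subseteq> I j \<and> I j \<subseteq> {lo j..hi j}) \<Longrightarrow>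
      X \<le> ln X ^ 50 * card A \<and>
      \<bar>card (corr_set k A (\<lambda>j. (\<lambda>t. t / card A) ` I j) \<alpha>) / card A - (\<Prod>j\<in>{2..k}. hi j - lo j)\<bar> \<le> \<xi>"
proof -
  define Vol where "Vol = (\<Prod>j\<in>{2..k}. hi j - lo j)"
  have Vol0: "Vol \<ge> 0" unfolding Vol_def using lohi by (intro prod_nonneg) auto
  obtain \<zeta> where \<zeta>: "0 < \<zeta>" "\<zeta> \<le> 1 / 10" and \<zeta>up: "(1 + \<zeta>) * (1 + 10 * \<zeta>) ^ k * Vol + 4 * \<zeta> \<le> Vol + \<xi>"
    and \<zeta>lo: "Vol - \<xi> \<le> (1 - \<zeta>) * (1 - 10 * \<zeta>) ^ k * Vol - 4 * \<zeta>"
    using exists_small_parameter[OF \<xi>] by blast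
  have \<zeta>1: "\<zeta> \<le> 1" using \<zeta> by simp
  define \<kappa> where "\<kappa> = 1 + (\<Sum>j\<in>{2..k}. hi j - lo j)"
  have \<kappa>j: "hi j - lo j \<le> \<kappa>" if "j \<in> {2..k}" for j
  proof -
    have "hi j - lo j \<le> (\<Sum>j\<in>{2..k}. hi j - lo j)" using that lohi by (intro member_le_sum) auto
    then show ?thesis by (simp add: \<kappa>_def)
  qed
  have \<kappa>1: "\<kappa> \<ge> 1"
  proof -
    have "0 \<le> (\<Sum>j\<in>{2..k}. hi j - lo j)" by (intro sum_nonneg) (use lohi in auto)
    then show ?thesis by (simp add: \<kappa>_def)
  qed
  \<comment> \<open>The bound for the expected number of partners of a point: the sifted mass will
    be at most \<open>2 * card A\<close>, and the intervals have length at most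
    \<open>\<kappa> / card A\<close>.\<close>
  have B: "1 \<le> 2 * \<kappa>" using \<kappa>1 by simp
  obtain w :: nat and A C :: real where A: "A \<ge> 1" and C: "C \<ge> 0" and tc: "\<And>(X::nat) (u::nat \<Rightarrow> int) (v::nat \<Rightarrow> int) (z::nat \<Rightarrow> real) (lo::nat \<Rightarrow> real) (hi::nat \<Rightarrow> real) (J::nat \<Rightarrow> real set) (x::real) (\<sigma>::real) (D::real).
      ln X \<ge> A \<Longrightarrow> (\<And>j. j \<in> {1..k} \<Longrightarrow> 0 \<le> u j \<and> u j < v j \<and> v j \<le> int X) \<Longrightarrow>
      (\<And>j. j \<in> {1..k} \<Longrightarrow> w \<le> z j \<and> z j \<le> x \<and> mertens_prod 0 (z j) \<le> \<sigma>) \<Longrightarrow>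
      (\<And>j. j \<in> {2..k} \<Longrightarrow> lo j \<le> hi j \<and> hi j - lo j < 1 \<and> {lo j<..<hi j} \<subseteq> J j \<and> J j \<subseteq> {lo j..hi j} \<and>
         mertens_prod 0 (z j) * (real_of_int (v j - u j) * (hi j - lo j)) \<le> 2 * \<kappa> \<and> X * (hi j - lo j) \<le> D) \<Longrightarrow>
      x \<ge> 2 \<Longrightarrow> 0 \<le> \<sigma> \<Longrightarrow> A * sqrt \<sigma> \<le> 1 \<Longrightarrow> D \<ge> 1 \<Longrightarrow>
      \<bar>real (card (tuple_set k u v z J \<alpha>)) - real_of_int (v 1 - u 1) * mertens_prod 0 (z 1) * (\<Prod>j\<in>{2..k}. mertens_prod 0 (z j) * (real_of_int (v j - u j) * (hi j - lo j)))\<bar> \<le>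
        \<zeta> * (real_of_int (v 1 - u 1) * mertens_prod 0 (z 1) * (\<Prod>j\<in>{2..k}. mertens_prod 0 (z j) * (real_of_int (v j - u j) * (hi j - lo j)))) +
        A * (real_of_int (v 1 - u 1) * mertens_prod 0 (z 1)) * sqrt \<sigma> * ln (ln X) powr A + A * D ^ k * x powr C"
    by (rule tuple_count[OF k \<alpha> B \<zeta>(1) \<zeta>1]) blast
  \<comment> \<open>The same estimate with a single coordinate, for the number of points.\<close>
  obtain w1 :: nat and A1 C1 :: real where A1: "A1 \<ge> 1" and C1: "C1 \<ge> 0" and tc1: "\<And>(X::nat) (u::nat \<Rightarrow> int) (v::nat \<Rightarrow> int) (z::nat \<Rightarrow> real) (lo::nat \<Rightarrow> real) (hi::nat \<Rightarrow> real) (J::nat \<Rightarrow> real set) (x::real) (\<sigma>::real) (D::real).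
      ln X \<ge> A1 \<Longrightarrow> (\<And>j. j \<in> {1..1} \<Longrightarrow> 0 \<le> u j \<and> u j < v j \<and> v j \<le> int X) \<Longrightarrow>
      (\<And>j. j \<in> {1..1} \<Longrightarrow> w1 \<le> z j \<and> z j \<le> x \<and> mertens_prod 0 (z j) \<le> \<sigma>) \<Longrightarrow>
      (\<And>j. j \<in> {2..1} \<Longrightarrow> lo j \<le> hi j \<and> hi j - lo j < 1 \<and> {lo j<..<hi j} \<subseteq> J j \<and> J j \<subseteq> {lo j..hi j} \<and>
         mertens_prod 0 (z j) * (real_of_int (v j - u j) * (hi j - lo j)) \<le> 1 \<and> X * (hi j - lo j) \<le> D) \<Longrightarrow>
      x \<ge> 2 \<Longrightarrow> 0 \<le> \<sigma> \<Longrightarrow> A1 * sqrt \<sigma> \<le> 1 \<Longrightarrow> D \<ge> 1 \<Longrightarrow>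
      \<bar>real (card (tuple_set 1 u v z J \<alpha>)) - real_of_int (v 1 - u 1) * mertens_prod 0 (z 1) * (\<Prod>j\<in>{2..1}. mertens_prod 0 (z j) * (real_of_int (v j - u j) * (hi j - lo j)))\<bar> \<le>
        \<zeta> * (real_of_int (v 1 - u 1) * mertens_prod 0 (z 1) * (\<Prod>j\<in>{2..1}. mertens_prod 0 (z j) * (real_of_int (v j - u j) * (hi j - lo j)))) +
        A1 * (real_of_int (v 1 - u 1) * mertens_prod 0 (z 1)) * sqrt \<sigma> * ln (ln X) powr A1 + A1 * D ^ 1 * x powr C1"
    by (rule tuple_count[OF order_refl \<alpha> order_refl \<zeta>(1) \<zeta>1]) blast
  obtain CB :: real where CB: "CB \<ge> 1" and bohr: "\<And>(X::nat) (lo::real) (hi::real) J D. X \<ge> 1 \<Longrightarrow> {lo<..<hi} \<subseteq> J \<Longrightarrow> J \<subseteq> {lo..hi} \<Longrightarrow> lo \<le> hi \<Longrightarrow> hi - lo < 1 \<Longrightarrow>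
       X * (hi - lo) \<le> D \<Longrightarrow> D \<ge> 1 \<Longrightarrow> real (card (bohr_set (int X) J \<alpha>)) \<le> CB * D"
    by (rule card_bohr_set_le[OF \<alpha>]) blast
  \<comment> \<open>The first bound makes \<open>zm\<close> and \<open>zp\<close> so close in
    exponent that their densities agree up to \<open>1 + \<zeta>\<close>. The second keeps the sieve
    remainder \<open>x powr C\<close>, with \<open>x = X powr (2 * \<epsilon>)\<close>, below
    \<open>X powr (1 - \<epsilon>)\<close>.\<close>
  define \<epsilon> where "\<epsilon> = min (\<zeta> / 1024) (1 / (16 * (C + C1 + 1)))"
  have \<epsilon>: "0 < \<epsilon>" "\<epsilon> \<le> \<zeta> / 1024" "\<epsilon> \<le> 1 / 4" using \<zeta> C C1 by (auto simp: \<epsilon>_def)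
  have \<epsilon>C: "2 * \<epsilon> * C \<le> 1 / 4" "2 * \<epsilon> * C1 \<le> 1 / 4"
  proof -
    have "\<epsilon> * (C + C1 + 1) \<le> 1 / (16 * (C + C1 + 1)) * (C + C1 + 1)"
      using C C1 by (intro mult_right_mono) (auto simp: \<epsilon>_def)
    also have "\<dots> = 1 / 16" using C C1 by (simp add: field_simps)
    finally have 1: "\<epsilon> * C + \<epsilon> * C1 + \<epsilon> \<le> 1 / 16" by (simp add: algebra_simps)
    moreover have "0 \<le> \<epsilon> * C" "0 \<le> \<epsilon> * C1" using C C1 \<epsilon> by auto
    ultimately show "2 * \<epsilon> * C \<le> 1 / 4" "2 * \<epsilon> * C1 \<le> 1 / 4" using \<epsilon>(1) by linarith+
  qed
  \<comment> \<open>With \<open>\<sigma> = 2 * lam powr (- E)\<close>, the factor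
    \<open>sqrt \<sigma>\<close> is of order \<open>lam powr (- (A + A1 + k + 2))\<close>. It pays
    for the powers of \<open>lam\<close> in the counting estimates and for \<open>k\<close> more
    from the number of pieces, leaving \<open>lam powr (- 2)\<close>.\<close>
  define E where "E = 2 * (A + A1 + real k + 2)"
  have E1: "E \<ge> 1" using A A1 by (simp add: E_def)
  define K\<epsilon> where "K\<epsilon> = 1 / ln (1 + \<epsilon>) + 1"
  have K\<epsilon>: "K\<epsilon> \<ge> 1" using \<epsilon> by (simp add: K\<epsilon>_def)
  define c1 where "c1 = 1 + A + A1 + 2 * exp 40 + 4 * \<kappa> + 2 * (A + A1) * K\<epsilon> ^ k / \<zeta> + 2 * ln (real (w + w1 + 5)) + 128 / \<zeta>"
  \<comment> \<open>Large enough for every power of \<open>ln X\<close> that multiplies an error of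
    size \<open>X powr (1 - \<epsilon>)\<close> below: \<open>51 * k\<close> from the number of
    pieces and \<open>D ^ k\<close>, and 50 for comparing \<open>X\<close> with
    \<open>card A\<close>.\<close>
  define n0 where "n0 = 51 * k + 101"
  define K0 where "K0 = K\<epsilon> ^ k * (A + A1) + k * CB ^ k + K\<epsilon> * A1 + 8"
  have K0: "K0 \<ge> 8" "K0 \<ge> K\<epsilon> ^ k * (A + A1)" "K0 \<ge> k * CB ^ k" "K0 \<ge> K\<epsilon> * A1"
  proof -
    have "0 \<le> K\<epsilon> ^ k * (A + A1)" "0 \<le> k * CB ^ k" "0 \<le> K\<epsilon> * A1" using K\<epsilon> A A1 CB by auto
    then show "K0 \<ge> 8" "K0 \<ge> K\<epsilon> ^ k * (A + A1)" "K0 \<ge> k * CB ^ k" "K0 \<ge> K\<epsilon> * A1" by (auto simp: K0_def)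
  qed
  have c1: "c1 \<ge> 1" "c1 \<ge> A" "c1 \<ge> A1" "c1 \<ge> 2 * exp 40" "c1 \<ge> 4 * \<kappa>" "c1 \<ge> 2 * (A + A1) * K\<epsilon> ^ k / \<zeta>" "c1 \<ge> 2 * ln (real (w + w1 + 5))" "c1 \<ge> 128 / \<zeta>"
  proof -
    have p: "0 \<le> exp (40::real)" "0 \<le> 2 * (A + A1) * K\<epsilon> ^ k / \<zeta>" "0 \<le> ln (real (w + w1 + 5))" "0 \<le> 128 / \<zeta>"
      using K\<epsilon> A A1 \<zeta> by auto
    show "c1 \<ge> 1" "c1 \<ge> A" "c1 \<ge> A1" "c1 \<ge> 2 * exp 40" "c1 \<ge> 4 * \<kappa>" "c1 \<ge> 2 * (A + A1) * K\<epsilon> ^ k / \<zeta>" "c1 \<ge> 2 * ln (real (w + w1 + 5))" "c1 \<ge> 128 / \<zeta>"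
      unfolding c1_def using p A A1 \<kappa>1 by linarith+
  qed
  have "eventually (\<lambda>X::nat. c1 \<le> ln (ln (real X)) \<and> ln (real X) ^ n0 \<le> \<zeta> / K0 * real X powr \<epsilon> \<and> X \<ge> 3) sequentially"
    using K0 \<zeta> \<epsilon> by (intro eventually_conj eventually_ln_ln_ge eventually_ln_power_le eventually_ge_at_top) auto
  then obtain Z where Z: "\<And>X. X \<ge> Z \<Longrightarrow> c1 \<le> ln (ln (real X)) \<and> ln (real X) ^ n0 \<le> \<zeta> / K0 * real X powr \<epsilon> \<and> X \<ge> 3"
    by (auto simp: eventually_sequentially)
  show thesis
  proof (rule that[of \<epsilon> E Z], goal_cases)
    case 1 show ?case by (rule \<epsilon>)
  next
    case 2 show ?case by (rule \<epsilon>)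
  next
    case 3 show ?case using E1 by simp
  next
    case (4 X AA r I)
    note XZ = 4(1) and mono = 4(2) and small = 4(3) and rX = 4(4) and AA = 4(5) and AAin = 4(6) and AAout = 4(7) and II = 4(8)
    define L where "L = ln (real X)"
    define lam where "lam = ln L"
    define x\<epsilon> where "x\<epsilon> = real X powr (1 - \<epsilon>)"
    have lam: "c1 \<le> lam" and big: "K0 * L ^ n0 \<le> \<zeta> * X powr \<epsilon>" and X3: "X \<ge> 3"
      using Z[OF XZ] K0 by (auto simp: lam_def L_def field_simps)
    have lam1: "lam \<ge> 1" using lam c1 by linarith
    have L1: "L > 1"
    proof -
      have "L > 0" using X3 by (simp add: L_def)
      moreover have "ln L > 0" using lam1 by (simp add: lam_def)
      ultimately show ?thesis by simp
    qed
    have lamL: "lam \<le> L" using ln_le_minus_one[of L] L1 by (simp add: lam_def)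
    have X0: "real X > 0" using X3 by simp
    have Xpow: "x\<epsilon> * X powr \<epsilon> = X" using X0 by (simp add: x\<epsilon>_def flip: powr_add)
    have x\<epsilon>1: "x\<epsilon> \<ge> 1" unfolding x\<epsilon>_def using X3 \<epsilon> by (intro ge_one_powr_ge_zero) auto
    have X\<epsilon>1: "X powr \<epsilon> \<ge> 1" using X3 \<epsilon> by (intro ge_one_powr_ge_zero) auto
    have Lp: "L ^ a \<le> L ^ b" if "a \<le> b" for a b using that L1 by (intro power_increasing) auto
    have main_small: "K * L ^ n * x\<epsilon> \<le> \<zeta> * X" if K: "0 \<le> K" "K \<le> K0" and n: "n \<le> n0" for K n
    proof -
      have "K * L ^ n \<le> K0 * L ^ n0" using K Lp[OF n] K0 L1 by (intro mult_mono) auto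
      then have "K * L ^ n * x\<epsilon> \<le> \<zeta> * X powr \<epsilon> * x\<epsilon>" using big x\<epsilon>1 by (intro mult_right_mono) auto
      also have "\<dots> = \<zeta> * X" using Xpow by (simp add: mult_ac)
      finally show ?thesis .
    qed
    have x\<epsilon>X: "8 * x\<epsilon> \<le> X"
    proof -
      have "8 * x\<epsilon> \<le> \<zeta> * X" using main_small[of 8 0] K0 by simp
      moreover have "\<zeta> * X \<le> 1 * real X" using \<zeta>1 by (intro mult_right_mono) auto
      ultimately show ?thesis by linarith
    qed
    define \<rho> where "\<rho> = r (int X)"
    have \<rho>L: "lam \<le> \<rho> * L"
    proof -
      have "lam powr 1 \<le> lam powr E" using lam1 E1 by (intro powr_mono) auto
      then show ?thesis using rX lam1 by (simp add: \<rho>_def L_def lam_def)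
    qed
    have \<rho>0: "\<rho> > 0" using \<rho>L lam1 L1 by (metis less_le_trans zero_less_mult_pos2 zero_less_one less_trans)
    define X0' where "X0' = \<lfloor>x\<epsilon>\<rfloor>"
    have X0'iff: "X0' < a \<longleftrightarrow> x\<epsilon> < real_of_int a" for a unfolding X0'_def by (simp add: floor_less_iff)
    have X0'0: "0 \<le> X0'" using x\<epsilon>1 by (simp add: X0'_def)
    have lowr: "\<rho> \<le> r a" if "X0' < a" "a \<le> int X" for a
      using mono[of a "int X"] that unfolding \<rho>_def X0'iff x\<epsilon>_def by simp
    have "\<rho> * L \<ge> 1" using \<rho>L lam1 by linarith
    \<comment> \<open>This is why \<open>O(ln (ln X))\<close> pieces suffice: \<open>r\<close> lies
      between \<open>\<rho>\<close>, at least \<open>1 / L\<close>, and \<open>\<epsilon>\<close>,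
      hence within a factor \<open>L = exp lam\<close>.\<close>
    have highr: "r a \<le> \<rho> * exp lam" if "X0' < a" "a \<le> int X" for a
    proof -
      have "r a \<le> \<epsilon>" using small[of a] that unfolding X0'iff x\<epsilon>_def by simp
      moreover have "exp lam = L" using L1 by (simp add: lam_def)
      ultimately show ?thesis using \<open>\<rho> * L \<ge> 1\<close> \<epsilon> by simp
    qed
    have monor: "r b \<le> r a" if "X0' < a" "a \<le> b" "b \<le> int X" for a b
      using mono[of a b] that unfolding X0'iff x\<epsilon>_def by simp
    have lam0: "lam \<ge> 0" using lam1 by simp
    obtain P :: "nat set" and u v :: "nat \<Rightarrow> int" where P: "finite P" and cardP: "real (card P) \<le> lam / ln (1 + \<epsilon>) + 1"
      and disj: "disjoint_family_on (\<lambda>i. {u i<..v i}) P" and cover: "(\<Union>i\<in>P. {u i<..v i}) = {X0'<..int X}"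
      and uv: "\<And>i. i \<in> P \<Longrightarrow> X0' \<le> u i \<and> u i < v i \<and> v i \<le> int X"
      and lev: "\<And>i a. i \<in> P \<Longrightarrow> a \<in> {u i<..v i} \<Longrightarrow> \<rho> * (1 + \<epsilon>) ^ i \<le> r a \<and> r a \<le> \<rho> * (1 + \<epsilon>) ^ i * (1 + \<epsilon>)"
      by (rule level_pieces[of \<epsilon> \<rho> X0' "int X" r lam])
        ((rule \<epsilon>(1) \<rho>0 lam0 | erule (2) monor | erule (1) lowr | erule (1) highr)+, blast)
    define \<rho>i where "\<rho>i i = \<rho> * (1 + \<epsilon>) ^ i" for i
    \<comment> \<open>On piece \<open>i\<close>, \<open>r a\<close> lies between
      \<open>\<rho>i i\<close> and \<open>(1 + \<epsilon>) * \<rho>i i\<close>. Hence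
      \<open>zp i\<close> is at least every \<open>X powr r a\<close>, and \<open>zm i\<close> is at
      most every \<open>X powr ((1 - \<epsilon>) * r a)\<close>.\<close>
    define zm where "zm i = X powr ((1 - \<epsilon>) * \<rho>i i)" for i
    define zp where "zp i = X powr ((1 + \<epsilon>) * \<rho>i i)" for i
    define x where "x = X powr (2 * \<epsilon>)"
    define \<sigma> where "\<sigma> = 2 * lam powr (- E)"
    define Y where "Y i = real_of_int (v i - u i)" for i
    define S where "S = (\<Sum>i\<in>P. Y i * mertens_prod 0 (zp i))"
    define S' where "S' = (\<Sum>i\<in>P. Y i * mertens_prod 0 (zm i))"
    define M where "M = K\<epsilon> * lam"
    have PM: "real (card P) \<le> M" using cardP lam1 by (simp add: M_def K\<epsilon>_def algebra_simps)
    have Y0: "Y i \<ge> 0" if "i \<in> P" for i using uv[OF that] by (simp add: Y_def)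
    have \<rho>i\<rho>: "\<rho> \<le> \<rho>i i" for i
      using \<rho>0 \<epsilon> mult_left_mono[of 1 "(1 + \<epsilon>) ^ i" \<rho>] by (simp add: \<rho>i_def)
    have \<rho>i\<epsilon>: "\<rho>i i \<le> \<epsilon>" if i: "i \<in> P" for i
    proof -
      have "v i \<in> {u i<..v i}" using uv[OF i] by simp
      then have "\<rho>i i \<le> r (v i)" using lev[OF i] unfolding \<rho>i_def by blast
      also have "\<dots> \<le> \<epsilon>" using small[of "v i"] uv[OF i] X0'iff[of "v i"] unfolding x\<epsilon>_def by auto
      finally show ?thesis .
    qed
    have \<rho>iL: "lam \<le> \<rho>i i * L" for i
    proof -
      have "\<rho> * L \<le> \<rho>i i * L" using \<rho>i\<rho>[of i] L1 by (intro mult_right_mono) auto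
      then show ?thesis using \<rho>L by linarith
    qed
    have lnz: "ln (zm i) = (1 - \<epsilon>) * \<rho>i i * L" "ln (zp i) = (1 + \<epsilon>) * \<rho>i i * L" for i
      using X0 by (simp_all add: zm_def zp_def ln_powr L_def)
    have z0: "zm i > 0" "zp i > 0" for i using X0 by (simp_all add: zm_def zp_def)
    have zmp: "zm i \<le> zp i" for i
      unfolding zm_def zp_def using X3 \<epsilon> \<rho>i\<rho>[of i] \<rho>0 by (intro powr_mono mult_right_mono) auto
    have zpx: "zp i \<le> x" if "i \<in> P" for i
      unfolding zp_def x_def
    proof (rule powr_mono)
      have "(1 + \<epsilon>) * \<rho>i i \<le> 2 * \<epsilon>" using \<rho>i\<epsilon>[OF that] \<epsilon> \<rho>i\<rho>[of i] \<rho>0 by (intro mult_mono) auto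
      then show "(1 + \<epsilon>) * \<rho>i i \<le> 2 * \<epsilon>" .
    qed (use X3 in simp)
    have \<rho>iE: "lam powr E \<le> \<rho>i i * L" for i
    proof -
      have "\<rho> * L \<le> \<rho>i i * L" using \<rho>i\<rho>[of i] L1 by (intro mult_right_mono) auto
      moreover have "lam powr E \<le> \<rho> * L" using rX unfolding \<rho>_def L_def lam_def .
      ultimately show ?thesis by linarith
    qed
    have lnzm: "lam powr E / 2 \<le> ln (zm i)" for i
    proof -
      have "(1 / 2) * (\<rho>i i * L) \<le> (1 - \<epsilon>) * (\<rho>i i * L)"
        using \<epsilon> \<rho>iL[of i] lam1 by (intro mult_right_mono) auto
      then show ?thesis using \<rho>iE[of i] unfolding lnz by (simp add: mult.assoc)
    qed
    have lamE: "lam \<le> lam powr E"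
    proof -
      have "lam powr 1 \<le> lam powr E" using lam1 E1 by (intro powr_mono) auto
      then show ?thesis using lam1 by simp
    qed
    have zmw: "real (w + w1 + 5) \<le> zm i" for i
    proof -
      have "ln (real (w + w1 + 5)) \<le> ln (zm i)" using lnzm[of i] lamE lam c1(7) by linarith
      then show ?thesis using z0 by (subst (asm) ln_le_cancel_iff) auto
    qed
    have mer: "mertens_prod 0 (zm i) \<le> \<sigma>" "mertens_prod 0 (zp i) \<le> \<sigma>" for i
    proof -
      have zm1: "zm i > 1" using zmw[of i] by simp
      have "mertens_prod 0 (zm i) \<le> 1 / ln (zm i)" using zm1 by (rule mertens_prod_le)
      also have "\<dots> \<le> 1 / (lam powr E / 2)" using lnzm[of i] lam1 zm1 by (intro divide_left_mono) auto
      also have "\<dots> = \<sigma>" using lam1 by (simp add: \<sigma>_def powr_minus field_simps)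
      finally show 1: "mertens_prod 0 (zm i) \<le> \<sigma>" .
      show "mertens_prod 0 (zp i) \<le> \<sigma>" using mertens_prod_antimono[OF zmp[of i], of 0] 1 by simp
    qed
    \<comment> \<open>The logarithms differ by \<open>2 * \<epsilon>\<close> times
      \<open>\<rho>i i * L\<close>. The additive 1 in the prime sum is harmless because
      \<open>\<rho>i i * L\<close> is at least \<open>lam\<close>.\<close>
    have ratio: "mertens_prod 0 (zm i) \<le> (1 + \<zeta>) * mertens_prod 0 (zp i)" for i
    proof (rule mertens_prod_ratio)
      show "4 \<le> zm i" using zmw[of i] by simp
      show "zm i \<le> zp i" by (rule zmp)
      have a: "\<rho>i i * L \<ge> 128 / \<zeta>" "\<rho>i i * L > 0" using \<rho>iL[of i] lam c1(8) lam1 by linarith+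
      have b: "ln (zm i) \<ge> \<rho>i i * L / 2" unfolding lnz using \<epsilon> a mult_right_mono[of "1/2" "1 - \<epsilon>" "\<rho>i i * L"] by (simp add: mult.assoc)
      have "ln (zp i) - ln (zm i) + 1 = 2 * \<epsilon> * (\<rho>i i * L) + 1" unfolding lnz by (simp add: algebra_simps)
      then have "32 * ((ln (zp i) - ln (zm i) + 1) / ln (zm i)) \<le> 32 * ((2 * \<epsilon> * (\<rho>i i * L) + 1) / (\<rho>i i * L / 2))"
      proof -
        define t where "t = \<rho>i i * L"
        have t: "t > 0" "t / 2 \<le> ln (zm i)" using a b by (simp_all add: t_def)
        have "(2 * \<epsilon> * t + 1) / ln (zm i) \<le> (2 * \<epsilon> * t + 1) / (t / 2)"
        proof (rule divide_left_mono)
          show "0 < ln (zm i) * (t / 2)" using t by (intro mult_pos_pos) linarith+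
        qed (use t \<epsilon> in auto)
        then show ?thesis using \<open>ln (zp i) - ln (zm i) + 1 = 2 * \<epsilon> * (\<rho>i i * L) + 1\<close> unfolding t_def by (intro mult_left_mono) simp_all
      qed
      also have "\<dots> = 128 * \<epsilon> + 64 / (\<rho>i i * L)" 
      proof -
        have "32 * ((2 * \<epsilon> * t + 1) / (t / 2)) = 128 * \<epsilon> + 64 / t" if "t > 0" for t :: real
          using that by (simp add: field_simps)
        then show ?thesis using a(2) by blast
      qed
      also have "64 / (\<rho>i i * L) \<le> 64 / (128 / \<zeta>)" using a \<zeta> by (intro divide_left_mono) auto
      then have "128 * \<epsilon> + 64 / (\<rho>i i * L) \<le> 128 * \<epsilon> + 64 / (128 / \<zeta>)" by simp
      also have "\<dots> \<le> \<zeta>" using \<epsilon> by simp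
      finally show "32 * ((ln (zp i) - ln (zm i) + 1) / ln (zm i)) \<le> \<zeta>" .
    qed (use \<zeta> in auto)
    have SS': "S \<le> S'" "S' \<le> (1 + \<zeta>) * S"
    proof -
      show "S \<le> S'" unfolding S_def S'_def using Y0 mertens_prod_antimono[OF zmp] by (intro sum_mono mult_left_mono) auto
      have "S' \<le> (\<Sum>i\<in>P. Y i * ((1 + \<zeta>) * mertens_prod 0 (zp i)))" unfolding S'_def using Y0 ratio by (intro sum_mono mult_left_mono) auto
      also have "\<dots> = (1 + \<zeta>) * S" unfolding S_def sum_distrib_left by (intro sum.cong) auto
      finally show "S' \<le> (1 + \<zeta>) * S" .
    qed
    \<comment> \<open>The pieces have total length at least \<open>X / 2\<close>, and each density
      is at least \<open>exp (- 40) / L ^ 48\<close>; the constants cost one more power of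
      \<open>L\<close>.\<close>
    have Slow: "X \<le> S * L ^ 49"
    proof -
      have sumY: "(\<Sum>i\<in>P. Y i) \<ge> X / 2"
      proof -
        have "real (card (\<Union>i\<in>P. {u i<..v i})) = (\<Sum>i\<in>P. Y i)"
        proof -
          have "card (\<Union>i\<in>P. {u i<..v i}) = (\<Sum>i\<in>P. card {u i<..v i})"
            using P disj by (intro card_UN_disjoint) (auto simp: disjoint_family_on_def)
          moreover have "real (card {u i<..v i}) = Y i" if "i \<in> P" for i using uv[OF that] by (simp add: Y_def)
          ultimately show ?thesis by simp
        qed
        moreover have "real_of_int X0' \<le> x\<epsilon>" by (simp add: X0'_def)
        then have "real (card {X0'<..int X}) \<ge> X - x\<epsilon>" using X0'0 by simp
        ultimately show ?thesis using x\<epsilon>X x\<epsilon>1 unfolding cover by linarith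
      qed
      have merX: "exp (- 40) / L ^ 48 \<le> mertens_prod 0 (zp i)" if "i \<in> P" for i
      proof -
        have "zp i \<le> X"
        proof -
          have "x \<le> X powr 1" unfolding x_def using X3 \<epsilon> by (intro powr_mono) auto
          then show ?thesis using zpx[OF that] X0 by simp
        qed
        have L16: "real X \<ge> 16"
        proof -
          have "ln (16::real) \<le> 4" using ln_realpow[of 2 4] ln_le_minus_one[of 2] by simp
          also have "(4::real) \<le> 2 * exp 40" using exp_ge_add_one_self[of 40] by simp
          also have "\<dots> \<le> L" using c1(4) lam lamL by linarith
          finally show ?thesis unfolding L_def using X0 by (subst (asm) ln_le_cancel_iff) auto
        qed
        have "exp (- 40) / L ^ 48 = exp (- 40) * L powr (- 48)" using L1 by (simp add: powr_minus powr_numeral field_simps)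
        also have "\<dots> \<le> mertens_prod 0 X" unfolding L_def by (rule mertens_prod_ge[OF L16])
        also have "\<dots> \<le> mertens_prod 0 (zp i)" using \<open>zp i \<le> X\<close> by (rule mertens_prod_antimono)
        finally show ?thesis .
      qed
      have "X / 2 * (exp (- 40) / L ^ 48) \<le> (\<Sum>i\<in>P. Y i) * (exp (- 40) / L ^ 48)"
        using sumY L1 by (intro mult_right_mono) auto
      also have "\<dots> \<le> S" unfolding S_def sum_distrib_right using Y0 merX by (intro sum_mono mult_left_mono) auto
      finally have "X / 2 * (exp (- 40) / L ^ 48) * (L ^ 48 * (2 * exp 40)) \<le> S * (L ^ 48 * (2 * exp 40))"
        using L1 by (intro mult_right_mono) auto
      moreover have "X / 2 * (exp (- 40) / L ^ 48) * (L ^ 48 * (2 * exp 40)) = X"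
        using L1 by (simp add: exp_minus field_simps)
      moreover have S0: "S \<ge> 0" unfolding S_def using Y0 mertens_prod_pos by (intro sum_nonneg mult_nonneg_nonneg) (auto intro: less_imp_le)
      have "2 * exp 40 \<le> L" using c1(4) lam lamL by linarith
      then have "S * (L ^ 48 * (2 * exp 40)) \<le> S * (L ^ 48 * L)" using S0 L1 by (intro mult_left_mono) auto
      ultimately show ?thesis by (simp add: power_Suc[symmetric] mult.commute del: power_Suc)
    qed
    have S0: "S > 0"
    proof (rule ccontr)
      assume "\<not> S > 0"
      then have "S * L ^ 49 \<le> 0" using L1 by (simp add: mult_le_0_iff)
      then show False using Slow X0 by linarith
    qed
    have S'0: "S' > 0" using SS' S0 by linarith
    define q where "q = sqrt \<sigma> * lam powr (A + A1)"
    have \<sigma>0: "\<sigma> \<ge> 0" by (simp add: \<sigma>_def)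
    have q0: "q \<ge> 0" using \<sigma>0 by (simp add: q_def)
    \<comment> \<open>The decisive comparison: the square root of the density outweighs the powers
      of \<open>lam\<close> from the averaged singular series and from the choice of pieces.\<close>
    have qM: "(A + A1) * q * M ^ k \<le> \<zeta>"
    proof -
      have "sqrt \<sigma> = sqrt 2 * lam powr (- (A + A1 + real k + 2))"
      proof -
        have "lam powr (- E) = lam powr (- (A + A1 + real k + 2)) * lam powr (- (A + A1 + real k + 2))"
        proof -
          have e: "- E = - (A + A1 + real k + 2) + - (A + A1 + real k + 2)" by (simp add: E_def)
          show ?thesis unfolding e by (rule powr_add)
        qed
        then show ?thesis by (simp add: \<sigma>_def real_sqrt_mult)
      qed
      moreover have "sqrt 2 \<le> (2::real)" by (rule sqrt_le_self) simp
      ultimately have "sqrt \<sigma> \<le> 2 * lam powr (- (A + A1 + real k + 2))" by (simp add: mult_right_mono)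
      then have "q \<le> 2 * lam powr (- (A + A1 + real k + 2)) * lam powr (A + A1)"
        unfolding q_def by (intro mult_right_mono) auto
      also have "\<dots> = 2 * lam powr (- (real k + 2))"
      proof -
        have e: "- (real k + 2) = - (A + A1 + real k + 2) + (A + A1)" by simp
        show ?thesis unfolding e powr_add by simp
      qed
      finally have "q * M ^ k \<le> 2 * lam powr (- (real k + 2)) * (K\<epsilon> * lam) ^ k"
        unfolding M_def using K\<epsilon> lam1 by (intro mult_right_mono) auto
      also have "\<dots> = 2 * K\<epsilon> ^ k * (lam powr (- (real k + 2)) * lam powr real k)"
        using lam1 by (simp add: power_mult_distrib powr_realpow)
      also have "lam powr (- (real k + 2)) * lam powr real k = lam powr (- 2)"
      proof -
        have e: "- 2 = - (real k + 2) + real k" by simp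
        show ?thesis unfolding e powr_add by simp
      qed
      also have "lam powr (- 2) \<le> lam powr (- 1)" using lam1 by (intro powr_mono) auto
      then have "2 * K\<epsilon> ^ k * lam powr (- 2) \<le> 2 * K\<epsilon> ^ k * lam powr (- 1)" using K\<epsilon> by (intro mult_left_mono) auto
      also have "lam powr (- 1) = 1 / lam" using lam1 by (simp add: powr_minus_divide)
      finally have "(A + A1) * (q * M ^ k) \<le> (A + A1) * (2 * K\<epsilon> ^ k * (1 / lam))"
        using A A1 by (intro mult_left_mono) auto
      also have "\<dots> = 2 * (A + A1) * K\<epsilon> ^ k / lam" by simp
      also have "\<dots> \<le> \<zeta>" using c1(6) lam lam1 \<zeta> by (simp add: field_simps) (meson mult_left_mono order_trans less_imp_le)
      finally show ?thesis by (simp add: mult.assoc)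
    qed
    have M1: "M \<ge> 1" using mult_mono[of 1 K\<epsilon> 1 lam] K\<epsilon> lam1 by (simp add: M_def)
    have Mk: "M ^ i \<le> M ^ k" if "i \<le> k" for i using M1 that by (intro power_increasing) auto
    have qA: "A * (sqrt \<sigma> * lam powr A) * M ^ i \<le> \<zeta>" "A1 * (sqrt \<sigma> * lam powr A1) * M ^ i \<le> \<zeta>" if "i \<le> k" for i
    proof -
      have *: "a * (sqrt \<sigma> * lam powr a) * M ^ i \<le> \<zeta>" if a: "a = A \<or> a = A1" for a
      proof -
        have "a * (sqrt \<sigma> * lam powr a) * M ^ i \<le> (A + A1) * (sqrt \<sigma> * lam powr (A + A1)) * M ^ k"
          using a A A1 lam1 M1 \<sigma>0 Mk[OF \<open>i \<le> k\<close>] by (intro mult_mono powr_mono) auto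
        then show ?thesis using qM by (simp add: q_def)
      qed
      show "A * (sqrt \<sigma> * lam powr A) * M ^ i \<le> \<zeta>" "A1 * (sqrt \<sigma> * lam powr A1) * M ^ i \<le> \<zeta>" using * by auto
    qed
    have sq1: "A * sqrt \<sigma> \<le> 1" "A1 * sqrt \<sigma> \<le> 1"
    proof -
      have *: "a * sqrt \<sigma> \<le> 1" if a: "a \<ge> 1" "a * (sqrt \<sigma> * lam powr a) * M ^ 0 \<le> \<zeta>" for a
      proof -
        have "1 \<le> lam powr a" using lam1 a(1) by (intro ge_one_powr_ge_zero) auto
        then have "a * (sqrt \<sigma> * 1) \<le> a * (sqrt \<sigma> * lam powr a)" using a(1) \<sigma>0 by (intro mult_left_mono) auto
        then show ?thesis using a(2) \<zeta>1 by simp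
      qed
      show "A * sqrt \<sigma> \<le> 1" "A1 * sqrt \<sigma> \<le> 1" using *[OF A qA(1)] *[OF A1 qA(2)] by auto
    qed
    have x2: "x \<ge> 2"
    proof -
      have "P \<noteq> {}" using S0 by (auto simp: S_def)
      then obtain i where i: "i \<in> P" by blast
      have "2 \<le> real (w + w1 + 5)" by simp
      also have "\<dots> \<le> x" using zmw[of i] zmp[of i] zpx[OF i] by linarith
      finally show ?thesis .
    qed
    have xC: "x powr C \<le> x\<epsilon>" "x powr C1 \<le> x\<epsilon>"
      unfolding x_def x\<epsilon>_def powr_powr using \<epsilon> \<epsilon>C X3 by (auto intro!: powr_mono)
    have LA: "A \<le> ln X" "A1 \<le> ln X" using c1(2,3) lam lamL unfolding L_def by linarith+
    have zfam: "w \<le> z i \<and> w1 \<le> z i \<and> z i \<le> x \<and> mertens_prod 0 (z i) \<le> \<sigma>" if "z = zm \<or> z = zp" "i \<in> P" for z :: "nat \<Rightarrow> real" and i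
      using that zmw[of i] zmp[of i] zpx[OF that(2)] mer[of i] by auto
    have uvX: "0 \<le> u i \<and> u i < v i \<and> v i \<le> int X" if "i \<in> P" for i using uv[OF that] X0'0 by auto
    define N where "N = real (card AA)"
    have finAA: "finite AA" using AA by (rule finite_subset) auto
    have sub_in: "t \<in> AA" if "i \<in> P" "t \<in> {u i<..v i}" "\<forall>p\<in>primes_between 0 (zp i). \<not> int p dvd t" for i t
    proof (rule AAin)
      have tR: "t \<in> {X0'<..int X}" using that cover by blast
      then show "X powr (1 - \<epsilon>) < real_of_int t" "t \<le> int X" using X0'iff[of t] unfolding x\<epsilon>_def by auto
      fix p assume p: "prime p" "int p dvd t"
      have "p \<notin> primes_between 0 (zp i)" using that(3) p by blast
      then have "zp i < real p" using p prime_gt_0_nat by (auto simp: primes_between_def)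
      moreover have "X powr r t \<le> zp i"
        unfolding zp_def using lev[OF that(1,2)] X3 by (intro powr_mono) (auto simp: \<rho>i_def mult.commute)
      ultimately show "X powr r t < real p" by linarith
    qed
    define Sm where "Sm = {1..X0'}"
    have sub_out: "t \<in> Sm \<or> (\<exists>i\<in>P. t \<in> {u i<..v i} \<and> (\<forall>p\<in>primes_between 0 (zm i). \<not> int p dvd t))" if t: "t \<in> AA" for t
    proof (cases "t \<le> X0'")
      case True
      then show ?thesis using t AA by (auto simp: Sm_def)
    next
      case False
      then have "t \<in> {X0'<..int X}" using t AA by auto
      then obtain i where i: "i \<in> P" "t \<in> {u i<..v i}" using cover by blast
      have "\<not> int p dvd t" if p: "p \<in> primes_between 0 (zm i)" for p
      proof
        assume "int p dvd t"
        then have "X powr ((1 - \<epsilon>) * r t) < real p"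
          using AAout[OF t, of p] p False X0'iff[of t] unfolding x\<epsilon>_def by (auto dest: prime_primes_between)
        moreover have "zm i \<le> X powr ((1 - \<epsilon>) * r t)"
          unfolding zm_def using lev[OF i] X3 \<epsilon> by (intro powr_mono mult_left_mono) (auto simp: \<rho>i_def)
        ultimately show False using p by (auto simp: primes_between_def)
      qed
      then show ?thesis using i by blast
    qed
    have cardSm: "real (card Sm) \<le> x\<epsilon>" using x\<epsilon>1 by (simp add: Sm_def X0'_def)
    \<comment> \<open>A dummy, since for \<open>k = 1\<close> there are no differences to
      constrain.\<close>
    define Js where "Js = (\<lambda>j::nat. {} :: real set)"
    have est1: "\<bar>real (\<Sum>\<phi>\<in>PiE {1..1} (\<lambda>_. P). card (tuple_set 1 (\<lambda>j. u (\<phi> j)) (\<lambda>j. v (\<phi> j)) (\<lambda>j. z (\<phi> j)) Js \<alpha>)) - W\<bar> \<le> 3 * \<zeta> * W"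
      if z: "z = zm \<or> z = zp" and W: "W = (\<Sum>i\<in>P. Y i * mertens_prod 0 (z i))" for z :: "nat \<Rightarrow> real" and W :: real
    proof -
      have WS: "S \<le> W" using z SS' W unfolding S_def S'_def by auto
      have W0: "0 < W" using WS S0 by linarith
      have "\<bar>real (\<Sum>\<phi>\<in>PiE {1..1} (\<lambda>_. P). card (tuple_set 1 (\<lambda>j. u (\<phi> j)) (\<lambda>j. v (\<phi> j)) (\<lambda>j. z (\<phi> j)) Js \<alpha>)) - W ^ 1 * (\<Prod>j\<in>{2..1::nat}. 0)\<bar> \<le>
        \<zeta> * (W ^ 1 * (\<Prod>j\<in>{2..1::nat}. 0)) + (A1 * (sqrt \<sigma> * lam powr A1)) * (W * real (card P) ^ (1 - 1)) + real (card P) ^ 1 * (A1 * 1 ^ 1 * x powr C1)"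
        unfolding W Y_def
      proof (rule sum_tuple_sets_bounds[OF P order_refl])
        fix \<phi> :: "nat \<Rightarrow> nat" assume \<phi>: "\<phi> \<in> PiE {1..1} (\<lambda>_. P)"
        have \<phi>P: "\<phi> 1 \<in> P" using PiE_mem[OF \<phi>, of 1] by simp
        have "\<bar>real (card (tuple_set 1 (\<lambda>j. u (\<phi> j)) (\<lambda>j. v (\<phi> j)) (\<lambda>j. z (\<phi> j)) Js \<alpha>)) - real_of_int (v (\<phi> 1) - u (\<phi> 1)) * mertens_prod 0 (z (\<phi> 1)) * (\<Prod>j\<in>{2..1}. mertens_prod 0 (z (\<phi> j)) * (real_of_int (v (\<phi> j) - u (\<phi> j)) * ((\<lambda>_. 0) j - (\<lambda>_. 0) j)))\<bar> \<le>
        \<zeta> * (real_of_int (v (\<phi> 1) - u (\<phi> 1)) * mertens_prod 0 (z (\<phi> 1)) * (\<Prod>j\<in>{2..1}. mertens_prod 0 (z (\<phi> j)) * (real_of_int (v (\<phi> j) - u (\<phi> j)) * ((\<lambda>_. 0) j - (\<lambda>_. 0) j)))) +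
        A1 * (real_of_int (v (\<phi> 1) - u (\<phi> 1)) * mertens_prod 0 (z (\<phi> 1))) * sqrt \<sigma> * ln (ln X) powr A1 + A1 * 1 ^ 1 * x powr C1"
        proof (rule tc1)
          show "0 \<le> u (\<phi> j) \<and> u (\<phi> j) < v (\<phi> j) \<and> v (\<phi> j) \<le> int X" if "j \<in> {1..1}" for j using uvX[OF \<phi>P] that by simp
          show "real w1 \<le> z (\<phi> j) \<and> z (\<phi> j) \<le> x \<and> mertens_prod 0 (z (\<phi> j)) \<le> \<sigma>" if "j \<in> {1..1}" for j using zfam[OF z \<phi>P] that by simp
        qed (use LA x2 \<sigma>0 sq1 in auto)
        then show "\<bar>real (card (tuple_set 1 (\<lambda>j. u (\<phi> j)) (\<lambda>j. v (\<phi> j)) (\<lambda>j. z (\<phi> j)) Js \<alpha>)) -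
         real_of_int (v (\<phi> 1) - u (\<phi> 1)) * mertens_prod 0 (z (\<phi> 1)) * (\<Prod>j\<in>{2..1}. mertens_prod 0 (z (\<phi> j)) * (real_of_int (v (\<phi> j) - u (\<phi> j)) * 0))\<bar> \<le>
       \<zeta> * (real_of_int (v (\<phi> 1) - u (\<phi> 1)) * mertens_prod 0 (z (\<phi> 1)) * (\<Prod>j\<in>{2..1}. mertens_prod 0 (z (\<phi> j)) * (real_of_int (v (\<phi> j) - u (\<phi> j)) * 0))) +
        A1 * (sqrt \<sigma> * lam powr A1) * (real_of_int (v (\<phi> 1) - u (\<phi> 1)) * mertens_prod 0 (z (\<phi> 1))) + A1 * 1 ^ 1 * x powr C1"
          by (simp add: lam_def L_def mult_ac)
      qed
      then have "\<bar>real (\<Sum>\<phi>\<in>PiE {1..1} (\<lambda>_. P). card (tuple_set 1 (\<lambda>j. u (\<phi> j)) (\<lambda>j. v (\<phi> j)) (\<lambda>j. z (\<phi> j)) Js \<alpha>)) - W\<bar> \<le>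
        \<zeta> * W + A1 * (sqrt \<sigma> * lam powr A1) * W + real (card P) * (A1 * x powr C1)" by simp
      moreover have "A1 * (sqrt \<sigma> * lam powr A1) * W \<le> \<zeta> * W" using qA(2)[of 0] W0 by (intro mult_right_mono) auto
      moreover have "real (card P) * (A1 * x powr C1) \<le> \<zeta> * W"
      proof -
        have "real (card P) * (A1 * x powr C1) \<le> (K\<epsilon> * L) * (A1 * x\<epsilon>)"
        proof (intro mult_mono)
          show "real (card P) \<le> K\<epsilon> * L" using PM lamL K\<epsilon> mult_left_mono[of lam L K\<epsilon>] unfolding M_def by linarith
        qed (use xC A1 K\<epsilon> L1 in auto)
        then have "real (card P) * (A1 * x powr C1) * L ^ 49 \<le> (K\<epsilon> * L) * (A1 * x\<epsilon>) * L ^ 49" using L1 by (intro mult_right_mono) auto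
        also have "\<dots> = (K\<epsilon> * A1) * L ^ 50 * x\<epsilon>" by (simp add: mult_ac power_Suc[symmetric] del: power_Suc)
        also have "\<dots> \<le> \<zeta> * X" using K0 K\<epsilon> A1 by (intro main_small) (auto simp: n0_def)
        also have "\<dots> \<le> \<zeta> * (S * L ^ 49)" using Slow \<zeta> by (intro mult_left_mono) auto
        also have "\<dots> \<le> \<zeta> * (W * L ^ 49)" using WS \<zeta> L1 by (intro mult_left_mono mult_right_mono) auto
        finally have "real (card P) * (A1 * x powr C1) * L ^ 49 \<le> (\<zeta> * W) * L ^ 49" by (simp add: mult.assoc)
        then show ?thesis using L1 by (simp add: mult_le_cancel_right)
      qed
      ultimately show ?thesis by linarith
    qed
    have Nlow: "(1 - 3 * \<zeta>) * S \<le> N"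
    proof -
      have "(\<Sum>\<phi>\<in>PiE {1..1} (\<lambda>_. P). card (tuple_set 1 (\<lambda>j. u (\<phi> j)) (\<lambda>j. v (\<phi> j)) (\<lambda>j. zp (\<phi> j)) Js \<alpha>)) \<le> card (corr_set 1 AA Js \<alpha>)"
        by (rule corr_set_pieces_lower[OF P finAA disj sub_in])
      then have "real (\<Sum>\<phi>\<in>PiE {1..1} (\<lambda>_. P). card (tuple_set 1 (\<lambda>j. u (\<phi> j)) (\<lambda>j. v (\<phi> j)) (\<lambda>j. zp (\<phi> j)) Js \<alpha>)) \<le> N"
        unfolding card_corr_set_1 N_def by (simp only: of_nat_le_iff)
      moreover have "S - 3 * \<zeta> * S \<le> real (\<Sum>\<phi>\<in>PiE {1..1} (\<lambda>_. P). card (tuple_set 1 (\<lambda>j. u (\<phi> j)) (\<lambda>j. v (\<phi> j)) (\<lambda>j. zp (\<phi> j)) Js \<alpha>))"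
        using est1[of zp S, OF disjI2[OF refl] S_def] by linarith
      ultimately show ?thesis by (simp add: algebra_simps)
    qed
    have Nup: "N \<le> (1 + 4 * \<zeta>) * S'"
    proof -
      have "card (corr_set 1 AA Js \<alpha>) \<le> (\<Sum>\<phi>\<in>PiE {1..1} (\<lambda>_. P). card (tuple_set 1 (\<lambda>j. u (\<phi> j)) (\<lambda>j. v (\<phi> j)) (\<lambda>j. zm (\<phi> j)) Js \<alpha>))
         + (\<Sum>l\<in>{1..1}. card {a \<in> corr_set 1 AA Js \<alpha>. a l \<in> Sm})"
        by (rule corr_set_pieces_upper[OF P finAA sub_out])
      moreover have sum1: "(\<Sum>l\<in>{1..1}. card {a \<in> corr_set 1 AA Js \<alpha>. a l \<in> Sm}) = card {a \<in> corr_set 1 AA Js \<alpha>. a 1 \<in> Sm}" by simp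
      ultimately have "N \<le> real (\<Sum>\<phi>\<in>PiE {1..1} (\<lambda>_. P). card (tuple_set 1 (\<lambda>j. u (\<phi> j)) (\<lambda>j. v (\<phi> j)) (\<lambda>j. zm (\<phi> j)) Js \<alpha>)) + real (card {a \<in> corr_set 1 AA Js \<alpha>. a 1 \<in> Sm})"
        unfolding card_corr_set_1 N_def sum1 of_nat_add[symmetric] of_nat_le_iff by - assumption
      moreover have "real (\<Sum>\<phi>\<in>PiE {1..1} (\<lambda>_. P). card (tuple_set 1 (\<lambda>j. u (\<phi> j)) (\<lambda>j. v (\<phi> j)) (\<lambda>j. zm (\<phi> j)) Js \<alpha>)) \<le> S' + 3 * \<zeta> * S'"
        using est1[of zm S', OF disjI1[OF refl] S'_def] by linarith
      moreover have "real (card {a \<in> corr_set 1 AA Js \<alpha>. a 1 \<in> Sm}) \<le> real (card Sm) * 1 ^ 1"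
        using AA by (intro card_bohr_tuples_le) (auto simp: Sm_def)
      moreover have "x\<epsilon> \<le> \<zeta> * S"
      proof -
        have "x\<epsilon> * L ^ 49 \<le> \<zeta> * X" using main_small[of 1 49] K0 by (simp add: n0_def mult.commute)
        also have "\<dots> \<le> \<zeta> * (S * L ^ 49)" using Slow \<zeta> by (intro mult_left_mono) auto
        finally have "x\<epsilon> * L ^ 49 \<le> (\<zeta> * S) * L ^ 49" by (simp add: mult.assoc)
        then show ?thesis using L1 by (simp add: mult_le_cancel_right)
      qed
      moreover have "\<zeta> * S \<le> \<zeta> * S'" using SS' \<zeta> by (intro mult_left_mono) auto
      ultimately show ?thesis using cardSm by (simp add: algebra_simps)
    qed
    have NS: "S / 2 \<le> N"
    proof -
      have "(1 / 2) * S \<le> (1 - 3 * \<zeta>) * S" using \<zeta> S0 by (intro mult_right_mono) auto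
      then show ?thesis using Nlow by linarith
    qed
    have N0: "N > 0" using NS S0 by linarith
    have r1: "S' / N \<le> 1 + 10 * \<zeta>"
    proof -
      have "S' \<le> (1 + \<zeta>) * S" by (rule SS')
      also have "\<dots> \<le> (1 + 10 * \<zeta>) * ((1 - 3 * \<zeta>) * S)"
      proof -
        have "\<zeta> * \<zeta> \<le> \<zeta> * (1 / 10)" using \<zeta> by (intro mult_left_mono) auto
        then have "1 + \<zeta> \<le> (1 + 10 * \<zeta>) * (1 - 3 * \<zeta>)" using \<zeta> by (simp add: algebra_simps)
        then show ?thesis using S0 by (simp only: mult.assoc[symmetric] mult_le_cancel_right) simp
      qed
      also have "\<dots> \<le> (1 + 10 * \<zeta>) * N" using Nlow \<zeta> by (intro mult_left_mono) auto
      finally show ?thesis using N0 by (simp add: field_simps)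
    qed
    have r2: "1 - 10 * \<zeta> \<le> S / N"
    proof -
      have "(1 - 10 * \<zeta>) * N \<le> (1 - 10 * \<zeta>) * ((1 + 4 * \<zeta>) * ((1 + \<zeta>) * S))"
      proof (rule mult_left_mono)
        have "(1 + 4 * \<zeta>) * S' \<le> (1 + 4 * \<zeta>) * ((1 + \<zeta>) * S)" using SS' \<zeta> by (intro mult_left_mono) auto
        then show "N \<le> (1 + 4 * \<zeta>) * ((1 + \<zeta>) * S)" using Nup by linarith
      qed (use \<zeta> in simp)
      also have "\<dots> \<le> 1 * S"
      proof -
        have "(1 - 10 * \<zeta>) * ((1 + 4 * \<zeta>) * (1 + \<zeta>)) = 1 - 5 * \<zeta> - 46 * (\<zeta> * \<zeta>) - 40 * (\<zeta> * \<zeta> * \<zeta>)" by (simp add: algebra_simps)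
        also have "\<dots> \<le> 1"
        proof -
          have "0 \<le> \<zeta> * \<zeta>" "0 \<le> \<zeta> * \<zeta> * \<zeta>" using \<zeta> by auto
          then show ?thesis using \<zeta> by linarith
        qed
        finally have "(1 - 10 * \<zeta>) * ((1 + 4 * \<zeta>) * (1 + \<zeta>)) * S \<le> 1 * S" using S0 by (intro mult_right_mono) auto
        then show ?thesis by (simp only: mult.assoc)
      qed
      finally show ?thesis using N0 by (simp add: field_simps)
    qed
    \<comment> \<open>A bound for \<open>X\<close> times the length of the intervals.
      \<open>X / N\<close> is at most \<open>2 * L ^ 49\<close>, and one more power of
      \<open>L\<close> covers \<open>\<kappa>\<close>.\<close>
    define D where "D = L ^ 50"
    have LX: "X \<le> L ^ 50 * N"
    proof -
      have "S * L ^ 49 \<le> 2 * N * L ^ 49" using NS L1 by (intro mult_right_mono) auto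
      also have "\<dots> \<le> L * N * L ^ 49"
      proof -
        have "4 * \<kappa> \<le> L" using c1(5) lam lamL by linarith
        then have "2 \<le> L" using \<kappa>1 by linarith
        then show ?thesis using N0 L1 by (intro mult_right_mono) auto
      qed
      also have "\<dots> = L ^ 50 * N"
      proof -
        have "L ^ 50 = L * L ^ 49" by (simp flip: power_Suc)
        then show ?thesis by simp
      qed
      finally show ?thesis using Slow by linarith
    qed
    have D1: "D \<ge> 1" unfolding D_def using L1 by (intro one_le_power) simp
    have dl: "(hi j - lo j) / N \<le> 2 * \<kappa> / S \<and> X * ((hi j - lo j) / N) \<le> D \<and> (hi j - lo j) / N < 1" if j: "j \<in> {2..k}" for j
    proof -
      have "(hi j - lo j) / N \<le> \<kappa> / N" using \<kappa>j[OF j] N0 by (intro divide_right_mono) auto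
      also have "\<dots> \<le> \<kappa> / (S / 2)" using NS S0 N0 \<kappa>1 by (intro divide_left_mono) auto
      finally have a: "(hi j - lo j) / N \<le> 2 * \<kappa> / S" by (simp add: mult.commute)
      have "X * ((hi j - lo j) / N) \<le> X * (2 * \<kappa> / S)" using a X0 by (intro mult_left_mono) auto
      also have "\<dots> \<le> (S * L ^ 49) * (2 * \<kappa> / S)" using Slow \<kappa>1 S0 by (intro mult_right_mono) auto
      also have "\<dots> = 2 * \<kappa> * L ^ 49" using S0 by simp
      also have "\<dots> \<le> L * L ^ 49"
      proof (rule mult_right_mono)
        have "4 * \<kappa> \<le> L" using c1(5) lam lamL by linarith
        then show "2 * \<kappa> \<le> L" using \<kappa>1 by linarith
      qed (use L1 in simp)
      also have "\<dots> = D" by (simp add: D_def power_Suc[symmetric] del: power_Suc)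
      finally have b: "X * ((hi j - lo j) / N) \<le> D" .
      have "D < X"
      proof -
        have "8 * L ^ 50 * x\<epsilon> \<le> \<zeta> * X" using K0 by (intro main_small) (auto simp: n0_def)
        also have "\<dots> \<le> 1 * real X" using \<zeta>1 by (intro mult_right_mono) auto
        finally have "8 * L ^ 50 * x\<epsilon> \<le> X" by simp
        moreover have "8 * L ^ 50 * 1 \<le> 8 * L ^ 50 * x\<epsilon>" using x\<epsilon>1 L1 by (intro mult_left_mono) auto
        ultimately show ?thesis using D1 unfolding D_def by linarith
      qed
      then have "real X * ((hi j - lo j) / N) < real X * 1" using b by simp
      then have "(hi j - lo j) / N < 1" using X0 by (simp only: mult_less_cancel_left_pos)
      then show ?thesis using a b by blast
    qed
    define J where "J j = (\<lambda>t. t / N) ` I j" for j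
    have J: "{lo j / N<..<hi j / N} \<subseteq> J j \<and> J j \<subseteq> {lo j / N..hi j / N}" if j: "j \<in> {2..k}" for j
    proof
      show "{lo j / N<..<hi j / N} \<subseteq> J j"
      proof
        fix t assume "t \<in> {lo j / N<..<hi j / N}"
        then have "t * N \<in> {lo j<..<hi j}" using N0 by (auto simp: field_simps)
        then have "t * N \<in> I j" using II[OF j] by blast
        then have "(t * N) / N \<in> J j" unfolding J_def by (rule imageI)
        then show "t \<in> J j" using N0 by simp
      qed
      show "J j \<subseteq> {lo j / N..hi j / N}"
      proof
        fix s assume "s \<in> J j"
        then obtain t where t: "s = t / N" "t \<in> I j" by (auto simp: J_def)
        then have "t \<in> {lo j..hi j}" using II[OF j] by blast
        then show "s \<in> {lo j / N..hi j / N}" using t N0 by (auto intro!: divide_right_mono)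
      qed
    qed
    define dd where "dd j = (hi j - lo j) / N" for j
    \<comment> \<open>Each of the \<open>k - 1\<close> intervals has length of order
      \<open>1 / N\<close>, so the \<open>k\<close>-th power of the sifted mass \<open>W\<close>
      becomes \<open>N\<close> times a power of \<open>W / N\<close>, and this ratio is close to 1
      for \<open>S\<close> and \<open>S'\<close>.\<close>
    have prod_dd: "W ^ k * (\<Prod>j\<in>{2..k}. dd j) = N * ((W / N) ^ k * Vol)" for W
    proof -
      have "(\<Prod>j\<in>{2..k}. dd j) = Vol / N ^ (k - 1)" by (simp add: dd_def Vol_def prod_dividef)
      moreover have "N ^ k = N * N ^ (k - 1)" using k by (simp add: power_Suc[symmetric] del: power_Suc)
      ultimately show ?thesis using N0 by (simp add: power_divide)
    qed
    have estk: "\<bar>real (\<Sum>\<phi>\<in>PiE {1..k} (\<lambda>_. P). card (tuple_set k (\<lambda>j. u (\<phi> j)) (\<lambda>j. v (\<phi> j)) (\<lambda>j. z (\<phi> j)) J \<alpha>)) - N * ((W / N) ^ k * Vol)\<bar> \<le>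
       \<zeta> * (N * ((W / N) ^ k * Vol)) + 3 * \<zeta> * N"
      if z: "z = zm \<or> z = zp" and W: "W = (\<Sum>i\<in>P. Y i * mertens_prod 0 (z i))" for z :: "nat \<Rightarrow> real" and W :: real
    proof -
      have WS: "W \<le> S'" "0 < W" using z SS' W S0 unfolding S_def S'_def by auto
      have "\<bar>real (\<Sum>\<phi>\<in>PiE {1..k} (\<lambda>_. P). card (tuple_set k (\<lambda>j. u (\<phi> j)) (\<lambda>j. v (\<phi> j)) (\<lambda>j. z (\<phi> j)) J \<alpha>)) - W ^ k * (\<Prod>j\<in>{2..k}. dd j)\<bar> \<le>
        \<zeta> * (W ^ k * (\<Prod>j\<in>{2..k}. dd j)) + (A * (sqrt \<sigma> * lam powr A)) * (W * real (card P) ^ (k - 1)) + real (card P) ^ k * (A * D ^ k * x powr C)"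
        unfolding W Y_def
      proof (rule sum_tuple_sets_bounds[OF P k])
        fix \<phi> :: "nat \<Rightarrow> nat" assume \<phi>: "\<phi> \<in> PiE {1..k} (\<lambda>_. P)"
        have \<phi>P: "\<phi> j \<in> P" if "j \<in> {1..k}" for j using PiE_mem[OF \<phi> that] .
        have "\<bar>real (card (tuple_set k (\<lambda>j. u (\<phi> j)) (\<lambda>j. v (\<phi> j)) (\<lambda>j. z (\<phi> j)) J \<alpha>)) - real_of_int (v (\<phi> 1) - u (\<phi> 1)) * mertens_prod 0 (z (\<phi> 1)) * (\<Prod>j\<in>{2..k}. mertens_prod 0 (z (\<phi> j)) * (real_of_int (v (\<phi> j) - u (\<phi> j)) * ((\<lambda>j. hi j / N) j - (\<lambda>j. lo j / N) j)))\<bar> \<le>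
        \<zeta> * (real_of_int (v (\<phi> 1) - u (\<phi> 1)) * mertens_prod 0 (z (\<phi> 1)) * (\<Prod>j\<in>{2..k}. mertens_prod 0 (z (\<phi> j)) * (real_of_int (v (\<phi> j) - u (\<phi> j)) * ((\<lambda>j. hi j / N) j - (\<lambda>j. lo j / N) j)))) +
        A * (real_of_int (v (\<phi> 1) - u (\<phi> 1)) * mertens_prod 0 (z (\<phi> 1))) * sqrt \<sigma> * ln (ln X) powr A + A * D ^ k * x powr C"
        proof (rule tc)
          show "0 \<le> u (\<phi> j) \<and> u (\<phi> j) < v (\<phi> j) \<and> v (\<phi> j) \<le> int X" if "j \<in> {1..k}" for j using uvX[OF \<phi>P[OF that]] .
          show "real w \<le> z (\<phi> j) \<and> z (\<phi> j) \<le> x \<and> mertens_prod 0 (z (\<phi> j)) \<le> \<sigma>" if "j \<in> {1..k}" for j using zfam[OF z \<phi>P[OF that]] by blast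
          fix j assume j: "j \<in> {2..k}"
          have eqd: "hi j / N - lo j / N = (hi j - lo j) / N" by (simp add: diff_divide_distrib)
          have jP: "\<phi> j \<in> P" using \<phi>P[of j] j by auto
          have "Y (\<phi> j) * mertens_prod 0 (z (\<phi> j)) \<le> W"
          proof -
            have "0 \<le> Y i * mertens_prod 0 (z i)" if "i \<in> P" for i
              using Y0[OF that] mertens_prod_pos[of 0 "z i"] by simp
            then show ?thesis unfolding W using jP P by (intro member_le_sum) auto
          qed
          also have "\<dots> \<le> (1 + \<zeta>) * S" using WS SS' by linarith
          finally have yv: "mertens_prod 0 (z (\<phi> j)) * Y (\<phi> j) \<le> S'" using \<open>Y (\<phi> j) * mertens_prod 0 (z (\<phi> j)) \<le> W\<close> WS by (simp add: mult.commute)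
          have "mertens_prod 0 (z (\<phi> j)) * (Y (\<phi> j) * ((hi j - lo j) / N)) \<le> S' * ((hi j - lo j) / N)"
            unfolding mult.assoc[symmetric, of "mertens_prod 0 (z (\<phi> j))"] using yv lohi[OF j] N0 by (intro mult_right_mono) auto
          also have "\<dots> = S' / N * (hi j - lo j)" by simp
          also have "\<dots> \<le> 2 * \<kappa>"
            using r1 \<zeta> \<kappa>j[OF j] lohi[OF j] S'0 N0 by (intro mult_mono) auto
          finally have bb: "mertens_prod 0 (z (\<phi> j)) * (Y (\<phi> j) * ((hi j - lo j) / N)) \<le> 2 * \<kappa>" .
          show "lo j / N \<le> hi j / N \<and> hi j / N - lo j / N < 1 \<and> {lo j / N<..<hi j / N} \<subseteq> J j \<and> J j \<subseteq> {lo j / N..hi j / N} \<and>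
            mertens_prod 0 (z (\<phi> j)) * (real_of_int (v (\<phi> j) - u (\<phi> j)) * (hi j / N - lo j / N)) \<le> 2 * \<kappa> \<and> real X * (hi j / N - lo j / N) \<le> D"
            using J[OF j] dl[OF j] bb lohi[OF j] N0 unfolding eqd Y_def by (simp add: divide_right_mono)
        qed (use LA x2 \<sigma>0 sq1 D1 in auto)
        then show "\<bar>real (card (tuple_set k (\<lambda>j. u (\<phi> j)) (\<lambda>j. v (\<phi> j)) (\<lambda>j. z (\<phi> j)) J \<alpha>)) -
         real_of_int (v (\<phi> 1) - u (\<phi> 1)) * mertens_prod 0 (z (\<phi> 1)) * (\<Prod>j\<in>{2..k}. mertens_prod 0 (z (\<phi> j)) * (real_of_int (v (\<phi> j) - u (\<phi> j)) * dd j))\<bar> \<le>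
       \<zeta> * (real_of_int (v (\<phi> 1) - u (\<phi> 1)) * mertens_prod 0 (z (\<phi> 1)) * (\<Prod>j\<in>{2..k}. mertens_prod 0 (z (\<phi> j)) * (real_of_int (v (\<phi> j) - u (\<phi> j)) * dd j))) +
        A * (sqrt \<sigma> * lam powr A) * (real_of_int (v (\<phi> 1) - u (\<phi> 1)) * mertens_prod 0 (z (\<phi> 1))) + A * D ^ k * x powr C"
          by (simp add: lam_def L_def dd_def diff_divide_distrib mult_ac)
      qed
      moreover have "(A * (sqrt \<sigma> * lam powr A)) * (W * real (card P) ^ (k - 1)) \<le> \<zeta> * (2 * N)"
      proof -
        have "real (card P) ^ (k - 1) \<le> M ^ (k - 1)" using PM by (intro power_mono) auto
        then have "(A * (sqrt \<sigma> * lam powr A)) * (W * real (card P) ^ (k - 1)) \<le> (A * (sqrt \<sigma> * lam powr A)) * (W * M ^ (k - 1))"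
          using A \<sigma>0 WS by (intro mult_left_mono) auto
        also have "\<dots> = (A * (sqrt \<sigma> * lam powr A) * M ^ (k - 1)) * W" by simp
        also have "\<dots> \<le> \<zeta> * (2 * N)"
        proof (rule mult_mono)
          have "S' \<le> (1 + 10 * \<zeta>) * N" using r1 N0 by (simp add: field_simps)
          also have "\<dots> \<le> 2 * N" using \<zeta> N0 by (intro mult_right_mono) auto
          finally show "W \<le> 2 * N" using WS by linarith
        qed (use qA(1)[of "k - 1"] \<zeta> WS in auto)
        finally show ?thesis .
      qed
      moreover have "real (card P) ^ k * (A * D ^ k * x powr C) \<le> \<zeta> * N"
      proof -
        have "real (card P) ^ k * (A * D ^ k * x powr C) \<le> (K\<epsilon> * L) ^ k * (A * D ^ k * x\<epsilon>)"
        proof (intro mult_mono power_mono)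
          show "real (card P) \<le> K\<epsilon> * L" using PM lamL K\<epsilon> mult_left_mono[of lam L K\<epsilon>] unfolding M_def by linarith
        qed (use xC A K\<epsilon> L1 D1 in auto)
        then have "real (card P) ^ k * (A * D ^ k * x powr C) * L ^ 50 \<le> (K\<epsilon> * L) ^ k * (A * D ^ k * x\<epsilon>) * L ^ 50"
          using L1 by (intro mult_right_mono) auto
        also have "\<dots> = (K\<epsilon> ^ k * A) * L ^ (51 * k + 50) * x\<epsilon>"
          by (simp add: D_def power_mult_distrib power_add power_mult[symmetric] mult_ac) (simp add: mult.commute flip: power_add)
        also have "\<dots> \<le> \<zeta> * X"
        proof (rule main_small)
          have "K\<epsilon> ^ k * A \<le> K\<epsilon> ^ k * (A + A1)" using K\<epsilon> A1 by (intro mult_left_mono) auto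
          then show "K\<epsilon> ^ k * A \<le> K0" using K0(2) by linarith
        qed (use K\<epsilon> A in \<open>auto simp: n0_def\<close>)
        also have "\<dots> \<le> \<zeta> * (L ^ 50 * N)" using LX \<zeta> by (intro mult_left_mono) auto
        finally have "real (card P) ^ k * (A * D ^ k * x powr C) * L ^ 50 \<le> (\<zeta> * N) * L ^ 50" by (simp add: mult_ac)
        then show ?thesis using L1 by (simp add: mult_le_cancel_right)
      qed
      ultimately show ?thesis unfolding prod_dd by linarith
    qed
    \<comment> \<open>Tuples with an entry up to \<open>X powr (1 - \<epsilon>)\<close>. The bound
      without sieving exceeds the number of such entries only by a power of \<open>L\<close>, which
      is still small compared with \<open>N\<close>.\<close>
    have small_tuples: "real (\<Sum>l\<in>{1..k}. card {a \<in> corr_set k AA J \<alpha>. a l \<in> Sm}) \<le> \<zeta> * N"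
    proof -
      have bd: "real (card (bohr_set (int X) (J j) \<alpha>)) \<le> CB * D" if j: "j \<in> {2..k}" for j
      proof (rule bohr)
        show "lo j / N \<le> hi j / N" using lohi[OF j] N0 by (intro divide_right_mono) auto
        show "hi j / N - lo j / N < 1" "real X * (hi j / N - lo j / N) \<le> D"
          using dl[OF j] by (simp_all add: diff_divide_distrib)
      qed (use J[OF j] X3 D1 in auto)
      have CBD: "1 \<le> CB * D" using mult_mono[of 1 CB 1 D] CB D1 by simp
      have "real (\<Sum>l\<in>{1..k}. card {a \<in> corr_set k AA J \<alpha>. a l \<in> Sm}) = (\<Sum>l\<in>{1..k}. real (card {a \<in> corr_set k AA J \<alpha>. a l \<in> Sm}))" by simp
      also have "\<dots> \<le> (\<Sum>l\<in>{1..k}. card Sm * (CB * D) ^ k)"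
        using AA CBD bd by (intro sum_mono card_bohr_tuples_le[where X = X]) (auto simp: Sm_def)
      also have "\<dots> = k * (card Sm * (CB * D) ^ k)" by simp
      also have "\<dots> \<le> k * (x\<epsilon> * (CB * D) ^ k)" using cardSm CBD by (intro mult_left_mono mult_right_mono) auto
      finally have "real (\<Sum>l\<in>{1..k}. card {a \<in> corr_set k AA J \<alpha>. a l \<in> Sm}) * L ^ 50 \<le> k * (x\<epsilon> * (CB * D) ^ k) * L ^ 50"
        using L1 by (intro mult_right_mono) auto
      also have "\<dots> = (k * CB ^ k) * L ^ (50 * k + 50) * x\<epsilon>"
        by (simp add: D_def power_mult_distrib power_add power_mult[symmetric] mult_ac)
      also have "\<dots> \<le> \<zeta> * X" using K0 CB by (intro main_small) (auto simp: n0_def)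
      also have "\<dots> \<le> \<zeta> * (L ^ 50 * N)" using LX \<zeta> by (intro mult_left_mono) auto
      finally have "real (\<Sum>l\<in>{1..k}. card {a \<in> corr_set k AA J \<alpha>. a l \<in> Sm}) * L ^ 50 \<le> (\<zeta> * N) * L ^ 50" by (simp add: mult_ac)
      then show ?thesis using L1 by (simp add: mult_le_cancel_right)
    qed
    define T where "T = real (card (corr_set k AA J \<alpha>))"
    have Tlow: "N * ((1 - \<zeta>) * (1 - 10 * \<zeta>) ^ k * Vol - 4 * \<zeta>) \<le> T"
    proof -
      have "(\<Sum>\<phi>\<in>PiE {1..k} (\<lambda>_. P). card (tuple_set k (\<lambda>j. u (\<phi> j)) (\<lambda>j. v (\<phi> j)) (\<lambda>j. zp (\<phi> j)) J \<alpha>)) \<le> card (corr_set k AA J \<alpha>)"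
        by (rule corr_set_pieces_lower[OF P finAA disj sub_in])
      then have "real (\<Sum>\<phi>\<in>PiE {1..k} (\<lambda>_. P). card (tuple_set k (\<lambda>j. u (\<phi> j)) (\<lambda>j. v (\<phi> j)) (\<lambda>j. zp (\<phi> j)) J \<alpha>)) \<le> T"
        unfolding T_def by (simp only: of_nat_le_iff)
      then have t: "(1 - \<zeta>) * (N * ((S / N) ^ k * Vol)) - 3 * \<zeta> * N \<le> T"
        using estk[of zp S] unfolding S_def[symmetric] abs_le_iff by (simp add: algebra_simps S_def)
      have "(1 - 10 * \<zeta>) ^ k \<le> (S / N) ^ k" using r2 \<zeta> by (intro power_mono) auto
      then have "(1 - \<zeta>) * (N * ((1 - 10 * \<zeta>) ^ k * Vol)) \<le> (1 - \<zeta>) * (N * ((S / N) ^ k * Vol))"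
        using \<zeta> N0 Vol0 by (intro mult_left_mono mult_right_mono) auto
      moreover have "N * ((1 - \<zeta>) * (1 - 10 * \<zeta>) ^ k * Vol - 4 * \<zeta>) = (1 - \<zeta>) * (N * ((1 - 10 * \<zeta>) ^ k * Vol)) - 4 * (\<zeta> * N)"
        by (simp add: right_diff_distrib mult_ac)
      moreover have "0 \<le> \<zeta> * N" using \<zeta> N0 by simp
      ultimately show ?thesis using t by linarith
    qed
    have Tup: "T \<le> N * ((1 + \<zeta>) * (1 + 10 * \<zeta>) ^ k * Vol + 4 * \<zeta>)"
    proof -
      have "card (corr_set k AA J \<alpha>) \<le> (\<Sum>\<phi>\<in>PiE {1..k} (\<lambda>_. P). card (tuple_set k (\<lambda>j. u (\<phi> j)) (\<lambda>j. v (\<phi> j)) (\<lambda>j. zm (\<phi> j)) J \<alpha>))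
         + (\<Sum>l\<in>{1..k}. card {a \<in> corr_set k AA J \<alpha>. a l \<in> Sm})"
        by (rule corr_set_pieces_upper[OF P finAA sub_out])
      then have "T \<le> real ((\<Sum>\<phi>\<in>PiE {1..k} (\<lambda>_. P). card (tuple_set k (\<lambda>j. u (\<phi> j)) (\<lambda>j. v (\<phi> j)) (\<lambda>j. zm (\<phi> j)) J \<alpha>))
         + (\<Sum>l\<in>{1..k}. card {a \<in> corr_set k AA J \<alpha>. a l \<in> Sm}))"
        unfolding T_def by (simp only: of_nat_le_iff)
      then have "T \<le> real (\<Sum>\<phi>\<in>PiE {1..k} (\<lambda>_. P). card (tuple_set k (\<lambda>j. u (\<phi> j)) (\<lambda>j. v (\<phi> j)) (\<lambda>j. zm (\<phi> j)) J \<alpha>)) + \<zeta> * N"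
        using small_tuples unfolding of_nat_add by linarith
      then have t: "T \<le> (1 + \<zeta>) * (N * ((S' / N) ^ k * Vol)) + 4 * (\<zeta> * N)"
        using estk[of zm S'] unfolding S'_def[symmetric] abs_le_iff by (simp add: algebra_simps S'_def)
      have "(S' / N) ^ k \<le> (1 + 10 * \<zeta>) ^ k" using r1 S'0 N0 by (intro power_mono) auto
      then have "(1 + \<zeta>) * (N * ((S' / N) ^ k * Vol)) \<le> (1 + \<zeta>) * (N * ((1 + 10 * \<zeta>) ^ k * Vol))"
        using \<zeta> N0 Vol0 by (intro mult_left_mono mult_right_mono) auto
      moreover have "N * ((1 + \<zeta>) * (1 + 10 * \<zeta>) ^ k * Vol + 4 * \<zeta>) = (1 + \<zeta>) * (N * ((1 + 10 * \<zeta>) ^ k * Vol)) + 4 * (\<zeta> * N)"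
        by (simp add: distrib_left mult_ac)
      ultimately show ?thesis using t by linarith
    qed
    have "T / N \<le> Vol + \<xi>" "Vol - \<xi> \<le> T / N"
    proof -
      have "T / N \<le> (1 + \<zeta>) * (1 + 10 * \<zeta>) ^ k * Vol + 4 * \<zeta>" using Tup N0 by (simp add: pos_divide_le_eq mult.commute)
      then show "T / N \<le> Vol + \<xi>" using \<zeta>up by linarith
      have "(1 - \<zeta>) * (1 - 10 * \<zeta>) ^ k * Vol - 4 * \<zeta> \<le> T / N" using Tlow N0 by (simp add: pos_le_divide_eq mult.commute)
      then show "Vol - \<xi> \<le> T / N" using \<zeta>lo by linarith
    qed
    then have "\<bar>T / N - Vol\<bar> \<le> \<xi>" by linarith
    then show ?case using LX unfolding T_def J_def N_def Vol_def L_def by blast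
  qed
qed

section \<open>Gaps from correlations\<close>

text \<open>Two ways of fibring the same set. The first isolates the base point of a correlation;
  the second extends injective maps by one value.\<close>

lemma card_PiE_insert:
  assumes x: "x \<notin> S" and S: "finite S" and T: "\<And>i. i \<in> insert x S \<Longrightarrow> finite (T i)"
  shows "card {a \<in> PiE (insert x S) T. Q a} = (\<Sum>y\<in>T x. card {g \<in> PiE S T. Q (g(x := y))})"
    and "card {a \<in> PiE (insert x S) T. Q a} = (\<Sum>g\<in>PiE S T. card {y \<in> T x. Q (g(x := y))})"
proof -
  let ?f = "\<lambda>(y, g). g(x := y)"
  have eq: "{a \<in> PiE (insert x S) T. Q a} = ?f ` {p \<in> T x \<times> PiE S T. Q (?f p)}"
    unfolding PiE_insert_eq by auto
  have inj: "inj_on ?f {p \<in> T x \<times> PiE S T. Q (?f p)}"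
    by (rule inj_on_subset[OF inj_combinator[OF x]]) auto
  have fin: "finite (T x)" "finite (PiE S T)" using S T by (auto intro!: finite_PiE)
  have 1: "{p \<in> T x \<times> PiE S T. Q (?f p)} = (SIGMA y:T x. {g \<in> PiE S T. Q (g(x := y))})" by auto
  show "card {a \<in> PiE (insert x S) T. Q a} = (\<Sum>y\<in>T x. card {g \<in> PiE S T. Q (g(x := y))})"
    unfolding eq card_image[OF inj] unfolding 1 using fin by (subst card_SigmaI) auto
  have 2: "{p \<in> T x \<times> PiE S T. Q (?f p)} = prod.swap ` (SIGMA g:PiE S T. {y \<in> T x. Q (g(x := y))})" by auto
  have "inj_on prod.swap (SIGMA g:PiE S T. {y \<in> T x. Q (g(x := y))})" by (auto intro!: inj_onI)
  then show "card {a \<in> PiE (insert x S) T. Q a} = (\<Sum>g\<in>PiE S T. card {y \<in> T x. Q (g(x := y))})"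
    unfolding eq card_image[OF inj] unfolding 2 using fin by (subst card_image) (auto simp: card_SigmaI)
qed

lemma card_injective_PiE:
  assumes "finite S" and M: "finite M"
  shows "card {g \<in> PiE S (\<lambda>_. M). inj_on g S} = fact (card S) * (card M choose card S)"
  using assms(1)
proof (induction S rule: finite_induct)
  case empty
  then show ?case by simp
next
  case (insert x S)
  have "card {a \<in> PiE (insert x S) (\<lambda>_. M). inj_on a (insert x S)} = (\<Sum>g\<in>PiE S (\<lambda>_. M). card {y \<in> M. inj_on (g(x := y)) (insert x S)})"
    using insert M by (intro card_PiE_insert(2)) auto
  also have "\<dots> = (\<Sum>g\<in>PiE S (\<lambda>_. M). if inj_on g S then card M - card S else 0)"
  proof (rule sum.cong[OF refl])
    fix g assume g: "g \<in> PiE S (\<lambda>_. M)"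
    have on: "inj_on (g(x := y)) (insert x S) \<longleftrightarrow> inj_on g S \<and> y \<notin> g ` S" for y
    proof -
      have "inj_on (g(x := y)) S \<longleftrightarrow> inj_on g S" using insert(2) by (intro inj_on_cong) auto
      moreover have "(g(x := y)) ` S = g ` S" using insert(2) by auto
      ultimately show ?thesis using insert(2) by simp
    qed
    show "card {y \<in> M. inj_on (g(x := y)) (insert x S)} = (if inj_on g S then card M - card S else 0)"
    proof (cases "inj_on g S")
      case True
      have "{y \<in> M. inj_on (g(x := y)) (insert x S)} = M - g ` S" unfolding on using True by auto
      moreover have "g ` S \<subseteq> M" using g by auto
      ultimately show ?thesis using True insert(1) by (simp add: card_Diff_subset card_image)
    next
      case False
      then show ?thesis unfolding on by simp
    qed
  qed
  also have "\<dots> = card {g \<in> PiE S (\<lambda>_. M). inj_on g S} * (card M - card S)"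
    using insert(1) M by (simp add: finite_PiE flip: sum.inter_filter)
  also have "\<dots> = fact (card S) * ((card M - card S) * (card M choose card S))" unfolding insert.IH by (simp add: mult_ac)
  also have "(card M - card S) * (card M choose card S) = Suc (card S) * (card M choose Suc (card S))"
    by (simp only: binomial_absorb_comp binomial_absorption)
  also have "fact (card S) * (Suc (card S) * (card M choose Suc (card S))) = fact (card (insert x S)) * (card M choose card (insert x S))"
    using insert by (simp add: algebra_simps)
  finally show ?case .
qed

text \<open>For \<open>c = Suc d\<close> Pascal's rule collapses the alternating sum to
  \<open>(-1) ^ b * (d choose b)\<close>, and \<open>d choose b\<close> is at most
  \<open>Suc d choose Suc b\<close>.\<close>

lemma alternating_binomial_bound:
  "\<bar>(if c = 0 then 1 else 0) - (\<Sum>j\<le>b. (- 1) ^ j * real (c choose j))\<bar> \<le> real (c choose Suc b)"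
proof (cases c)
  case 0
  have "(\<Sum>j\<le>b. (- 1) ^ j * real (0 choose j)) = (\<Sum>j\<in>{0}. (- 1) ^ j * real (0 choose j))"
    by (intro sum.mono_neutral_right) auto
  then show ?thesis using 0 by simp
next
  case (Suc d)
  have "(\<Sum>j\<le>b. (- 1) ^ j * real (Suc d choose j)) = (- 1) ^ b * real (d choose b)"
  proof (induction b)
    case (Suc b)
    then show ?case by (simp add: algebra_simps)
  qed simp
  then show ?thesis using Suc by (simp add: abs_mult power_abs)
qed

lemma ncard_zero_bound:
  fixes c :: "'a \<Rightarrow> nat"
  assumes "finite D"
  shows "\<bar>real (card {n \<in> D. c n = 0}) - (\<Sum>j\<le>b. (- 1) ^ j * (\<Sum>n\<in>D. real (c n choose j)))\<bar> \<le> (\<Sum>n\<in>D. real (c n choose Suc b))"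
proof -
  have "real (card {n \<in> D. c n = 0}) = (\<Sum>n\<in>D. if c n = 0 then 1 else 0)"
    using assms by (simp flip: sum.inter_filter)
  moreover have "(\<Sum>j\<le>b. (- 1) ^ j * (\<Sum>n\<in>D. real (c n choose j))) = (\<Sum>n\<in>D. \<Sum>j\<le>b. (- 1) ^ j * real (c n choose j))"
    unfolding sum_distrib_left by (rule sum.swap)
  ultimately have "\<bar>real (card {n \<in> D. c n = 0}) - (\<Sum>j\<le>b. (- 1) ^ j * (\<Sum>n\<in>D. real (c n choose j)))\<bar> =
     \<bar>\<Sum>n\<in>D. (if c n = 0 then 1 else 0) - (\<Sum>j\<le>b. (- 1) ^ j * real (c n choose j))\<bar>"
    by (simp add: sum_subtractf)
  also have "\<dots> \<le> (\<Sum>n\<in>D. \<bar>(if c n = 0 then 1 else 0) - (\<Sum>j\<le>b. (- 1) ^ j * real (c n choose j))\<bar>)" by (rule sum_abs)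
  also have "\<dots> \<le> (\<Sum>n\<in>D. real (c n choose Suc b))" by (intro sum_mono alternating_binomial_bound)
  finally show ?thesis .
qed

text \<open>For \<open>I\<close> on the negative axis these are the points that follow
  \<open>x n\<close> at a distance measured in units of \<open>1 / N\<close>, so having no
  neighbours means being followed by a long gap.\<close>

definition neighbours :: "real set \<Rightarrow> nat \<Rightarrow> (nat \<Rightarrow> real) \<Rightarrow> nat \<Rightarrow> nat set" where
  "neighbours I N x n = {m \<in> {1..N}. real N * (x n - x m) \<in> I}"

text \<open>The first entry is the base point \<open>n\<close>; the others form an injective map
  into its neighbours, and \<open>fact j\<close> times the binomial coefficient counts such maps.
  \<open>0 \<notin> I\<close> keeps \<open>n\<close> out of its own neighbours, so injectivity of
  the whole tuple follows.\<close>

lemma correlation_eq_sum_binomial: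
  assumes I: "0 \<notin> I"
  shows "correlation (Suc j) (PiE {2..Suc j} (\<lambda>_. I)) N x = fact j * (\<Sum>n\<in>{1..N}. real (card (neighbours I N x n) choose j)) / real N"
proof -
  have ins: "{1..Suc j} = insert 1 {2..Suc j}" by auto
  have notin: "(1::nat) \<notin> {2..Suc j}" by simp
  let ?Q = "\<lambda>a. inj_on a (insert 1 {2..Suc j}) \<and> (\<forall>i\<in>{2..Suc j}. real N * (x (a 1) - x (a i)) \<in> I)"
  have "card {a \<in> PiE (insert 1 {2..Suc j}) (\<lambda>_. {1..N}). ?Q a} = (\<Sum>n\<in>{1..N}. card {g \<in> PiE {2..Suc j} (\<lambda>_. {1..N}). ?Q (g(1 := n))})"
    by (rule card_PiE_insert(1)) auto
  also have "\<dots> = (\<Sum>n\<in>{1..N}. fact j * (card (neighbours I N x n) choose j))"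
  proof (rule sum.cong[OF refl])
    fix n assume n: "n \<in> {1..N}"
    have "{g \<in> PiE {2..Suc j} (\<lambda>_. {1..N}). ?Q (g(1 := n))} = {g \<in> PiE {2..Suc j} (\<lambda>_. neighbours I N x n). inj_on g {2..Suc j}}"
    proof (intro subset_antisym subsetI)
      fix g assume "g \<in> {g \<in> PiE {2..Suc j} (\<lambda>_. {1..N}). ?Q (g(1 := n))}"
      then have g: "g \<in> PiE {2..Suc j} (\<lambda>_. {1..N})" and inj: "inj_on (g(1 := n)) (insert 1 {2..Suc j})"
        and c: "\<forall>i\<in>{2..Suc j}. real N * (x ((g(1 := n)) 1) - x ((g(1 := n)) i)) \<in> I" by auto
      have "inj_on (g(1 := n)) {2..Suc j}" using inj by (rule inj_on_subset) auto
      then have "inj_on g {2..Suc j}" by (rule inj_on_cong[THEN iffD1, rotated]) auto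
      moreover have "g i \<in> neighbours I N x n" if "i \<in> {2..Suc j}" for i
        using c[rule_format, OF that] that PiE_mem[OF g that] by (auto simp: neighbours_def)
      ultimately show "g \<in> {g \<in> PiE {2..Suc j} (\<lambda>_. neighbours I N x n). inj_on g {2..Suc j}}"
        using g by (auto simp: PiE_iff)
    next
      fix g assume "g \<in> {g \<in> PiE {2..Suc j} (\<lambda>_. neighbours I N x n). inj_on g {2..Suc j}}"
      then have g: "g \<in> PiE {2..Suc j} (\<lambda>_. neighbours I N x n)" and inj: "inj_on g {2..Suc j}" by auto
      have gm: "g i \<in> {1..N}" "real N * (x n - x (g i)) \<in> I" if "i \<in> {2..Suc j}" for i
        using PiE_mem[OF g that] by (auto simp: neighbours_def)
      have "inj_on (g(1 := n)) {2..Suc j}" using inj by (rule inj_on_cong[THEN iffD1, rotated]) auto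
      moreover have "n \<notin> (g(1 := n)) ` {2..Suc j}"
      proof
        assume "n \<in> (g(1 := n)) ` {2..Suc j}"
        then obtain i where i: "i \<in> {2..Suc j}" "n = (g(1 := n)) i" by blast
        then have "n = g i" by auto
        then show False using gm(2)[OF i(1)] I by simp
      qed
      ultimately have "inj_on (g(1 := n)) (insert 1 {2..Suc j})" by simp
      then show "g \<in> {g \<in> PiE {2..Suc j} (\<lambda>_. {1..N}). ?Q (g(1 := n))}"
        using g gm by (auto simp: PiE_iff)
    qed
    moreover have "finite (neighbours I N x n)" by (simp add: neighbours_def)
    ultimately show "card {g \<in> PiE {2..Suc j} (\<lambda>_. {1..N}). ?Q (g(1 := n))} = fact j * (card (neighbours I N x n) choose j)"
      by (simp add: card_injective_PiE)
  qed
  finally have "real (card {a \<in> PiE (insert 1 {2..Suc j}) (\<lambda>_. {1..N}). ?Q a}) = fact j * (\<Sum>n\<in>{1..N}. real (card (neighbours I N x n) choose j))"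
    by (simp add: sum_distrib_left)
  then show ?thesis unfolding correlation_def restrict_PiE_iff ins by simp
qed

lemma interval_measure:
  fixes I :: "real set"
  assumes "lo \<le> hi" "{lo<..<hi} \<subseteq> I" "I \<subseteq> {lo..hi}"
  shows "I \<in> sets lborel" "emeasure lborel I = ennreal (hi - lo)"
proof -
  have "I = {lo<..<hi} \<union> (I \<inter> {lo, hi})" using assms by force
  moreover have "finite (I \<inter> {lo, hi})" by simp
  then have "I \<inter> {lo, hi} \<in> sets borel" by (intro borel_closed finite_imp_closed)
  then have "{lo<..<hi} \<union> (I \<inter> {lo, hi}) \<in> sets borel" by (intro sets.Un) auto
  ultimately show I: "I \<in> sets lborel" by (metis sets_lborel)
  have "emeasure lborel I \<le> emeasure lborel {lo..hi}" by (rule emeasure_mono[OF assms(3)]) simp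
  moreover have "emeasure lborel {lo<..<hi} \<le> emeasure lborel I" by (rule emeasure_mono[OF assms(2) I])
  ultimately show "emeasure lborel I = ennreal (hi - lo)" using assms(1) by simp
qed

lemma rectangle_volume_PiE:
  assumes "\<And>j. j \<in> {2..k} \<Longrightarrow> lo j \<le> hi j \<and> {lo j<..<hi j} \<subseteq> I j \<and> I j \<subseteq> {lo j..hi j}"
  shows "rectangle_volume k (PiE {2..k} I) = (\<Prod>j\<in>{2..k}. hi j - lo j)"
proof -
  interpret product_sigma_finite "\<lambda>_::nat. lborel :: real measure"
    by (simp add: product_sigma_finite_def sigma_finite_lborel)
  have m: "I j \<in> sets lborel" "emeasure lborel (I j) = ennreal (hi j - lo j)" "0 \<le> hi j - lo j" if "j \<in> {2..k}" for j
    using assms[OF that] interval_measure[of "lo j" "hi j" "I j"] by simp_all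
  have "emeasure (PiM {2..k} (\<lambda>_. lborel)) (PiE {2..k} I) = (\<Prod>j\<in>{2..k}. emeasure lborel (I j))"
    using m(1) by (intro emeasure_PiM) simp_all
  also have "\<dots> = (\<Prod>j\<in>{2..k}. ennreal (hi j - lo j))" using m(2) by (intro prod.cong refl)
  also have "\<dots> = ennreal (\<Prod>j\<in>{2..k}. hi j - lo j)" by (rule prod_ennreal) (rule m(3))
  finally show ?thesis using prod_nonneg[OF m(3), of "{2..k}"] by (simp add: rectangle_volume_def measure_def)
qed

text \<open>The binomial moments of the number of neighbours are the correlations divided by factorials.\<close>

lemma isolated_proportion_tendsto:
  fixes L :: "nat \<Rightarrow> nat" and y :: "nat \<Rightarrow> nat \<Rightarrow> real"
  assumes L: "filterlim L at_top sequentially"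
    and corr: "\<And>k. k \<ge> 2 \<Longrightarrow> array_poissonian_correlations k L y"
    and I: "lo \<le> hi" "{lo<..<hi} \<subseteq> I" "I \<subseteq> {lo..hi}" "is_interval I" "0 \<notin> I"
  shows "(\<lambda>m. real (card {n \<in> {1..L m}. card (neighbours I (L m) (y m) n) = 0}) / real (L m)) \<longlonglongrightarrow> exp (- (hi - lo))"
proof -
  define s where "s = hi - lo"
  have s0: "s \<ge> 0" using I by (simp add: s_def)
  define B where "B j m = (\<Sum>n\<in>{1..L m}. real (card (neighbours I (L m) (y m) n) choose j)) / real (L m)" for j m
  define p where "p m = real (card {n \<in> {1..L m}. card (neighbours I (L m) (y m) n) = 0}) / real (L m)" for m
  have B: "B j \<longlonglongrightarrow> s ^ j / fact j" for j
  proof (cases "j = 0")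
    case True
    have "eventually (\<lambda>m. L m \<ge> 1) sequentially" using L by (simp add: filterlim_at_top)
    then have "eventually (\<lambda>m. B j m = 1) sequentially" by eventually_elim (simp add: B_def True)
    then have "B j \<longlonglongrightarrow> 1" by (rule tendsto_eventually)
    then show ?thesis using True by simp
  next
    case False
    have "bounded I" by (rule bounded_subset[OF bounded_closed_interval I(3)])
    then have "bounded_rectangle (Suc j) (PiE {2..Suc j} (\<lambda>_. I))" using I by (auto simp: bounded_rectangle_def)
    then have "(\<lambda>m. correlation (Suc j) (PiE {2..Suc j} (\<lambda>_. I)) (L m) (y m)) \<longlonglongrightarrow> rectangle_volume (Suc j) (PiE {2..Suc j} (\<lambda>_. I))"
      using corr[of "Suc j"] False unfolding array_poissonian_correlations_def by simp
    moreover have "rectangle_volume (Suc j) (PiE {2..Suc j} (\<lambda>_. I)) = s ^ j"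
      using I by (subst rectangle_volume_PiE[where lo = "\<lambda>_. lo" and hi = "\<lambda>_. hi"]) (auto simp: s_def)
    moreover have "correlation (Suc j) (PiE {2..Suc j} (\<lambda>_. I)) (L m) (y m) = fact j * B j m" for m
      unfolding correlation_eq_sum_binomial[OF I(5)] B_def by simp
    ultimately have "(\<lambda>m. fact j * B j m / fact j) \<longlonglongrightarrow> s ^ j / fact j" by (intro tendsto_divide) auto
    then show ?thesis by simp
  qed
  have key: "\<bar>p m - (\<Sum>j\<le>b. (- 1) ^ j * B j m)\<bar> \<le> B (Suc b) m" for b m
  proof -
    let ?q = "real (card {n \<in> {1..L m}. card (neighbours I (L m) (y m) n) = 0})"
    let ?t = "\<lambda>j. \<Sum>n\<in>{1..L m}. real (card (neighbours I (L m) (y m) n) choose j)"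
    have "\<bar>?q - (\<Sum>j\<le>b. (- 1) ^ j * ?t j)\<bar> / real (L m) \<le> ?t (Suc b) / real (L m)"
      by (intro divide_right_mono ncard_zero_bound) auto
    moreover have "p m - (\<Sum>j\<le>b. (- 1) ^ j * B j m) = (?q - (\<Sum>j\<le>b. (- 1) ^ j * ?t j)) / real (L m)"
    proof -
      have "(\<Sum>j\<le>b. (- 1) ^ j * B j m) = (\<Sum>j\<le>b. (- 1) ^ j * ?t j) / real (L m)"
        by (simp only: B_def sum_divide_distrib[of _ "{..b}"] times_divide_eq_right)
      then show ?thesis by (simp only: p_def diff_divide_distrib)
    qed
    ultimately show ?thesis by (simp add: B_def abs_divide)
  qed
  \<comment> \<open>The cutoff \<open>b\<close> is chosen first, so that the partial exponential
    series and its next term are within \<open>e / 4\<close>; only finitely many moments are then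
    needed as \<open>m\<close> grows.\<close>
  have "p \<longlonglongrightarrow> exp (- s)"
  proof (rule LIMSEQ_I)
    fix e :: real assume e: "e > 0"
    have "(\<lambda>b. (\<Sum>j\<le>b. (- s) ^ j / fact j)) \<longlonglongrightarrow> exp (- s)"
      using exp_converges[of "- s"] by (simp add: sums_def_le divide_inverse mult.commute)
    then have 1: "eventually (\<lambda>b. \<bar>(\<Sum>j\<le>b. (- s) ^ j / fact j) - exp (- s)\<bar> < e / 4) sequentially"
      using e by (auto dest!: tendstoD[where e = "e / 4"] simp: dist_real_def)
    have "(\<lambda>b. s ^ b / fact b) \<longlonglongrightarrow> 0"
      using summable_LIMSEQ_zero[OF summable_exp[of s]] by (simp add: divide_inverse mult.commute)
    then have "(\<lambda>b. s ^ Suc b / fact (Suc b)) \<longlonglongrightarrow> 0" by (rule LIMSEQ_Suc)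
    then have 2: "eventually (\<lambda>b. s ^ Suc b / fact (Suc b) < e / 4) sequentially"
      using e by (intro order_tendstoD) auto
    obtain b where b: "\<bar>(\<Sum>j\<le>b. (- s) ^ j / fact j) - exp (- s)\<bar> < e / 4" "s ^ Suc b / fact (Suc b) < e / 4"
      using eventually_happens'[OF sequentially_bot eventually_conj[OF 1 2]] by blast
    have "(\<lambda>m. \<Sum>j\<le>b. (- 1) ^ j * B j m) \<longlonglongrightarrow> (\<Sum>j\<le>b. (- 1) ^ j * (s ^ j / fact j))"
      by (intro tendsto_sum tendsto_mult tendsto_const B)
    moreover have "(\<Sum>j\<le>b. (- 1) ^ j * (s ^ j / fact j)) = (\<Sum>j\<le>b. (- s) ^ j / fact j)"
      by (intro sum.cong refl) (simp add: power_minus[of s])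
    ultimately have 3: "eventually (\<lambda>m. \<bar>(\<Sum>j\<le>b. (- 1) ^ j * B j m) - (\<Sum>j\<le>b. (- s) ^ j / fact j)\<bar> < e / 4) sequentially"
      using e by (auto dest!: tendstoD[where e = "e / 4"] simp: dist_real_def)
    have 4: "eventually (\<lambda>m. B (Suc b) m < e / 4) sequentially" using order_tendstoD(2)[OF B b(2)] .
    have "eventually (\<lambda>m. norm (p m - exp (- s)) < e) sequentially"
      using 3 4
    proof eventually_elim
      case (elim m)
      show ?case using key[of m b] elim b e unfolding real_norm_def by linarith
    qed
    then show "\<exists>no. \<forall>n\<ge>no. norm (p n - exp (- s)) < e" by (simp add: eventually_sequentially)
  qed
  then show ?thesis by (simp add: p_def[abs_def] s_def)
qed

text \<open>\<open>U\<close> marks a distance as short and passes to smaller distances, so a point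
  has no point shortly after it exactly if the next gap is not short. The largest point always
  qualifies but starts no gap, whence \<open>Suc\<close>. An abstract \<open>U\<close> covers strict
  and weak inequalities alike.\<close>

lemma card_large_gaps:
  fixes xs :: "real list" and U :: "real \<Rightarrow> bool"
  assumes xs: "sorted xs" "distinct xs" "xs \<noteq> []" and U: "\<And>d d'. U d \<Longrightarrow> 0 < d' \<Longrightarrow> d' \<le> d \<Longrightarrow> U d'"
  shows "card {v \<in> set xs. \<forall>v'\<in>set xs. v < v' \<longrightarrow> \<not> U (v' - v)} = Suc (card {n \<in> {1..length xs - 1}. \<not> U (xs ! n - xs ! (n - 1))})"
proof -
  define N where "N = length xs"
  have N: "N \<ge> 1" using xs by (cases xs) (auto simp: N_def)
  have less: "xs ! i < xs ! j" if "i < j" "j < N" for i j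
    using sorted_nth_mono[OF xs(1), of i j] nth_eq_iff_index_eq[OF xs(2), of i j] that by (force simp: N_def)
  have less_iff: "xs ! i < xs ! j \<longleftrightarrow> i < j" if "i < N" "j < N" for i j
    using less[of i j] less[of j i] that by (cases i j rule: linorder_cases) auto
  let ?Q = "\<lambda>v. \<forall>v'\<in>set xs. v < v' \<longrightarrow> \<not> U (v' - v)"
  have "{v \<in> set xs. ?Q v} = (\<lambda>i. xs ! i) ` {i. i < N \<and> ?Q (xs ! i)}"
    unfolding N_def by (auto simp: in_set_conv_nth)
  moreover have "inj_on (\<lambda>i. xs ! i) {i. i < N \<and> ?Q (xs ! i)}"
    using nth_eq_iff_index_eq[OF xs(2)] by (auto simp: inj_on_def N_def)
  ultimately have "card {v \<in> set xs. ?Q v} = card {i. i < N \<and> ?Q (xs ! i)}" by (simp add: card_image)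
  also have "{i. i < N \<and> ?Q (xs ! i)} = insert (N - 1) ((\<lambda>n. n - 1) ` {n \<in> {1..N - 1}. \<not> U (xs ! n - xs ! (n - 1))})"
  proof (intro subset_antisym subsetI)
    fix i assume i: "i \<in> {i. i < N \<and> ?Q (xs ! i)}"
    show "i \<in> insert (N - 1) ((\<lambda>n. n - 1) ` {n \<in> {1..N - 1}. \<not> U (xs ! n - xs ! (n - 1))})"
    proof (cases "i = N - 1")
      case False
      then have "Suc i < N" using i by auto
      then have "xs ! Suc i \<in> set xs" "xs ! i < xs ! Suc i" using less[of i "Suc i"] by (auto simp: N_def)
      then have "\<not> U (xs ! Suc i - xs ! i)" using i by blast
      then have "Suc i \<in> {n \<in> {1..N - 1}. \<not> U (xs ! n - xs ! (n - 1))}" using \<open>Suc i < N\<close> by auto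
      then have "Suc i - 1 \<in> (\<lambda>n. n - 1) ` {n \<in> {1..N - 1}. \<not> U (xs ! n - xs ! (n - 1))}" by (rule imageI)
      then show ?thesis by simp
    qed simp
  next
    fix i assume i: "i \<in> insert (N - 1) ((\<lambda>n. n - 1) ` {n \<in> {1..N - 1}. \<not> U (xs ! n - xs ! (n - 1))})"
    have iN: "i < N" using i N by auto
    have "\<not> U (v' - xs ! i)" if v': "v' \<in> set xs" "xs ! i < v'" for v'
    proof -
      obtain j where j: "j < N" "v' = xs ! j" using v' by (auto simp: in_set_conv_nth N_def)
      then have ij: "i < j" using less_iff[OF iN j(1)] v' by simp
      then have "i \<noteq> N - 1" using j by auto
      then obtain n where n: "n \<in> {1..N - 1}" "\<not> U (xs ! n - xs ! (n - 1))" "i = n - 1" using i by auto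
      then have "xs ! n \<le> v'" using j ij sorted_nth_mono[OF xs(1), of n j] by (auto simp: N_def)
      moreover have "xs ! (n - 1) < xs ! n" using n by (intro less) auto
      ultimately show ?thesis using n U[of "v' - xs ! i" "xs ! n - xs ! (n - 1)"] by auto
    qed
    then show "i \<in> {i. i < N \<and> ?Q (xs ! i)}" using iN by blast
  qed
  also have "card \<dots> = Suc (card ((\<lambda>n. n - 1) ` {n \<in> {1..N - 1}. \<not> U (xs ! n - xs ! (n - 1))}))"
    by (rule card_insert_disjoint) auto
  also have "card ((\<lambda>n. n - 1) ` {n \<in> {1..N - 1}. \<not> U (xs ! n - xs ! (n - 1))}) = card {n \<in> {1..N - 1}. \<not> U (xs ! n - xs ! (n - 1))}"
    by (intro card_image) (auto simp: inj_on_def)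
  finally show ?thesis unfolding N_def .
qed

text \<open>Gaps that are not below \<open>a / N\<close>, minus those that exceed
  \<open>b / N\<close>. The window is open at \<open>- a\<close> and closed at \<open>- b\<close>,
  which matches the closed interval in the definition. The largest point is counted in both terms
  and cancels.\<close>

lemma gap_proportion_eq:
  assumes N: "N \<ge> 1" and x: "inj_on x {1..N}" and ab: "0 \<le> a" "a \<le> b"
  shows "gap_proportion a b N x = real (card {n \<in> {1..N}. card (neighbours {- a<..<0} N x n) = 0}) / real N
      - real (card {n \<in> {1..N}. card (neighbours {- b..<0} N x n) = 0}) / real N"
proof -
  define xs where "xs = sort (map x [1..<N + 1])"
  have set: "set xs = x ` {1..N}" by (auto simp: xs_def)
  have xs: "sorted xs" "distinct xs" "xs \<noteq> []" "length xs = N"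
  proof -
    show "distinct xs" using x by (simp add: xs_def distinct_map atLeastLessThanSuc_atLeastAtMost del: upt_Suc)
    show len: "length xs = N" by (simp add: xs_def)
    then show "xs \<noteq> []" using N by auto
  qed (simp add: xs_def)
  have N0: "real N > 0" using N by simp
  have iso: "card {v \<in> set xs. \<forall>v'\<in>set xs. v < v' \<longrightarrow> \<not> U (v' - v)} = card {n \<in> {1..N}. card (neighbours I N x n) = 0}"
    if U: "\<And>d. d \<in> I \<longleftrightarrow> d < 0 \<and> U (- d / N)" for U I
  proof -
    have "{v \<in> set xs. \<forall>v'\<in>set xs. v < v' \<longrightarrow> \<not> U (v' - v)} = x ` {n \<in> {1..N}. \<forall>m\<in>{1..N}. x n < x m \<longrightarrow> \<not> U (x m - x n)}"
      unfolding set by auto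
    moreover have "inj_on x {n \<in> {1..N}. \<forall>m\<in>{1..N}. x n < x m \<longrightarrow> \<not> U (x m - x n)}"
      by (rule inj_on_subset[OF x]) auto
    moreover have "(\<forall>m\<in>{1..N}. x n < x m \<longrightarrow> \<not> U (x m - x n)) \<longleftrightarrow> card (neighbours I N x n) = 0" for n
    proof -
      have "real N * (x n - x m) \<in> I \<longleftrightarrow> x n < x m \<and> U (x m - x n)" for m
        unfolding U using N0 by (simp add: mult_less_0_iff)
      then show ?thesis by (auto simp: neighbours_def)
    qed
    ultimately show ?thesis by (simp add: card_image)
  qed
  let ?g = "\<lambda>n. xs ! n - xs ! (n - 1)"
  have 1: "card {n \<in> {1..N}. card (neighbours {- a<..<0} N x n) = 0} = Suc (card {n \<in> {1..N - 1}. \<not> ?g n < a / N})"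
  proof -
    have "card {v \<in> set xs. \<forall>v'\<in>set xs. v < v' \<longrightarrow> \<not> v' - v < a / N} = Suc (card {n \<in> {1..length xs - 1}. \<not> ?g n < a / N})"
      by (rule card_large_gaps[OF xs(1-3), of "\<lambda>d. d < a / N"]) simp
    moreover have "card {v \<in> set xs. \<forall>v'\<in>set xs. v < v' \<longrightarrow> \<not> v' - v < a / N} = card {n \<in> {1..N}. card (neighbours {- a<..<0} N x n) = 0}"
      by (rule iso[of "{- a<..<0}" "\<lambda>d. d < a / N"]) (use N0 in \<open>auto simp: field_simps\<close>)
    ultimately show ?thesis unfolding xs(4) by simp
  qed
  have 2: "card {n \<in> {1..N}. card (neighbours {- b..<0} N x n) = 0} = Suc (card {n \<in> {1..N - 1}. \<not> ?g n \<le> b / N})"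
  proof -
    have "card {v \<in> set xs. \<forall>v'\<in>set xs. v < v' \<longrightarrow> \<not> v' - v \<le> b / N} = Suc (card {n \<in> {1..length xs - 1}. \<not> ?g n \<le> b / N})"
      by (rule card_large_gaps[OF xs(1-3), of "\<lambda>d. d \<le> b / N"]) simp
    moreover have "card {v \<in> set xs. \<forall>v'\<in>set xs. v < v' \<longrightarrow> \<not> v' - v \<le> b / N} = card {n \<in> {1..N}. card (neighbours {- b..<0} N x n) = 0}"
      by (rule iso[of "{- b..<0}" "\<lambda>d. d \<le> b / N"]) (use N0 in \<open>auto simp: field_simps\<close>)
    ultimately show ?thesis unfolding xs(4) by simp
  qed
  have ab': "a / N \<le> b / N" using ab N0 by (intro divide_right_mono) auto
  have os: "ordered_sample N x n = xs ! (n - 1)" for n by (simp only: ordered_sample_def xs_def)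
  have "{n \<in> {1..N - 1}. ordered_sample N x (n + 1) - ordered_sample N x n \<in> {a / real N..b / real N}} =
     {n \<in> {1..N - 1}. \<not> ?g n < a / N} - {n \<in> {1..N - 1}. \<not> ?g n \<le> b / N}"
    by (auto simp: os)
  moreover have "{n \<in> {1..N - 1}. \<not> ?g n \<le> b / N} \<subseteq> {n \<in> {1..N - 1}. \<not> ?g n < a / N}" using ab' by auto
  ultimately have c: "card {n \<in> {1..N - 1}. ordered_sample N x (n + 1) - ordered_sample N x n \<in> {a / real N..b / real N}} =
     card {n \<in> {1..N - 1}. \<not> ?g n < a / N} - card {n \<in> {1..N - 1}. \<not> ?g n \<le> b / N}"
    and le: "card {n \<in> {1..N - 1}. \<not> ?g n \<le> b / N} \<le> card {n \<in> {1..N - 1}. \<not> ?g n < a / N}"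
    by (simp_all add: card_Diff_subset card_mono)
  then show ?thesis unfolding gap_proportion_def 1 2 c of_nat_diff[OF le] by (simp add: diff_divide_distrib add_divide_distrib)
qed

lemma integral_exp_minus:
  fixes a b :: real
  assumes "a \<le> b"
  shows "integral {a..b} (\<lambda>t. exp (- t)) = exp (- a) - exp (- b)"
proof -
  have "((\<lambda>t. exp (- t)) has_integral (- exp (- b) - - exp (- a))) {a..b}"
    using assms by (intro fundamental_theorem_of_calculus)
      (auto intro!: derivative_eq_intros simp flip: has_real_derivative_iff_has_vector_derivative)
  then show ?thesis by (simp add: integral_unique)
qed

lemma array_poissonian_gaps_if_correlations:
  assumes L: "filterlim L at_top sequentially" and inj: "\<And>m. inj_on (y m) {1..L m}"
    and corr: "\<And>k. k \<ge> 2 \<Longrightarrow> array_poissonian_correlations k L y"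
  shows "array_poissonian_gaps L y"
  unfolding array_poissonian_gaps_def
proof (intro allI impI)
  fix a b :: real assume "0 \<le> a \<and> a \<le> b"
  then have ab: "0 \<le> a" "a \<le> b" by auto
  let ?p = "\<lambda>I m. real (card {n \<in> {1..L m}. card (neighbours I (L m) (y m) n) = 0}) / real (L m)"
  have "?p {- a<..<0} \<longlonglongrightarrow> exp (- (0 - (- a)))"
    using ab by (intro isolated_proportion_tendsto L corr) (auto simp: is_interval_oo)
  moreover have "?p {- b..<0} \<longlonglongrightarrow> exp (- (0 - (- b)))"
    using ab by (intro isolated_proportion_tendsto L corr) (auto simp: is_interval_co)
  ultimately have "(\<lambda>m. ?p {- a<..<0} m - ?p {- b..<0} m) \<longlonglongrightarrow> exp (- (0 - (- a))) - exp (- (0 - (- b)))"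
    by (rule tendsto_diff)
  moreover have "eventually (\<lambda>m. L m \<ge> 1) sequentially" using L by (simp add: filterlim_at_top)
  then have "eventually (\<lambda>m. gap_proportion a b (L m) (y m) = ?p {- a<..<0} m - ?p {- b..<0} m) sequentially"
    by eventually_elim (rule gap_proportion_eq[OF _ inj ab])
  ultimately show "(\<lambda>m. gap_proportion a b (L m) (y m)) \<longlonglongrightarrow> integral {a..b} (\<lambda>t. exp (- t))"
    using ab by (subst tendsto_cong) (auto simp: integral_exp_minus)
qed

section \<open>Sequences of rough numbers\<close>

text \<open>The count in the definition of correlations, where differences of fractional parts are
  not reduced modulo 1. It can differ from \<open>corr_set\<close> only for points near the ends of
  the unit interval.\<close>

definition frac_corr_set :: "nat \<Rightarrow> int set \<Rightarrow> (nat \<Rightarrow> real set) \<Rightarrow> real \<Rightarrow> real \<Rightarrow> (nat \<Rightarrow> int) set" where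
  "frac_corr_set k A I N \<alpha> = {a \<in> PiE {1..k} (\<lambda>_. A). inj_on a {1..k} \<and>
     (\<forall>j\<in>{2..k}. N * (frac (of_int (a 1) * \<alpha>) - frac (of_int (a j) * \<alpha>)) \<in> I j)}"

lemma frac_corr_set_subset:
  assumes N: "N > 0"
  shows "frac_corr_set k A I N \<alpha> \<subseteq> corr_set k A (\<lambda>j. (\<lambda>t. t / N) ` I j) \<alpha>"
proof
  fix a assume a: "a \<in> frac_corr_set k A I N \<alpha>"
  have "mod1_in ((\<lambda>t. t / N) ` I j) (of_int (a 1 - a j) * \<alpha>)" if j: "j \<in> {2..k}" for j
  proof -
    let ?t = "N * (frac (of_int (a 1) * \<alpha>) - frac (of_int (a j) * \<alpha>))"
    have "?t \<in> I j" using a j by (auto simp: frac_corr_set_def)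
    then have "?t / N \<in> (\<lambda>t. t / N) ` I j" by (rule imageI)
    moreover have "of_int (a 1 - a j) * \<alpha> - of_int (\<lfloor>of_int (a 1) * \<alpha>\<rfloor> - \<lfloor>of_int (a j) * \<alpha>\<rfloor>) = ?t / N"
    proof -
      have "?t / N = frac (of_int (a 1) * \<alpha>) - frac (of_int (a j) * \<alpha>)" using N by simp
      then show ?thesis by (simp add: frac_def left_diff_distrib)
    qed
    ultimately show ?thesis unfolding mod1_in_def by metis
  qed
  then show "a \<in> corr_set k A (\<lambda>j. (\<lambda>t. t / N) ` I j) \<alpha>" using a by (auto simp: frac_corr_set_def corr_set_def)
qed

text \<open>A tuple counted only modulo 1 has two fractional parts whose difference is within
  \<open>\<kappa> / N\<close> of a nonzero integer. This forces the first of them to within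
  \<open>\<kappa> / N\<close> of 0 or 1.\<close>

lemma corr_set_diff_subset:
  assumes N: "N > 0" and k: "k \<ge> 1" and A: "A \<subseteq> {1..int X}" and I: "\<And>j. j \<in> {2..k} \<Longrightarrow> I j \<subseteq> {- \<kappa>..\<kappa>}"
  shows "corr_set k A (\<lambda>j. (\<lambda>t. t / N) ` I j) \<alpha> - frac_corr_set k A I N \<alpha> \<subseteq>
    {a \<in> corr_set k A (\<lambda>j. (\<lambda>t. t / N) ` I j) \<alpha>. a 1 \<in> bohr_set (int X) {- \<kappa> / N..\<kappa> / N} \<alpha>}"
proof
  fix a assume a: "a \<in> corr_set k A (\<lambda>j. (\<lambda>t. t / N) ` I j) \<alpha> - frac_corr_set k A I N \<alpha>"
  then have aP: "a \<in> PiE {1..k} (\<lambda>_. A)" and inj: "inj_on a {1..k}" by (auto simp: corr_set_def)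
  then obtain j where j: "j \<in> {2..k}" and notin: "N * (frac (of_int (a 1) * \<alpha>) - frac (of_int (a j) * \<alpha>)) \<notin> I j"
    using a by (auto simp: frac_corr_set_def)
  have "mod1_in ((\<lambda>t. t / N) ` I j) (of_int (a 1 - a j) * \<alpha>)" using a j by (auto simp: corr_set_def)
  then obtain m :: int and t where t: "t \<in> I j" and m: "of_int (a 1 - a j) * \<alpha> - of_int m = t / N"
    by (auto simp: mod1_in_def)
  define u v where "u = frac (of_int (a 1) * \<alpha>)" and "v = frac (of_int (a j) * \<alpha>)"
  define l where "l = m - \<lfloor>of_int (a 1) * \<alpha>\<rfloor> + \<lfloor>of_int (a j) * \<alpha>\<rfloor>"
  have uv: "u - v = t / N + of_int l" using m by (simp add: u_def v_def l_def frac_def algebra_simps)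
  have l0: "l \<noteq> 0"
  proof
    assume "l = 0"
    then have "N * (u - v) = t" using uv N by simp
    then show False using t notin by (simp add: u_def v_def)
  qed
  have "t \<in> {- \<kappa>..\<kappa>}" using I[OF j] t by blast
  then have tk: "- \<kappa> / N \<le> t / N" "t / N \<le> \<kappa> / N" using N by (auto intro!: divide_right_mono simp del: divide_minus_left)
  have k0: "0 \<le> \<kappa> / N" using tk by simp
  have u: "0 \<le> u" "u < 1" and v: "0 \<le> v" "v < 1" by (simp_all add: u_def v_def frac_lt_1)
  have "\<exists>m::int. of_int (a 1) * \<alpha> - of_int m \<in> {- \<kappa> / N..\<kappa> / N}"
  proof (cases "l > 0")
    case True
    then have "of_int l \<ge> (1::real)" by linarith
    then have "u - 1 \<in> {- \<kappa> / N..\<kappa> / N}" using uv tk u v k0 by simp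
    moreover have "u - 1 = of_int (a 1) * \<alpha> - of_int (\<lfloor>of_int (a 1) * \<alpha>\<rfloor> + 1)" by (simp add: u_def frac_def)
    ultimately show ?thesis by metis
  next
    case False
    then have "of_int l \<le> (- 1::real)" using l0 by linarith
    then have "u \<in> {- \<kappa> / N..\<kappa> / N}" using uv tk u v k0 by simp
    moreover have "u = of_int (a 1) * \<alpha> - of_int \<lfloor>of_int (a 1) * \<alpha>\<rfloor>" by (simp add: u_def frac_def)
    ultimately show ?thesis by metis
  qed
  moreover have "a 1 \<in> A" using PiE_mem[OF aP, of 1] k by simp
  then have "a 1 \<in> {- int X..int X}" using A by auto
  ultimately have "a 1 \<in> bohr_set (int X) {- \<kappa> / N..\<kappa> / N} \<alpha>" by (simp add: bohr_set_def mod1_in_def)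
  then show "a \<in> {a \<in> corr_set k A (\<lambda>j. (\<lambda>t. t / N) ` I j) \<alpha>. a 1 \<in> bohr_set (int X) {- \<kappa> / N..\<kappa> / N} \<alpha>}"
    using a by blast
qed

text \<open>One factor \<open>G\<close> counts the positions of \<open>a 1\<close> near an integer;
  the remaining power counts the differences.\<close>

lemma card_corr_set_diff_le:
  assumes N: "N > 0" and k: "k \<ge> 1" and A: "A \<subseteq> {1..int X}" and I: "\<And>j. j \<in> {2..k} \<Longrightarrow> I j \<subseteq> {- \<kappa>..\<kappa>}"
    and G: "G \<ge> 1" "real (card (bohr_set (int X) {- \<kappa> / N..\<kappa> / N} \<alpha>)) \<le> G"
  shows "\<bar>real (card (corr_set k A (\<lambda>j. (\<lambda>t. t / N) ` I j) \<alpha>)) - real (card (frac_corr_set k A I N \<alpha>))\<bar> \<le> G ^ Suc k"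
proof -
  let ?C = "corr_set k A (\<lambda>j. (\<lambda>t. t / N) ` I j) \<alpha>" and ?F = "frac_corr_set k A I N \<alpha>"
  let ?S = "bohr_set (int X) {- \<kappa> / N..\<kappa> / N} \<alpha>"
  have finA: "finite A" using A by (rule finite_subset) simp
  have fC: "finite ?C" using finA by (rule finite_corr_set)
  have FC: "?F \<subseteq> ?C" using N by (rule frac_corr_set_subset)
  have le: "card ?F \<le> card ?C" using fC FC by (rule card_mono)
  have "real (card ?C) - real (card ?F) = real (card (?C - ?F))"
    using FC fC le by (simp add: card_Diff_subset finite_subset of_nat_diff)
  also have "\<dots> \<le> real (card {a \<in> ?C. a 1 \<in> ?S})"
    using corr_set_diff_subset[OF N k A I] fC by (intro of_nat_mono card_mono) auto
  also have "\<dots> \<le> card ?S * G ^ k"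
  proof (rule card_bohr_tuples_le[OF _ finite_bohr_set A G(1)])
    fix j assume j: "j \<in> {2..k}"
    have "(\<lambda>t. t / N) ` I j \<subseteq> {- \<kappa> / N..\<kappa> / N}"
    proof (rule image_subsetI)
      fix t assume "t \<in> I j"
      then have "t \<in> {- \<kappa>..\<kappa>}" using I[OF j] by blast
      then show "t / N \<in> {- \<kappa> / N..\<kappa> / N}" using N by (auto intro!: divide_right_mono simp del: divide_minus_left)
    qed
    then have "bohr_set (int X) ((\<lambda>t. t / N) ` I j) \<alpha> \<subseteq> ?S" unfolding bohr_set_def mod1_in_def by blast
    then have "card (bohr_set (int X) ((\<lambda>t. t / N) ` I j) \<alpha>) \<le> card ?S" by (intro card_mono finite_bohr_set)
    then show "real (card (bohr_set (int X) ((\<lambda>t. t / N) ` I j) \<alpha>)) \<le> G" using G(2) by linarith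
  qed (use k in simp)
  also have "\<dots> \<le> G * G ^ k" using G by (intro mult_right_mono) auto
  finally show ?thesis using le by simp
qed

text \<open>The two membership conditions leave a gap between \<open>X powr ((1 - \<epsilon>) * r a)\<close> and
  \<open>X powr r a\<close>, so that they hold both for the constant threshold \<open>f X\<close> and for the threshold
  \<open>f a = a powr r a\<close>.\<close>

definition rough_approx :: "real \<Rightarrow> real \<Rightarrow> nat \<Rightarrow> int set \<Rightarrow> (int \<Rightarrow> real) \<Rightarrow> bool" where
  "rough_approx \<epsilon> E X A r \<longleftrightarrow>
     (\<forall>a b. X powr (1 - \<epsilon>) < real_of_int a \<longrightarrow> a \<le> b \<longrightarrow> b \<le> int X \<longrightarrow> r b \<le> r a) \<and>
     (\<forall>a. X powr (1 - \<epsilon>) < real_of_int a \<longrightarrow> a \<le> int X \<longrightarrow> r a \<le> \<epsilon>) \<and>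
     ln (ln X) powr E \<le> r (int X) * ln X \<and> A \<subseteq> {1..int X} \<and>
     (\<forall>a. X powr (1 - \<epsilon>) < real_of_int a \<longrightarrow> a \<le> int X \<longrightarrow> (\<forall>p. prime p \<longrightarrow> int p dvd a \<longrightarrow> X powr r a < real p) \<longrightarrow> a \<in> A) \<and>
     (\<forall>a p. a \<in> A \<longrightarrow> X powr (1 - \<epsilon>) < real_of_int a \<longrightarrow> prime p \<longrightarrow> int p dvd a \<longrightarrow> X powr ((1 - \<epsilon>) * r a) < real p)"

text \<open>The wrap-around tuples are bounded by a power of \<open>ln X\<close>, whereas
  \<open>card A\<close> is at least \<open>X\<close> divided by \<open>ln X ^ 50\<close>, so they do
  not affect the limit.\<close>

lemma rough_frac_tuples:
  fixes k :: nat and \<alpha> \<xi> :: real and lo hi :: "nat \<Rightarrow> real" and I :: "nat \<Rightarrow> real set"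
  assumes \<alpha>: "badly_approximable \<alpha>" and k: "k \<ge> 1"
    and I: "\<And>j. j \<in> {2..k} \<Longrightarrow> lo j \<le> hi j \<and> {lo j<..<hi j} \<subseteq> I j \<and> I j \<subseteq> {lo j..hi j}" and \<xi>: "\<xi> > 0"
  obtains \<epsilon> E :: real and Z :: nat where "0 < \<epsilon>" "\<epsilon> \<le> 1 / 4" "E > 0"
    "\<And>X A r. X \<ge> Z \<Longrightarrow> rough_approx \<epsilon> E X A r \<Longrightarrow> X \<le> ln X ^ 50 * card A \<and>
      \<bar>card (frac_corr_set k A I (card A) \<alpha>) / card A - (\<Prod>j\<in>{2..k}. hi j - lo j)\<bar> \<le> \<xi>"
proof -
  have lohi: "lo j \<le> hi j" if "j \<in> {2..k}" for j using I[OF that] by blast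
  obtain \<epsilon> E :: real and Z :: nat where \<epsilon>: "0 < \<epsilon>" "\<epsilon> \<le> 1 / 4" "E > 0"
    and Z: "\<And>(X::nat) (A::int set) (r::int \<Rightarrow> real) (I::nat \<Rightarrow> real set). X \<ge> Z \<Longrightarrow>
      (\<And>a b. X powr (1 - \<epsilon>) < real_of_int a \<Longrightarrow> a \<le> b \<Longrightarrow> b \<le> int X \<Longrightarrow> r b \<le> r a) \<Longrightarrow>
      (\<And>a. X powr (1 - \<epsilon>) < real_of_int a \<Longrightarrow> a \<le> int X \<Longrightarrow> r a \<le> \<epsilon>) \<Longrightarrow>
      ln (ln X) powr E \<le> r (int X) * ln X \<Longrightarrow> A \<subseteq> {1..int X} \<Longrightarrow>
      (\<And>a. X powr (1 - \<epsilon>) < real_of_int a \<Longrightarrow> a \<le> int X \<Longrightarrow> (\<And>p. prime p \<Longrightarrow> int p dvd a \<Longrightarrow> X powr r a < real p) \<Longrightarrow> a \<in> A) \<Longrightarrow>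
      (\<And>a p. a \<in> A \<Longrightarrow> X powr (1 - \<epsilon>) < real_of_int a \<Longrightarrow> prime p \<Longrightarrow> int p dvd a \<Longrightarrow> X powr ((1 - \<epsilon>) * r a) < real p) \<Longrightarrow>
      (\<And>j. j \<in> {2..k} \<Longrightarrow> {lo j<..<hi j} \<subseteq> I j \<and> I j \<subseteq> {lo j..hi j}) \<Longrightarrow>
      X \<le> ln X ^ 50 * card A \<and>
      \<bar>card (corr_set k A (\<lambda>j. (\<lambda>t. t / card A) ` I j) \<alpha>) / card A - (\<Prod>j\<in>{2..k}. hi j - lo j)\<bar> \<le> \<xi> / 2"
    by (rule rough_tuples[where k = k and \<alpha> = \<alpha> and \<xi> = "\<xi> / 2" and lo = lo and hi = hi])
      ((rule \<alpha> k half_gt_zero[OF \<xi>] | erule lohi)+, blast)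
  define \<kappa> where "\<kappa> = 1 + (\<Sum>j\<in>{2..k}. \<bar>lo j\<bar> + \<bar>hi j\<bar>)"
  have \<kappa>1: "\<kappa> \<ge> 1"
  proof -
    have "0 \<le> (\<Sum>j\<in>{2..k}. \<bar>lo j\<bar> + \<bar>hi j\<bar>)" by (rule sum_nonneg) simp
    then show ?thesis by (simp add: \<kappa>_def)
  qed
  have I\<kappa>: "I j \<subseteq> {- \<kappa>..\<kappa>}" if "j \<in> {2..k}" for j
  proof -
    have "\<bar>lo j\<bar> + \<bar>hi j\<bar> \<le> (\<Sum>j\<in>{2..k}. \<bar>lo j\<bar> + \<bar>hi j\<bar>)" using that by (intro member_le_sum) auto
    then have "- \<kappa> \<le> lo j" "hi j \<le> \<kappa>" by (simp_all add: \<kappa>_def)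
    then show ?thesis using I[OF that] by force
  qed
  obtain CB :: real where CB: "CB \<ge> 1" and bohr: "\<And>(X::nat) (lo::real) (hi::real) J D. X \<ge> 1 \<Longrightarrow> {lo<..<hi} \<subseteq> J \<Longrightarrow> J \<subseteq> {lo..hi} \<Longrightarrow> lo \<le> hi \<Longrightarrow> hi - lo < 1 \<Longrightarrow>
       X * (hi - lo) \<le> D \<Longrightarrow> D \<ge> 1 \<Longrightarrow> real (card (bohr_set (int X) J \<alpha>)) \<le> CB * D"
    by (rule card_bohr_set_le[OF \<alpha>]) blast
  define B where "B = (CB * (2 * \<kappa>)) ^ Suc k"
  have B0: "B > 0" using CB \<kappa>1 by (simp add: B_def)
  define n0 where "n0 = 50 * Suc (Suc k)"
  have "eventually (\<lambda>X::nat. 1 \<le> ln (ln (real X)) \<and> ln (real X) ^ n0 \<le> \<xi> / (2 * B) * real X powr 1 \<and>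
      ln (real X) ^ 50 \<le> 1 / (4 * \<kappa>) * real X powr 1 \<and> X \<ge> 3) sequentially"
    using B0 \<xi> \<kappa>1 by (intro eventually_conj eventually_ln_ln_ge eventually_ln_power_le eventually_ge_at_top) auto
  then obtain Z' where Z': "\<And>X. X \<ge> Z' \<Longrightarrow> 1 \<le> ln (ln (real X)) \<and> ln (real X) ^ n0 \<le> \<xi> / (2 * B) * real X powr 1 \<and>
      ln (real X) ^ 50 \<le> 1 / (4 * \<kappa>) * real X powr 1 \<and> X \<ge> 3"
    by (auto simp: eventually_sequentially)
  show thesis
  proof (rule that[of \<epsilon> E "max Z Z'"])
    fix X A r assume X: "max Z Z' \<le> X" and ra: "rough_approx \<epsilon> E X A r"
    have XZ: "Z \<le> X" "Z' \<le> X" using X by auto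
    have AX: "A \<subseteq> {1..int X}" using ra by (simp add: rough_approx_def)
    have main: "X \<le> ln X ^ 50 * card A \<and>
      \<bar>card (corr_set k A (\<lambda>j. (\<lambda>t. t / card A) ` I j) \<alpha>) / card A - (\<Prod>j\<in>{2..k}. hi j - lo j)\<bar> \<le> \<xi> / 2"
    proof (rule Z[OF XZ(1), where r = r])
      show "{lo j<..<hi j} \<subseteq> I j \<and> I j \<subseteq> {lo j..hi j}" if "j \<in> {2..k}" for j using I[OF that] by blast
    qed (use ra in \<open>unfold rough_approx_def, blast\<close>)+
    define N where "N = real (card A)"
    define L where "L = ln (real X)"
    have X3: "X \<ge> 3" and lnln: "1 \<le> ln L" and Ln0: "L ^ n0 \<le> \<xi> / (2 * B) * X" and L50: "L ^ 50 \<le> 1 / (4 * \<kappa>) * X"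
      using Z'[OF XZ(2)] by (auto simp: L_def)
    have X0: "real X > 0" using X3 by simp
    have L1: "L > 1"
    proof -
      have "L > 0" using X3 by (simp add: L_def)
      moreover have "ln L > 0" using lnln by simp
      ultimately show ?thesis by simp
    qed
    have LX: "X \<le> L ^ 50 * N" using main by (simp add: L_def N_def)
    have N0: "N > 0"
    proof (rule ccontr)
      assume "\<not> N > 0"
      then have "L ^ 50 * N = 0" by (simp add: N_def)
      then show False using LX X0 by linarith
    qed
    define D where "D = 2 * \<kappa> * L ^ 50"
    have D1: "D \<ge> 1"
    proof -
      have "1 \<le> L ^ 50" using L1 by (intro one_le_power) simp
      then have "1 * 1 \<le> (2 * \<kappa>) * L ^ 50" using \<kappa>1 by (intro mult_mono) auto
      then show ?thesis by (simp add: D_def)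
    qed
    have XN: "X / N \<le> L ^ 50" using LX N0 by (simp add: pos_divide_le_eq)
    have bD: "real (card (bohr_set (int X) {- \<kappa> / N..\<kappa> / N} \<alpha>)) \<le> CB * D"
    proof (rule bohr[where lo = "- \<kappa> / N" and hi = "\<kappa> / N"])
      have e: "\<kappa> / N - - \<kappa> / N = 2 * \<kappa> / N" by (simp add: add_divide_distrib)
      show XD: "real X * (\<kappa> / N - - \<kappa> / N) \<le> D"
        unfolding e D_def using mult_left_mono[OF XN, of "2 * \<kappa>"] \<kappa>1 by (simp add: mult_ac)
      have "L ^ 50 * (4 * \<kappa>) \<le> X" using L50 \<kappa>1 by (simp add: field_simps)
      then have "2 * D \<le> X" by (simp add: D_def mult_ac)
      then have "real X * (\<kappa> / N - - \<kappa> / N) < real X * 1" using XD D1 by linarith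
      then show "\<kappa> / N - - \<kappa> / N < 1" using X0 by (simp only: mult_less_cancel_left_pos)
      have "0 \<le> \<kappa> / N" using \<kappa>1 N0 by simp
      then show "- \<kappa> / N \<le> \<kappa> / N" by simp
    qed (use X3 D1 in auto)
    have CBD: "1 \<le> CB * D" using mult_mono[of 1 CB 1 D] CB D1 by simp
    have "\<bar>real (card (corr_set k A (\<lambda>j. (\<lambda>t. t / N) ` I j) \<alpha>)) - real (card (frac_corr_set k A I N \<alpha>))\<bar> \<le> (CB * D) ^ Suc k"
      by (rule card_corr_set_diff_le[OF N0 k AX I\<kappa> CBD bD])
    also have "(CB * D) ^ Suc k \<le> \<xi> / 2 * N"
    proof -
      have "(CB * D) ^ Suc k * L ^ 50 = B * L ^ n0"
      proof -
        have "(CB * D) ^ Suc k = B * (L ^ 50) ^ Suc k" unfolding B_def D_def by (simp only: power_mult_distrib mult_ac)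
        also have "(L ^ 50) ^ Suc k = L ^ (50 * Suc k)" by (simp only: power_mult)
        finally have "(CB * D) ^ Suc k * L ^ 50 = B * (L ^ (50 * Suc k) * L ^ 50)" by (simp only: mult.assoc)
        also have "L ^ (50 * Suc k) * L ^ 50 = L ^ n0" unfolding n0_def by (simp flip: power_add)
        finally show ?thesis .
      qed
      also have "\<dots> \<le> B * (\<xi> / (2 * B) * X)" using Ln0 B0 by (intro mult_left_mono) auto
      also have "\<dots> = \<xi> / 2 * X" using B0 by simp
      also have "\<dots> \<le> \<xi> / 2 * (L ^ 50 * N)" using LX \<xi> by (intro mult_left_mono) auto
      finally have "(CB * D) ^ Suc k * L ^ 50 \<le> (\<xi> / 2 * N) * L ^ 50" by (simp only: mult_ac)
      then show ?thesis using L1 by (simp only: mult_le_cancel_right) simp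
    qed
    finally have "\<bar>real (card (corr_set k A (\<lambda>j. (\<lambda>t. t / N) ` I j) \<alpha>)) / N - real (card (frac_corr_set k A I N \<alpha>)) / N\<bar> \<le> \<xi> / 2"
      using N0 by (simp add: diff_divide_distrib[symmetric] abs_divide pos_divide_le_eq)
    then show "X \<le> ln X ^ 50 * card A \<and> \<bar>card (frac_corr_set k A I (card A) \<alpha>) / card A - (\<Prod>j\<in>{2..k}. hi j - lo j)\<bar> \<le> \<xi>"
      using main unfolding N_def by linarith
  qed (use \<epsilon> in auto)
qed

lemma correlation_frac:
  assumes g: "inj_on g {1..N}" and x: "\<And>n. n \<in> {1..N} \<Longrightarrow> x n = frac (real (g n) * \<alpha>)"
  shows "correlation k (PiE {2..k} I) N x = real (card (frac_corr_set k (int ` g ` {1..N}) I N \<alpha>)) / N"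
proof -
  let ?F = "{n \<in> {1..k} \<rightarrow>\<^sub>E {1..N}. inj_on n {1..k} \<and> (\<forall>j\<in>{2..k}. real N * (x (n 1) - x (n j)) \<in> I j)}"
  define h where "h n = int (g n)" for n
  have hinj: "inj_on h {1..N}"
  proof (rule inj_onI)
    fix a b assume "a \<in> {1..N}" "b \<in> {1..N}" "h a = h b"
    then show "a = b" using inj_onD[OF g, of a b] by (simp add: h_def)
  qed
  have himg: "int ` g ` {1..N} = h ` {1..N}" by (auto simp: h_def)
  let ?c = "\<lambda>n. \<lambda>i\<in>{1..k}. h (n i)"
  have inj_iff: "inj_on (?c n) {1..k} \<longleftrightarrow> inj_on n {1..k}" if "n \<in> {1..k} \<rightarrow>\<^sub>E {1..N}" for n
  proof -
    have "inj_on (?c n) {1..k} \<longleftrightarrow> inj_on (\<lambda>i. h (n i)) {1..k}" by (rule inj_on_cong) simp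
    also have "\<dots> \<longleftrightarrow> inj_on n {1..k}"
    proof
      assume n: "inj_on n {1..k}"
      show "inj_on (\<lambda>i. h (n i)) {1..k}"
      proof (rule inj_onI)
        fix i i' assume i: "i \<in> {1..k}" "i' \<in> {1..k}" "h (n i) = h (n i')"
        then have "n i = n i'" using inj_onD[OF hinj _ PiE_mem[OF that] PiE_mem[OF that]] by blast
        then show "i = i'" using inj_onD[OF n] i by blast
      qed
    next
      assume n: "inj_on (\<lambda>i. h (n i)) {1..k}"
      show "inj_on n {1..k}"
      proof (rule inj_onI)
        fix i i' assume "i \<in> {1..k}" "i' \<in> {1..k}" "n i = n i'"
        then show "i = i'" using inj_onD[OF n, of i i'] by simp
      qed
    qed
    finally show ?thesis .
  qed
  have cond: "real N * (frac (of_int (?c n 1) * \<alpha>) - frac (of_int (?c n j) * \<alpha>)) \<in> I j \<longleftrightarrow> real N * (x (n 1) - x (n j)) \<in> I j"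
    if n: "n \<in> {1..k} \<rightarrow>\<^sub>E {1..N}" and j: "j \<in> {2..k}" for n j
  proof -
    have 1: "1 \<in> {1..k}" "j \<in> {1..k}" using j by auto
    then have "n 1 \<in> {1..N}" "n j \<in> {1..N}" using PiE_mem[OF n] by blast+
    then have "x (n 1) = frac (of_int (h (n 1)) * \<alpha>)" "x (n j) = frac (of_int (h (n j)) * \<alpha>)" using x unfolding h_def of_int_of_nat_eq by blast+
    moreover have "?c n 1 = h (n 1)" "?c n j = h (n j)" using 1 by (simp_all only: restrict_apply if_True)
    ultimately show ?thesis by (simp only:)
  qed
  have "bij_betw ?c ?F (frac_corr_set k (h ` {1..N}) I N \<alpha>)"
  proof (rule bij_betw_imageI)
    show "inj_on ?c ?F"
    proof (rule inj_onI)
      fix n n' assume n: "n \<in> ?F" "n' \<in> ?F" and eq: "?c n = ?c n'"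
      have nP: "n \<in> {1..k} \<rightarrow>\<^sub>E {1..N}" "n' \<in> {1..k} \<rightarrow>\<^sub>E {1..N}" using n by auto
      show "n = n'"
      proof (rule PiE_ext[OF nP])
        fix i assume i: "i \<in> {1..k}"
        have "h (n i) = h (n' i)" using fun_cong[OF eq, of i] i by simp
        then show "n i = n' i" using inj_onD[OF hinj _ PiE_mem[OF nP(1) i] PiE_mem[OF nP(2) i]] by blast
      qed
    qed
    show "?c ` ?F = frac_corr_set k (h ` {1..N}) I N \<alpha>"
    proof (intro subset_antisym subsetI)
      fix a assume "a \<in> ?c ` ?F"
      then obtain n where n: "n \<in> ?F" "a = ?c n" by blast
      then have nP: "n \<in> {1..k} \<rightarrow>\<^sub>E {1..N}" by simp
      have "?c n \<in> PiE {1..k} (\<lambda>_. h ` {1..N})" using PiE_mem[OF nP] by auto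
      moreover have "inj_on (?c n) {1..k}" using inj_iff[OF nP] n by blast
      moreover have "\<forall>j\<in>{2..k}. real N * (frac (of_int (?c n 1) * \<alpha>) - frac (of_int (?c n j) * \<alpha>)) \<in> I j"
        using cond[OF nP] n by blast
      ultimately show "a \<in> frac_corr_set k (h ` {1..N}) I N \<alpha>" unfolding n(2) frac_corr_set_def by blast
    next
      fix a assume a: "a \<in> frac_corr_set k (h ` {1..N}) I N \<alpha>"
      then have aP: "a \<in> PiE {1..k} (\<lambda>_. h ` {1..N})" by (simp add: frac_corr_set_def)
      define n where "n = (\<lambda>i\<in>{1..k}. inv_into {1..N} h (a i))"
      have nP: "n \<in> {1..k} \<rightarrow>\<^sub>E {1..N}" using PiE_mem[OF aP] by (auto simp: n_def intro!: inv_into_into)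
      have an: "?c n = a"
      proof (rule PiE_ext[of _ "{1..k}" "\<lambda>_. h ` {1..N}"])
        show "?c n \<in> PiE {1..k} (\<lambda>_. h ` {1..N})" using PiE_mem[OF nP] by auto
        show "?c n i = a i" if "i \<in> {1..k}" for i using PiE_mem[OF aP that] that by (simp add: n_def f_inv_into_f)
      qed (rule aP)
      have "inj_on n {1..k}" using inj_iff[OF nP] a unfolding an frac_corr_set_def by blast
      moreover have "\<forall>j\<in>{2..k}. real N * (x (n 1) - x (n j)) \<in> I j"
        using cond[OF nP] a unfolding an frac_corr_set_def by blast
      ultimately have "n \<in> ?F" using nP by blast
      then show "a \<in> ?c ` ?F" using an by blast
    qed
  qed
  then have "card ?F = card (frac_corr_set k (h ` {1..N}) I N \<alpha>)" by (rule bij_betw_same_card)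
  then show ?thesis unfolding correlation_def restrict_PiE_iff himg by simp
qed

text \<open>Brings a bounded interval with arbitrary endpoints into the form in which the counting
  lemmas accept it.\<close>

lemma bounded_interval_bounds:
  fixes I :: "real set"
  assumes "is_interval I" "bounded I" "I \<noteq> {}"
  shows "Inf I \<le> Sup I \<and> {Inf I<..<Sup I} \<subseteq> I \<and> I \<subseteq> {Inf I..Sup I}"
proof -
  have bdd: "bdd_below I" "bdd_above I" using assms(2) by (simp_all add: bounded_imp_bdd_below bounded_imp_bdd_above)
  have "{Inf I<..<Sup I} \<subseteq> I"
  proof
    fix t assume t: "t \<in> {Inf I<..<Sup I}"
    obtain a where a: "a \<in> I" "a < t" using cInf_lessD[OF assms(3), of t] t by auto
    obtain b where b: "b \<in> I" "t < b" using less_cSupD[OF assms(3), of t] t by auto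
    show "t \<in> I" using mem_is_interval_1_I[OF assms(1) a(1) b(1)] a b by simp
  qed
  then show ?thesis using cInf_le_cSup[OF assms(3) bdd(2,1)] bdd by (auto intro: cInf_lower cSup_upper)
qed

lemma badly_approximable_irrational: "badly_approximable \<alpha> \<Longrightarrow> \<alpha> \<notin> \<rat>"
  by (simp add: badly_approximable_def)

text \<open>Irrationality makes the sample points distinct, as the passage from correlations to gaps
  requires.\<close>

lemma frac_multiple_eq_iff:
  assumes "\<alpha> \<notin> \<rat>"
  shows "frac (real a * \<alpha>) = frac (real b * \<alpha>) \<longleftrightarrow> a = b"
proof
  assume eq: "frac (real a * \<alpha>) = frac (real b * \<alpha>)"
  show "a = b"
  proof (rule ccontr)
    assume ne: "a \<noteq> b"
    have "(real a - real b) * \<alpha> = of_int (\<lfloor>real a * \<alpha>\<rfloor> - \<lfloor>real b * \<alpha>\<rfloor>)"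
      using eq by (simp add: frac_def algebra_simps)
    then have "\<alpha> = of_int (\<lfloor>real a * \<alpha>\<rfloor> - \<lfloor>real b * \<alpha>\<rfloor>) / (real a - real b)"
      using ne by (simp add: field_simps)
    also have "\<dots> \<in> \<rat>" by (intro Rats_divide Rats_diff Rats_of_int Rats_of_nat)
    finally show False using assms by blast
  qed
qed simp

text \<open>Common to the sequence and the array: row \<open>m\<close> lists by \<open>g m\<close> a
  set of integers up to \<open>X m\<close>, and \<open>L m\<close> is its size. All estimates are in
  terms of \<open>X m\<close>, so only \<open>rough_approx\<close> has to be verified separately in
  the two cases.\<close>

lemma rough_approx_limits:
  fixes X L :: "nat \<Rightarrow> nat" and g :: "nat \<Rightarrow> nat \<Rightarrow> nat"
  assumes \<alpha>: "badly_approximable \<alpha>" and X: "filterlim X at_top sequentially"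
    and g: "\<And>m. inj_on (g m) {1..L m}" and y: "\<And>m n. n \<in> {1..L m} \<Longrightarrow> y m n = frac (real (g m n) * \<alpha>)"
    and approx: "\<And>\<epsilon> E. 0 < \<epsilon> \<Longrightarrow> \<epsilon> \<le> 1 / 4 \<Longrightarrow> E > 0 \<Longrightarrow>
      eventually (\<lambda>m. \<exists>r. rough_approx \<epsilon> E (X m) (int ` g m ` {1..L m}) r) sequentially"
  shows "\<And>k. k \<ge> 2 \<Longrightarrow> array_poissonian_correlations k L y" and "array_poissonian_gaps L y"
proof -
  define A where "A m = int ` g m ` {1..L m}" for m
  have cardA: "card (A m) = L m" for m
  proof -
    have "inj_on int (g m ` {1..L m})" by (simp add: inj_on_def)
    then show ?thesis using g[of m] by (simp add: A_def card_image)
  qed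
  have uniform: "eventually (\<lambda>m. X m \<le> ln (X m) ^ 50 * L m \<and>
      \<bar>card (frac_corr_set k (A m) I (L m) \<alpha>) / L m - (\<Prod>j\<in>{2..k}. hi j - lo j)\<bar> \<le> \<xi>) sequentially"
    if k: "k \<ge> 1" and I: "\<And>j. j \<in> {2..k} \<Longrightarrow> lo j \<le> hi j \<and> {lo j<..<hi j} \<subseteq> I j \<and> I j \<subseteq> {lo j..hi j}" and \<xi>: "\<xi> > 0"
    for k :: nat and lo hi :: "nat \<Rightarrow> real" and I \<xi>
  proof -
    obtain \<epsilon> E :: real and Z :: nat where \<epsilon>: "0 < \<epsilon>" "\<epsilon> \<le> 1 / 4" "E > 0"
      and Z: "\<And>X A r. X \<ge> Z \<Longrightarrow> rough_approx \<epsilon> E X A r \<Longrightarrow> X \<le> ln X ^ 50 * card A \<and>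
        \<bar>card (frac_corr_set k A I (card A) \<alpha>) / card A - (\<Prod>j\<in>{2..k}. hi j - lo j)\<bar> \<le> \<xi>"
      by (rule rough_frac_tuples[where k = k and lo = lo and hi = hi and I = I and \<xi> = \<xi> and \<alpha> = \<alpha>])
        ((rule \<alpha> k \<xi> | erule I)+, blast)
    have "eventually (\<lambda>m. X m \<ge> Z) sequentially" using X by (simp add: filterlim_at_top)
    then show ?thesis using approx[OF \<epsilon>]
    proof eventually_elim
      case (elim m)
      then obtain r where "rough_approx \<epsilon> E (X m) (A m) r" by (auto simp: A_def)
      from Z[OF elim(1) this] show ?case unfolding cardA .
    qed
  qed
  have Llim: "filterlim L at_top sequentially"
    unfolding filterlim_at_top
  proof
    fix K :: nat
    \<comment> \<open>The case \<open>k = 1\<close>, in which the intervals are vacuous, provides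
      the lower bound for the number of points.\<close>
    have 1: "eventually (\<lambda>m. X m \<le> ln (X m) ^ 50 * L m) sequentially"
      using uniform[of 1 "\<lambda>_. 0" "\<lambda>_. 0" "\<lambda>_. {}" 1] by (rule eventually_mono) auto
    have "eventually (\<lambda>X. ln (real X) ^ 50 \<le> 1 / (real K + 1) * real X powr 1 \<and> X \<ge> 1) sequentially"
      by (intro eventually_conj eventually_ln_power_le eventually_ge_at_top) auto
    then have 2: "eventually (\<lambda>m. ln (real (X m)) ^ 50 \<le> 1 / (real K + 1) * real (X m) powr 1 \<and> X m \<ge> 1) sequentially"
      by (rule eventually_compose_filterlim[OF _ X])
    show "eventually (\<lambda>m. K \<le> L m) sequentially"
      using 1 2
    proof eventually_elim
      case (elim m)
      have Xm: "real (X m) > 0" using elim by simp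
      have "real (X m) \<le> ln (X m) ^ 50 * L m" using elim by simp
      also have "\<dots> \<le> 1 / (real K + 1) * real (X m) * L m" using elim Xm by (intro mult_right_mono) auto
      finally have "real (X m) * (real K + 1) \<le> real (X m) * L m" by (simp add: field_simps)
      then have "real K + 1 \<le> L m" using Xm by simp
      then show ?case by linarith
    qed
  qed
  show corr: "array_poissonian_correlations k L y" if k: "k \<ge> 2" for k
    unfolding array_poissonian_correlations_def
  proof (intro allI impI)
    fix R assume "bounded_rectangle k R"
    then obtain I where I: "\<forall>j\<in>{2..k}. is_interval (I j) \<and> bounded (I j)" and R: "R = PiE {2..k} I"
      unfolding bounded_rectangle_def by blast
    show "(\<lambda>m. correlation k R (L m) (y m)) \<longlonglongrightarrow> rectangle_volume k R"
    proof (cases "\<exists>j\<in>{2..k}. I j = {}")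
      case True
      then have "R = {}" unfolding R by (simp add: PiE_eq_empty_iff)
      then show ?thesis by (simp add: correlation_def rectangle_volume_def)
    next
      case False
      define lo hi where "lo j = Inf (I j)" and "hi j = Sup (I j)" for j
      have I': "lo j \<le> hi j \<and> {lo j<..<hi j} \<subseteq> I j \<and> I j \<subseteq> {lo j..hi j}" if "j \<in> {2..k}" for j
        unfolding lo_def hi_def using I False that by (intro bounded_interval_bounds) auto
      have vol: "rectangle_volume k R = (\<Prod>j\<in>{2..k}. hi j - lo j)" unfolding R using I' by (rule rectangle_volume_PiE)
      have cor: "correlation k R (L m) (y m) = card (frac_corr_set k (A m) I (L m) \<alpha>) / L m" for m
        unfolding R A_def by (rule correlation_frac[OF g y])
      show ?thesis
        unfolding vol
      proof (rule LIMSEQ_I)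
        fix e :: real assume e: "e > 0"
        have "eventually (\<lambda>m. X m \<le> ln (X m) ^ 50 * L m \<and>
            \<bar>card (frac_corr_set k (A m) I (L m) \<alpha>) / L m - (\<Prod>j\<in>{2..k}. hi j - lo j)\<bar> \<le> e / 2) sequentially"
          by (rule uniform) (use k e in simp, erule I', use k e in simp)
        then have "eventually (\<lambda>m. norm (correlation k R (L m) (y m) - (\<Prod>j\<in>{2..k}. hi j - lo j)) < e) sequentially"
        proof (rule eventually_mono)
          fix m assume "X m \<le> ln (X m) ^ 50 * L m \<and>
            \<bar>card (frac_corr_set k (A m) I (L m) \<alpha>) / L m - (\<Prod>j\<in>{2..k}. hi j - lo j)\<bar> \<le> e / 2"
          then show "norm (correlation k R (L m) (y m) - (\<Prod>j\<in>{2..k}. hi j - lo j)) < e"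
            unfolding cor real_norm_def using e by linarith
        qed
        then show "\<exists>no. \<forall>n\<ge>no. norm (correlation k R (L n) (y n) - (\<Prod>j\<in>{2..k}. hi j - lo j)) < e"
          by (simp add: eventually_sequentially)
      qed
    qed
  qed
  show "array_poissonian_gaps L y"
  proof (rule array_poissonian_gaps_if_correlations[OF Llim _ corr])
    show "inj_on (y m) {1..L m}" for m
    proof (rule inj_onI)
      fix n n' assume n: "n \<in> {1..L m}" "n' \<in> {1..L m}" "y m n = y m n'"
      then have "g m n = g m n'" using frac_multiple_eq_iff[OF badly_approximable_irrational[OF \<alpha>]] by (simp add: y)
      then show "n = n'" using n inj_onD[OF g[of m]] by blast
    qed
  qed
qed

text \<open>For \<open>n \<ge> 1\<close> the infimum is over a finite set and attained, or over the
  empty set and infinite. So the strict inequality passes between the infimum and the single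
  primes.\<close>

lemma least_prime_divisor_gt_iff:
  assumes "n \<ge> 1"
  shows "least_prime_divisor n > ereal t \<longleftrightarrow> (\<forall>p. prime p \<longrightarrow> p dvd n \<longrightarrow> t < real p)"
proof -
  let ?P = "{p. prime p \<and> p dvd n}"
  have fin: "finite ?P" by (rule finite_subset[of _ "{..n}"]) (use assms in \<open>auto dest: dvd_imp_le\<close>)
  show ?thesis
  proof (cases "?P = {}")
    case True
    then have "\<not> p dvd n" if "prime p" for p using that by blast
    moreover have "least_prime_divisor n = \<infinity>" unfolding least_prime_divisor_def True by (simp add: top_ereal_def)
    ultimately show ?thesis by auto
  next
    case False
    have "least_prime_divisor n = Min ((\<lambda>p. ereal (real p)) ` ?P)"
      unfolding least_prime_divisor_def by (rule Min_Inf[symmetric]) (use fin False in auto)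
    then show ?thesis using fin False by (simp add: Min_gr_iff) blast
  qed
qed

section \<open>Rough numbers with the prescribed thresholds\<close>

lemma mem_rough_set_iff: "n \<in> rough_set f \<longleftrightarrow> 1 \<le> n \<and> (\<forall>p. prime p \<longrightarrow> p dvd n \<longrightarrow> f n < real p)"
  using least_prime_divisor_gt_iff[of n "f n"] by (auto simp: rough_set_def)

lemma mem_rough_row_iff: "n \<in> rough_row f x \<longleftrightarrow> 1 \<le> n \<and> n \<le> x \<and> (\<forall>p. prime p \<longrightarrow> p dvd n \<longrightarrow> f x < real p)"
  using least_prime_divisor_gt_iff[of n "f x"] by (auto simp: rough_row_def)

lemma antimono_null_nonneg:
  fixes r :: "nat \<Rightarrow> real"
  assumes r: "antimono_on {1..} r" "r \<longlonglongrightarrow> 0" and n: "n \<ge> 1"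
  shows "r n \<ge> 0"
proof (rule LIMSEQ_le_const2[OF r(2)])
  have "r m \<le> r n" if "m \<ge> n" for m using monotone_onD[OF r(1), of n m] that n by simp
  then show "\<exists>N. \<forall>m\<ge>N. r m \<le> r n" by blast
qed

text \<open>The growth hypothesis is used with \<open>E + 1\<close>; the spare factor
  \<open>ln (ln x)\<close> absorbs the constant \<open>c\<close>.\<close>

lemma rough_growth:
  fixes r :: "nat \<Rightarrow> real"
  assumes r_growth: "\<And>A :: real. A > 0 \<Longrightarrow>
      \<exists>c > 0. \<forall>\<^sub>F x in sequentially. r x \<ge> c * (ln (ln (real x)) powr A / ln (real x))" and E: "E > 0"
  shows "eventually (\<lambda>x. ln (ln (real x)) powr E \<le> r x * ln (real x)) sequentially"
proof -
  obtain c where c: "c > 0" and ev: "eventually (\<lambda>x. r x \<ge> c * (ln (ln (real x)) powr (E + 1) / ln (real x))) sequentially"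
    using r_growth[of "E + 1"] E by auto
  have "eventually (\<lambda>x::nat. 1 + 1 / c \<le> ln (ln (real x))) sequentially" by (rule eventually_ln_ln_ge)
  then show ?thesis using ev eventually_ge_at_top[of 3]
  proof eventually_elim
    case (elim x)
    define l where "l = ln (ln (real x))"
    have l: "l \<ge> 1 + 1 / c" using elim by (simp add: l_def)
    have l0: "l > 0" using l c by (smt (verit) divide_pos_pos)
    have L0: "ln (real x) > 0" using elim by simp
    have "1 \<le> c * l" using l c by (simp add: field_simps)
    then have "1 * l powr E \<le> (c * l) * l powr E" by (intro mult_right_mono) auto
    also have "\<dots> = c * l powr (E + 1)" using l0 by (simp add: powr_add)
    also have "\<dots> = c * (l powr (E + 1) / ln (real x)) * ln (real x)" using L0 by simp
    also have "\<dots> \<le> r x * ln (real x)" using elim L0 unfolding l_def by (intro mult_right_mono) auto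
    finally show ?case by (simp add: l_def)
  qed
qed

text \<open>The exponent is a constant function here. The weaker of the two membership conditions
  follows from the exact threshold because \<open>r x\<close> is nonnegative.\<close>

lemma rough_row_approx:
  fixes f r :: "nat \<Rightarrow> real"
  assumes f_eq: "\<And>x. 1 \<le> x \<Longrightarrow> f x = real x powr r x" and r: "antimono_on {1..} r" "r \<longlonglongrightarrow> 0"
    and r_growth: "\<And>A :: real. A > 0 \<Longrightarrow>
      \<exists>c > 0. \<forall>\<^sub>F x in sequentially. r x \<ge> c * (ln (ln (real x)) powr A / ln (real x))"
    and \<epsilon>: "0 < \<epsilon>" "\<epsilon> \<le> 1 / 4" and E: "E > 0"
  shows "eventually (\<lambda>x. rough_approx \<epsilon> E x (int ` rough_row f x) (\<lambda>_. r x)) sequentially"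
proof -
  have "eventually (\<lambda>x. r x < \<epsilon>) sequentially" using r(2) \<epsilon> by (intro order_tendstoD) auto
  moreover have "eventually (\<lambda>x. ln (ln (real x)) powr E \<le> r x * ln (real x)) sequentially"
    by (rule rough_growth[OF r_growth E])
  ultimately show ?thesis using eventually_ge_at_top[of 1]
  proof eventually_elim
    case (elim x)
    have fx: "f x = real x powr r x" using elim f_eq by simp
    have "a \<in> int ` rough_row f x"
      if a: "real x powr (1 - \<epsilon>) < real_of_int a" "a \<le> int x" and p: "\<forall>p. prime p \<longrightarrow> int p dvd a \<longrightarrow> real x powr r x < real p" for a
    proof -
      have "0 \<le> real x powr (1 - \<epsilon>)" by simp
      then have "real_of_int a > 0" using a by linarith
      then have "a > 0" by simp
      then obtain n where n: "a = int n" "n > 0" by (metis zero_less_imp_eq_int)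
      have "n \<in> rough_row f x" unfolding mem_rough_row_iff fx using n a p by auto
      then show ?thesis using n by blast
    qed
    moreover have "real x powr ((1 - \<epsilon>) * r x) < real p" if a: "a \<in> int ` rough_row f x" and p: "prime p" "int p dvd a" for a p
    proof -
      obtain n where n: "a = int n" "n \<in> rough_row f x" using a by blast
      then have "real x powr r x < real p" using p by (auto simp: mem_rough_row_iff fx)
      moreover have "(1 - \<epsilon>) * r x \<le> 1 * r x" using antimono_null_nonneg[OF r, of x] elim \<epsilon> by (intro mult_right_mono) auto
      then have "real x powr ((1 - \<epsilon>) * r x) \<le> real x powr r x" using elim by (intro powr_mono) auto
      ultimately show ?thesis by linarith
    qed
    moreover have "int ` rough_row f x \<subseteq> {1..int x}" by (auto simp: mem_rough_row_iff)
    ultimately show ?case using elim unfolding rough_approx_def by (auto simp: less_imp_le)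
  qed
qed

lemma rough_set_approx:
  fixes f r :: "nat \<Rightarrow> real"
  assumes f_eq: "\<And>x. 1 \<le> x \<Longrightarrow> f x = real x powr r x" and r: "antimono_on {1..} r" "r \<longlonglongrightarrow> 0"
    and r_growth: "\<And>A :: real. A > 0 \<Longrightarrow>
      \<exists>c > 0. \<forall>\<^sub>F x in sequentially. r x \<ge> c * (ln (ln (real x)) powr A / ln (real x))"
    and \<epsilon>: "0 < \<epsilon>" "\<epsilon> \<le> 1 / 4" and E: "E > 0"
  shows "eventually (\<lambda>X. rough_approx \<epsilon> E X (int ` (rough_set f \<inter> {1..X})) (\<lambda>a. r (nat a))) sequentially"
proof -
  have "eventually (\<lambda>x. r x < \<epsilon>) sequentially" using r(2) \<epsilon> by (intro order_tendstoD) auto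
  then obtain n0 where n0: "\<And>n. n \<ge> n0 \<Longrightarrow> r n < \<epsilon>" by (auto simp: eventually_sequentially)
  have "eventually (\<lambda>x. ln (ln (real x)) powr E \<le> r x * ln (real x)) sequentially"
    by (rule rough_growth[OF r_growth E])
  \<comment> \<open>From \<open>n0 ^ 2 \<le> X\<close> and \<open>\<epsilon> \<le> 1 / 4\<close> it
    follows that \<open>n0 \<le> X powr (1 - \<epsilon>)\<close>, so \<open>r < \<epsilon>\<close>
    holds on the whole range in question.\<close>
  then show ?thesis using eventually_ge_at_top[of "max 1 (n0 ^ 2)"]
  proof eventually_elim
    case (elim X)
    have X1: "X \<ge> 1" and Xn: "n0 ^ 2 \<le> X" using elim by auto
    have big: "real n0 \<le> real X powr (1 - \<epsilon>)"
    proof -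
      have "real n0 ^ 2 \<le> real X" using Xn by (metis of_nat_le_iff of_nat_power)
      then have "real n0 \<le> sqrt (real X)" by (rule real_le_rsqrt)
      also have "\<dots> = real X powr (1 / 2)" by (simp add: powr_half_sqrt)
      also have "\<dots> \<le> real X powr (1 - \<epsilon>)" using \<epsilon> X1 by (intro powr_mono) auto
      finally show ?thesis .
    qed
    have pos: "\<exists>n. a = int n \<and> 1 \<le> n \<and> n0 \<le> n \<and> real X powr (1 - \<epsilon>) < real n" if a: "real X powr (1 - \<epsilon>) < real_of_int a" for a
    proof -
      have "0 \<le> real X powr (1 - \<epsilon>)" by simp
      then have "real_of_int a > 0" using a by linarith
      then have "a > 0" by simp
      then obtain n where n: "a = int n" "n > 0" by (metis zero_less_imp_eq_int)
      then have "real n0 < real n" using a big by simp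
      then show ?thesis using n a by auto
    qed
    have 1: "r (nat b) \<le> r (nat a)" if a: "real X powr (1 - \<epsilon>) < real_of_int a" and b: "a \<le> b" for a b
    proof -
      obtain n where n: "a = int n" "1 \<le> n" using pos[OF a] by blast
      then show ?thesis using b monotone_onD[OF r(1), of n "nat b"] by simp
    qed
    have 2: "r (nat a) \<le> \<epsilon>" if a: "real X powr (1 - \<epsilon>) < real_of_int a" for a
    proof -
      obtain n where n: "a = int n" "n0 \<le> n" using pos[OF a] by blast
      then show ?thesis using n0[of n] by simp
    qed
    have 3: "a \<in> int ` (rough_set f \<inter> {1..X})"
      if a: "real X powr (1 - \<epsilon>) < real_of_int a" "a \<le> int X"
        and p: "\<forall>p. prime p \<longrightarrow> int p dvd a \<longrightarrow> real X powr r (nat a) < real p" for a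
    proof -
      obtain n where n: "a = int n" "1 \<le> n" using pos[OF a(1)] by blast
      have nX: "n \<le> X" using a(2) n by simp
      have "f n = real n powr r n" using f_eq n by blast
      also have "\<dots> \<le> real X powr r n" using nX n antimono_null_nonneg[OF r n(2)] by (intro powr_mono2) auto
      finally have le: "f n \<le> real X powr r n" .
      have "f n < real q" if "prime q" "q dvd n" for q
      proof -
        have "real X powr r n < real q" using p that n by simp
        then show ?thesis using le by linarith
      qed
      then have "n \<in> rough_set f" using n mem_rough_set_iff by blast
      then show ?thesis using n nX by auto
    qed
    have 4: "real X powr ((1 - \<epsilon>) * r (nat a)) < real p"
      if a: "a \<in> int ` (rough_set f \<inter> {1..X})" "real X powr (1 - \<epsilon>) < real_of_int a" and p: "prime p" "int p dvd a" for a p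
    proof -
      obtain n where n: "a = int n" "n \<in> rough_set f" "1 \<le> n" using a(1) by auto
      have "real X powr ((1 - \<epsilon>) * r n) = (real X powr (1 - \<epsilon>)) powr r n" by (simp add: powr_powr)
      also have "\<dots> \<le> real n powr r n"
        using a(2) n antimono_null_nonneg[OF r n(3)] by (intro powr_mono2) auto
      also have "\<dots> = f n" using f_eq n by simp
      also have "\<dots> < real p" using n p by (auto simp: mem_rough_set_iff)
      finally show ?thesis using n by simp
    qed
    have 5: "int ` (rough_set f \<inter> {1..X}) \<subseteq> {1..int X}" by auto
    have 6: "ln (ln (real X)) powr E \<le> r (nat (int X)) * ln (real X)" using elim by simp
    show ?case unfolding rough_approx_def using 1 2 3 4 5 6 by (intro conjI allI impI) blast+
  qed
qed

text \<open>Every large prime belongs to it, since \<open>p powr r p < p\<close> as soon as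
  \<open>r p < 1\<close>.\<close>

lemma infinite_rough_set:
  fixes f r :: "nat \<Rightarrow> real"
  assumes f_eq: "\<And>x. 1 \<le> x \<Longrightarrow> f x = real x powr r x" and r: "r \<longlonglongrightarrow> 0"
  shows "infinite (rough_set f)"
proof
  assume fin: "finite (rough_set f)"
  have "eventually (\<lambda>x. r x < 1) sequentially" using r by (intro order_tendstoD) auto
  then obtain n0 where n0: "\<And>n. n \<ge> n0 \<Longrightarrow> r n < 1" by (auto simp: eventually_sequentially)
  have "{p::nat. prime p} \<subseteq> {..n0} \<union> rough_set f"
  proof
    fix p :: nat assume "p \<in> {p. prime p}"
    then have p: "prime p" by simp
    show "p \<in> {..n0} \<union> rough_set f"
    proof (cases "p \<le> n0")
      case False
      have p1: "p > 1" using p by (rule prime_gt_1_nat)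
      have "f p = real p powr r p" using f_eq p1 by simp
      also have "\<dots> < real p powr 1" using n0[of p] False p1 by (intro powr_less_mono) auto
      finally have "f p < real p" using p1 by simp
      then have "p \<in> rough_set f" unfolding mem_rough_set_iff using p p1 by (auto dest: primes_dvd_imp_eq)
      then show ?thesis by blast
    qed simp
  qed
  then have "finite {p::nat. prime p}" using fin finite_subset by blast
  then show False using primes_infinite by blast
qed

text \<open>\<open>X\<close> is taken to be the \<open>N\<close>-th element \<open>g N\<close>, so
  that the first \<open>N\<close> elements are exactly the members of \<open>rough_set f\<close> up
  to \<open>X\<close>. The estimates with cutoff \<open>X\<close> then apply to every initial
  segment of the sequence.\<close>

lemma rough_sequence_limits:
  fixes f r :: "nat \<Rightarrow> real"
  assumes f_eq: "\<And>x. 1 \<le> x \<Longrightarrow> f x = real x powr r x" and r: "antimono_on {1..} r" "r \<longlonglongrightarrow> 0"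
    and r_growth: "\<And>A :: real. A > 0 \<Longrightarrow>
      \<exists>c > 0. \<forall>\<^sub>F x in sequentially. r x \<ge> c * (ln (ln (real x)) powr A / ln (real x))"
    and \<alpha>: "badly_approximable \<alpha>"
  shows "(\<forall>k \<ge> 2. poissonian_correlations k (rough_seq f \<alpha>)) \<and> poissonian_gaps (rough_seq f \<alpha>)"
proof -
  define S where "S = rough_set f"
  have inf: "infinite S" unfolding S_def by (rule infinite_rough_set[OF f_eq r(2)])
  have S1: "S \<subseteq> {1..}" by (auto simp: S_def mem_rough_set_iff)
  define g where "g n = enumerate S (n - 1)" for n
  have lim: "filterlim g at_top sequentially"
    unfolding filterlim_at_top
  proof
    fix K
    show "eventually (\<lambda>n. K \<le> g n) sequentially"
      using eventually_ge_at_top[of "Suc K"]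
    proof eventually_elim
      case (elim n)
      then show ?case using le_enumerate[OF inf, of "n - 1"] by (simp add: g_def)
    qed
  qed
  have inj: "inj_on g {1..N}" for N
  proof (rule inj_onI)
    fix m n assume "m \<in> {1..N}" "n \<in> {1..N}" "g m = g n"
    then show "m = n" using enumerate_mono[OF _ inf, of "m - 1" "n - 1"] enumerate_mono[OF _ inf, of "n - 1" "m - 1"]
      by (cases "m - 1" "n - 1" rule: linorder_cases) (auto simp: g_def)
  qed
  have img: "g ` {1..N} = S \<inter> {1..g N}" if N: "N \<ge> 1" for N
  proof (intro subset_antisym subsetI)
    fix s assume "s \<in> g ` {1..N}"
    then obtain n where n: "n \<in> {1..N}" "s = g n" by blast
    have "s \<in> S" using n enumerate_in_set[OF inf] by (simp add: g_def)
    moreover have "s \<le> g N"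
    proof (cases "n = N")
      case False
      then have "n - 1 < N - 1" using n by auto
      then show ?thesis using enumerate_mono[OF _ inf, of "n - 1" "N - 1"] n by (simp add: g_def)
    qed (use n in simp)
    ultimately show "s \<in> S \<inter> {1..g N}" using S1 by auto
  next
    fix s assume s: "s \<in> S \<inter> {1..g N}"
    then obtain i where i: "enumerate S i = s" using enumerate_Ex[OF inf, of s] by blast
    have "i \<le> N - 1" using enumerate_mono[OF _ inf, of "N - 1" i] i s by (force simp: g_def)
    then have "Suc i \<in> {1..N}" using N by simp
    moreover have "g (Suc i) = s" using i by (simp add: g_def)
    ultimately show "s \<in> g ` {1..N}" by blast
  qed
  have approx: "eventually (\<lambda>N. \<exists>r'. rough_approx \<epsilon> E (g N) (int ` g ` {1..N}) r') sequentially"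
    if \<epsilon>: "0 < \<epsilon>" "\<epsilon> \<le> 1 / 4" and E: "E > 0" for \<epsilon> E
  proof -
    have "eventually (\<lambda>N. rough_approx \<epsilon> E (g N) (int ` (S \<inter> {1..g N})) (\<lambda>a. r (nat a))) sequentially"
      unfolding S_def
      by (rule eventually_compose_filterlim[OF rough_set_approx[OF f_eq r r_growth \<epsilon> E] lim])
    then show ?thesis using eventually_ge_at_top[of 1]
    proof eventually_elim
      case (elim N)
      then show ?case using img[of N] by auto
    qed
  qed
  have y: "rough_seq f \<alpha> n = frac (real (g n) * \<alpha>)" for n by (simp add: rough_seq_def g_def S_def)
  have "array_poissonian_correlations k (\<lambda>N. N) (\<lambda>_. rough_seq f \<alpha>)" if "k \<ge> 2" for k
    by (rule rough_approx_limits(1)[where X = g and g = "\<lambda>_. g", OF \<alpha> lim inj y approx that])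
  moreover have "array_poissonian_gaps (\<lambda>N. N) (\<lambda>_. rough_seq f \<alpha>)"
    by (rule rough_approx_limits(2)[where X = g and g = "\<lambda>_. g", OF \<alpha> lim inj y approx])
  ultimately show ?thesis
    by (simp add: array_poissonian_correlations_def poissonian_correlations_def array_poissonian_gaps_def poissonian_gaps_def)
qed

text \<open>Here \<open>X\<close> is the row index itself, and the enumeration of a finite row is a
  bijection for indices up to its cardinality.\<close>

lemma rough_array_limits:
  fixes f r :: "nat \<Rightarrow> real"
  assumes f_eq: "\<And>x. 1 \<le> x \<Longrightarrow> f x = real x powr r x" and r: "antimono_on {1..} r" "r \<longlonglongrightarrow> 0"
    and r_growth: "\<And>A :: real. A > 0 \<Longrightarrow>
      \<exists>c > 0. \<forall>\<^sub>F x in sequentially. r x \<ge> c * (ln (ln (real x)) powr A / ln (real x))"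
    and \<alpha>: "badly_approximable \<alpha>"
  shows "(\<forall>k \<ge> 2. array_poissonian_correlations k (\<lambda>x. card (rough_row f x)) (rough_array f \<alpha>)) \<and>
    array_poissonian_gaps (\<lambda>x. card (rough_row f x)) (rough_array f \<alpha>)"
proof -
  define g where "g x n = enumerate (rough_row f x) (n - 1)" for x n
  have bij: "bij_betw (g x) {1..card (rough_row f x)} (rough_row f x)" for x
  proof -
    have fin: "finite (rough_row f x)" by (rule finite_subset[of _ "{..x}"]) (auto simp: mem_rough_row_iff)
    have "bij_betw (\<lambda>n. n - 1) {1..card (rough_row f x)} {..<card (rough_row f x)}"
      by (rule bij_betw_byWitness[where f' = Suc]) auto
    then have "bij_betw (enumerate (rough_row f x) \<circ> (\<lambda>n. n - 1)) {1..card (rough_row f x)} (rough_row f x)"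
      using finite_bij_enumerate[OF fin] by (rule bij_betw_trans)
    then show ?thesis by (simp add: comp_def g_def[abs_def])
  qed
  have inj: "inj_on (g x) {1..card (rough_row f x)}" for x using bij by (rule bij_betw_imp_inj_on)
  have y: "rough_array f \<alpha> x n = frac (real (g x n) * \<alpha>)" for x n by (simp add: rough_array_def g_def)
  have approx: "eventually (\<lambda>x. \<exists>r'. rough_approx \<epsilon> E x (int ` g x ` {1..card (rough_row f x)}) r') sequentially"
    if \<epsilon>: "0 < \<epsilon>" "\<epsilon> \<le> 1 / 4" and E: "E > 0" for \<epsilon> E
  proof -
    have "eventually (\<lambda>x. rough_approx \<epsilon> E x (int ` rough_row f x) (\<lambda>_. r x)) sequentially"
      by (rule rough_row_approx[OF f_eq r r_growth \<epsilon> E])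
    then show ?thesis
    proof (rule eventually_mono)
      fix x assume "rough_approx \<epsilon> E x (int ` rough_row f x) (\<lambda>_. r x)"
      then show "\<exists>r'. rough_approx \<epsilon> E x (int ` g x ` {1..card (rough_row f x)}) r'"
        unfolding bij_betw_imp_surj_on[OF bij] by blast
    qed
  qed
  have "array_poissonian_correlations k (\<lambda>x. card (rough_row f x)) (rough_array f \<alpha>)" if "k \<ge> 2" for k
    by (rule rough_approx_limits(1)[where X = "\<lambda>x. x" and g = g, OF \<alpha> filterlim_ident inj y approx that])
  moreover have "array_poissonian_gaps (\<lambda>x. card (rough_row f x)) (rough_array f \<alpha>)"
    by (rule rough_approx_limits(2)[where X = "\<lambda>x. x" and g = g, OF \<alpha> filterlim_ident inj y approx])
  ultimately show ?thesis by blast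
qed

theorem theorem1:
  fixes f r :: "nat \<Rightarrow> real" and \<alpha> :: real
  assumes f_eq: "\<And>x. 1 \<le> x \<Longrightarrow> f x = real x powr r x"
    and r_decreasing: "antimono_on {1..} r"
    and r_tendsto_0: "r \<longlonglongrightarrow> 0"
    and r_growth: "\<And>A :: real. A > 0 \<Longrightarrow>
      \<exists>c > 0. \<forall>\<^sub>F x in sequentially. r x \<ge> c * (ln (ln (real x)) powr A / ln (real x))"
    and alpha: "badly_approximable \<alpha>"
  shows "((\<forall>k \<ge> 2. poissonian_correlations k (rough_seq f \<alpha>)) \<and>
           poissonian_gaps (rough_seq f \<alpha>)) \<and>
         ((\<forall>k \<ge> 2. array_poissonian_correlations k (\<lambda>x. card (rough_row f x)) (rough_array f \<alpha>)) \<and>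
           array_poissonian_gaps (\<lambda>x. card (rough_row f x)) (rough_array f \<alpha>))"
proof
  show "(\<forall>k \<ge> 2. poissonian_correlations k (rough_seq f \<alpha>)) \<and> poissonian_gaps (rough_seq f \<alpha>)"
    by (rule rough_sequence_limits[OF f_eq r_decreasing r_tendsto_0 r_growth alpha])
  show "(\<forall>k \<ge> 2. array_poissonian_correlations k (\<lambda>x. card (rough_row f x)) (rough_array f \<alpha>)) \<and>
      array_poissonian_gaps (\<lambda>x. card (rough_row f x)) (rough_array f \<alpha>)"
    by (rule rough_array_limits[OF f_eq r_decreasing r_tendsto_0 r_growth alpha])
qed

end
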